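(* Let $\mathbb{M}$ be a monster model of a complete $C$-minimal expansion of ACVF whose language contains a constant symbol $t$ with $v(t)>0$. Suppose that $k^\times$ has no exotic automorphisms or $\Gamma$ has no exotic automorphisms. Then $\mathbb{M}$ is polynomially bounded: for every definable function $f:\mathbb{M}\to\mathbb{M}$ there is an integer $n$ such that $v(f(x))>n\cdot v(x)$ for all $x$ outside a bounded set.
   Context: ACVF is the theory of algebraically closed non-trivially valued fields; $C$-minimal means that in every model every definable subset of the home sort is a finite boolean combination of balls and points. "Definable" means definable with parameters. $v$ is the valuation, $\Gamma$ the value group, $\mathcal{O}$ the valuation ring, $\mathfrak m$ its maximal ideal, $k=\mathcal{O}/\mathfrak m$ the residue field. "$k^\times$ has no exotic automorphisms" means every definable automorphism of the multiplicative group $k^\times$ is definable in the pure ring language on $k$ (equivalently, is of the form $x\mapsto x^{\pm p^n}$ with $n\in\mathbb Z$, $p$ the characteristic exponent of $k$). "$\Gamma$ has no exotic automorphisms" means the only definable automorphisms of the ordered group $(\Gamma,+,\le)$ are multiplication by positive rational numbers. A set is bounded if it is contained in some ball. *)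

theory Defs
  imports "HOL-Algebra.Algebra"
begin

unbundle cardinal_syntax

section \<open>First-order logic\<close>

text \<open>A language assigns an arity to each of its symbols; an element of the symbol types that is
  mapped to \<open>None\<close> does not belong to the language. Constants are function symbols of arity 0.\<close>

record ('f, 'r) lang =
  farity :: "'f \<Rightarrow> nat option"
  rarity :: "'r \<Rightarrow> nat option"

datatype 'f tm = Var nat | Fn 'f "'f tm list"

datatype ('f, 'r) fm =
    Eql "'f tm" "'f tm"
  | Rel 'r "'f tm list"
  | Bot
  | Imp "('f, 'r) fm" "('f, 'r) fm"
  | All nat "('f, 'r) fm"

abbreviation Neg :: "('f, 'r) fm \<Rightarrow> ('f, 'r) fm" where
  "Neg \<phi> \<equiv> Imp \<phi> Bot"

fun fv_tm :: "'f tm \<Rightarrow> nat set" where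
  "fv_tm (Var i) = {i}"
| "fv_tm (Fn f ts) = (\<Union>s\<in>set ts. fv_tm s)"

fun fv :: "('f, 'r) fm \<Rightarrow> nat set" where
  "fv (Eql s u) = fv_tm s \<union> fv_tm u"
| "fv (Rel r ts) = (\<Union>s\<in>set ts. fv_tm s)"
| "fv Bot = {}"
| "fv (Imp \<phi> \<psi>) = fv \<phi> \<union> fv \<psi>"
| "fv (All i \<phi>) = fv \<phi> - {i}"

fun wf_tm :: "('f, 'r) lang \<Rightarrow> 'f tm \<Rightarrow> bool" where
  "wf_tm L (Var i) = True"
| "wf_tm L (Fn f ts) = (farity L f = Some (length ts) \<and> (\<forall>s\<in>set ts. wf_tm L s))"

fun wf_fm :: "('f, 'r) lang \<Rightarrow> ('f, 'r) fm \<Rightarrow> bool" where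
  "wf_fm L (Eql s u) = (wf_tm L s \<and> wf_tm L u)"
| "wf_fm L (Rel r ts) = (rarity L r = Some (length ts) \<and> (\<forall>s\<in>set ts. wf_tm L s))"
| "wf_fm L Bot = True"
| "wf_fm L (Imp \<phi> \<psi>) = (wf_fm L \<phi> \<and> wf_fm L \<psi>)"
| "wf_fm L (All i \<phi>) = wf_fm L \<phi>"

definition sentence :: "('f, 'r) lang \<Rightarrow> ('f, 'r) fm \<Rightarrow> bool" where
  "sentence L \<phi> \<longleftrightarrow> wf_fm L \<phi> \<and> fv \<phi> = {}"

record ('f, 'r, 'a) fo_struct =
  univ :: "'a set"
  fun_int :: "'f \<Rightarrow> 'a list \<Rightarrow> 'a"
  rel_int :: "'r \<Rightarrow> 'a list \<Rightarrow> bool"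

definition tuples :: "nat \<Rightarrow> 'a set \<Rightarrow> 'a list set" where
  "tuples n A = {xs. length xs = n \<and> set xs \<subseteq> A}"

definition is_struct :: "('f, 'r) lang \<Rightarrow> ('f, 'r, 'a) fo_struct \<Rightarrow> bool" where
  "is_struct L M \<longleftrightarrow> univ M \<noteq> {} \<and>
     (\<forall>f n. farity L f = Some n \<longrightarrow> (\<forall>xs\<in>tuples n (univ M). fun_int M f xs \<in> univ M))"

fun eval_tm :: "('f, 'r, 'a) fo_struct \<Rightarrow> (nat \<Rightarrow> 'a) \<Rightarrow> 'f tm \<Rightarrow> 'a" where
  "eval_tm M e (Var i) = e i"
| "eval_tm M e (Fn f ts) = fun_int M f (map (eval_tm M e) ts)"

primrec sat :: "('f, 'r, 'a) fo_struct \<Rightarrow> (nat \<Rightarrow> 'a) \<Rightarrow> ('f, 'r) fm \<Rightarrow> bool" where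
  "sat M e (Eql s u) \<longleftrightarrow> eval_tm M e s = eval_tm M e u"
| "sat M e (Rel r ts) \<longleftrightarrow> rel_int M r (map (eval_tm M e) ts)"
| "sat M e Bot \<longleftrightarrow> False"
| "sat M e (Imp \<phi> \<psi>) \<longleftrightarrow> (sat M e \<phi> \<longrightarrow> sat M e \<psi>)"
| "sat M e (All i \<phi>) \<longleftrightarrow> (\<forall>a\<in>univ M. sat M (e(i := a)) \<phi>)"

definition is_model :: "('f, 'r) lang \<Rightarrow> ('f, 'r) fm set \<Rightarrow> ('f, 'r, 'a) fo_struct \<Rightarrow> bool" where
  "is_model L T M \<longleftrightarrow> is_struct L M \<and> (\<forall>\<phi>\<in>T. \<forall>e. range e \<subseteq> univ M \<longrightarrow> sat M e \<phi>)"

text \<open>HOL cannot quantify over types, so notions referring to all models of a theory quantify over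
  all models whose universe is a subset of a given type \<open>'a\<close>. By the Loewenheim-Skolem theorem
  this agrees with the unrestricted notion as soon as \<open>'a\<close> is infinite and has at least as many
  elements as there are formulas of the language, in particular when \<open>'a\<close> carries a monster
  model in the sense below.\<close>

definition entails ::
  "'a itself \<Rightarrow> ('f, 'r) lang \<Rightarrow> ('f, 'r) fm set \<Rightarrow> ('f, 'r) fm \<Rightarrow> bool" where
  "entails _ L T \<sigma> \<longleftrightarrow>
     (\<forall>N :: ('f, 'r, 'a) fo_struct. is_model L T N \<longrightarrow> (\<forall>e. range e \<subseteq> univ N \<longrightarrow> sat N e \<sigma>))"

definition complete_theory :: "'a itself \<Rightarrow> ('f, 'r) lang \<Rightarrow> ('f, 'r) fm set \<Rightarrow> bool" where
  "complete_theory A L T \<longleftrightarrow> (\<forall>\<sigma>\<in>T. sentence L \<sigma>) \<and>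
     (\<exists>N :: ('f, 'r, 'a) fo_struct. is_model L T N) \<and>
     (\<forall>\<sigma>. sentence L \<sigma> \<longrightarrow> entails A L T \<sigma> \<or> entails A L T (Neg \<sigma>))"

text \<open>Definability is with parameters: the variables \<open>0, \<dots>, n - 1\<close> range over the tuple, while
  the assignment \<open>e\<close> provides parameters for the remaining (finitely many) free variables.\<close>

definition definable ::
  "('f, 'r) lang \<Rightarrow> ('f, 'r, 'a) fo_struct \<Rightarrow> nat \<Rightarrow> 'a list set \<Rightarrow> bool" where
  "definable L M n D \<longleftrightarrow> (\<exists>\<phi> e. wf_fm L \<phi> \<and> range e \<subseteq> univ M \<and>
     D = {xs \<in> tuples n (univ M). sat M (\<lambda>i. if i < n then xs ! i else e i) \<phi>})"

text \<open>A partial type in the variable 0 over \<open>A\<close> is represented by pairs of a formula and an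
  assignment sending its other free variables to elements of \<open>A\<close>.\<close>

definition saturated :: "'a rel \<Rightarrow> ('f, 'r) lang \<Rightarrow> ('f, 'r, 'a) fo_struct \<Rightarrow> bool" where
  "saturated \<kappa> L M \<longleftrightarrow>
     (\<forall>A p. A \<subseteq> univ M \<longrightarrow> |A| <o \<kappa> \<longrightarrow>
        (\<forall>(\<phi>, e)\<in>p. wf_fm L \<phi> \<and> e ` (fv \<phi> - {0}) \<subseteq> A) \<longrightarrow>
        (\<forall>q. finite q \<longrightarrow> q \<subseteq> p \<longrightarrow> (\<exists>a\<in>univ M. \<forall>(\<phi>, e)\<in>q. sat M (e(0 := a)) \<phi>)) \<longrightarrow>
        (\<exists>a\<in>univ M. \<forall>(\<phi>, e)\<in>p. sat M (e(0 := a)) \<phi>))"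

definition elementary_map ::
  "('f, 'r) lang \<Rightarrow> ('f, 'r, 'a) fo_struct \<Rightarrow> 'a set \<Rightarrow> ('a \<Rightarrow> 'a) \<Rightarrow> bool" where
  "elementary_map L M A g \<longleftrightarrow> g ` A \<subseteq> univ M \<and>
     (\<forall>\<phi> e. wf_fm L \<phi> \<longrightarrow> range e \<subseteq> A \<longrightarrow> sat M e \<phi> = sat M (g \<circ> e) \<phi>)"

definition struct_automorphism ::
  "('f, 'r) lang \<Rightarrow> ('f, 'r, 'a) fo_struct \<Rightarrow> ('a \<Rightarrow> 'a) \<Rightarrow> bool" where
  "struct_automorphism L M h \<longleftrightarrow> bij_betw h (univ M) (univ M) \<and>
     (\<forall>f n. farity L f = Some n \<longrightarrow>
        (\<forall>xs\<in>tuples n (univ M). h (fun_int M f xs) = fun_int M f (map h xs))) \<and>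
     (\<forall>r n. rarity L r = Some n \<longrightarrow>
        (\<forall>xs\<in>tuples n (univ M). rel_int M r xs = rel_int M r (map h xs)))"

definition strongly_homogeneous :: "'a rel \<Rightarrow> ('f, 'r) lang \<Rightarrow> ('f, 'r, 'a) fo_struct \<Rightarrow> bool" where
  "strongly_homogeneous \<kappa> L M \<longleftrightarrow>
     (\<forall>A g. A \<subseteq> univ M \<longrightarrow> |A| <o \<kappa> \<longrightarrow> elementary_map L M A g \<longrightarrow>
        (\<exists>h. struct_automorphism L M h \<and> (\<forall>a\<in>A. h a = g a)))"

text \<open>The set of formulas has cardinality \<open>|L| + \<aleph>\<^sub>0\<close>. An infinite \<open>\<kappa>\<close>-saturated structure has
  at least \<open>\<kappa>\<close> elements, so it is no restriction to look for \<open>\<kappa>\<close> on the type \<open>'a\<close>.\<close>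

definition monster_model :: "('f, 'r) lang \<Rightarrow> ('f, 'r) fm set \<Rightarrow> ('f, 'r, 'a) fo_struct \<Rightarrow> bool" where
  "monster_model L T M \<longleftrightarrow> is_model L T M \<and>
     (\<exists>\<kappa> :: 'a rel. Card_order \<kappa> \<and> |{\<phi>. wf_fm L \<phi>}| <o \<kappa> \<and>
        saturated \<kappa> L M \<and> strongly_homogeneous \<kappa> L M)"


section \<open>Rings and valued fields as first-order structures\<close>

datatype ring_sym = RZero | ROne | RAdd | RMul | RNeg

primrec ring_arity :: "ring_sym \<Rightarrow> nat" where
  "ring_arity RZero = 0"
| "ring_arity ROne = 0"
| "ring_arity RAdd = 2"
| "ring_arity RMul = 2"
| "ring_arity RNeg = 1"

definition pure_ring_lang :: "(ring_sym, unit) lang" where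
  "pure_ring_lang = \<lparr>farity = (\<lambda>f. Some (ring_arity f)), rarity = (\<lambda>_. None)\<rparr>"

definition ring_struct :: "('b, 'c) ring_scheme \<Rightarrow> (ring_sym, unit, 'b) fo_struct" where
  "ring_struct R =
     \<lparr>univ = carrier R,
      fun_int = (\<lambda>f xs. case f of
          RZero \<Rightarrow> \<zero>\<^bsub>R\<^esub>
        | ROne \<Rightarrow> \<one>\<^bsub>R\<^esub>
        | RAdd \<Rightarrow> xs ! 0 \<oplus>\<^bsub>R\<^esub> xs ! 1
        | RMul \<Rightarrow> xs ! 0 \<otimes>\<^bsub>R\<^esub> xs ! 1
        | RNeg \<Rightarrow> \<ominus>\<^bsub>R\<^esub> (xs ! 0)),
      rel_int = (\<lambda>_ _. False)\<rparr>"

text \<open>The language of valued fields is the language of rings together with a unary predicate for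
  the valuation ring. An expansion of it by further function and relation symbols is given by a
  language \<open>L\<close> consisting of the additional symbols. The valued field is the only sort: the value
  group and the residue field are treated as quotients (imaginary sorts) of it.\<close>

datatype val_sym = InO

type_synonym ('f, 'r, 'a) vf_struct = "(ring_sym + 'f, val_sym + 'r, 'a) fo_struct"

definition vf_lang :: "('f, 'r) lang \<Rightarrow> (ring_sym + 'f, val_sym + 'r) lang" where
  "vf_lang L =
     \<lparr>farity = case_sum (\<lambda>f. Some (ring_arity f)) (farity L),
      rarity = case_sum (\<lambda>_. Some 1) (rarity L)\<rparr>"

definition vfield :: "('f, 'r, 'a) vf_struct \<Rightarrow> 'a ring" where
  "vfield M =
     \<lparr>carrier = univ M,
      monoid.mult = (\<lambda>x y. fun_int M (Inl RMul) [x, y]),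
      one = fun_int M (Inl ROne) [],
      ring.zero = fun_int M (Inl RZero) [],
      ring.add = (\<lambda>x y. fun_int M (Inl RAdd) [x, y])\<rparr>"

definition valset :: "('f, 'r, 'a) vf_struct \<Rightarrow> 'a set" where
  "valset M = {x \<in> univ M. rel_int M (Inl InO) [x]}"

definition ACVF :: "('f, 'r, 'a) vf_struct \<Rightarrow> bool" where
  "ACVF M \<longleftrightarrow>
     algebraically_closed (vfield M) \<and>
     (\<forall>x\<in>univ M. fun_int M (Inl RNeg) [x] = \<ominus>\<^bsub>vfield M\<^esub> x) \<and>
     subring (valset M) (vfield M) \<and>
     (\<forall>x\<in>univ M. x \<noteq> \<zero>\<^bsub>vfield M\<^esub> \<longrightarrow> x \<in> valset M \<or> inv\<^bsub>vfield M\<^esub> x \<in> valset M) \<and>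
     valset M \<noteq> univ M"

definition valring :: "('f, 'r, 'a) vf_struct \<Rightarrow> 'a ring" where
  "valring M = (vfield M)\<lparr>carrier := valset M\<rparr>"

definition maxideal :: "('f, 'r, 'a) vf_struct \<Rightarrow> 'a set" where
  "maxideal M = valset M - Units (valring M)"

definition resfield :: "('f, 'r, 'a) vf_struct \<Rightarrow> 'a set ring" where
  "resfield M = valring M Quot maxideal M"

definition res :: "('f, 'r, 'a) vf_struct \<Rightarrow> 'a \<Rightarrow> 'a set" where
  "res M x = maxideal M +>\<^bsub>valring M\<^esub> x"

text \<open>The value group is the multiplicative group of the field modulo the units of the valuation
  ring. It inherits multiplicative notation, so that \<open>\<one>\<close> is the value 0 and \<open>\<gamma> [^] n\<close> is the
  multiple \<open>n \<cdot> \<gamma>\<close>.\<close>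

definition valgroup :: "('f, 'r, 'a) vf_struct \<Rightarrow> 'a set monoid" where
  "valgroup M = units_of (vfield M) Mod Units (valring M)"

definition gval :: "('f, 'r, 'a) vf_struct \<Rightarrow> 'a \<Rightarrow> 'a set" where
  "gval M x = Units (valring M) #>\<^bsub>units_of (vfield M)\<^esub> x"

definition gle :: "('f, 'r, 'a) vf_struct \<Rightarrow> 'a set \<Rightarrow> 'a set \<Rightarrow> bool" where
  "gle M \<alpha> \<beta> \<longleftrightarrow> (\<exists>x\<in>\<alpha>. \<exists>y\<in>\<beta>. y \<otimes>\<^bsub>vfield M\<^esub> inv\<^bsub>vfield M\<^esub> x \<in> valset M)"

text \<open>The extended value group; \<open>None\<close> is the value \<open>\<infinity>\<close> of \<open>\<zero>\<close>.\<close>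

definition val :: "('f, 'r, 'a) vf_struct \<Rightarrow> 'a \<Rightarrow> 'a set option" where
  "val M x = (if x = \<zero>\<^bsub>vfield M\<^esub> then None else Some (gval M x))"

fun vle :: "('f, 'r, 'a) vf_struct \<Rightarrow> 'a set option \<Rightarrow> 'a set option \<Rightarrow> bool" where
  "vle M \<alpha> None \<longleftrightarrow> True"
| "vle M None (Some \<beta>) \<longleftrightarrow> False"
| "vle M (Some \<alpha>) (Some \<beta>) \<longleftrightarrow> gle M \<alpha> \<beta>"

definition vless :: "('f, 'r, 'a) vf_struct \<Rightarrow> 'a set option \<Rightarrow> 'a set option \<Rightarrow> bool" where
  "vless M \<alpha> \<beta> \<longleftrightarrow> \<not> vle M \<beta> \<alpha>"

definition vmult :: "('f, 'r, 'a) vf_struct \<Rightarrow> int \<Rightarrow> 'a set option \<Rightarrow> 'a set option" where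
  "vmult M n \<alpha> = map_option (\<lambda>\<gamma>. \<gamma> [^]\<^bsub>valgroup M\<^esub> n) \<alpha>"

definition is_ball :: "('f, 'r, 'a) vf_struct \<Rightarrow> 'a set \<Rightarrow> bool" where
  "is_ball M B \<longleftrightarrow> (\<exists>c\<in>univ M. \<exists>\<gamma>\<in>carrier (valgroup M).
     B = {x \<in> univ M. vle M (Some \<gamma>) (val M (x \<ominus>\<^bsub>vfield M\<^esub> c))} \<or>
     B = {x \<in> univ M. vless M (Some \<gamma>) (val M (x \<ominus>\<^bsub>vfield M\<^esub> c))})"

definition vbounded :: "('f, 'r, 'a) vf_struct \<Rightarrow> 'a set \<Rightarrow> bool" where
  "vbounded M S \<longleftrightarrow> (\<exists>B. is_ball M B \<and> S \<subseteq> B)"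

inductive_set ball_combinations :: "('f, 'r, 'a) vf_struct \<Rightarrow> 'a set set"
  for M :: "('f, 'r, 'a) vf_struct" where
  ball: "is_ball M B \<Longrightarrow> B \<in> ball_combinations M"
| point: "a \<in> univ M \<Longrightarrow> {a} \<in> ball_combinations M"
| compl: "S \<in> ball_combinations M \<Longrightarrow> univ M - S \<in> ball_combinations M"
| union: "S \<in> ball_combinations M \<Longrightarrow> S' \<in> ball_combinations M \<Longrightarrow> S \<union> S' \<in> ball_combinations M"


section \<open>C-minimal expansions of ACVF\<close>

definition C_minimal_ACVF_expansion ::
  "'a itself \<Rightarrow> ('f, 'r) lang \<Rightarrow> (ring_sym + 'f, val_sym + 'r) fm set \<Rightarrow> bool" where
  "C_minimal_ACVF_expansion _ L T \<longleftrightarrow>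
     (\<forall>N :: ('f, 'r, 'a) vf_struct. is_model (vf_lang L) T N \<longrightarrow>
        ACVF N \<and>
        (\<forall>S \<subseteq> univ N. definable (vf_lang L) N 1 ((\<lambda>x. [x]) ` S) \<longrightarrow> S \<in> ball_combinations N))"

text \<open>A map on a quotient \<open>\<pi> ` S\<close> of a set \<open>S\<close> is definable if the preimage of its graph in
  \<open>S \<times> S\<close> is.\<close>

definition definable_quot_map ::
  "('f, 'r) lang \<Rightarrow> ('f, 'r, 'a) fo_struct \<Rightarrow> 'a set \<Rightarrow> ('a \<Rightarrow> 'b) \<Rightarrow> ('b \<Rightarrow> 'b) \<Rightarrow> bool" where
  "definable_quot_map L M S \<pi> \<sigma> \<longleftrightarrow>
     definable L M 2 {[x, y] |x y. x \<in> S \<and> y \<in> S \<and> \<sigma> (\<pi> x) = \<pi> y}"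

definition no_exotic_automorphisms_residue ::
  "('f, 'r) lang \<Rightarrow> ('f, 'r, 'a) vf_struct \<Rightarrow> bool" where
  "no_exotic_automorphisms_residue L M \<longleftrightarrow>
     (\<forall>\<sigma>. \<sigma> \<in> iso (units_of (resfield M)) (units_of (resfield M)) \<longrightarrow>
        definable_quot_map (vf_lang L) M (Units (valring M)) (res M) \<sigma> \<longrightarrow>
        definable pure_ring_lang (ring_struct (resfield M)) 2
          {[\<alpha>, \<sigma> \<alpha>] |\<alpha>. \<alpha> \<in> Units (resfield M)})"

text \<open>The value group of an algebraically closed valued field is uniquely divisible, so
  multiplication by the positive rational \<open>m / n\<close> is the map \<open>\<sigma>\<close> with \<open>n \<cdot> \<sigma> \<gamma> = m \<cdot> \<gamma>\<close>.\<close>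

definition no_exotic_automorphisms_value ::
  "('f, 'r) lang \<Rightarrow> ('f, 'r, 'a) vf_struct \<Rightarrow> bool" where
  "no_exotic_automorphisms_value L M \<longleftrightarrow>
     (\<forall>\<sigma>. \<sigma> \<in> iso (valgroup M) (valgroup M) \<longrightarrow>
        (\<forall>\<alpha>\<in>carrier (valgroup M). \<forall>\<beta>\<in>carrier (valgroup M). gle M \<alpha> \<beta> = gle M (\<sigma> \<alpha>) (\<sigma> \<beta>)) \<longrightarrow>
        definable_quot_map (vf_lang L) M (Units (vfield M)) (gval M) \<sigma> \<longrightarrow>
        (\<exists>(m :: nat) (n :: nat). m > 0 \<and> n > 0 \<and>
           (\<forall>\<gamma>\<in>carrier (valgroup M). \<sigma> \<gamma> [^]\<^bsub>valgroup M\<^esub> n = \<gamma> [^]\<^bsub>valgroup M\<^esub> m)))"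

definition polynomially_bounded :: "('f, 'r) lang \<Rightarrow> ('f, 'r, 'a) vf_struct \<Rightarrow> bool" where
  "polynomially_bounded L M \<longleftrightarrow>
     (\<forall>f \<in> univ M \<rightarrow> univ M.
        definable (vf_lang L) M 2 {[x, f x] |x. x \<in> univ M} \<longrightarrow>
        (\<exists>n :: int. \<exists>S. vbounded M S \<and>
           (\<forall>x \<in> univ M - S. vless M (vmult M n (val M x)) (val M (f x)))))"

end

theory Submission
  imports Defs
begin

text \<open>Suppose \<open>f\<close> grows faster than every power. By C-minimality a definable subgroup of the units of
  the valuation ring with infinitely many residues contains all units, so \<open>v (f x)\<close> depends only on
  \<open>v x\<close> for large \<open>x\<close>.

  Residues: the residue of \<open>f (c x) / f x\<close> for large \<open>x\<close> defines a homomorphism \<open>\<sigma>\<close> on the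
  multiplicative group of the residue field. If it is not trivial, its kernel is a group of roots of
  unity, say of order \<open>N\<close>, and \<open>c ^ N \<mapsto> \<sigma> c\<close> is an automorphism. Since it is definable in the pure
  ring language, quantifier elimination and independence of characters make a power of \<open>\<sigma> c\<close> a power
  of \<open>c\<close>. A monomial \<open>g\<close> in \<open>f\<close> and \<open>x\<close> thus has leading term depending only on \<open>v x\<close>, and \<open>v g\<close>
  is strictly monotone; then the set of all elements with the same leading term as some \<open>g x\<close> is
  unbounded but omits unboundedly many elements, against C-minimality.

  Values: \<open>f\<close> induces a function \<open>F\<close> on the o-minimal value group, superlinear at infinity. A function
  whose increments by \<open>a\<close> are eventually bounded but exceed all multiples of \<open>a\<close> has as asymptotic
  slope an exotic automorphism. Saturation provides elements \<open>u\<close> and \<open>a\<close> with \<open>n u \<le> a\<close> for all \<open>n\<close>, from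
  which such a function is built out of \<open>F\<close> and its inverse.\<close>

section \<open>Ordered abelian groups\<close>

text \<open>The main obstacle is uniformity. A property of \<open>f (c x)\<close> holds for each
  unit \<open>c\<close> only beyond a bound that depends on \<open>c\<close>, and nothing is
  complete or Archimedean. The remedy is a finiteness principle: in a definable family that grows as
  the level decreases, if every member is finite, so is the union; for units, residues are counted
  instead of elements. So a growing family of definable subgroups that exhausts the units has a
  member with infinitely many residues, and that member is everything. The same principle drives the
  monotonicity theorem on the value group.

  On the value group the slope of \<open>F\<close> itself is out of reach, because the increments of
  a superlinear function are unbounded. The increments of its inverse tend to 0 but lose less than
  half of their size under a bounded shift. Matching an increment for the step \<open>u\<close> with
  one for the step \<open>a\<close> far away rescales the group: \<open>u\<close> plays the role of
  \<open>a\<close>, and the limit has increments that are bounded yet exceed all multiples of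
  \<open>u\<close>. No rational factor does this if \<open>a\<close> exceeds all multiples of
  \<open>u\<close>.

  Large field elements have very negative values, so signs are reversed in the passage to the value
  group.\<close>

definition ordered_comm_group :: "'b monoid \<Rightarrow> ('b \<Rightarrow> 'b \<Rightarrow> bool) \<Rightarrow> bool" where
  "ordered_comm_group H leq \<longleftrightarrow> comm_group H \<and>
     (\<forall>x\<in>carrier H. \<forall>y\<in>carrier H. leq x y \<or> leq y x) \<and>
     (\<forall>x\<in>carrier H. \<forall>y\<in>carrier H. leq x y \<longrightarrow> leq y x \<longrightarrow> x = y) \<and>
     (\<forall>x\<in>carrier H. \<forall>y\<in>carrier H. \<forall>z\<in>carrier H. leq x y \<longrightarrow> leq y z \<longrightarrow> leq x z) \<and>
     (\<forall>x\<in>carrier H. \<forall>y\<in>carrier H. \<forall>z\<in>carrier H. leq x y \<longrightarrow> leq (z \<otimes>\<^bsub>H\<^esub> x) (z \<otimes>\<^bsub>H\<^esub> y))"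

text \<open>The index type of a product: one index for each ordered abelian group whose carrier lies
  in \<open>'b\<close>. The one-element group shows that the type is inhabited.\<close>

typedef 'b ogroup = "{(H :: 'b monoid, leq). ordered_comm_group H leq}"
proof
  let ?H = "\<lparr>carrier = {undefined :: 'b}, monoid.mult = (\<lambda>_ _. undefined), one = undefined\<rparr>"
  have "comm_group ?H"
    by (rule comm_groupI) auto
  then show "(?H, \<lambda>_ _. True) \<in> {(H :: 'b monoid, leq). ordered_comm_group H leq}"
    by (auto simp: ordered_comm_group_def)
qed

definition og_group :: "'b ogroup \<Rightarrow> 'b monoid" where "og_group S = fst (Rep_ogroup S)"
definition og_le :: "'b ogroup \<Rightarrow> 'b \<Rightarrow> 'b \<Rightarrow> bool" where "og_le S = snd (Rep_ogroup S)"

lemma ordered_comm_group_og: "ordered_comm_group (og_group S) (og_le S)"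
  using Rep_ogroup[of S] by (auto simp: og_group_def og_le_def)

lemma comm_group_og: "comm_group (og_group S)"
  using ordered_comm_group_og by (auto simp: ordered_comm_group_def)

lemma group_og: "group (og_group S)" and monoid_og: "monoid (og_group S)"
  and comm_monoid_og: "comm_monoid (og_group S)"
  using comm_group_og[of S] by (auto simp: comm_group_def group_def)

lemma og_le_linear: "x \<in> carrier (og_group S) ==> y \<in> carrier (og_group S) ==> og_le S x y \<or> og_le S y x"
  and og_le_antisym: "x \<in> carrier (og_group S) ==> y \<in> carrier (og_group S) ==>
        og_le S x y ==> og_le S y x ==> x = y"
  and og_le_trans: "x \<in> carrier (og_group S) ==> y \<in> carrier (og_group S) ==> z \<in> carrier (og_group S) ==>
        og_le S x y ==> og_le S y z ==> og_le S x z"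
  and og_le_mult: "x \<in> carrier (og_group S) ==> y \<in> carrier (og_group S) ==> z \<in> carrier (og_group S) ==>
        og_le S x y ==> og_le S (z \<otimes>\<^bsub>og_group S\<^esub> x) (z \<otimes>\<^bsub>og_group S\<^esub> y)"
  using ordered_comm_group_og[of S] unfolding ordered_comm_group_def by blast+

text \<open>A locale parameter cannot be turned into a type, but all ordered abelian groups on subsets of
  \<open>'b\<close> embed into one type of class \<open>linordered_ab_group_add\<close>: their lexicographic product along some
  well-ordering of the index set.\<close>

typedef 'b lexprod = "{h :: 'b ogroup \<Rightarrow> 'b. \<forall>S. h S \<in> carrier (og_group S)}"
proof
  show "(\<lambda>S. \<one>\<^bsub>og_group S\<^esub>) \<in> {h :: 'b ogroup \<Rightarrow> 'b. \<forall>S. h S \<in> carrier (og_group S)}"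
    by (auto intro: monoid.one_closed monoid_og)
qed

setup_lifting type_definition_lexprod

text \<open>Any total well-founded order serves. Well-foundedness yields the first coordinate at
  which two families differ, and this coordinate decides their comparison.\<close>

definition ogroup_less :: "'b ogroup \<Rightarrow> 'b ogroup \<Rightarrow> bool" where
  "ogroup_less = (SOME less. wfp less \<and> transp less \<and> (\<forall>x y. x \<noteq> y \<longrightarrow> less x y \<or> less y x))"

lemma ogroup_less:
  shows wfp_ogroup_less: "wfp (ogroup_less :: 'b ogroup \<Rightarrow> _)"
    and ogroup_less_trans: "ogroup_less x y ==> ogroup_less y z ==> ogroup_less x (z :: 'b ogroup)"
    and ogroup_less_total: "x \<noteq> y ==> ogroup_less x y \<or> ogroup_less y (x :: 'b ogroup)"
proof -
  obtain r :: "'b ogroup rel" where r: "well_order_on UNIV r"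
    using well_order_on by blast
  have "wfp (\<lambda>x y. (x, y) \<in> r - Id)"
  proof -
    have "{(x, y). (x, y) \<in> r - Id} = r - Id" by auto
    then show ?thesis using r unfolding well_order_on_def wfp_def by simp
  qed
  moreover have "transp (\<lambda>x y. (x, y) \<in> r - Id)"
  proof -
    have "trans r" "antisym r"
      using r unfolding well_order_on_def linear_order_on_def partial_order_on_def preorder_on_def by blast+
    then show ?thesis by (intro transpI) (blast dest: transD antisymD)
  qed
  moreover have "\<forall>x y. x \<noteq> y \<longrightarrow> (x, y) \<in> r - Id \<or> (y, x) \<in> r - Id"
    using r by (auto simp: well_order_on_def linear_order_on_def total_on_def)
  ultimately have "\<exists>less :: 'b ogroup \<Rightarrow> _.
      wfp less \<and> transp less \<and> (\<forall>x y. x \<noteq> y \<longrightarrow> less x y \<or> less y x)"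
    by blast
  from someI_ex[OF this] show "wfp (ogroup_less :: 'b ogroup \<Rightarrow> _)"
    "ogroup_less x y ==> ogroup_less y z ==> ogroup_less x (z :: 'b ogroup)"
    "x \<noteq> y ==> ogroup_less x y \<or> ogroup_less y (x :: 'b ogroup)"
    unfolding ogroup_less_def transp_def by (blast, blast, blast)
qed

lemma ogroup_less_irrefl: "\<not> ogroup_less x x"
  using wfp_ogroup_less by (meson wfp_imp_irreflp irreflpD)

instantiation lexprod :: (type) ab_group_add
begin
lift_definition zero_lexprod :: "'a lexprod" is "\<lambda>S. \<one>\<^bsub>og_group S\<^esub>"
  by (auto intro: monoid.one_closed monoid_og)
lift_definition plus_lexprod :: "'a lexprod \<Rightarrow> 'a lexprod \<Rightarrow> 'a lexprod" is
  "\<lambda>x y S. x S \<otimes>\<^bsub>og_group S\<^esub> y S"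
  by (auto intro: monoid.m_closed monoid_og)
lift_definition uminus_lexprod :: "'a lexprod \<Rightarrow> 'a lexprod" is "\<lambda>x S. inv\<^bsub>og_group S\<^esub> x S"
  by (auto intro: group.inv_closed group_og)
definition minus_lexprod :: "'a lexprod \<Rightarrow> 'a lexprod \<Rightarrow> 'a lexprod" where "x - y = x + - y" for x y :: "'a lexprod"
instance
proof
  fix a b c :: "'a lexprod"
  show "a + b + c = a + (b + c)"
    by transfer (auto simp: monoid.m_assoc[OF monoid_og])
  show "a + b = b + a"
    by transfer (auto simp: comm_monoid.m_comm[OF comm_monoid_og])
  show "0 + a = a"
    by transfer (auto simp: monoid.l_one[OF monoid_og])
  show "- a + a = 0"
    by transfer (auto simp: group.l_inv[OF group_og])
  show "a - b = a + - b"
    by (simp add: minus_lexprod_def)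
qed
end

instantiation lexprod :: (type) linordered_ab_group_add
begin
lift_definition less_lexprod :: "'a lexprod \<Rightarrow> 'a lexprod \<Rightarrow> bool" is
  "\<lambda>x y. \<exists>S. x S \<noteq> y S \<and> og_le S (x S) (y S) \<and> (\<forall>S'. ogroup_less S' S \<longrightarrow> x S' = y S')" .
definition less_eq_lexprod :: "'a lexprod \<Rightarrow> 'a lexprod \<Rightarrow> bool" where
  "x \<le> y \<longleftrightarrow> x = y \<or> x < y" for x y :: "'a lexprod"
instance
proof -
  have irrefl: "\<not> a < a" for a :: "'a lexprod"
    by transfer auto
  have trans: "a < c" if "a < b" "b < c" for a b c :: "'a lexprod"
    using that
  proof transfer
    fix a b c :: "'a ogroup \<Rightarrow> 'a"
    assume cl: "\<forall>S. a S \<in> carrier (og_group S)" "\<forall>S. b S \<in> carrier (og_group S)" "\<forall>S. c S \<in> carrier (og_group S)"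
    assume "\<exists>S. a S \<noteq> b S \<and> og_le S (a S) (b S) \<and> (\<forall>S'. ogroup_less S' S \<longrightarrow> a S' = b S')"
      "\<exists>S. b S \<noteq> c S \<and> og_le S (b S) (c S) \<and> (\<forall>S'. ogroup_less S' S \<longrightarrow> b S' = c S')"
    then obtain S S' where S: "a S \<noteq> b S" "og_le S (a S) (b S)" "\<And>R. ogroup_less R S ==> a R = b R"
      and S': "b S' \<noteq> c S'" "og_le S' (b S') (c S')" "\<And>R. ogroup_less R S' ==> b R = c R"
      by blast
    \<comment> \<open>The earlier of the two deciding coordinates decides the comparison of
      \<open>a\<close> with \<open>c\<close>.\<close>
    consider "S = S'" | "ogroup_less S S'" | "ogroup_less S' S"
      using ogroup_less_total by blast
    then show "\<exists>S. a S \<noteq> c S \<and> og_le S (a S) (c S) \<and> (\<forall>S'. ogroup_less S' S \<longrightarrow> a S' = c S')"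
    proof cases
      case 1
      then have le: "og_le S (a S) (b S)" "og_le S (b S) (c S)" and ne: "b S \<noteq> c S"
        using S(2) S'(1,2) by simp_all
      have eq: "a R = c R" if "ogroup_less R S" for R
        using S(3)[OF that] S'(3)[of R] that 1 by simp
      have "og_le S (a S) (c S)" "a S \<noteq> c S"
        using le ne cl og_le_trans[of "a S" S "b S" "c S"] og_le_antisym[of "b S" S "c S"] by auto
      then show ?thesis using eq by blast
    next
      case 2
      then have "b S = c S" by (rule S'(3))
      then have "a S \<noteq> c S" "og_le S (a S) (c S)" using S(1,2) by simp_all
      moreover have "a R = c R" if "ogroup_less R S" for R
        using S(3)[OF that] S'(3)[OF ogroup_less_trans[OF that 2]] by simp
      ultimately show ?thesis by blast
    next
      case 3
      then have "a S' = b S'" by (rule S(3))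
      then have "a S' \<noteq> c S'" "og_le S' (a S') (c S')" using S'(1,2) by simp_all
      moreover have "a R = c R" if "ogroup_less R S'" for R
        using S'(3)[OF that] S(3)[OF ogroup_less_trans[OF that 3]] by simp
      ultimately show ?thesis by blast
    qed
  qed
  have linear: "a < b \<or> a = b \<or> b < a" for a b :: "'a lexprod"
  proof transfer
    fix a b :: "'a ogroup \<Rightarrow> 'a"
    assume cl: "\<forall>S. a S \<in> carrier (og_group S)" "\<forall>S. b S \<in> carrier (og_group S)"
    show "(\<exists>S. a S \<noteq> b S \<and> og_le S (a S) (b S) \<and> (\<forall>S'. ogroup_less S' S \<longrightarrow> a S' = b S')) \<or> a = b \<or>
       (\<exists>S. b S \<noteq> a S \<and> og_le S (b S) (a S) \<and> (\<forall>S'. ogroup_less S' S \<longrightarrow> b S' = a S'))"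
    proof (cases "a = b")
      case False
      then obtain S where "S \<in> {S. a S \<noteq> b S}" by auto
      then obtain S where ab: "a S \<noteq> b S" and eq: "\<And>R. ogroup_less R S ==> R \<notin> {S. a S \<noteq> b S}"
        using wfE_min[OF wfp_ogroup_less[unfolded wfp_def], of S "{S. a S \<noteq> b S}"] by auto
      have "og_le S (a S) (b S) \<or> og_le S (b S) (a S)" using cl og_le_linear[of "a S" S "b S"] by simp
      then show ?thesis
      proof
        assume "og_le S (a S) (b S)"
        with ab eq have "\<exists>S. a S \<noteq> b S \<and> og_le S (a S) (b S) \<and> (\<forall>S'. ogroup_less S' S \<longrightarrow> a S' = b S')"
          by (intro exI[of _ S]) simp
        then show ?thesis by simp
      next
        assume "og_le S (b S) (a S)"
        with ab eq have "\<exists>S. b S \<noteq> a S \<and> og_le S (b S) (a S) \<and> (\<forall>S'. ogroup_less S' S \<longrightarrow> b S' = a S')"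
          by (intro exI[of _ S]) simp
        then show ?thesis by simp
      qed
    qed simp
  qed
  have mono: "c + a < c + b" if "a < b" for a b c :: "'a lexprod"
    using that
  proof transfer
    fix a b c :: "'a ogroup \<Rightarrow> 'a"
    assume cl: "\<forall>S. a S \<in> carrier (og_group S)" "\<forall>S. b S \<in> carrier (og_group S)" "\<forall>S. c S \<in> carrier (og_group S)"
    assume "\<exists>S. a S \<noteq> b S \<and> og_le S (a S) (b S) \<and> (\<forall>S'. ogroup_less S' S \<longrightarrow> a S' = b S')"
    then obtain S where S: "a S \<noteq> b S" "og_le S (a S) (b S)" "\<forall>S'. ogroup_less S' S \<longrightarrow> a S' = b S'"
      by blast
    then show "\<exists>S. c S \<otimes>\<^bsub>og_group S\<^esub> a S \<noteq> c S \<otimes>\<^bsub>og_group S\<^esub> b S \<and>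
         og_le S (c S \<otimes>\<^bsub>og_group S\<^esub> a S) (c S \<otimes>\<^bsub>og_group S\<^esub> b S) \<and>
         (\<forall>S'. ogroup_less S' S \<longrightarrow> c S' \<otimes>\<^bsub>og_group S'\<^esub> a S' = c S' \<otimes>\<^bsub>og_group S'\<^esub> b S')"
      using cl og_le_mult[of "a S" S "b S" "c S"] by (intro exI[of _ S]) (auto simp: monoid.Units_l_cancel[OF monoid_og] group.Units_eq[OF group_og])
  qed
  show "OFCLASS('a lexprod, linordered_ab_group_add_class)"
  proof
    fix a b c :: "'a lexprod"
    show "(a < b) = (a \<le> b \<and> \<not> b \<le> a)"
      unfolding less_eq_lexprod_def using irrefl[of a] trans[of a b a] by auto
    show "a \<le> a" by (simp add: less_eq_lexprod_def)
    show "a \<le> b ==> b \<le> c ==> a \<le> c" unfolding less_eq_lexprod_def using trans[of a b c] by auto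
    show "a \<le> b ==> b \<le> a ==> a = b" unfolding less_eq_lexprod_def using irrefl[of a] trans[of a b a] by auto
    show "a \<le> b \<or> b \<le> a" unfolding less_eq_lexprod_def using linear[of a b] by auto
    show "a \<le> b ==> c + a \<le> c + b" unfolding less_eq_lexprod_def using mono[of a b c] by auto
  qed
qed
end

text \<open>An element is sent to the family that carries it at the coordinate of the group itself
  and neutral elements elsewhere. Two such families can differ at that coordinate only, so the
  lexicographic order restricts to the given one.\<close>

lemma embed_ordered_comm_group:
  fixes H :: "'b monoid"
  assumes "ordered_comm_group H leq"
  obtains \<iota> :: "'b \<Rightarrow> 'b lexprod"
  where "\<And>x y. x \<in> carrier H ==> y \<in> carrier H ==> \<iota> (x \<otimes>\<^bsub>H\<^esub> y) = \<iota> x + \<iota> y"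
    and "\<And>x y. x \<in> carrier H ==> y \<in> carrier H ==> \<iota> x \<le> \<iota> y \<longleftrightarrow> leq x y"
    and "inj_on \<iota> (carrier H)"
proof -
  interpret H: comm_group H using assms by (simp add: ordered_comm_group_def)
  define S0 where "S0 = Abs_ogroup (H, leq)"
  have S0: "og_group S0 = H" "og_le S0 = leq"
    using assms by (simp_all add: S0_def og_group_def og_le_def Abs_ogroup_inverse)
  define h where "h x = (\<lambda>S. if S = S0 then x else \<one>\<^bsub>og_group S\<^esub>)" for x
  define \<iota> where "\<iota> x = Abs_lexprod (h x)" for x
  have h: "\<forall>S. h x S \<in> carrier (og_group S)" if "x \<in> carrier H" for x
    using that S0 by (auto simp: h_def intro: monoid.one_closed monoid_og)
  have rep: "Rep_lexprod (\<iota> x) = h x" if "x \<in> carrier H" for x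
    using h[OF that] by (simp add: \<iota>_def Abs_lexprod_inverse)
  have inj: "inj_on \<iota> (carrier H)"
  proof (rule inj_onI)
    fix x y assume "x \<in> carrier H" "y \<in> carrier H" "\<iota> x = \<iota> y"
    then have "h x S0 = h y S0" using rep[of x] rep[of y] by simp
    then show "x = y" by (simp add: h_def)
  qed
  have less: "\<iota> x < \<iota> y \<longleftrightarrow> x \<noteq> y \<and> leq x y" if "x \<in> carrier H" "y \<in> carrier H" for x y
  proof -
    have ne: "h x S \<noteq> h y S \<longleftrightarrow> S = S0 \<and> x \<noteq> y" for S by (simp add: h_def)
    have "\<iota> x < \<iota> y \<longleftrightarrow> (\<exists>S. h x S \<noteq> h y S \<and> og_le S (h x S) (h y S) \<and>
        (\<forall>S'. ogroup_less S' S \<longrightarrow> h x S' = h y S'))"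
      using that unfolding less_lexprod.rep_eq by (simp add: rep)
    also have "\<dots> \<longleftrightarrow> x \<noteq> y \<and> og_le S0 (h x S0) (h y S0)"
    proof
      assume "\<exists>S. h x S \<noteq> h y S \<and> og_le S (h x S) (h y S) \<and>
        (\<forall>S'. ogroup_less S' S \<longrightarrow> h x S' = h y S')"
      then obtain S where S: "h x S \<noteq> h y S" "og_le S (h x S) (h y S)" by blast
      then have "S = S0" "x \<noteq> y" using ne[of S] by simp_all
      with S show "x \<noteq> y \<and> og_le S0 (h x S0) (h y S0)" by simp
    next
      assume r: "x \<noteq> y \<and> og_le S0 (h x S0) (h y S0)"
      have "h x S' = h y S'" if "ogroup_less S' S0" for S'
        using ne[of S'] that ogroup_less_irrefl[of S0] by blast
      then show "\<exists>S. h x S \<noteq> h y S \<and> og_le S (h x S) (h y S) \<and>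
        (\<forall>S'. ogroup_less S' S \<longrightarrow> h x S' = h y S')"
        using r ne[of S0] by (intro exI[of _ S0]) simp
    qed
    finally show ?thesis by (simp add: S0 h_def)
  qed
  show thesis
  proof
    fix x y assume xy: "x \<in> carrier H" "y \<in> carrier H"
    show "\<iota> (x \<otimes>\<^bsub>H\<^esub> y) = \<iota> x + \<iota> y"
    proof -
      have h_mult: "h (x \<otimes>\<^bsub>H\<^esub> y) = (\<lambda>S. h x S \<otimes>\<^bsub>og_group S\<^esub> h y S)"
      proof
        fix S :: "'b ogroup"
        have "\<one>\<^bsub>og_group S\<^esub> \<otimes>\<^bsub>og_group S\<^esub> \<one>\<^bsub>og_group S\<^esub> = \<one>\<^bsub>og_group S\<^esub>"
          by (rule monoid.l_one[OF monoid_og monoid.one_closed[OF monoid_og]])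
        then show "h (x \<otimes>\<^bsub>H\<^esub> y) S = h x S \<otimes>\<^bsub>og_group S\<^esub> h y S"
          unfolding h_def by (cases "S = S0") (simp_all add: S0)
      qed
      have xy_H: "x \<otimes>\<^bsub>H\<^esub> y \<in> carrier H" using xy by (rule H.m_closed)
      have "Rep_lexprod (\<iota> x + \<iota> y) = h (x \<otimes>\<^bsub>H\<^esub> y)"
        unfolding h_mult plus_lexprod.rep_eq rep[OF xy(1)] rep[OF xy(2)] by (rule refl)
      then show ?thesis
        unfolding Rep_lexprod_inject[symmetric] rep[OF xy_H] by (rule sym)
    qed
    have "\<forall>x\<in>carrier H. \<forall>y\<in>carrier H. leq x y \<or> leq y x"
      using assms unfolding ordered_comm_group_def by (elim conjE)
    then have "leq x x" using xy(1) by blast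
    moreover have "\<iota> x = \<iota> y \<longleftrightarrow> x = y" using inj xy by (rule inj_on_eq_iff)
    ultimately show "\<iota> x \<le> \<iota> y \<longleftrightarrow> leq x y"
      unfolding le_less[of "\<iota> x"] less[OF xy] by blast
  qed (fact inj)
qed

section \<open>O-minimal ordered groups\<close>

text \<open>Natural multiples in an ordered group. They serve to say that an element exceeds all
  multiples of another, and to express rational factors by cross multiplication.\<close>

primrec nmul :: "nat \<Rightarrow> 'g :: linordered_ab_group_add \<Rightarrow> 'g" where
  "nmul 0 x = 0"
| "nmul (Suc n) x = x + nmul n x"

lemma nmul_add: "nmul n (x + y) = nmul n x + nmul n y"
  by (induction n) (simp_all add: algebra_simps)

lemma nmul_plus: "nmul (m + n) x = nmul m x + nmul n x"
  by (induction m) (simp_all add: algebra_simps)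

lemma nmul_minus: "nmul n (- x) = - nmul n x"
  by (induction n) simp_all

lemma nmul_nonneg: "0 \<le> x ==> 0 \<le> nmul n x"
  by (induction n) simp_all

lemma nmul_mono_left: "0 \<le> x ==> m \<le> n ==> nmul m x \<le> nmul n x"
  using nmul_nonneg[of x "n - m"] nmul_plus[of "n - m" m x] by simp

lemma add_self_less_iff: "x + x < y + y \<longleftrightarrow> x < (y :: 'g :: linordered_ab_group_add)"
  by (meson add_mono add_strict_mono linorder_not_le)

text \<open>\<open>D P\<close> reads: the predicate \<open>P\<close> on assignments is definable
  with parameters, where only assignments into \<open>G\<close> count. Variables are de Bruijn
  indices; a quantified variable is index 0 and the others are shifted. The interface will be
  instantiated by the valued field and, through pullback along the valuation, by the value
  group.\<close>

locale definable_sets =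
  fixes G :: "'a set" and D :: "((nat \<Rightarrow> 'a) \<Rightarrow> bool) \<Rightarrow> bool"
  assumes D_cong: "D P ==> (\<And>E. range E \<subseteq> G ==> P E \<longleftrightarrow> P' E) ==> D P'"
    and D_not: "D P ==> D (\<lambda>E. \<not> P E)"
    and D_conj: "D P ==> D P' ==> D (\<lambda>E. P E \<and> P' E)"
    and D_ex: "D (\<lambda>E. R (\<lambda>i. E (Suc i)) (E 0)) ==> D (\<lambda>E. \<exists>x\<in>G. R E x)"
    and D_subst: "D P ==> D (\<lambda>E. P (\<lambda>i. E (f i)))"
    and D_eq0: "D (\<lambda>E. E 0 = E 1)"
    and D_const0: "c \<in> G ==> D (\<lambda>E. E 0 = c)"
begin

lemma D_disj: assumes "D P" "D P'" shows "D (\<lambda>E. P E \<or> P' E)"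
  using D_not[OF D_conj[OF D_not[OF assms(1)] D_not[OF assms(2)]]] by simp

lemma D_imp: assumes "D P" "D P'" shows "D (\<lambda>E. P E \<longrightarrow> P' E)"
  using D_not[OF D_conj[OF assms(1) D_not[OF assms(2)]]] by simp

lemma D_all: assumes "D (\<lambda>E. R (\<lambda>i. E (Suc i)) (E 0))" shows "D (\<lambda>E. \<forall>x\<in>G. R E x)"
  using D_not[OF D_ex[of "\<lambda>E x. \<not> R E x", OF D_not[OF assms]]] by simp

text \<open>Functions with definable graph take the place of terms. In the graph, index 0 holds the
  value and the shifted indices hold the arguments.\<close>

definition tm :: "((nat \<Rightarrow> 'a) \<Rightarrow> 'a) \<Rightarrow> bool" where
  "tm t \<longleftrightarrow> (\<forall>E. range E \<subseteq> G \<longrightarrow> t E \<in> G) \<and> D (\<lambda>E. E 0 = t (\<lambda>i. E (Suc i)))"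

lemma tm_G: "tm t ==> range E \<subseteq> G ==> t E \<in> G"
  by (simp add: tm_def)

lemma tm_G1: "tm (\<lambda>E. F (E 0)) ==> x \<in> G ==> F x \<in> G"
  using tm_G[of "\<lambda>E. F (E 0)" "\<lambda>_. x"] by auto

lemma tm_G2: "tm (\<lambda>E. F (E 0) (E 1)) ==> x \<in> G ==> y \<in> G ==> F x y \<in> G"
  using tm_G[of "\<lambda>E. F (E 0) (E 1)" "\<lambda>i. if i = 0 then x else y"] by auto

lemma tm_var: "tm (\<lambda>E. E i)"
  using D_subst[OF D_eq0, of "\<lambda>j. if j = 0 then 0 else Suc i"] by (auto simp: tm_def)

lemma tm_const: "c \<in> G ==> tm (\<lambda>E. c)"
  by (auto simp: tm_def intro: D_const0)

lemma tm_subst: assumes "tm t" shows "tm (\<lambda>E. t (\<lambda>i. E (f i)))"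
proof -
  have "D (\<lambda>E. E 0 = t (\<lambda>i. E (Suc (f i))))"
    using assms D_subst[of "\<lambda>E. E 0 = t (\<lambda>i. E (Suc i))" "\<lambda>j. case j of 0 \<Rightarrow> 0 | Suc i \<Rightarrow> Suc (f i)"]
    by (simp add: tm_def)
  moreover have "t (\<lambda>i. E (f i)) \<in> G" if "range E \<subseteq> G" for E
  proof -
    have "range (\<lambda>i. E (f i)) \<subseteq> G" using that by auto
    then show ?thesis using assms by (simp add: tm_def)
  qed
  ultimately show ?thesis by (simp add: tm_def)
qed

text \<open>Substitution of a definable function amounts to a quantifier over its value.\<close>

lemma D_plug:
  assumes "tm t" "D (\<lambda>E. R (\<lambda>i. E (Suc i)) (E 0))"
  shows "D (\<lambda>E. R E (t E))"
proof -
  have "D (\<lambda>E. \<exists>x\<in>G. x = t E \<and> R E x)"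
    using assms by (intro D_ex D_conj) (auto simp: tm_def)
  then show ?thesis by (rule D_cong) (use assms(1) in \<open>auto simp: tm_def\<close>)
qed

lemma D_comp1: "D (\<lambda>E. Q (E 0)) ==> tm t ==> D (\<lambda>E. Q (t E))"
  by (rule D_plug[where R = "\<lambda>E x. Q x"])

lemma D_comp2:
  assumes "D (\<lambda>E. R (E 0) (E 1))" "tm t" "tm u"
  shows "D (\<lambda>E. R (t E) (u E))"
proof (rule D_plug[OF assms(2), where R = "\<lambda>E x. R x (u E)"],
    rule D_plug[OF tm_subst[OF assms(3)], where R = "\<lambda>E x. R (E 0) x"])
  show "D (\<lambda>E. R (E (Suc 0)) (E 0))"
    using D_subst[OF assms(1), of "\<lambda>i. 1 - i"] by simp
qed

lemma D_comp3:
  assumes "D (\<lambda>E. R (E 0) (E 1) (E 2))" "tm t" "tm u" "tm v"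
  shows "D (\<lambda>E. R (t E) (u E) (v E))"
proof (rule D_plug[OF assms(2), where R = "\<lambda>E x. R x (u E) (v E)"],
    rule D_plug[OF tm_subst[OF assms(3)], where R = "\<lambda>E x. R (E 0) x (v (\<lambda>i. E (Suc i)))"],
    rule D_plug[OF tm_subst[OF assms(4)], where R = "\<lambda>E x. R (E (Suc 0)) (E 0) x"])
  show "D (\<lambda>E. R (E (Suc (Suc 0))) (E (Suc 0)) (E 0))"
    using D_subst[OF assms(1), of "\<lambda>i. 2 - i"] by (simp add: numeral_2_eq_2)
qed

lemma tm_comp1:
  assumes "tm (\<lambda>E. F (E 0))" "tm t" shows "tm (\<lambda>E. F (t E))"
proof -
  have "D (\<lambda>E. E 0 = F (E 1))" using assms(1) by (simp add: tm_def)
  from D_comp2[of "\<lambda>x y. x = F y", OF this tm_var tm_subst[OF assms(2)]]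
  have "D (\<lambda>E. E 0 = F (t (\<lambda>i. E (Suc i))))" .
  then show ?thesis using tm_G1[OF assms(1)] tm_G[OF assms(2)] by (simp add: tm_def)
qed

lemma tm_comp2:
  assumes "tm (\<lambda>E. F (E 0) (E 1))" "tm t" "tm u" shows "tm (\<lambda>E. F (t E) (u E))"
proof -
  have "D (\<lambda>E. E 0 = F (E 1) (E 2))" using assms(1) by (simp add: tm_def numeral_2_eq_2)
  from D_comp3[of "\<lambda>x y z. x = F y z", OF this tm_var tm_subst[OF assms(2)] tm_subst[OF assms(3)]]
  have "D (\<lambda>E. E 0 = F (t (\<lambda>i. E (Suc i))) (u (\<lambda>i. E (Suc i))))" .
  then show ?thesis using tm_G2[OF assms(1)] tm_G[OF assms(2)] tm_G[OF assms(3)] by (simp add: tm_def)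
qed

lemma D_eq: "tm t ==> tm u ==> D (\<lambda>E. t E = u E)"
  by (rule D_comp2[OF D_eq0])

lemma D_triv: "D (\<lambda>E. b)"
  using D_eq[OF tm_var tm_var, of 0 0] D_not[OF D_eq[OF tm_var tm_var, of 0 0]] by (cases b) simp_all

lemma D_in_G: "tm t ==> D (\<lambda>E. t E \<in> G)"
  by (rule D_cong[OF D_triv[of True]]) (simp add: tm_G)

text \<open>Inverse functions, limits and slopes are all obtained as the unique solution of a
  definable relation.\<close>

lemma tm_the:
  assumes "\<And>E. range E \<subseteq> G ==> \<exists>!x. x \<in> G \<and> R E x"
    and "D (\<lambda>E. R (\<lambda>i. E (Suc i)) (E 0))"
  shows "tm (\<lambda>E. THE x. x \<in> G \<and> R E x)"
  unfolding tm_def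
proof (intro conjI allI impI)
  show "(THE x. x \<in> G \<and> R E x) \<in> G" if "range E \<subseteq> G" for E
    using theI'[OF assms(1)[OF that]] by blast
  show "D (\<lambda>E. E 0 = (THE x. x \<in> G \<and> R (\<lambda>i. E (Suc i)) x))"
  proof (rule D_cong[OF assms(2)])
    fix E :: "nat \<Rightarrow> 'a" assume E: "range E \<subseteq> G"
    then have "range (\<lambda>i. E (Suc i)) \<subseteq> G" "E 0 \<in> G" by auto
    then show "R (\<lambda>i. E (Suc i)) (E 0) \<longleftrightarrow> E 0 = (THE x. x \<in> G \<and> R (\<lambda>i. E (Suc i)) x)"
      using theI'[OF assms(1)] the1_equality[OF assms(1)] by metis
  qed
qed

end

text \<open>\<open>G\<close> is a subset of the type because it will be the image of a valuation.
  The assumption \<open>cells\<close> is o-minimality: off a finite set \<open>B\<close>, the truth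
  of a definable \<open>Q\<close> depends only on the position relative to \<open>B\<close>. Halves
  make the order dense.\<close>

locale ominimal_group = definable_sets G D
  for G :: "'g :: linordered_ab_group_add set" and D :: "((nat \<Rightarrow> 'g) \<Rightarrow> bool) \<Rightarrow> bool" +
  assumes zero_G [simp, intro]: "0 \<in> G"
    and add_G [simp, intro]: "x \<in> G ==> y \<in> G ==> x + y \<in> G"
    and minus_G [simp, intro]: "x \<in> G ==> - x \<in> G"
    and nontrivial: "\<exists>x\<in>G. x \<noteq> 0"
    and half: "x \<in> G ==> \<exists>y\<in>G. y + y = x"
    and D_le0: "D (\<lambda>E. E 0 \<le> E 1)"
    and D_add0: "D (\<lambda>E. E 0 = E 1 + E 2)"
    and cells: "D (\<lambda>E. Q (E 0)) ==> \<exists>B\<subseteq>G. finite B \<and>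
      (\<forall>x\<in>G - B. \<forall>y\<in>G - B. (\<forall>b\<in>B. b < x \<longleftrightarrow> b < y) \<longrightarrow> Q x = Q y)"
begin

lemma diff_G [simp, intro]: "x \<in> G ==> y \<in> G ==> x - y \<in> G"
  using add_G[of x "- y"] minus_G[of y] by simp

lemma nmul_G [simp, intro]: "x \<in> G ==> nmul n x \<in> G"
  by (induction n) simp_all

lemma ex_pos: obtains p where "p \<in> G" "0 < p"
proof -
  obtain x where "x \<in> G" "x \<noteq> 0" using nontrivial by blast
  then show thesis using that[of x] that[of "- x"] by (cases "0 < x") auto
qed

lemma ex_greater: assumes "x \<in> G" obtains y where "y \<in> G" "x < y"
  using ex_pos assms by (metis add_G less_add_same_cancel1)

lemma dense_G: assumes "x \<in> G" "y \<in> G" "x < y" obtains z where "z \<in> G" "x < z" "z < y"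
proof -
  obtain z where "z \<in> G" "z + z = x + y" using half[of "x + y"] assms by auto
  moreover have "x + x < x + y" "x + y < y + y" using assms by simp_all
  ultimately show thesis using that[of z] by (metis add_self_less_iff)
qed

lemma infinite_interval: assumes "a \<in> G" "b \<in> G" "a < b" shows "infinite {x\<in>G. a < x \<and> x < b}"
proof
  assume fin: "finite {x\<in>G. a < x \<and> x < b}" (is "finite ?I")
  obtain m where "m \<in> ?I" using dense_G[OF assms] by blast
  then have "Min ?I \<in> ?I" using fin Min_in by blast
  then obtain z where "z \<in> ?I" "z < Min ?I"
    using dense_G[of a "Min ?I"] assms by (smt (verit, best) mem_Collect_eq order_less_trans)
  then show False using fin Min_le leD by blast
qed

lemma D_le: "tm t ==> tm u ==> D (\<lambda>E. t E \<le> u E)"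
  by (rule D_comp2[OF D_le0])

lemma D_less: "tm t ==> tm u ==> D (\<lambda>E. t E < u E)"
  using D_not[OF D_le[of u t]] by (simp add: not_le)

lemma tm_add: assumes "tm t" "tm u" shows "tm (\<lambda>E. t E + u E)"
proof -
  have "tm (\<lambda>E. E 0 + E 1)" using D_add0 by (auto simp: tm_def numeral_2_eq_2)
  from tm_comp2[OF this assms] show ?thesis .
qed

lemma tm_minus: assumes "tm t" shows "tm (\<lambda>E. - t E)"
proof -
  have "D (\<lambda>E. E 0 + E 1 = 0)"
    by (intro D_eq tm_add tm_var tm_const) simp
  then have "tm (\<lambda>E. - E 0)"
    by (auto simp: tm_def eq_neg_iff_add_eq_0)
  from tm_comp1[OF this assms] show ?thesis .
qed

lemma tm_diff: assumes "tm t" "tm u" shows "tm (\<lambda>E. t E - u E)"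
  using tm_add[OF assms(1) tm_minus[OF assms(2)]] by simp

lemma tm_nmul: assumes "tm t" shows "tm (\<lambda>E. nmul n (t E))"
  by (induction n) (simp_all add: tm_const tm_add assms)

text \<open>The filter of neighbourhoods of plus infinity relative to \<open>G\<close>; points
  outside \<open>G\<close> are disregarded.\<close>

definition at_inf :: "'g filter" where
  "at_inf = (INF c\<in>G. principal {x\<in>G. c < x})"

lemma eventually_at_inf: "eventually P at_inf \<longleftrightarrow> (\<exists>c\<in>G. \<forall>x\<in>G. c < x \<longrightarrow> P x)"
proof -
  have "\<exists>x\<in>G. principal {y\<in>G. x < y} \<le> inf (principal {y\<in>G. a < y}) (principal {y\<in>G. b < y})"
    if "a \<in> G" "b \<in> G" for a b
    using that by (intro bexI[of _ "max a b"]) (auto simp: max_def)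
  then have "eventually P at_inf \<longleftrightarrow> (\<exists>c\<in>G. eventually P (principal {x\<in>G. c < x}))"
    unfolding at_inf_def by (intro eventually_INF_base) auto
  then show ?thesis by (auto simp: eventually_principal)
qed

lemma at_inf_nontrivial [simp]: "at_inf \<noteq> bot"
  unfolding trivial_limit_def eventually_at_inf using ex_greater by blast

lemma ev_gt: "c \<in> G ==> \<forall>\<^sub>F x in at_inf. c < x"
  unfolding eventually_at_inf by blast

lemma ev_G: "\<forall>\<^sub>F x in at_inf. x \<in> G"
  unfolding eventually_at_inf using zero_G by blast

lemma ev_shift: assumes "eventually P at_inf" "b \<in> G" shows "\<forall>\<^sub>F x in at_inf. P (x + b)"
proof -
  obtain c where "c \<in> G" "\<forall>x\<in>G. c < x \<longrightarrow> P x" using assms unfolding eventually_at_inf by blast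
  then have "\<forall>x\<in>G. c - b < x \<longrightarrow> P (x + b)" using assms(2) by (auto simp: diff_less_eq)
  then show ?thesis unfolding eventually_at_inf using \<open>c \<in> G\<close> assms(2) by blast
qed

lemma D_ev: "D (\<lambda>E. R (\<lambda>i. E (Suc i)) (E 0)) ==> D (\<lambda>E. \<forall>\<^sub>F x in at_inf. R E x)"
  unfolding eventually_at_inf
  by (intro D_ex D_all D_imp D_less tm_var) (drule D_subst[where f = "\<lambda>i. case i of 0 \<Rightarrow> 0 | Suc i \<Rightarrow> Suc (Suc i)"], simp)

lemmas D_intros = D_not D_conj D_disj D_imp D_ex D_all D_ev D_in_G D_le D_less D_eq
  tm_var tm_const tm_add tm_minus tm_diff tm_nmul

end


section \<open>Consequences of o-minimality: dichotomies, suprema and a finiteness principle\<close>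

context ominimal_group
begin

lemma gap_right:
  assumes "finite B" "x \<in> G" "B \<subseteq> G"
  obtains c where "c \<in> G" "x < c" "\<And>b. b \<in> B ==> b \<le> x \<or> c \<le> b"
proof -
  obtain p where p: "p \<in> G" "x < p" using ex_greater assms(2) by blast
  let ?A = "insert p {b\<in>B. x < b}"
  have fin: "finite ?A" "?A \<noteq> {}" using assms(1) by auto
  have "Min ?A \<in> ?A" using fin by (rule Min_in)
  moreover have "b \<le> x \<or> Min ?A \<le> b" if "b \<in> B" for b
  proof (cases "b \<le> x")
    case False
    then have "b \<in> ?A" using that by auto
    then show ?thesis using Min_le[OF fin(1)] by simp
  qed simp
  ultimately show thesis using that[of "Min ?A"] p assms(3) by auto
qed

text \<open>Between \<open>x\<close> and the next break point to its right there is a single cell,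
  on which a definable property is constant.\<close>

lemma dich_right:
  assumes "D (\<lambda>E. Q (E 0))" "x \<in> G"
  obtains c where "c \<in> G" "x < c"
    "(\<forall>y\<in>G. x < y \<and> y < c \<longrightarrow> Q y) \<or> (\<forall>y\<in>G. x < y \<and> y < c \<longrightarrow> \<not> Q y)"
proof -
  obtain B where B: "B \<subseteq> G" "finite B"
    "\<And>x y. x \<in> G - B ==> y \<in> G - B ==> (\<forall>b\<in>B. b < x \<longleftrightarrow> b < y) ==> Q x = Q y"
    using cells[OF assms(1)] by blast
  obtain c where c: "c \<in> G" "x < c" "\<And>b. b \<in> B ==> b \<le> x \<or> c \<le> b"
    using gap_right[OF B(2) assms(2) B(1)] by metis
  have "Q y = Q z" if "y \<in> G" "x < y" "y < c" "z \<in> G" "x < z" "z < c" for y z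
  proof (rule B(3))
    have "b < y \<longleftrightarrow> b < z" "b \<noteq> y" "b \<noteq> z" if "b \<in> B" for b
      using c(3)[OF that] \<open>x < y\<close> \<open>y < c\<close> \<open>x < z\<close> \<open>z < c\<close> by auto
    then show "y \<in> G - B" "z \<in> G - B" "\<forall>b\<in>B. b < y \<longleftrightarrow> b < z" using that by auto
  qed
  then show thesis using that[OF c(1,2)] by blast
qed

lemma D_reflect:
  assumes "D (\<lambda>E. Q (E 0))" shows "D (\<lambda>E. Q (- E 0))"
  by (rule D_comp1[OF assms tm_minus[OF tm_var]])

lemma dich_left:
  assumes "D (\<lambda>E. Q (E 0))" "x \<in> G"
  obtains c where "c \<in> G" "c < x"
    "(\<forall>y\<in>G. c < y \<and> y < x \<longrightarrow> Q y) \<or> (\<forall>y\<in>G. c < y \<and> y < x \<longrightarrow> \<not> Q y)"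
proof -
  obtain c where c: "c \<in> G" "- x < c"
    "(\<forall>y\<in>G. - x < y \<and> y < c \<longrightarrow> Q (- y)) \<or> (\<forall>y\<in>G. - x < y \<and> y < c \<longrightarrow> \<not> Q (- y))"
    using dich_right[OF D_reflect[OF assms(1)] minus_G[OF assms(2)]] by metis
  have "- c \<in> G" "- c < x" using c(1,2) by (auto simp: minus_less_iff)
  moreover have "Q y = Q (- (- y)) \<and> - y \<in> G \<and> - x < - y \<and> - y < c" if "y \<in> G" "- c < y" "y < x" for y
    using that by (auto simp: minus_less_iff)
  ultimately show thesis using that[of "- c"] c(3) by blast
qed

text \<open>Beyond the largest break point there is a single cell. This dichotomy takes the place of
  continuity and intermediate values.\<close>

lemma ev_cases:
  assumes "D (\<lambda>E. Q (E 0))"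
  shows "(\<forall>\<^sub>F x in at_inf. Q x) \<or> (\<forall>\<^sub>F x in at_inf. \<not> Q x)"
proof -
  obtain B where B: "B \<subseteq> G" "finite B"
    "\<And>x y. x \<in> G - B ==> y \<in> G - B ==> (\<forall>b\<in>B. b < x \<longleftrightarrow> b < y) ==> Q x = Q y"
    using cells[OF assms(1)] by blast
  define c where "c = Max (insert 0 B)"
  have "c \<in> insert 0 B" unfolding c_def using B(2) by (intro Max_in) auto
  then have c: "c \<in> G" using B(1) by auto
  have gt: "b < x" if "c < x" "b \<in> B" for x b
    using that B(2) by (auto simp: c_def)
  have "Q y = Q z" if "y \<in> G" "c < y" "z \<in> G" "c < z" for y z
    by (rule B(3)) (use that gt in blast)+
  then show ?thesis unfolding eventually_at_inf using c by blast
qed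

text \<open>\<open>G\<close> is not complete, but the supremum of a definable set is found among the
  finitely many break points and the given bound \<open>c\<close>.\<close>

lemma ex_Sup:
  assumes "D (\<lambda>E. Q (E 0))" "x0 \<in> G" "Q x0" "c \<in> G" "\<And>x. x \<in> G ==> Q x ==> x \<le> c"
  obtains s where "s \<in> G" "\<And>x. x \<in> G ==> Q x ==> x \<le> s"
    "\<And>u. u \<in> G ==> u < s ==> \<exists>x\<in>G. Q x \<and> u < x"
proof -
  obtain B where B: "B \<subseteq> G" "finite B"
    "\<And>x y. x \<in> G - B ==> y \<in> G - B ==> (\<forall>b\<in>B. b < x \<longleftrightarrow> b < y) ==> Q x = Q y"
    using cells[OF assms(1)] by blast
  let ?U = "{b \<in> insert c B. \<forall>x\<in>G. Q x \<longrightarrow> x \<le> b}"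
  define s where "s = Min ?U"
  have fin: "finite ?U" "?U \<noteq> {}" using B(2) assms(5) by auto
  have "s \<in> ?U" unfolding s_def using fin by (rule Min_in)
  then have s: "s \<in> G" "\<And>x. x \<in> G ==> Q x ==> x \<le> s" using B(1) assms(4) by auto
  have below: "\<exists>x\<in>G. Q x \<and> b < x" if "b \<in> B" "b < s" for b
  proof (rule ccontr)
    assume "\<not> ?thesis"
    then have "b \<in> ?U" using that(1) by (auto simp: not_less)
    then have "s \<le> b" unfolding s_def using fin(1) by (rule Min_le[rotated])
    then show False using that(2) by simp
  qed
  have "\<exists>x\<in>G. Q x \<and> u < x" if u: "u \<in> G" "u < s" for u
  proof (rule ccontr)
    assume "\<not> ?thesis"
    then have le_u: "\<And>x. x \<in> G ==> Q x ==> x \<le> u" by (auto simp: not_less)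
    \<comment> \<open>A member of the set beyond all break points below \<open>s\<close>. A point
      \<open>z\<close> between \<open>u\<close> and \<open>s\<close> lies in the same cell, so it is
      a member too, although it exceeds the alleged bound \<open>u\<close>.\<close>
    obtain x1 where x1: "x1 \<in> G" "Q x1" "\<And>b. b \<in> B ==> b < s ==> b < x1"
    proof (cases "{b\<in>B. b < s} = {}")
      case True
      then show ?thesis using that[of x0] assms(2,3) by blast
    next
      case False
      then have "Max {b\<in>B. b < s} \<in> {b\<in>B. b < s}" using B(2) by (intro Max_in) auto
      then obtain x where "x \<in> G" "Q x" "Max {b\<in>B. b < s} < x" using below by blast
      moreover have "b \<le> Max {b\<in>B. b < s}" if "b \<in> B" "b < s" for b
        using that B(2) by (intro Max_ge) auto
      ultimately show ?thesis using that[of x] by (meson order_le_less_trans)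
    qed
    obtain z where z: "z \<in> G" "u < z" "z < s" using dense_G u s(1) by blast
    have "x1 \<le> u" using le_u x1 by blast
    have same: "Q x1 = Q z"
    proof (rule B(3))
      show "x1 \<in> G - B" using x1 \<open>x1 \<le> u\<close> u by fastforce
      show "z \<in> G - B" using z x1(3) \<open>x1 \<le> u\<close> by fastforce
      show "\<forall>b\<in>B. b < x1 \<longleftrightarrow> b < z" using x1(3) \<open>x1 \<le> u\<close> z by fastforce
    qed
    then show False using le_u[of z] z x1(2) by auto
  qed
  then show thesis using that[OF s] by blast
qed

text \<open>A member that is not a break point brings with it the part of its cell to its
  right.\<close>

lemma interval_of_infinite:
  assumes "D (\<lambda>E. Q (E 0))" "infinite {x\<in>G. Q x}"
  obtains a b where "a \<in> G" "b \<in> G" "a < b" "\<And>x. x \<in> G ==> a \<le> x ==> x < b ==> Q x"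
proof -
  obtain B where B: "B \<subseteq> G" "finite B"
    "\<And>x y. x \<in> G - B ==> y \<in> G - B ==> (\<forall>b\<in>B. b < x \<longleftrightarrow> b < y) ==> Q x = Q y"
    using cells[OF assms(1)] by blast
  obtain a where "a \<in> {x\<in>G. Q x} - B"
    using infinite_imp_nonempty[OF Diff_infinite_finite[OF B(2) assms(2)]] by blast
  then have a: "a \<in> G" "Q a" "a \<notin> B" by auto
  obtain b where b: "b \<in> G" "a < b" "\<And>c. c \<in> B ==> c \<le> a \<or> b \<le> c"
    using gap_right[OF B(2) a(1) B(1)] by metis
  have "Q x" if x: "x \<in> G" "a \<le> x" "x < b" for x
  proof -
    have "Q a = Q x"
    proof (rule B(3))
      have "c < a \<longleftrightarrow> c < x" "c \<noteq> x" if "c \<in> B" for c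
        using b(3)[OF that] x(2,3) a(3) that by (auto simp: order.strict_iff_order)
      then show "a \<in> G - B" "x \<in> G - B" "\<forall>c\<in>B. c < a \<longleftrightarrow> c < x" using a x by auto
    qed
    then show ?thesis using a(2) by simp
  qed
  then show thesis using that a b by blast
qed

text \<open>The place where a property that is inherited downwards turns from true to false. The
  truth value at the place itself is left open.\<close>

definition threshold :: "'g set \<Rightarrow> ('x \<Rightarrow> 'g \<Rightarrow> bool) \<Rightarrow> 'x \<Rightarrow> 'g \<Rightarrow> bool" where
  "threshold J P x g \<longleftrightarrow> g \<in> J \<and> (\<forall>h\<in>G. h \<in> J \<and> h < g \<longrightarrow> P x h) \<and> (\<forall>h\<in>G. g < h \<longrightarrow> \<not> P x h)"

text \<open>If the union were infinite, so would be the set of thresholds; hence it would contain an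
  interval, and one of the sets would be infinite.\<close>

lemma finite_UN_antitone:
  fixes P :: "'x \<Rightarrow> 'g \<Rightarrow> bool"
  assumes J: "J \<subseteq> G" "J \<noteq> {}" "\<And>h g. h \<in> J ==> g \<in> G ==> h \<le> g ==> g \<in> J"
    "\<And>h. h \<in> J ==> \<exists>g\<in>J. g < h"
    and antit: "\<And>x h g. x \<in> A ==> g \<in> J ==> h \<in> J ==> h \<le> g ==> P x g ==> P x h"
    and D_P: "\<And>x. x \<in> A ==> D (\<lambda>E. E 0 \<in> J \<and> P x (E 0))"
    and D_thr: "D (\<lambda>E. \<exists>x\<in>A. threshold J P x (E 0))"
    and fin: "\<And>g. g \<in> J ==> finite {x\<in>A. P x g}"
  shows "finite {x\<in>A. \<exists>g\<in>J. P x g}"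
proof -
  let ?T = "{g\<in>G. \<exists>x\<in>A. threshold J P x g}"
  have TJ: "?T \<subseteq> J" by (auto simp: threshold_def)
  have uniq: "g = h" if "x \<in> A" "threshold J P x g" "threshold J P x h" for x g h
  proof (rule ccontr)
    have *: False if gh: "threshold J P x g" "threshold J P x h" "g < h" for g h
    proof -
      have "g \<in> J" "h \<in> J" using gh by (auto simp: threshold_def)
      then obtain m where "m \<in> G" "g < m" "m < h" using dense_G gh(3) J(1) by blast
      then show False using gh J(3)[OF \<open>g \<in> J\<close>, of m] by (auto simp: threshold_def)
    qed
    assume "g \<noteq> h"
    then consider "g < h" | "h < g" by (rule neqE)
    then show False using *[OF that(2,3)] *[OF that(3,2)] by cases
  qed
  have "finite ?T"
  proof (rule ccontr)
    assume "infinite ?T"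
    then obtain a b where ab: "a \<in> G" "b \<in> G" "a < b" "\<And>x. x \<in> G ==> a \<le> x ==> x < b ==> \<exists>y\<in>A. threshold J P y x"
      using interval_of_infinite[OF D_thr] by metis
    then have aJ: "a \<in> J" using TJ by blast
    obtain f where f: "\<And>x. x \<in> G ==> a \<le> x ==> x < b ==> f x \<in> A \<and> threshold J P (f x) x"
      using ab(4) by metis
    \<comment> \<open>Distinct thresholds have distinct owners, and the owner of a threshold beyond
      \<open>a\<close> satisfies the property at \<open>a\<close>. Infinitely many such owners
      contradict \<open>fin\<close>.\<close>
    have "inj_on f {x\<in>G. a < x \<and> x < b}"
    proof (rule inj_onI)
      fix x y assume "x \<in> {x\<in>G. a < x \<and> x < b}" "y \<in> {x\<in>G. a < x \<and> x < b}" "f x = f y"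
      then show "x = y" using f[of x] f[of y] uniq[of "f x" x y] by auto
    qed
    moreover have "f ` {x\<in>G. a < x \<and> x < b} \<subseteq> {x\<in>A. P x a}"
      using f aJ ab(1) by (auto simp: threshold_def)
    ultimately have "finite {x\<in>G. a < x \<and> x < b}"
      using fin[OF aJ] by (rule inj_on_finite)
    then show False using infinite_interval ab by blast
  qed
  \<comment> \<open>Below all thresholds the set no longer depends on the level: whatever has the
    property at some level in \<open>J\<close> has it at \<open>g0\<close>.\<close>
  obtain g0 where g0: "g0 \<in> J" "\<And>t. t \<in> ?T ==> g0 < t"
  proof (cases "?T = {}")
    case True
    then show ?thesis using J(2) that by blast
  next
    case False
    then have "Min ?T \<in> ?T" using \<open>finite ?T\<close> by (intro Min_in)
    then obtain g where "g \<in> J" "g < Min ?T" using J(4) TJ by blast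
    moreover have "Min ?T \<le> t" if "t \<in> ?T" for t using \<open>finite ?T\<close> that by (rule Min_le)
    ultimately show ?thesis using that by (meson order_less_le_trans)
  qed
  have "P x g0" if x: "x \<in> A" and g: "g \<in> J" "P x g" for x g
  proof (cases "\<forall>h\<in>J. P x h")
    case False
    then obtain h1 where h1: "h1 \<in> J" "\<not> P x h1" by blast
    have "h \<le> h1" if "h \<in> J" "P x h" for h
      using antit[OF x that(1) h1(1)] h1(2) that(2) by (meson linear)
    then have bound: "\<And>y. y \<in> G ==> y \<in> J \<and> P x y ==> y \<le> h1" by blast
    have "g \<in> G" "h1 \<in> G" using g(1) h1(1) J(1) by auto
    obtain s where s: "s \<in> G" "\<And>y. y \<in> G ==> y \<in> J \<and> P x y ==> y \<le> s"
      "\<And>u. u \<in> G ==> u < s ==> \<exists>y\<in>G. (y \<in> J \<and> P x y) \<and> u < y"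
      using ex_Sup[OF D_P[OF x] \<open>g \<in> G\<close> conjI[OF g] \<open>h1 \<in> G\<close> bound] by blast
    have "g \<le> s" using s(2) g J(1) by blast
    then have "s \<in> J" using J(3) g s(1) by blast
    have "threshold J P x s"
      unfolding threshold_def
    proof (intro conjI ballI impI)
      show "s \<in> J" by fact
      show "P x h" if "h \<in> G" "h \<in> J \<and> h < s" for h
        using s(3)[of h] that antit[OF x] by (meson less_imp_le)
      show "\<not> P x h" if "h \<in> G" "s < h" for h
        using s(2)[of h] J(3)[OF \<open>s \<in> J\<close> that(1)] that by (meson less_imp_le not_le)
    qed
    then have "g0 < s" using g0(2) x s(1) by blast
    then show ?thesis using \<open>threshold J P x s\<close> g0(1) J(1) by (auto simp: threshold_def)
  qed (use g0 in blast)
  then have "{x\<in>A. \<exists>g\<in>J. P x g} \<subseteq> {x\<in>A. P x g0}" by blast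
  then show ?thesis using fin[OF g0(1)] finite_subset by blast
qed

end


section \<open>Monotonicity of definable functions at infinity\<close>

context ominimal_group
begin

lemma max_G [simp]: "x \<in> G ==> y \<in> G ==> max x y \<in> G"
  and min_G [simp]: "x \<in> G ==> y \<in> G ==> min x y \<in> G"
  by (simp_all add: max_def min_def)

text \<open>Let \<open>s\<close> be the supremum of the points up to which \<open>R x\<close> holds.
  A left neighbourhood of \<open>s\<close> together with transitivity reaches \<open>s\<close>, and
  a right neighbourhood leads beyond it.\<close>

lemma local_to_global:
  assumes D_R: "\<And>x. x \<in> G ==> D (\<lambda>E. R x (E 0))" and c: "c \<in> G"
    and trans: "\<And>x y z. x \<in> G ==> y \<in> G ==> z \<in> G ==> c < x ==> x < y ==> y < z ==>
      R x y ==> R y z ==> R x z"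
    and right: "\<And>x. x \<in> G ==> c < x ==> \<exists>d\<in>G. x < d \<and> (\<forall>y\<in>G. x < y \<and> y < d \<longrightarrow> R x y)"
    and left: "\<And>x. x \<in> G ==> c < x ==> \<exists>d\<in>G. d < x \<and> (\<forall>y\<in>G. d < y \<and> y < x \<longrightarrow> R y x)"
    and x: "x \<in> G" "c < x" and y: "y \<in> G" "x < y"
  shows "R x y"
proof (rule ccontr)
  assume "\<not> R x y"
  define Q where "Q z \<longleftrightarrow> x < z \<and> (\<forall>w\<in>G. x < w \<and> w \<le> z \<longrightarrow> R x w)" for z
  have "D (\<lambda>E. R x (E i))" for i by (rule D_comp1[OF D_R[OF x(1)] tm_var])
  then have D_Q: "D (\<lambda>E. Q (E 0))"
    unfolding Q_def by (intro D_intros x)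
  have bound: "z \<le> y" if "z \<in> G" "Q z" for z
    using that \<open>\<not> R x y\<close> y unfolding Q_def by (meson le_less_linear less_imp_le)
  obtain d where d: "d \<in> G" "x < d" "\<forall>y\<in>G. x < y \<and> y < d \<longrightarrow> R x y" using right x by blast
  obtain m where m: "m \<in> G" "x < m" "m < d" using dense_G x d by blast
  have "Q m" unfolding Q_def using m d by (meson le_less_trans)
  then obtain s where s: "s \<in> G" "\<And>z. z \<in> G ==> Q z ==> z \<le> s"
    "\<And>u. u \<in> G ==> u < s ==> \<exists>z\<in>G. Q z \<and> u < z"
    using ex_Sup[OF D_Q m(1) \<open>Q m\<close> y(1) bound] by blast
  have xs: "x < s" using s(2)[OF m(1) \<open>Q m\<close>] m(2) by simp
  have below: "R x w" if "w \<in> G" "x < w" "w < s" for w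
    using s(3)[OF that(1,3)] that unfolding Q_def by (meson less_imp_le)
  have "c < s" using xs x(2) by simp
  obtain l where l: "l \<in> G" "l < s" "\<forall>y\<in>G. l < y \<and> y < s \<longrightarrow> R y s" using left[OF s(1) \<open>c < s\<close>] by blast
  obtain w where w: "w \<in> G" "max l x < w" "w < s"
    by (rule dense_G[of "max l x" s]) (use l xs x s in auto)
  then have "R x w" "R w s" using below l by auto
  then have "R x s" using trans[OF x(1) w(1) s(1) x(2)] w by simp
  obtain r where r: "r \<in> G" "s < r" "\<forall>y\<in>G. s < y \<and> y < r \<longrightarrow> R s y" using right[OF s(1) \<open>c < s\<close>] by blast
  obtain v where v: "v \<in> G" "s < v" "v < r" using dense_G r s(1) by blast
  have "R x w" if w: "w \<in> G" "x < w" "w \<le> v" for w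
  proof -
    consider "w < s" | "w = s" | "s < w" by fastforce
    then show ?thesis
    proof cases
      case 3
      then have "R s w" using r(3) w v by auto
      then show ?thesis using trans[OF x(1) s(1) w(1) x(2) xs 3 \<open>R x s\<close>] by simp
    qed (use below w \<open>R x s\<close> in auto)
  qed
  then have "Q v" unfolding Q_def using xs v by auto
  then show False using s(2) v by fastforce
qed

text \<open>If infinitely many points were strict minima within a common radius \<open>g\<close>,
  they would contain an interval, and of two points in it closer than \<open>g\<close> each would
  have the smaller value. So each radius serves finitely many points, and by
  \<open>finite_UN_antitone\<close> all radii together serve finitely many. But every point of an
  interval has some radius.\<close>

lemma no_local_min_at_inf:
  assumes F: "tm (\<lambda>E. F (E 0))" and c: "c \<in> G"
    and right: "\<And>x. x \<in> G ==> c < x ==> \<exists>d\<in>G. x < d \<and> (\<forall>y\<in>G. x < y \<and> y < d \<longrightarrow> F x < F y)"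
    and left: "\<And>x. x \<in> G ==> c < x ==> \<exists>d\<in>G. d < x \<and> (\<forall>y\<in>G. d < y \<and> y < x \<longrightarrow> F x < F y)"
  shows False
proof -
  obtain b where b: "b \<in> G" "c < b" using ex_greater c by blast
  define P where "P x d \<longleftrightarrow> (\<forall>y\<in>G. y \<noteq> x \<and> y - x < d \<and> x - y < d \<longrightarrow> F x < F y)" for x d
  define J where "J = {d\<in>G. 0 < d}"
  let ?A = "{x\<in>G. c < x \<and> x < b}"
  note F' = tm_comp1[OF F]
  have "finite {x \<in> ?A. \<exists>g\<in>J. P x g}"
  proof (rule finite_UN_antitone)
    show "J \<subseteq> G" "J \<noteq> {}" using ex_pos by (auto simp: J_def)
    show "\<And>h g. h \<in> J ==> g \<in> G ==> h \<le> g ==> g \<in> J" by (auto simp: J_def)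
    show "\<exists>g\<in>J. g < h" if "h \<in> J" for h
      using dense_G[of 0 h] that by (auto simp: J_def)
    show "P x h" if "h \<le> g" "P x g" for x h g
      using that unfolding P_def by fastforce
    show "D (\<lambda>E. E 0 \<in> J \<and> P x (E 0))" if "x \<in> ?A" for x
    proof -
      have "D (\<lambda>E. (E 0 \<in> G \<and> 0 < E 0) \<and> (\<forall>y\<in>G. \<not> y = x \<and> y - x < E 0 \<and> x - y < E 0 \<longrightarrow> F x < F y))"
        using that tm_G1[OF F] by (intro D_intros F') auto
      then show ?thesis by (simp add: J_def P_def)
    qed
    have "D (\<lambda>E. \<exists>x\<in>G. (c < x \<and> x < b) \<and> (E 0 \<in> G \<and> 0 < E 0) \<and>
        (\<forall>h\<in>G. (0 < h) \<and> h < E 0 \<longrightarrow> (\<forall>y\<in>G. \<not> y = x \<and> y - x < h \<and> x - y < h \<longrightarrow> F x < F y)) \<and>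
        (\<forall>h\<in>G. E 0 < h \<longrightarrow> \<not> (\<forall>y\<in>G. \<not> y = x \<and> y - x < h \<and> x - y < h \<longrightarrow> F x < F y)))"
      using b(1) c by (intro D_intros F') auto
    then show "D (\<lambda>E. \<exists>x\<in>?A. threshold J P x (E 0))"
      by (rule D_cong) (auto simp: threshold_def J_def P_def)
    show "finite {x \<in> ?A. P x g}" if "g \<in> J" for g
    proof (rule ccontr)
      assume inf: "infinite {x \<in> ?A. P x g}"
      define Q where "Q x \<longleftrightarrow> (c < x \<and> x < b) \<and>
        (\<forall>y\<in>G. \<not> y = x \<and> y - x < g \<and> x - y < g \<longrightarrow> F x < F y)" for x
      have D_Q: "D (\<lambda>E. Q (E 0))"
        unfolding Q_def using b(1) c that by (intro D_intros F') (auto simp: J_def)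
      have Q: "{x \<in> ?A. P x g} = {x \<in> G. Q x}"
        by (auto simp: P_def Q_def)
      obtain a a' where a: "a \<in> G" "a' \<in> G" "a < a'"
        "\<And>x. x \<in> G ==> a \<le> x ==> x < a' ==> Q x"
        using interval_of_infinite[OF D_Q inf[unfolded Q]] by blast
      have aP: "P x g" if "x \<in> G" "a \<le> x" "x < a'" for x
        using a(4)[OF that] by (simp add: Q_def P_def)
      have g: "g \<in> G" "0 < g" using that by (auto simp: J_def)
      have amin: "a < min a' (a + g)" using a g by auto
      obtain x where x: "x \<in> G" "a < x" "x < min a' (a + g)"
        by (rule dense_G[of a "min a' (a + g)"]) (use amin a g in auto)
      have "a - x < 0" using x(2) by simp
      then have "a - x < g" using g(2) by (rule less_trans)
      moreover have "x - a < g" using x(3) by (simp add: diff_less_eq add.commute)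
      ultimately have xa: "x - a < g" "a - x < g" by simp_all
      have "P a g" "P x g" using aP a x by auto
      then have "F a < F x" "F x < F a" using xa x(1,2) a(1) unfolding P_def by auto
      then show False by simp
    qed
  qed
  moreover have "\<exists>g\<in>J. P x g" if x: "x \<in> ?A" for x
  proof -
    obtain d where d: "d \<in> G" "x < d" "\<forall>y\<in>G. x < y \<and> y < d \<longrightarrow> F x < F y" using right x by blast
    obtain d' where d': "d' \<in> G" "d' < x" "\<forall>y\<in>G. d' < y \<and> y < x \<longrightarrow> F x < F y" using left x by blast
    have "min (d - x) (x - d') \<in> J" using d d' x by (auto simp: J_def min_def)
    moreover have "P x (min (d - x) (x - d'))"
      unfolding P_def using d(3) d'(3) by (auto simp: neq_iff)
    ultimately show ?thesis by blast
  qed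
  then have "{x \<in> ?A. \<exists>g\<in>J. P x g} = ?A" by blast
  ultimately show False using infinite_interval[OF c b] by simp
qed

text \<open>Here and in \<open>left_rel\<close> the point further to the left is the first argument
  of \<open>r\<close>, so a locally increasing function has the relation \<open><\<close> on both
  sides.\<close>

definition right_rel :: "('g \<Rightarrow> 'g \<Rightarrow> bool) \<Rightarrow> ('g \<Rightarrow> 'g) \<Rightarrow> 'g \<Rightarrow> bool" where
  "right_rel r F x \<longleftrightarrow> (\<exists>d\<in>G. x < d \<and> (\<forall>y\<in>G. x < y \<and> y < d \<longrightarrow> r (F x) (F y)))"

definition left_rel :: "('g \<Rightarrow> 'g \<Rightarrow> bool) \<Rightarrow> ('g \<Rightarrow> 'g) \<Rightarrow> 'g \<Rightarrow> bool" where
  "left_rel r F x \<longleftrightarrow> (\<exists>d\<in>G. d < x \<and> (\<forall>y\<in>G. d < y \<and> y < x \<longrightarrow> r (F y) (F x)))"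

lemma right_rel_cases:
  assumes F: "tm (\<lambda>E. F (E 0))" and x: "x \<in> G"
  shows "right_rel (<) F x \<or> right_rel (=) F x \<or> right_rel (>) F x"
proof -
  note F' = tm_comp1[OF F]
  have D1: "D (\<lambda>E. F x < F (E 0))" using tm_G1[OF F x] by (intro D_intros F')
  have D2: "D (\<lambda>E. F x = F (E 0))" using tm_G1[OF F x] by (intro D_intros F')
  obtain c d where cd: "c \<in> G" "x < c" "d \<in> G" "x < d"
    "(\<forall>y\<in>G. x < y \<and> y < c \<longrightarrow> F x < F y) \<or> (\<forall>y\<in>G. x < y \<and> y < c \<longrightarrow> \<not> F x < F y)"
    "(\<forall>y\<in>G. x < y \<and> y < d \<longrightarrow> F x = F y) \<or> (\<forall>y\<in>G. x < y \<and> y < d \<longrightarrow> \<not> F x = F y)"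
    by (rule dich_right[OF D1 x], rule dich_right[OF D2 x], rule that)
  have "min c d \<in> G" "x < min c d" using cd by (auto simp: min_def)
  moreover have "(\<forall>y\<in>G. x < y \<and> y < min c d \<longrightarrow> F x < F y) \<or> (\<forall>y\<in>G. x < y \<and> y < min c d \<longrightarrow> F x = F y)
    \<or> (\<forall>y\<in>G. x < y \<and> y < min c d \<longrightarrow> F x > F y)"
    using cd(5,6) by (meson min_less_iff_conj neq_iff)
  ultimately show ?thesis unfolding right_rel_def by blast
qed

lemma left_rel_cases:
  assumes F: "tm (\<lambda>E. F (E 0))" and x: "x \<in> G"
  shows "left_rel (<) F x \<or> left_rel (=) F x \<or> left_rel (>) F x"
proof -
  note F' = tm_comp1[OF F]
  have D1: "D (\<lambda>E. F (E 0) < F x)" using tm_G1[OF F x] by (intro D_intros F')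
  have D2: "D (\<lambda>E. F (E 0) = F x)" using tm_G1[OF F x] by (intro D_intros F')
  obtain c d where cd: "c \<in> G" "c < x" "d \<in> G" "d < x"
    "(\<forall>y\<in>G. c < y \<and> y < x \<longrightarrow> F y < F x) \<or> (\<forall>y\<in>G. c < y \<and> y < x \<longrightarrow> \<not> F y < F x)"
    "(\<forall>y\<in>G. d < y \<and> y < x \<longrightarrow> F y = F x) \<or> (\<forall>y\<in>G. d < y \<and> y < x \<longrightarrow> \<not> F y = F x)"
    by (rule dich_left[OF D1 x], rule dich_left[OF D2 x], rule that)
  have "max c d \<in> G" "max c d < x" using cd by (auto simp: max_def)
  moreover have "(\<forall>y\<in>G. max c d < y \<and> y < x \<longrightarrow> F y < F x) \<or> (\<forall>y\<in>G. max c d < y \<and> y < x \<longrightarrow> F y = F x)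
    \<or> (\<forall>y\<in>G. max c d < y \<and> y < x \<longrightarrow> F y > F x)"
    using cd(5,6) by (meson max_less_iff_conj neq_iff)
  ultimately show ?thesis unfolding left_rel_def by blast
qed

lemma D_right_left_rel:
  assumes F: "tm (\<lambda>E. F (E 0))" and r: "r = (<) \<or> r = (=) \<or> r = (>)"
  shows "D (\<lambda>E. right_rel r F (E 0))" "D (\<lambda>E. left_rel r F (E 0))"
proof -
  note F' = tm_comp1[OF F]
  show "D (\<lambda>E. right_rel r F (E 0))" using r unfolding right_rel_def
    by (elim disjE; simp; intro D_intros F')
  show "D (\<lambda>E. left_rel r F (E 0))" using r unfolding left_rel_def
    by (elim disjE; simp; intro D_intros F')
qed

lemma ev_one_of_three:
  assumes "D (\<lambda>E. Q1 (E 0))" "D (\<lambda>E. Q2 (E 0))" "D (\<lambda>E. Q3 (E 0))"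
    and "\<And>x. x \<in> G ==> Q1 x \<or> Q2 x \<or> Q3 x"
  shows "(\<forall>\<^sub>F x in at_inf. Q1 x) \<or> (\<forall>\<^sub>F x in at_inf. Q2 x) \<or> (\<forall>\<^sub>F x in at_inf. Q3 x)"
proof (rule ccontr)
  assume "\<not> ?thesis"
  then have "\<forall>\<^sub>F x in at_inf. \<not> Q1 x" "\<forall>\<^sub>F x in at_inf. \<not> Q2 x" "\<forall>\<^sub>F x in at_inf. \<not> Q3 x"
    using ev_cases assms(1-3) by blast+
  with ev_G have "\<forall>\<^sub>F x in at_inf. False"
    by eventually_elim (use assms(4) in blast)
  then show False by simp
qed

text \<open>To the right of a point the function is constant on an interval. A point inside this
  interval sees its own value to its left, so \<open>r\<close> relates a value to itself.\<close>

lemma right_eq_rel_unique: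
  assumes "r = (<) \<or> r = (=) \<or> r = (>)"
    and "eventually (right_rel (=) F) at_inf" and "eventually (left_rel r F) at_inf"
  shows "r = (=)"
proof -
  obtain c where c: "c \<in> G" "\<forall>x\<in>G. c < x \<longrightarrow> right_rel (=) F x \<and> left_rel r F x"
    using eventually_conj[OF assms(2,3)] unfolding eventually_at_inf by blast
  obtain x where x: "x \<in> G" "c < x" using ex_greater c by blast
  then obtain d where d: "d \<in> G" "x < d" "\<forall>y\<in>G. x < y \<and> y < d \<longrightarrow> F x = F y"
    using c unfolding right_rel_def by blast
  obtain z where z: "z \<in> G" "x < z" "z < d" using dense_G x d by blast
  then obtain l where l: "l \<in> G" "l < z" "\<forall>y\<in>G. l < y \<and> y < z \<longrightarrow> r (F y) (F z)"
    using c x unfolding left_rel_def by (meson less_trans)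
  obtain y where "y \<in> G" "max l x < y" "y < z"
    by (rule dense_G[of "max l x" z]) (use l z x in auto)
  then have "r (F y) (F z)" "x < y" "y < d" using l z by auto
  moreover have "F x = F y" "F x = F z" using d(3) z \<open>y \<in> G\<close> calculation by blast+
  ultimately have "r (F z) (F z)" by simp
  then show ?thesis using assms(1) by auto
qed

lemma left_eq_rel_unique:
  assumes "r = (<) \<or> r = (=) \<or> r = (>)"
    and "eventually (left_rel (=) F) at_inf" and "eventually (right_rel r F) at_inf"
  shows "r = (=)"
proof -
  obtain c where c: "c \<in> G" "\<forall>x\<in>G. c < x \<longrightarrow> left_rel (=) F x \<and> right_rel r F x"
    using eventually_conj[OF assms(2,3)] unfolding eventually_at_inf by blast
  obtain x where x: "x \<in> G" "c < x" using ex_greater c by blast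
  then obtain d where d: "d \<in> G" "d < x" "\<forall>y\<in>G. d < y \<and> y < x \<longrightarrow> F y = F x"
    using c unfolding left_rel_def by blast
  obtain z where z: "z \<in> G" "max d c < z" "z < x"
    by (rule dense_G[of "max d c" x]) (use d c x in auto)
  then obtain l where l: "l \<in> G" "z < l" "\<forall>y\<in>G. z < y \<and> y < l \<longrightarrow> r (F z) (F y)"
    using c unfolding right_rel_def by auto
  obtain y where "y \<in> G" "z < y" "y < min l x"
    by (rule dense_G[of z "min l x"]) (use l z x in auto)
  then have "r (F z) (F y)" "F y = F x" "F z = F x" using l d z by auto
  then have "r (F z) (F z)" by simp
  then show ?thesis using assms(1) by auto
qed

text \<open>Eventually the behaviour to the right is of a fixed kind \<open>r\<close> and that to
  the left of a fixed kind \<open>l\<close>. If the kinds differ, neither is equality, and then all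
  large points are strict local minima or all are strict local maxima; the latter are minima of
  \<open>- F\<close>. If they agree, the relation is globalised by
  \<open>local_to_global\<close>.\<close>

lemma monotone_at_inf:
  assumes F: "tm (\<lambda>E. F (E 0))"
  obtains r c where "r = (<) \<or> r = (=) \<or> r = (>)" "c \<in> G"
    "\<And>x y. x \<in> G ==> y \<in> G ==> c < x ==> x < y ==> r (F x) (F y)"
proof -
  obtain r where r: "r = (<) \<or> r = (=) \<or> r = (>)" "\<forall>\<^sub>F x in at_inf. right_rel r F x"
    using ev_one_of_three[of "right_rel (<) F" "right_rel (=) F" "right_rel (>) F"]
      D_right_left_rel(1)[OF F] right_rel_cases[OF F] by auto
  obtain l where l: "l = (<) \<or> l = (=) \<or> l = (>)" "\<forall>\<^sub>F x in at_inf. left_rel l F x"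
    using ev_one_of_three[of "left_rel (<) F" "left_rel (=) F" "left_rel (>) F"]
      D_right_left_rel(2)[OF F] left_rel_cases[OF F] by auto
  obtain c where c: "c \<in> G" "\<And>x. x \<in> G ==> c < x ==> right_rel r F x" "\<And>x. x \<in> G ==> c < x ==> left_rel l F x"
    using eventually_conj[OF r(2) l(2)] unfolding eventually_at_inf by blast
  have "l = r"
  proof (rule ccontr)
    assume "l \<noteq> r"
    then have "r \<noteq> (=)" "l \<noteq> (=)"
      using right_eq_rel_unique[OF l(1) _ l(2)] left_eq_rel_unique[OF r(1) _ r(2)] r(2) l(2) by blast+
    then consider "r = (<)" "l = (>)" | "r = (>)" "l = (<)" using r(1) l(1) \<open>l \<noteq> r\<close> by blast
    then show False
    proof cases
      case 1
      then show ?thesis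
        using no_local_min_at_inf[OF F c(1)] c(2,3) unfolding right_rel_def left_rel_def by blast
    next
      case 2
      have F': "tm (\<lambda>E. - F (E 0))" by (rule tm_minus[OF F])
      show ?thesis
        using no_local_min_at_inf[of "\<lambda>x. - F x", OF F' c(1)] c(2,3) 2
        unfolding right_rel_def left_rel_def by simp
    qed
  qed
  have trans: "r a b ==> r b d ==> r a d" for a b d using r(1) by auto
  have "r (F x) (F y)" if "x \<in> G" "y \<in> G" "c < x" "x < y" for x y
  proof (rule local_to_global[where R = "\<lambda>x y. r (F x) (F y)" and c = c])
    show "D (\<lambda>E. r (F x) (F (E 0)))" if "x \<in> G" for x
      using r(1) tm_G1[OF F that] by (elim disjE; simp; intro D_intros tm_comp1[OF F]; simp)
  qed (use trans c(2,3) \<open>l = r\<close> that c(1) in \<open>auto simp: right_rel_def left_rel_def\<close>)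
  then show thesis using that r(1) c(1) by blast
qed

end

section \<open>Automorphisms as asymptotic slopes\<close>

context ominimal_group
begin

lemma increasing_at_inf:
  assumes F: "tm (\<lambda>E. F (E 0))" and inf: "\<And>r. r \<in> G ==> \<forall>\<^sub>F x in at_inf. r < F x"
  obtains c where "c \<in> G" "\<And>x y. x \<in> G ==> y \<in> G ==> c < x ==> x < y ==> F x < F y"
proof -
  obtain r c where r: "r = (<) \<or> r = (=) \<or> r = (>)" and c: "c \<in> G"
    "\<And>x y. x \<in> G ==> y \<in> G ==> c < x ==> x < y ==> r (F x) (F y)"
    using monotone_at_inf[OF F] by blast
  obtain x where x: "x \<in> G" "c < x" using ex_greater c by blast
  obtain d where d: "d \<in> G" "\<And>y. y \<in> G ==> d < y ==> F x < F y"
    using inf[OF tm_G1[OF F x(1)]] unfolding eventually_at_inf by blast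
  obtain y where y: "y \<in> G" "max x d < y" using ex_greater[of "max x d"] x d(1) by auto
  then have "r (F x) (F y)" "F x < F y" using c(2) d(2) x by auto
  then have "r = (<)" using r by auto
  then show thesis using that c by blast
qed

lemma decreasing_at_inf:
  assumes F: "tm (\<lambda>E. F (E 0))" and pos: "\<forall>\<^sub>F x in at_inf. 0 < F x"
    and null: "\<And>r. r \<in> G ==> 0 < r ==> \<forall>\<^sub>F x in at_inf. F x < r"
  shows "\<exists>c\<in>G. \<forall>x\<in>G. \<forall>y\<in>G. c < x \<and> x < y \<longrightarrow> F y < F x"
proof -
  obtain r c where r: "r = (<) \<or> r = (=) \<or> r = (>)" and c: "c \<in> G"
    "\<And>x y. x \<in> G ==> y \<in> G ==> c < x ==> x < y ==> r (F x) (F y)"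
    using monotone_at_inf[OF F] by blast
  obtain c' where c': "c' \<in> G" "\<And>x. x \<in> G ==> c' < x ==> 0 < F x"
    using pos unfolding eventually_at_inf by blast
  obtain x where x: "x \<in> G" "max c c' < x" using ex_greater[of "max c c'"] c(1) c'(1) by auto
  then have "0 < F x" using c' by auto
  then obtain d where d: "d \<in> G" "\<And>y. y \<in> G ==> d < y ==> F y < F x"
    using null[OF tm_G1[OF F x(1)]] unfolding eventually_at_inf by blast
  obtain y where y: "y \<in> G" "max x d < y" using ex_greater[of "max x d"] x d(1) by auto
  then have "r (F x) (F y)" "F y < F x" using c(2) d(2) x by auto
  then have "r = (>)" using r by auto
  then show ?thesis using c by blast
qed

text \<open>The image is definable, so large values are eventually all attained or eventually all
  missed, and an unbounded function cannot miss them all.\<close>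

lemma surj_at_inf:
  assumes F: "tm (\<lambda>E. F (E 0))" and inf: "\<And>r. r \<in> G ==> \<forall>\<^sub>F x in at_inf. r < F x" and c: "c \<in> G"
  shows "\<forall>\<^sub>F y in at_inf. \<exists>x\<in>G. c < x \<and> F x = y"
proof (rule ccontr)
  have D_im: "D (\<lambda>E. \<exists>x\<in>G. c < x \<and> F x = E 0)" by (intro D_intros tm_comp1[OF F] c)
  assume "\<not> ?thesis"
  then have "\<forall>\<^sub>F y in at_inf. \<not> (\<exists>x\<in>G. c < x \<and> F x = y)" using ev_cases[OF D_im] by blast
  then obtain d where d: "d \<in> G" "\<And>y. y \<in> G ==> d < y ==> \<not> (\<exists>x\<in>G. c < x \<and> F x = y)"
    unfolding eventually_at_inf by blast
  have "\<forall>\<^sub>F x in at_inf. x \<in> G \<and> c < x \<and> d < F x"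
    by (intro eventually_conj ev_G ev_gt[OF c] inf[OF d(1)])
  then obtain x where "x \<in> G" "c < x" "d < F x"
    using eventually_happens'[OF at_inf_nontrivial] by blast
  then show False using d(2)[OF tm_G1[OF F]] by blast
qed

section \<open>Limits at infinity\<close>

definition tends :: "('g \<Rightarrow> 'g) \<Rightarrow> 'g \<Rightarrow> bool" where
  "tends u l \<longleftrightarrow> (\<forall>d\<in>G. 0 < d \<longrightarrow> (\<forall>\<^sub>F x in at_inf. l - d < u x \<and> u x < l + d))"

lemma tendsD: "tends u l ==> d \<in> G ==> 0 < d ==> \<forall>\<^sub>F x in at_inf. l - d < u x \<and> u x < l + d"
  by (simp add: tends_def)

text \<open>The limit is the supremum of the eventual lower bounds. If \<open>u\<close> did not stay
  below \<open>l + d\<close>, it would by dichotomy stay above, making \<open>l + d\<close> an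
  eventual lower bound.\<close>

lemma tends_exists:
  assumes u: "tm (\<lambda>E. u (E 0))" and a: "a \<in> G" "\<forall>\<^sub>F x in at_inf. a \<le> u x"
    and b: "b \<in> G" "\<forall>\<^sub>F x in at_inf. u x \<le> b"
  shows "\<exists>l\<in>G. tends u l"
proof -
  have D1: "D (\<lambda>E. \<forall>\<^sub>F x in at_inf. E 0 \<le> u x)" by (intro D_intros tm_comp1[OF u])
  have bound: "r \<le> b" if "r \<in> G" "\<forall>\<^sub>F x in at_inf. r \<le> u x" for r
  proof -
    have "\<forall>\<^sub>F x in at_inf. r \<le> b" using that(2) b(2) by eventually_elim (rule order_trans)
    then show ?thesis by simp
  qed
  obtain l where l: "l \<in> G" "\<And>x. x \<in> G ==> (\<forall>\<^sub>F y in at_inf. x \<le> u y) ==> x \<le> l"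
    "\<And>r. r \<in> G ==> r < l ==> \<exists>x\<in>G. (\<forall>\<^sub>F y in at_inf. x \<le> u y) \<and> r < x"
    using ex_Sup[where Q = "\<lambda>r. \<forall>\<^sub>F x in at_inf. r \<le> u x", OF D1 a(1) a(2) b(1) bound] by blast
  have "\<forall>\<^sub>F x in at_inf. l - d < u x \<and> u x < l + d" if d: "d \<in> G" "0 < d" for d
  proof (rule eventually_conj)
    have "l - d \<in> G" "l - d < l" using l(1) d by auto
    then obtain x where "x \<in> G" "\<forall>\<^sub>F y in at_inf. x \<le> u y" "l - d < x" using l(3) by blast
    from this(2) show "\<forall>\<^sub>F x in at_inf. l - d < u x"
      by (rule eventually_mono) (use \<open>l - d < x\<close> in simp)
    show "\<forall>\<^sub>F x in at_inf. u x < l + d"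
    proof (rule ccontr)
      have D2: "D (\<lambda>E. u (E 0) < l + d)" using l(1) d(1) by (intro D_intros tm_comp1[OF u])
      assume "\<not> ?thesis"
      then have "\<forall>\<^sub>F x in at_inf. \<not> u x < l + d" using ev_cases[OF D2] by blast
      then have "\<forall>\<^sub>F x in at_inf. l + d \<le> u x" by (simp add: not_less)
      then have "l + d \<le> l" using l(1) d(1) by (intro l(2)) auto
      then show False using d(2) by simp
    qed
  qed
  then show ?thesis using l(1) by (auto simp: tends_def)
qed

lemma tends_le:
  assumes "tends u l" "l \<in> G" "b \<in> G" "\<forall>\<^sub>F x in at_inf. u x \<le> b"
  shows "l \<le> b"
proof (rule ccontr)
  assume "\<not> l \<le> b"
  then have d: "l - b \<in> G" "0 < l - b" using assms(2,3) by auto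
  have "\<forall>\<^sub>F x in at_inf. False"
    using tendsD[OF assms(1) d] assms(4) by eventually_elim (auto simp: not_less)
  then show False by simp
qed

lemma tends_ge:
  assumes "tends u l" "l \<in> G" "b \<in> G" "\<forall>\<^sub>F x in at_inf. b \<le> u x"
  shows "b \<le> l"
proof (rule ccontr)
  assume "\<not> b \<le> l"
  then have d: "b - l \<in> G" "0 < b - l" using assms(2,3) by auto
  have "\<forall>\<^sub>F x in at_inf. False"
    using tendsD[OF assms(1) d] assms(4) by eventually_elim (auto simp: not_less)
  then show False by simp
qed

lemma tends_minus: assumes "tends u l" shows "tends (\<lambda>x. - u x) (- l)"
  unfolding tends_def
proof (intro ballI impI)
  fix d assume "d \<in> G" "0 < d"
  then show "\<forall>\<^sub>F x in at_inf. - l - d < - u x \<and> - u x < - l + d"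
    by (rule eventually_mono[OF tendsD[OF assms]]) (auto simp: algebra_simps less_diff_eq minus_less_iff)
qed

lemma tends_add: assumes "tends u l" "tends w m" shows "tends (\<lambda>x. u x + w x) (l + m)"
  unfolding tends_def
proof (intro ballI impI)
  fix d assume d: "d \<in> G" "0 < d"
  obtain h where h: "h \<in> G" "h + h = d" using half d(1) by blast
  then have "0 < h" using d(2) add_self_less_iff[of 0 h] by simp
  from tendsD[OF assms(1) h(1) this] tendsD[OF assms(2) h(1) this]
  show "\<forall>\<^sub>F x in at_inf. l + m - d < u x + w x \<and> u x + w x < l + m + d"
  proof eventually_elim
    case (elim x)
    then have "(l - h) + (m - h) < u x + w x" "u x + w x < (l + h) + (m + h)"
      by (simp_all add: add_strict_mono)
    then show ?case by (simp add: h(2)[symmetric] algebra_simps)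
  qed
qed

lemma tends_diff: "tends u l ==> tends w m ==> tends (\<lambda>x. u x - w x) (l - m)"
  using tends_add[of u l "\<lambda>x. - w x" "- m"] tends_minus[of w m] by simp

lemma tends_shift: assumes "tends u l" "b \<in> G" shows "tends (\<lambda>x. u (x + b)) l"
  unfolding tends_def
proof (intro ballI impI)
  fix d assume "d \<in> G" "0 < d"
  then show "\<forall>\<^sub>F x in at_inf. l - d < u (x + b) \<and> u (x + b) < l + d"
    using ev_shift[OF tendsD[OF assms(1)] assms(2)] by simp
qed

lemma tends_unique:
  assumes "tends u l" "tends u m" "l \<in> G" "m \<in> G" shows "l = m"
proof -
  have "tends (\<lambda>x. u x - u x) (l - m)" "tends (\<lambda>x. u x - u x) (m - l)"
    by (rule tends_diff[OF assms(1,2)], rule tends_diff[OF assms(2,1)])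
  then have "l - m \<le> 0" "m - l \<le> 0"
    using tends_le[of "\<lambda>x. u x - u x" "l - m" 0] tends_le[of "\<lambda>x. u x - u x" "m - l" 0] assms(3,4)
    by simp_all
  then show ?thesis by simp
qed

lemma D_tends:
  assumes "tm (\<lambda>E. u (\<lambda>i. E (Suc i)) (E 0))" "tm t"
  shows "D (\<lambda>E. tends (u E) (t E))"
proof -
  have 1: "tm (\<lambda>E. t (\<lambda>i. E (Suc (Suc i))))"
    using tm_subst[OF assms(2), of "\<lambda>i. Suc (Suc i)"] .
  have 2: "tm (\<lambda>E. u (\<lambda>i. E (Suc (Suc i))) (E 0))"
    using tm_subst[OF assms(1), of "\<lambda>i. case i of 0 \<Rightarrow> 0 | Suc j \<Rightarrow> Suc (Suc j)"] by simp
  show ?thesis unfolding tends_def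
    by (intro D_intros 1 2 zero_G)
qed

text \<open>The hypothesis on the value group in additive form; multiplication by m / n is expressed
  without division.\<close>

definition no_exotic :: bool where
  "no_exotic \<longleftrightarrow> (\<forall>\<phi>. tm (\<lambda>E. \<phi> (E 0)) \<longrightarrow> bij_betw \<phi> G G \<longrightarrow>
     (\<forall>x\<in>G. \<forall>y\<in>G. \<phi> (x + y) = \<phi> x + \<phi> y) \<longrightarrow> (\<forall>x\<in>G. \<forall>y\<in>G. x < y \<longrightarrow> \<phi> x < \<phi> y) \<longrightarrow>
     (\<exists>m n. m > 0 \<and> n > 0 \<and> (\<forall>x\<in>G. nmul n (\<phi> x) = nmul m x)))"

text \<open>Induction along steps of size \<open>a\<close> in a possibly non-Archimedean group.
  Definability makes it work: a failure would give a supremum \<open>s\<close>, and a step from an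
  element above \<open>s - a\<close> leads beyond \<open>s\<close>.\<close>

lemma all_of_step:
  assumes D_Z: "D (\<lambda>E. Z (E 0))" and "Z 0" and a: "a \<in> G" "0 < a"
    and down: "\<And>x y. x \<in> G ==> y \<in> G ==> 0 \<le> x ==> x \<le> y ==> Z y ==> Z x"
    and step: "\<And>x. x \<in> G ==> 0 \<le> x ==> Z x ==> Z (x + a)"
    and b: "b \<in> G" "0 \<le> b"
  shows "Z b"
proof (rule ccontr)
  assume "\<not> Z b"
  define Q where "Q x \<longleftrightarrow> 0 \<le> x \<and> Z x" for x
  have D_Q: "D (\<lambda>E. Q (E 0))" unfolding Q_def by (intro D_intros D_Z zero_G)
  have bound: "x \<le> b" if "x \<in> G" "Q x" for x
  proof (rule ccontr)
    assume "\<not> x \<le> b"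
    then have "b \<le> x" by simp
    then have "Z b" using down[OF b(1) that(1) b(2)] that(2) by (simp add: Q_def)
    then show False using \<open>\<not> Z b\<close> by simp
  qed
  have Q0: "Q 0" using \<open>Z 0\<close> by (simp add: Q_def)
  obtain s where s: "s \<in> G" "\<And>x. x \<in> G ==> Q x ==> x \<le> s"
    "\<And>u. u \<in> G ==> u < s ==> \<exists>x\<in>G. Q x \<and> u < x"
    using ex_Sup[OF D_Q zero_G Q0 b(1) bound] by blast
  have "s - a \<in> G" "s - a < s" using s(1) a by auto
  then obtain x where x: "x \<in> G" "Q x" "s - a < x" using s(3) by blast
  then have "Q (x + a)" "x + a \<in> G" using step[of x] a by (auto simp: Q_def)
  then have "x + a \<le> s" using s(2) by blast
  then show False using x(3) by (simp add: diff_less_eq)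
qed

text \<open>A function with such increments would have the asymptotic slope \<open>\<phi>\<close>, an automorphism
  of \<open>G\<close> that is not multiplication by a rational number.\<close>

lemma no_exotic_slope:
  assumes "no_exotic" and h: "tm (\<lambda>E. h (E 0))" and a: "a \<in> G" "0 < a"
    and ge: "\<And>n. \<forall>\<^sub>F z in at_inf. nmul n a \<le> h (z + a) - h z"
    and r: "r \<in> G" and le: "\<forall>\<^sub>F z in at_inf. h (z + a) - h z \<le> r"
  shows False
proof -
  note h' = tm_comp1[OF h]
  have h_G: "h x \<in> G" if "x \<in> G" for x using tm_G1[OF h that] .
  obtain c where c: "c \<in> G" "\<And>x y. x \<in> G ==> y \<in> G ==> c < x ==> x < y ==> h x < h y"
  proof -
    obtain q c where q: "q = (<) \<or> q = (=) \<or> q = (>)" and c: "c \<in> G"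
      "\<And>x y. x \<in> G ==> y \<in> G ==> c < x ==> x < y ==> q (h x) (h y)"
      using monotone_at_inf[OF h] by blast
    obtain z where z: "z \<in> G" "c < z" "nmul 1 a \<le> h (z + a) - h z"
      using eventually_happens'[OF at_inf_nontrivial eventually_conj[OF ev_G eventually_conj[OF ev_gt[OF c(1)] ge]]]
      by blast
    have "q (h z) (h (z + a))" using c(2)[of z "z + a"] z a by auto
    moreover have "h z < h (z + a)" using z(3) a(2) by (simp add: le_diff_eq) (metis add.commute less_le_trans less_add_same_cancel2)
    ultimately have "q = (<)" using q by auto
    then show thesis using that c by blast
  qed
  define inc where "inc b z = h (z + b) - h z" for b z
  have tm_inc: "tm (\<lambda>E. inc (E 0) (E 1))" unfolding inc_def by (intro D_intros h')
  note inc' = tm_comp2[OF tm_inc]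
  have tm_inc1: "tm (\<lambda>E. inc b (E 0))" if "b \<in> G" for b using that by (intro inc' D_intros)
  have inc_mono: "\<forall>\<^sub>F z in at_inf. inc x z \<le> inc y z" if "x \<in> G" "y \<in> G" "0 \<le> x" "x \<le> y" for x y
    unfolding eventually_at_inf
  proof (intro bexI[OF _ c(1)] ballI impI)
    fix z assume z: "z \<in> G" "c < z"
    then have "c < z + x" using that(3) by (meson less_le_trans le_add_same_cancel1)
    moreover have "x = y \<or> x < y" using that(4) by auto
    ultimately show "inc x z \<le> inc y z"
      using c(2)[of "z + x" "z + y"] that z by (auto simp: inc_def)
  qed
  have inc_add: "inc (x + y) z = inc x (z + y) + inc y z" for x y z
    by (simp add: inc_def algebra_simps)
  \<comment> \<open>A bound for the step \<open>a\<close> extends to steps of every size by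
    \<open>all_of_step\<close>; each additional step costs at most \<open>r\<close>.\<close>
  have bounded: "\<exists>s\<in>G. \<forall>\<^sub>F z in at_inf. inc b z \<le> s" if b: "b \<in> G" "0 \<le> b" for b
  proof (rule all_of_step[where Z = "\<lambda>b. \<exists>s\<in>G. \<forall>\<^sub>F z in at_inf. inc b z \<le> s", OF _ _ a _ _ b])
    show "D (\<lambda>E. \<exists>s\<in>G. \<forall>\<^sub>F z in at_inf. inc (E 0) z \<le> s)" by (intro D_intros inc')
    show "\<exists>s\<in>G. \<forall>\<^sub>F z in at_inf. inc 0 z \<le> s" by (intro bexI[of _ 0]) (auto simp: inc_def)
  next
    fix x y assume xy: "x \<in> G" "y \<in> G" "0 \<le> x" "x \<le> y" and "\<exists>s\<in>G. \<forall>\<^sub>F z in at_inf. inc y z \<le> s"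
    then obtain s where s: "s \<in> G" "\<forall>\<^sub>F z in at_inf. inc y z \<le> s" by blast
    have "\<forall>\<^sub>F z in at_inf. inc x z \<le> s"
      using inc_mono[OF xy] s(2) by eventually_elim (rule order_trans)
    then show "\<exists>s\<in>G. \<forall>\<^sub>F z in at_inf. inc x z \<le> s" using s(1) by blast
  next
    fix x assume x: "x \<in> G" "0 \<le> x" and "\<exists>s\<in>G. \<forall>\<^sub>F z in at_inf. inc x z \<le> s"
    then obtain s where s: "s \<in> G" "\<forall>\<^sub>F z in at_inf. inc x z \<le> s" by blast
    have "\<forall>\<^sub>F z in at_inf. inc (x + a) z \<le> s + r"
      using ev_shift[OF s(2) a(1)] le
      by eventually_elim (metis inc_add inc_def add_mono)
    then show "\<exists>s\<in>G. \<forall>\<^sub>F z in at_inf. inc (x + a) z \<le> s" using s(1) r by blast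
  qed
  have lim_nonneg: "\<exists>l\<in>G. tends (inc b) l" if b: "b \<in> G" "0 \<le> b" for b
  proof -
    obtain s where s: "s \<in> G" "\<forall>\<^sub>F z in at_inf. inc b z \<le> s" using bounded[OF b] by blast
    have "\<forall>\<^sub>F z in at_inf. 0 \<le> inc b z" using inc_mono[of 0 b] b by (simp add: inc_def)
    then show ?thesis using tends_exists[OF tm_inc1[OF b(1)] zero_G _ s] by blast
  qed
  have lim: "\<exists>!l. l \<in> G \<and> tends (inc b) l" if b: "b \<in> G" for b
  proof -
    have "\<exists>l\<in>G. tends (inc b) l"
    proof (cases "0 \<le> b")
      case False
      then have "0 \<le> - b" by simp
      then obtain l where l: "l \<in> G" "tends (inc (- b)) l" using lim_nonneg[OF minus_G[OF b]] by blast
      \<comment> \<open>A step \<open>b\<close> from \<open>z\<close> is undone by the step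
        \<open>- b\<close> from \<open>z + b\<close>, which reduces negative steps to positive
        ones.\<close>
      have "tends (\<lambda>z. - inc (- b) (z + b)) (- l)" by (rule tends_minus[OF tends_shift[OF l(2) b]])
      moreover have "(\<lambda>z. - inc (- b) (z + b)) = inc b" by (simp add: inc_def fun_eq_iff)
      ultimately show ?thesis using l(1) by auto
    qed (use lim_nonneg b in blast)
    then show ?thesis using tends_unique by blast
  qed
  define \<phi> where "\<phi> b = (THE l. l \<in> G \<and> tends (inc b) l)" for b
  have \<phi>: "\<phi> b \<in> G" "tends (inc b) (\<phi> b)" if "b \<in> G" for b
    using theI'[OF lim[OF that]] by (auto simp: \<phi>_def)
  have tm_\<phi>: "tm (\<lambda>E. \<phi> (E 0))"
    unfolding \<phi>_def
  proof (rule tm_the)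
    show "\<exists>!x. x \<in> G \<and> tends (inc (E 0)) x" if "range E \<subseteq> G" for E
      using lim that by blast
    show "D (\<lambda>E. tends (inc (E (Suc 0))) (E 0))"
      by (intro D_tends[where u = "\<lambda>E. inc (E (Suc 0))"] inc' D_intros)
  qed
  have \<phi>_add: "\<phi> (x + y) = \<phi> x + \<phi> y" if "x \<in> G" "y \<in> G" for x y
  proof (rule tends_unique)
    show "tends (inc (x + y)) (\<phi> (x + y))" using \<phi> that by auto
    show "tends (inc (x + y)) (\<phi> x + \<phi> y)"
      using tends_add[OF tends_shift[OF \<phi>(2)[OF that(1)] that(2)] \<phi>(2)[OF that(2)]]
      by (simp add: inc_add[symmetric])
  qed (use \<phi> that in auto)
  have \<phi>_nonneg: "0 \<le> \<phi> b" if "b \<in> G" "0 \<le> b" for b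
    using tends_ge[OF \<phi>(2)[OF that(1)] \<phi>(1)[OF that(1)] zero_G] inc_mono[of 0 b] that
    by (simp add: inc_def)
  have \<phi>_diff: "\<phi> (x - y) = \<phi> x - \<phi> y" if "x \<in> G" "y \<in> G" for x y
    using \<phi>_add[of "x - y" y] that by (simp add: eq_diff_eq)
  have \<phi>_a: "nmul n a \<le> \<phi> a" for n
    using tends_ge[OF \<phi>(2)[OF a(1)] \<phi>(1)[OF a(1)]] ge[of n] a(1) by (simp add: inc_def)
  have \<phi>a_pos: "0 < \<phi> a" using \<phi>_a[of 1] a(2) by simp
  \<comment> \<open>A positive zero \<open>b\<close> of \<open>\<phi>\<close> would make the zero
    set closed under steps of size \<open>b\<close>, hence contain all positive elements, among them
    \<open>a\<close>, where \<open>\<phi>\<close> is positive.\<close>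
  have \<phi>_pos: "0 < \<phi> b" if b: "b \<in> G" "0 < b" for b
  proof (rule ccontr)
    assume "\<not> 0 < \<phi> b"
    then have "\<phi> b = 0" using \<phi>_nonneg[of b] b by simp
    have "\<phi> a = 0"
    proof (rule all_of_step[where Z = "\<lambda>x. \<phi> x = 0", OF _ _ b _ _ a(1)])
      show "D (\<lambda>E. \<phi> (E 0) = 0)" by (intro D_intros tm_\<phi>) simp
      show "\<phi> 0 = 0" using \<phi>_add[of 0 0] by simp
      show "\<phi> x = 0" if "x \<in> G" "y \<in> G" "0 \<le> x" "x \<le> y" "\<phi> y = 0" for x y
        using \<phi>_nonneg[of x] \<phi>_nonneg[of "y - x"] \<phi>_diff[of y x] that by auto
      show "\<phi> (x + b) = 0" if "x \<in> G" "\<phi> x = 0" for x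
        using \<phi>_add[of x b] that b \<open>\<phi> b = 0\<close> by simp
    qed (use a in auto)
    then show False using \<phi>a_pos by simp
  qed
  have \<phi>_mono: "\<phi> x < \<phi> y" if "x \<in> G" "y \<in> G" "x < y" for x y
    using \<phi>_pos[of "y - x"] \<phi>_diff[of y x] that by simp
  \<comment> \<open>The image is definable and closed under adding \<open>\<phi> a\<close>. If it
    were bounded, the supremum would be exceeded by such an addition; so it contains all large
    elements, and every element is a difference of two of them.\<close>
  have \<phi>_surj: "\<exists>b\<in>G. \<phi> b = y" if y: "y \<in> G" for y
  proof -
    have D_im: "D (\<lambda>E. \<exists>b\<in>G. \<phi> b = E 0)" by (intro D_intros tm_comp1[OF tm_\<phi>])
    have "\<not> (\<forall>\<^sub>F y in at_inf. \<not> (\<exists>b\<in>G. \<phi> b = y))"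
    proof
      assume "\<forall>\<^sub>F y in at_inf. \<not> (\<exists>b\<in>G. \<phi> b = y)"
      then obtain d where d: "d \<in> G" "\<And>y. y \<in> G ==> d < y ==> \<not> (\<exists>b\<in>G. \<phi> b = y)"
        unfolding eventually_at_inf by blast
      have bound: "x \<le> d" if "x \<in> G" "\<exists>b\<in>G. \<phi> b = x" for x
        using d(2)[OF that(1)] that(2) by (meson not_le)
      have ex0: "\<exists>b\<in>G. \<phi> b = \<phi> a" using a(1) by blast
      obtain s where s: "s \<in> G" "\<And>x. x \<in> G ==> \<exists>b\<in>G. \<phi> b = x ==> x \<le> s"
        "\<And>u. u \<in> G ==> u < s ==> \<exists>x\<in>G. (\<exists>b\<in>G. \<phi> b = x) \<and> u < x"
        using ex_Sup[where Q = "\<lambda>y. \<exists>b\<in>G. \<phi> b = y", OF D_im \<phi>(1)[OF a(1)] ex0 d(1) bound] by blast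
      have "s - \<phi> a \<in> G" "s - \<phi> a < s" using s(1) \<phi>(1)[OF a(1)] \<phi>a_pos by auto
      then obtain b where b: "b \<in> G" "s - \<phi> a < \<phi> b" using s(3) by blast
      have "\<phi> (b + a) \<le> s" using s(2)[of "\<phi> (b + a)"] \<phi>(1)[of "b + a"] a(1) b(1) by auto
      then show False using b \<phi>_add[of b a] a(1) by (simp add: diff_less_eq)
    qed
    then have "\<forall>\<^sub>F y in at_inf. \<exists>b\<in>G. \<phi> b = y" using ev_cases[OF D_im] by blast
    then obtain d where d: "d \<in> G" "\<And>y. y \<in> G ==> d < y ==> \<exists>b\<in>G. \<phi> b = y"
      unfolding eventually_at_inf by blast
    obtain w where w: "w \<in> G" "max d (d - y) < w" using ex_greater[of "max d (d - y)"] d(1) y by auto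
    obtain b1 where b1: "b1 \<in> G" "\<phi> b1 = w" using d(2)[of w] w by auto
    obtain b2 where b2: "b2 \<in> G" "\<phi> b2 = w + y" using d(2)[of "w + y"] w y by (auto simp: diff_less_eq)
    have "\<phi> (b2 - b1) = y" using \<phi>_diff[OF b2(1) b1(1)] b1 b2 by simp
    then show ?thesis using b1 b2 by blast
  qed
  have "inj_on \<phi> G" by (rule inj_onI) (metis \<phi>_mono neq_iff)
  moreover have "\<phi> ` G = G"
  proof
    show "\<phi> ` G \<subseteq> G" using \<phi>(1) by blast
    show "G \<subseteq> \<phi> ` G"
    proof
      fix y assume "y \<in> G"
      then obtain b where "b \<in> G" "\<phi> b = y" using \<phi>_surj by blast
      then show "y \<in> \<phi> ` G" by blast
    qed
  qed
  ultimately have bij: "bij_betw \<phi> G G" by (simp add: bij_betw_def)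
  have "\<exists>m n. m > 0 \<and> n > 0 \<and> (\<forall>x\<in>G. nmul n (\<phi> x) = nmul m x)"
    by (rule \<open>no_exotic\<close>[unfolded no_exotic_def, rule_format, OF tm_\<phi> bij]) (simp_all add: \<phi>_add \<phi>_mono)
  then obtain m n where mn: "m > 0" "n > 0" "\<And>x. x \<in> G ==> nmul n (\<phi> x) = nmul m x"
    by blast
  \<comment> \<open>A rational factor would bound \<open>\<phi> a\<close> by a multiple of
    \<open>a\<close>, whereas \<open>\<phi> a\<close> is at least every multiple of
    \<open>a\<close>.\<close>
  have "\<phi> a \<le> nmul n (\<phi> a)" using nmul_mono_left[of "\<phi> a" 1 n] mn(2) \<phi>a_pos by simp
  also have "\<dots> = nmul m a" using mn(3) a(1) .
  also have "\<dots> < nmul (Suc m) a" using a(2) by simp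
  also have "\<dots> \<le> \<phi> a" by (rule \<phi>_a)
  finally show False by simp
qed

end


section \<open>Superlinear functions on an o-minimal group\<close>

context ominimal_group
begin

text \<open>Subtracting a linear function leaves \<open>F\<close> unbounded, hence eventually
  increasing, so the increments by \<open>a\<close> reach every multiple of \<open>a\<close>. If
  they were bounded as well, \<open>no_exotic_slope\<close> would apply to \<open>F\<close>
  itself.\<close>

lemma increment_unbounded:
  assumes "no_exotic" and F: "tm (\<lambda>E. F (E 0))"
    and superlinear: "\<And>n. \<forall>\<^sub>F x in at_inf. nmul n x \<le> F x"
    and a: "a \<in> G" "0 < a" and r: "r \<in> G"
  shows "\<forall>\<^sub>F x in at_inf. r < F (x + a) - F x"
proof (rule ccontr)
  have D_inc: "D (\<lambda>E. r < F (E 0 + a) - F (E 0))" by (intro D_intros tm_comp1[OF F] a r)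
  assume "\<not> ?thesis"
  then have "\<forall>\<^sub>F x in at_inf. \<not> r < F (x + a) - F x" using ev_cases[where Q = "\<lambda>x. r < F (x + a) - F x", OF D_inc] by blast
  then have le: "\<forall>\<^sub>F x in at_inf. F (x + a) - F x \<le> r" by (simp add: not_less)
  have "\<forall>\<^sub>F z in at_inf. nmul n a \<le> F (z + a) - F z" for n
  proof -
    have tmF': "tm (\<lambda>E. F (E 0) - nmul n (E 0))" by (intro D_intros F)
    have "\<forall>\<^sub>F x in at_inf. r < F x - nmul n x" if "r \<in> G" for r
      using superlinear[of "Suc n"] ev_gt[OF that]
      by eventually_elim (simp add: less_diff_eq, meson add_strict_right_mono less_le_trans)
    then obtain c where c: "c \<in> G"
      "\<And>x y. x \<in> G ==> y \<in> G ==> c < x ==> x < y ==> F x - nmul n x < F y - nmul n y"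
      using increasing_at_inf[where F = "\<lambda>x. F x - nmul n x", OF tmF'] by blast
    have "nmul n a \<le> F (z + a) - F z" if "z \<in> G" "c < z" for z
      using c(2)[of z "z + a"] that a by (auto simp: nmul_add algebra_simps)
    then show ?thesis unfolding eventually_at_inf using c(1) by blast
  qed
  then show False using no_exotic_slope[OF \<open>no_exotic\<close> F a _ r le] by blast
qed

text \<open>Let \<open>H\<close> be the inverse of \<open>F\<close>. Its increments \<open>e b y = H (y + b) - H y\<close> tend to 0, and
  \<open>e b\<close> varies so slowly that it is almost additive in \<open>b\<close>. Choose \<open>Y y\<close> with
  \<open>e a (Y y) = e u y\<close>; transporting increments from \<open>y\<close> to \<open>Y y\<close> yields functions
  \<open>\<theta> b y\<close> of \<open>b\<close> that have slope \<open>a / u\<close> up to a factor 3. If \<open>a\<close> exceeds all multiples of \<open>u\<close>,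
  then the limit of \<open>\<theta> b y\<close> as \<open>y \<longrightarrow> \<infinity>\<close> contradicts \<open>no_exotic_slope\<close>.\<close>

lemma no_superlinear:
  assumes ne: "no_exotic" and F: "tm (\<lambda>E. F (E 0))"
    and superlinear: "\<And>n. \<forall>\<^sub>F x in at_inf. nmul n x \<le> F x"
    and u: "u \<in> G" "0 < u" and a0: "a0 \<in> G" "\<And>n. nmul n u \<le> a0"
  shows False
proof -
  note F' = tm_comp1[OF F]
  have F_G: "F x \<in> G" if "x \<in> G" for x using tm_G1[OF F that] .
  have F_inf: "\<forall>\<^sub>F x in at_inf. r < F x" if "r \<in> G" for r
    using superlinear[of 1] ev_gt[OF that] by eventually_elim simp
  obtain c0 where c0: "c0 \<in> G" "\<And>x y. x \<in> G ==> y \<in> G ==> c0 < x ==> x < y ==> F x < F y"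
    using increasing_at_inf[OF F F_inf] by blast
  have F_le: "F x \<le> F y" if "x \<in> G" "y \<in> G" "c0 < x" "x \<le> y" for x y
    using c0(2)[OF that(1-3)] that(4) by (cases "x = y") (auto simp: order_le_less)
  have F_le_iff: "F x \<le> F y \<longleftrightarrow> x \<le> y" if "x \<in> G" "y \<in> G" "c0 < x" "c0 < y" for x y
    using c0(2)[OF that(2,1,4)] F_le[OF that(1,2,3)] by (meson leD leI)
  obtain c1 where c1: "c1 \<in> G" "\<And>y. y \<in> G ==> c1 < y ==> \<exists>x\<in>G. c0 < x \<and> F x = y"
    using surj_at_inf[OF F F_inf c0(1)] unfolding eventually_at_inf by blast
  \<comment> \<open>Up to \<open>c1\<close> the inverse takes the value 0, which makes it
    total.\<close>
  define inverse where "inverse y x \<longleftrightarrow> (if c1 < y then c0 < x \<and> F x = y else x = 0)" for y x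
  have inverse: "\<exists>!x. x \<in> G \<and> inverse y x" if y: "y \<in> G" for y
  proof (cases "c1 < y")
    case True
    have "x = x'" if "x \<in> G" "x' \<in> G" "c0 < x" "c0 < x'" "F x = F x'" for x x'
      using F_le_iff[of x x'] F_le_iff[of x' x] that by auto
    then show ?thesis using c1(2)[OF y True] True unfolding inverse_def by auto
  qed (auto simp: inverse_def)
  define H where "H y = (THE x. x \<in> G \<and> inverse y x)" for y
  have tm_H: "tm (\<lambda>E. H (E 0))"
    unfolding H_def
  proof (rule tm_the)
    show "\<exists>!x. x \<in> G \<and> inverse (E 0) x" if "range E \<subseteq> G" for E using inverse that by blast
    have "D (\<lambda>E. (c1 < E (Suc 0) \<longrightarrow> c0 < E 0 \<and> F (E 0) = E (Suc 0)) \<and> (\<not> c1 < E (Suc 0) \<longrightarrow> E 0 = 0))"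
      by (intro D_intros F' c0 c1 zero_G)
    then show "D (\<lambda>E. inverse (E (Suc 0)) (E 0))" by (simp add: inverse_def if_bool_eq_conj)
  qed
  note H' = tm_comp1[OF tm_H]
  have H_G: "H y \<in> G" if "y \<in> G" for y using tm_G1[OF tm_H that] .
  have H: "c0 < H y" "F (H y) = y" if "y \<in> G" "c1 < y" for y
    using theI'[OF inverse[OF that(1)]] that(2) by (auto simp: H_def inverse_def)
  have H_F: "H (F x) = x" if "x \<in> G" "c0 < x" "c1 < F x" for x
    unfolding H_def using that F_G[OF that(1)]
    by (intro the1_equality[OF inverse]) (auto simp: inverse_def)
  have H_le_iff: "H x \<le> H y \<longleftrightarrow> x \<le> y" if "x \<in> G" "y \<in> G" "c1 < x" "c1 < y" for x y
    using F_le_iff[of "H x" "H y"] H[OF that(1,3)] H[OF that(2,4)] H_G that by simp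
  have H_less_iff: "H x < H y \<longleftrightarrow> x < y" if "x \<in> G" "y \<in> G" "c1 < x" "c1 < y" for x y
    using H_le_iff[OF that(2,1,4,3)] by (simp add: not_le[symmetric])
  have H_inf: "\<forall>\<^sub>F y in at_inf. r < H y" if r: "r \<in> G" for r
  proof -
    \<comment> \<open>Raised beyond \<open>c0\<close>, where \<open>F\<close> is strictly
      increasing.\<close>
    define r' where "r' = max r (c0 + u)"
    have r': "r' \<in> G" "c0 < r'" "r \<le> r'" using r c0(1) u by (auto simp: r'_def less_max_iff_disj)
    have "r < H y" if y: "y \<in> G" "max c1 (F r') < y" for y
    proof -
      have "c1 < y" using y by simp
      have "\<not> F (H y) \<le> F r'" using H[OF y(1) \<open>c1 < y\<close>] y by (simp add: not_le)
      then have "\<not> H y \<le> r'" using F_le_iff[of "H y" r'] H[OF y(1) \<open>c1 < y\<close>] H_G[OF y(1)] r' by simp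
      then show ?thesis using r'(3) by simp
    qed
    moreover have "max c1 (F r') \<in> G" using c1(1) F_G r'(1) by simp
    ultimately show ?thesis unfolding eventually_at_inf by blast
  qed
  have ev_H: "\<forall>\<^sub>F y in at_inf. P (H y)" if P: "eventually P at_inf" for P
  proof -
    obtain c where c: "c \<in> G" "\<And>x. x \<in> G ==> c < x ==> P x" using P unfolding eventually_at_inf by blast
    show ?thesis using H_inf[OF c(1)] ev_G by eventually_elim (use c H_G in blast)
  qed

  define e where "e b y = H (y + b) - H y" for b y
  have tm_e: "tm (\<lambda>E. e (E 0) (E 1))" unfolding e_def by (intro D_intros H')
  note e' = tm_comp2[OF tm_e]
  have tm_e1: "tm (\<lambda>E. e b (E 0))" if "b \<in> G" for b using that by (intro e' D_intros)
  have e_G: "e b y \<in> G" if "b \<in> G" "y \<in> G" for b y using that H_G by (auto simp: e_def)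
  have e_le_iff: "e b y \<le> e b' y \<longleftrightarrow> b \<le> b'"
    if "b \<in> G" "b' \<in> G" "y \<in> G" "0 \<le> b" "0 \<le> b'" "c1 < y" for b b' y
  proof -
    have "c1 < y + b" "c1 < y + b'" using that by (meson less_le_trans le_add_same_cancel1)+
    then show ?thesis using H_le_iff[of "y + b" "y + b'"] that by (simp add: e_def)
  qed
  have e_0: "e 0 y = 0" for y by (simp add: e_def)
  have e_pos: "0 < e b y" if "b \<in> G" "y \<in> G" "0 < b" "c1 < y" for b y
    using e_le_iff[of b 0 y] that e_0[of y] by (auto simp: not_le[symmetric])
  have e_add: "e (b + c) y = e b y + e c (y + b)" for b c y
    by (simp add: e_def algebra_simps)
  \<comment> \<open>At \<open>x = H y\<close> a step \<open>d\<close> raises \<open>F\<close> by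
    more than \<open>b\<close>. Read backwards, a step \<open>b\<close> from \<open>y\<close> raises
    \<open>H\<close> by less than \<open>d\<close>.\<close>
  have e_null: "\<forall>\<^sub>F y in at_inf. e b y < d" if b: "b \<in> G" "0 < b" and d: "d \<in> G" "0 < d" for b d
    using ev_H[OF increment_unbounded[OF ne F superlinear d b(1)]] ev_gt[OF c1(1)] ev_G
  proof eventually_elim
    case (elim y)
    have "c1 < y + b" using elim(2) b(2) by (meson less_trans less_add_same_cancel1)
    have "F (H (y + b)) < F (H y + d)"
      using elim H(2)[of y] H(2)[of "y + b"] \<open>c1 < y + b\<close> b by (simp add: less_diff_eq add.commute)
    moreover have "c0 < H y + d" using H(1)[of y] elim d(2) by (meson less_trans less_add_same_cancel1)
    ultimately have "H (y + b) < H y + d"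
      using F_le_iff[of "H y + d" "H (y + b)"] H(1)[of "y + b"] \<open>c1 < y + b\<close> H_G elim b d
      by (simp add: not_le[symmetric])
    then show ?case by (simp add: e_def diff_less_eq add.commute)
  qed
  have e_dec: "\<exists>c\<in>G. c1 \<le> c \<and> (\<forall>x\<in>G. \<forall>y\<in>G. c < x \<and> x < y \<longrightarrow> e b y < e b x)" if b: "b \<in> G" "0 < b" for b
  proof -
    have pos: "\<forall>\<^sub>F x in at_inf. 0 < e b x"
      using ev_gt[OF c1(1)] ev_G by eventually_elim (simp add: e_pos b)
    have "\<exists>c\<in>G. \<forall>x\<in>G. \<forall>y\<in>G. c < x \<and> x < y \<longrightarrow> e b y < e b x"
      by (rule decreasing_at_inf[OF tm_e1[OF b(1)] pos e_null[OF b]])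
    then obtain c where c: "c \<in> G" "\<forall>x\<in>G. \<forall>y\<in>G. c < x \<and> x < y \<longrightarrow> e b y < e b x"
      by blast
    show ?thesis
      by (intro bexI[of _ "max c1 c"] conjI ballI impI) (use c c1(1) in auto)
  qed
  \<comment> \<open>A shift by a constant \<open>c\<close> leaves more than half of an increment.
    The function \<open>w\<close> is unbounded, hence eventually increasing; its values at
    \<open>z\<close> and \<open>z + b\<close> are compared after exchanging the order of the steps
    \<open>b\<close> and \<open>c\<close>.\<close>
  have e_half: "\<forall>\<^sub>F z in at_inf. e b z < e b (z + c) + e b (z + c)"
    if b: "b \<in> G" "0 < b" and c: "c \<in> G" "0 < c" for b c
  proof -
    define w where "w y = H y + (e c y + e c y)" for y
    have tm_w: "tm (\<lambda>E. w (E 0))" unfolding w_def using c(1) by (intro D_intros H' e')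
    have "\<forall>\<^sub>F y in at_inf. r < w y" if "r \<in> G" for r
      using H_inf[OF that] ev_gt[OF c1(1)] ev_G
    proof eventually_elim
      case (elim y)
      have "0 \<le> e c y + e c y" using e_pos[of c y] c elim by (simp add: add_nonneg_nonneg less_imp_le)
      then show ?case using elim(1) unfolding w_def by (meson add_increasing2 less_le_trans order_refl)
    qed
    then obtain d where d: "d \<in> G" "\<And>x y. x \<in> G ==> y \<in> G ==> d < x ==> x < y ==> w x < w y"
      using increasing_at_inf[where F = w, OF tm_w] by blast
    have "e b z < e b (z + c) + e b (z + c)" if z: "z \<in> G" "d < z" for z
    proof -
      have "w z < w (z + b)" using d(2)[of z "z + b"] z b by auto
      then have "H z + (e c z + e c z) < H (z + b) + (e c (z + b) + e c (z + b))" by (simp add: w_def)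
      moreover have "e c z = e b z + e c (z + b) - e b (z + c)"
        using e_add[of c b z] e_add[of b c z] by (simp add: add.commute algebra_simps)
      ultimately show ?thesis by (simp add: e_def[of b z] algebra_simps)
    qed
    then show ?thesis unfolding eventually_at_inf using d(1) by blast
  qed
  \<comment> \<open>Of the three consecutive increments that make up the step
    \<open>b + b + b\<close>, the second and the third each exceed half of the first. This is where
    the factor 3 comes from.\<close>
  have e_3: "\<exists>c\<in>G. \<forall>z\<in>G. c < z \<longrightarrow> e b z + e b z < e (b + b + b) z" if b: "b \<in> G" "0 < b" for b
  proof -
    have "0 < b + b" using b(2) by (rule add_pos_pos[OF b(2)])
    then have "\<forall>\<^sub>F z in at_inf. e b z + e b z < e (b + b + b) z"
      using e_half[OF b b] e_half[OF b add_G[OF b(1) b(1)]]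
    proof (elim eventually_elim2)
      fix z assume "e b z < e b (z + b) + e b (z + b)" "e b z < e b (z + (b + b)) + e b (z + (b + b))"
      then have "e b z + e b z < (e b (z + b) + e b (z + (b + b))) + (e b (z + b) + e b (z + (b + b)))"
        using add_strict_mono by (fastforce simp: algebra_simps)
      then have "e b z < e b (z + b) + e b (z + (b + b))" by (simp only: add_self_less_iff)
      then show "e b z + e b z < e (b + b + b) z" by (simp add: e_add algebra_simps)
    qed
    then show ?thesis unfolding eventually_at_inf by blast
  qed

  have a0_pos: "0 < a0" using a0(2)[of 1] u(2) by simp
  \<comment> \<open>With this choice an increment by \<open>a\<close> is more than twice an
    increment by \<open>a0\<close> from the same point, which later keeps the slope at or above
    \<open>a0\<close>.\<close>
  define a where "a = a0 + a0 + a0"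
  have a: "a \<in> G" "0 < a" using a0(1) a0_pos by (auto simp: a_def add_pos_pos)
  obtain ca where ca: "ca \<in> G" "c1 \<le> ca" "\<And>x y. x \<in> G ==> y \<in> G ==> ca < x ==> x < y ==> e a y < e a x"
    using e_dec[OF a] by blast
  have ca_le: "e a y \<le> e a x" if "x \<in> G" "y \<in> G" "ca < x" "x \<le> y" for x y
    using ca(3)[of x y] that by (cases "x = y") (auto simp: order_le_less)
  obtain cu where cu: "cu \<in> G" "c1 \<le> cu" "\<And>x y. x \<in> G ==> y \<in> G ==> cu < x ==> x < y ==> e u y < e u x"
    using e_dec[OF u] by blast
  have cu_le: "e u y \<le> e u x" if "x \<in> G" "y \<in> G" "cu < x" "x \<le> y" for x y
    using cu(3)[of x y] that by (cases "x = y") (auto simp: order_le_less)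
  define im where "im y \<longleftrightarrow> (\<exists>z\<in>G. ca < z \<and> e a z = y)" for y
  have D_im: "D (\<lambda>E. im (E 0))" unfolding im_def using ca(1) a(1) by (intro D_intros e')
  \<comment> \<open>The values of \<open>e a\<close> form a definable set, so just above 0 all
    elements are values or none is. As \<open>e a\<close> takes arbitrarily small positive values,
    all are, and eventually \<open>e u y\<close> is that small.\<close>
  have Y_ex: "\<forall>\<^sub>F y in at_inf. im (e u y)"
  proof -
    obtain \<epsilon> where \<epsilon>: "\<epsilon> \<in> G" "0 < \<epsilon>"
        "(\<forall>y\<in>G. 0 < y \<and> y < \<epsilon> \<longrightarrow> im y) \<or> (\<forall>y\<in>G. 0 < y \<and> y < \<epsilon> \<longrightarrow> \<not> im y)"
      using dich_right[OF D_im zero_G] by blast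
    have "\<forall>\<^sub>F z in at_inf. z \<in> G \<and> ca < z \<and> e a z < \<epsilon>"
      by (intro eventually_conj ev_G ev_gt[OF ca(1)] e_null[OF a \<epsilon>(1,2)])
    then obtain z where z: "z \<in> G" "ca < z" "e a z < \<epsilon>"
      using eventually_happens'[OF at_inf_nontrivial] by blast
    have "c1 < z" using z(2) ca(2) by order
    then have "0 < e a z" "im (e a z)" using e_pos a z by (auto simp: im_def)
    then have im: "im y" if "y \<in> G" "0 < y" "y < \<epsilon>" for y
      using \<epsilon>(3) z(3) e_G[OF a(1) z(1)] that by blast
    show ?thesis
      using e_null[OF u \<epsilon>(1,2)] ev_gt[OF c1(1)] ev_G
    proof eventually_elim
      case (elim y)
      then show ?case using im[of "e u y"] e_pos[of u y] e_G[of u y] u by simp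
    qed
  qed
  \<comment> \<open>The value 0 stands in where no solution exists; for large \<open>y\<close> the
    first case applies.\<close>
  define R where "R y z \<longleftrightarrow> (if im (e u y) then ca < z \<and> e a z = e u y else z = 0)" for y z
  have R_ex: "\<exists>!z. z \<in> G \<and> R y z" if y: "y \<in> G" for y
  proof (cases "im (e u y)")
    case True
    have "z = z'" if "z \<in> G" "z' \<in> G" "ca < z" "ca < z'" "e a z = e a z'" for z z'
      using ca(3)[of z z'] ca(3)[of z' z] that by (metis neq_iff)
    then show ?thesis using True by (auto simp: R_def im_def)
  qed (use zero_G in \<open>auto simp: R_def\<close>)
  define Y where "Y y = (THE z. z \<in> G \<and> R y z)" for y
  have Y: "Y y \<in> G \<and> R y (Y y)" if "y \<in> G" for y
    unfolding Y_def by (rule theI'[OF R_ex[OF that]])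
  have Y_G: "Y y \<in> G" and R_Y: "R y (Y y)" if "y \<in> G" for y
    using Y[OF that] by auto
  have tm_Y: "tm (\<lambda>E. Y (E 0))"
    unfolding Y_def
  proof (rule tm_the)
    show "\<exists>!z. z \<in> G \<and> R (E 0) z" if "range E \<subseteq> G" for E using R_ex that by blast
    have D_im': "D (\<lambda>E. im (t E))" if "tm t" for t by (rule D_comp1[OF D_im that])
    have "D (\<lambda>E. (im (e u (E (Suc 0))) \<longrightarrow> ca < E 0 \<and> e a (E 0) = e u (E (Suc 0))) \<and>
        (\<not> im (e u (E (Suc 0))) \<longrightarrow> E 0 = 0))"
      by (intro D_im' D_intros e' ca u a zero_G)
    then show "D (\<lambda>E. R (E (Suc 0)) (E 0))" by (simp add: R_def if_bool_eq_conj)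
  qed
  obtain cY where cY: "cY \<in> G" "c1 \<le> cY" "cu \<le> cY"
    "\<And>y. y \<in> G ==> cY < y ==> ca < Y y \<and> e a (Y y) = e u y"
  proof -
    obtain c where c: "c \<in> G" "\<And>y. y \<in> G ==> c < y ==> im (e u y)"
      using Y_ex unfolding eventually_at_inf by blast
    show thesis
    proof (rule that[of "max c (max c1 cu)"])
      show "ca < Y y \<and> e a (Y y) = e u y" if "y \<in> G" "max c (max c1 cu) < y" for y
        using R_Y[OF that(1)] c(2)[OF that(1)] that(2) by (simp add: R_def)
    qed (use c(1) c1(1) cu(1) in \<open>auto simp: le_max_iff_disj\<close>)
  qed
  have Y_inf: "\<forall>\<^sub>F y in at_inf. r < Y y" if r: "r \<in> G" for r
  proof -
    define r' where "r' = max r (ca + u)"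
    have r': "r' \<in> G" "ca < r'" "r \<le> r'" using r ca(1) u by (auto simp: r'_def less_max_iff_disj)
    have "c1 < r'" using r'(2) ca(2) by order
    then have "0 < e a r'" using e_pos a r'(1) by simp
    from e_null[OF u e_G[OF a(1) r'(1)] this] ev_gt[OF cY(1)] ev_G
    show ?thesis
    proof eventually_elim
      case (elim y)
      have "ca < Y y" "e a (Y y) = e u y" using cY(4) elim by simp_all
      then have "\<not> Y y \<le> r'" using ca_le[of "Y y" r'] Y_G[of y] r'(1) elim by auto
      then show ?case using r'(3) by order
    qed
  qed
  have ev_Y: "\<forall>\<^sub>F y in at_inf. P (Y y)" if P: "eventually P at_inf" for P
  proof -
    obtain c where c: "c \<in> G" "\<And>x. x \<in> G ==> c < x ==> P x" using P unfolding eventually_at_inf by blast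
    show ?thesis using Y_inf[OF c(1)] ev_G
    proof eventually_elim
      case (elim y)
      then show ?case using c(2)[OF Y_G[of y]] by simp
    qed
  qed

  \<comment> \<open>The step \<open>\<theta> b y\<close> from \<open>Y y\<close> raises
    \<open>H\<close> by as much as the step \<open>b\<close> from \<open>y\<close>.\<close>
  define \<theta> where "\<theta> b y = F (H (Y y) + e b y) - Y y" for b y
  have tm_\<theta>: "tm (\<lambda>E. \<theta> (E 0) (E 1))"
    unfolding \<theta>_def by (intro D_intros F' H' tm_comp1[OF tm_Y] e')
  note \<theta>' = tm_comp2[OF tm_\<theta>]
  have \<theta>_G: "\<theta> b y \<in> G" if "b \<in> G" "y \<in> G" for b y
    unfolding \<theta>_def using that F_G H_G Y_G e_G by simp
  have Y_large: "c1 < Y y" "c0 < H (Y y)" "F (H (Y y)) = Y y" if "y \<in> G" "cY < y" for y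
  proof -
    show "c1 < Y y" using cY(4)[OF that] ca(2) by auto
    then show "c0 < H (Y y)" "F (H (Y y)) = Y y" using H Y_G[OF that(1)] by simp_all
  qed
  have e_nonneg: "0 \<le> e b y" if "b \<in> G" "y \<in> G" "0 \<le> b" "cY < y" for b y
  proof -
    have "c1 < y" using that(4) cY(2) by order
    then show ?thesis using e_le_iff[of 0 b y] that e_0[of y] by simp
  qed
  have \<theta>_mono: "\<theta> b y \<le> \<theta> b' y" if "b \<in> G" "b' \<in> G" "y \<in> G" "0 \<le> b" "b \<le> b'" "cY < y" for b b' y
  proof -
    have "c1 < y" using that(6) cY(2) by order
    then have "e b y \<le> e b' y" using e_le_iff[of b b' y] that by simp
    moreover have "c0 < H (Y y) + e b y"
      using Y_large(2)[OF that(3,6)] e_nonneg[OF that(1,3,4,6)] by (meson less_le_trans le_add_same_cancel1)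
    ultimately show ?thesis
      unfolding \<theta>_def using F_le[of "H (Y y) + e b y" "H (Y y) + e b' y"] that H_G Y_G e_G by simp
  qed
  have \<theta>_0: "\<theta> 0 y = 0" if "y \<in> G" "cY < y" for y
    using Y_large(3)[OF that] by (simp add: \<theta>_def e_0)
  have \<theta>_nonneg: "0 \<le> \<theta> b y" if "b \<in> G" "y \<in> G" "0 \<le> b" "cY < y" for b y
    using \<theta>_mono[of 0 b y] \<theta>_0[of y] that by simp
  have H_\<theta>: "H (Y y + \<theta> b y) = H (Y y) + e b y" if "b \<in> G" "y \<in> G" "0 \<le> b" "cY < y" for b y
  proof -
    have "c0 < H (Y y) + e b y"
      using Y_large(2)[OF that(2,4)] e_nonneg[OF that] by (meson less_le_trans le_add_same_cancel1)
    moreover have "c1 < F (H (Y y) + e b y)"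
      using \<theta>_nonneg[OF that] Y_large(1)[OF that(2,4)] unfolding \<theta>_def by (simp add: le_diff_eq)
    ultimately show ?thesis
      using H_F[of "H (Y y) + e b y"] that H_G Y_G e_G by (simp add: \<theta>_def)
  qed
  have e_\<theta>: "e (\<theta> (b + c) y - \<theta> b y) (Y y + \<theta> b y) = e c (y + b)"
    if "b \<in> G" "c \<in> G" "y \<in> G" "0 \<le> b" "0 \<le> c" "cY < y" for b c y
    using H_\<theta>[of b y] H_\<theta>[of "b + c" y] that e_add[of b c y]
    by (simp add: e_def[of "\<theta> (b + c) y - \<theta> b y"] algebra_simps)

  obtain c3 where c3: "c3 \<in> G" "\<And>z. z \<in> G ==> c3 < z ==> e a z + e a z < e (a + a + a) z"
    using e_3[OF a] by blast
  obtain c4 where c4: "c4 \<in> G" "\<And>z. z \<in> G ==> c4 < z ==> e a0 z + e a0 z < e a z"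
    using e_3[OF a0(1) a0_pos] unfolding a_def by blast
  \<comment> \<open>For \<open>z = Y y + \<theta> b y\<close> and the increment \<open>s\<close> of
    \<open>\<theta>\<close> one has \<open>e s z = e u (y + b)\<close>. This differs by a factor
    less than 2 from \<open>e u y = e a (Y y)\<close>, which in turn differs by a factor less than 2
    from \<open>e a z\<close>, as \<open>z\<close> is at bounded distance from \<open>Y y\<close>. A
    step above \<open>a + a + a\<close> or below \<open>a0\<close> would change the increment by
    more than these factors permit.\<close>
  have slope: "\<forall>\<^sub>F y in at_inf. a0 \<le> \<theta> (b + u) y - \<theta> b y \<and> \<theta> (b + u) y - \<theta> b y \<le> a + a + a"
    if b: "b \<in> G" "0 \<le> b" and bound: "r \<in> G" "\<forall>\<^sub>F y in at_inf. \<theta> b y \<le> r" for b r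
  proof -
    define r' where "r' = max r u"
    have r': "r' \<in> G" "0 < r'" using bound(1) u by (auto simp: r'_def less_max_iff_disj)
    have ev1: "\<forall>\<^sub>F y in at_inf. e a (Y y) < e a (Y y + r') + e a (Y y + r')"
      using ev_Y[OF e_half[OF a r']] .
    have ev2: "\<forall>\<^sub>F y in at_inf. e u y < e u (y + b) + e u (y + b)"
    proof (cases "b = 0")
      case True
      show ?thesis using ev_gt[OF c1(1)] ev_G
      proof eventually_elim
        case (elim y)
        then show ?case using True e_pos[of u y] u by simp
      qed
    qed (use e_half[OF u b(1)] b(2) in \<open>auto simp: order_le_less\<close>)
    from ev1 ev2 bound(2) ev_gt[OF cY(1)] Y_inf[OF c3(1)] Y_inf[OF c4(1)] ev_G
    show ?thesis
    proof eventually_elim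
      case (elim y)
      define z where "z = Y y + \<theta> b y"
      define s where "s = \<theta> (b + u) y - \<theta> b y"
      have b_u: "b + u \<in> G" "0 \<le> b + u" "b \<le> b + u" using b u by (auto simp: add_nonneg_nonneg less_imp_le)
      have th: "0 \<le> \<theta> b y" "\<theta> b y \<le> r'" "\<theta> b y \<in> G"
        using \<theta>_nonneg[of b y] \<theta>_G[of b y] elim b by (auto simp: r'_def le_max_iff_disj)
      have z: "z \<in> G" "Y y \<le> z" "z \<le> Y y + r'" using th Y_G elim by (auto simp: z_def)
      have z_large: "c1 < z" "ca < z" "c3 < z" "c4 < z" "ca < Y y"
        using z(2) Y_large(1)[of y] cY(4)[of y] elim by auto
      have s: "s \<in> G" "0 \<le> s"
        using \<theta>_mono[of b "b + u" y] \<theta>_G b b_u elim by (auto simp: s_def)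
      have e_s: "e s z = e u (y + b)"
        using e_\<theta>[of b u y] b u elim by (simp add: s_def z_def)
      have "cu < y" using cY(3) elim(4) by order
      then have 1: "e u (y + b) \<le> e u y" using cu_le[of y "y + b"] b elim by simp
      have 2: "e a z \<le> e a (Y y)" using ca_le[of "Y y" z] z z_large Y_G elim by simp
      have 3: "e a (Y y + r') \<le> e a z"
        using ca_le[of z "Y y + r'"] z z_large Y_G[of y] r'(1) elim by simp
      have 4: "e a (Y y) = e u y" using cY(4)[of y] elim by simp
      have a3: "a + a + a \<in> G" "0 \<le> a + a + a" using a by (auto simp: add_nonneg_nonneg less_imp_le)
      have "s \<le> a + a + a"
      proof (rule ccontr)
        assume "\<not> s \<le> a + a + a"
        then have "e (a + a + a) z \<le> e s z" using e_le_iff[of "a + a + a" s z] a3 s z(1) z_large by simp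
        moreover have "e a (Y y + r') + e a (Y y + r') \<le> e a z + e a z" using 3 3 by (rule add_mono)
        ultimately show False using 1 4 e_s elim(1) c3(2)[OF z(1) z_large(3)] by order
      qed
      moreover have "a0 \<le> s"
      proof (rule ccontr)
        assume "\<not> a0 \<le> s"
        then have "e s z \<le> e a0 z" using e_le_iff[of s a0 z] a0(1) a0_pos s z(1) z_large by simp
        then have "e s z + e s z \<le> e a0 z + e a0 z" using add_mono by blast
        moreover have "e u y < e s z + e s z" using elim(2) e_s by simp
        ultimately show False using 2 4 c4(2)[OF z(1) z_large(4)] by order
      qed
      ultimately show ?case by (simp add: s_def)
    qed
  qed
  have bounded: "\<exists>r\<in>G. \<forall>\<^sub>F y in at_inf. \<theta> b y \<le> r" if b: "b \<in> G" "0 \<le> b" for b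
  proof (rule all_of_step[where Z = "\<lambda>b. \<exists>r\<in>G. \<forall>\<^sub>F y in at_inf. \<theta> b y \<le> r", OF _ _ u _ _ b])
    show "D (\<lambda>E. \<exists>r\<in>G. \<forall>\<^sub>F y in at_inf. \<theta> (E 0) y \<le> r)" by (intro D_intros \<theta>')
    have "\<forall>\<^sub>F y in at_inf. \<theta> 0 y \<le> 0"
      using ev_gt[OF cY(1)] ev_G by eventually_elim (simp add: \<theta>_0)
    then show "\<exists>r\<in>G. \<forall>\<^sub>F y in at_inf. \<theta> 0 y \<le> r" using zero_G by blast
  next
    fix b b' assume b: "b \<in> G" "b' \<in> G" "0 \<le> b" "b \<le> b'" and "\<exists>r\<in>G. \<forall>\<^sub>F y in at_inf. \<theta> b' y \<le> r"
    then obtain r where r: "r \<in> G" "\<forall>\<^sub>F y in at_inf. \<theta> b' y \<le> r" by blast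
    have "\<forall>\<^sub>F y in at_inf. \<theta> b y \<le> r"
      using r(2) ev_gt[OF cY(1)] ev_G
    proof eventually_elim
      case (elim y)
      then show ?case using \<theta>_mono[of b b' y] b by simp
    qed
    then show "\<exists>r\<in>G. \<forall>\<^sub>F y in at_inf. \<theta> b y \<le> r" using r(1) by blast
  next
    fix b assume b: "b \<in> G" "0 \<le> b" and "\<exists>r\<in>G. \<forall>\<^sub>F y in at_inf. \<theta> b y \<le> r"
    then obtain r where r: "r \<in> G" "\<forall>\<^sub>F y in at_inf. \<theta> b y \<le> r" by blast
    have "\<forall>\<^sub>F y in at_inf. \<theta> (b + u) y \<le> (a + a + a) + r"
      using r(2) slope[OF b r]
    proof eventually_elim
      case (elim y)
      then have "(\<theta> (b + u) y - \<theta> b y) + \<theta> b y \<le> (a + a + a) + r" by (intro add_mono) simp_all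
      then show ?case by simp
    qed
    moreover have "(a + a + a) + r \<in> G" using a r by simp
    ultimately show "\<exists>r\<in>G. \<forall>\<^sub>F y in at_inf. \<theta> (b + u) y \<le> r" by blast
  qed
  \<comment> \<open>Negative \<open>b\<close> receive the value 0; only the behaviour of
    \<open>h\<close> at infinity will count.\<close>
  have lim: "\<exists>!l. l \<in> G \<and> (if 0 \<le> b then tends (\<theta> b) l else l = 0)" if b: "b \<in> G" for b
  proof (cases "0 \<le> b")
    case True
    obtain r where r: "r \<in> G" "\<forall>\<^sub>F y in at_inf. \<theta> b y \<le> r" using bounded[OF b True] by blast
    have "\<forall>\<^sub>F y in at_inf. 0 \<le> \<theta> b y"
      using ev_gt[OF cY(1)] ev_G by eventually_elim (simp add: \<theta>_nonneg b True)
    moreover have "tm (\<lambda>E. \<theta> b (E 0))" using b by (intro \<theta>' D_intros)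
    ultimately have "\<exists>l\<in>G. tends (\<theta> b) l" using tends_exists[where u = "\<theta> b"] zero_G r by blast
    then show ?thesis using True tends_unique by auto
  qed (use zero_G in auto)
  define h where "h b = (THE l. l \<in> G \<and> (if 0 \<le> b then tends (\<theta> b) l else l = 0))" for b
  have h_G: "h b \<in> G" if "b \<in> G" for b using theI'[OF lim[OF that]] by (simp add: h_def)
  have h: "tends (\<theta> b) (h b)" if "b \<in> G" "0 \<le> b" for b
    using theI'[OF lim[OF that(1)]] that(2) by (simp add: h_def)
  have tm_h: "tm (\<lambda>E. h (E 0))"
    unfolding h_def
  proof (rule tm_the)
    show "\<exists>!l. l \<in> G \<and> (if 0 \<le> E 0 then tends (\<theta> (E 0)) l else l = 0)" if "range E \<subseteq> G" for E
      using lim that by blast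
    have "D (\<lambda>E. tends (\<theta> (E (Suc 0))) (E 0))"
      by (intro D_tends[where u = "\<lambda>E. \<theta> (E (Suc 0))"] \<theta>' D_intros)
    then have "D (\<lambda>E. (0 \<le> E (Suc 0) \<longrightarrow> tends (\<theta> (E (Suc 0))) (E 0)) \<and> (\<not> 0 \<le> E (Suc 0) \<longrightarrow> E 0 = 0))"
      by (intro D_conj D_imp D_not D_le D_eq tm_var tm_const zero_G)
    then show "D (\<lambda>E. if 0 \<le> E (Suc 0) then tends (\<theta> (E (Suc 0))) (E 0) else E 0 = 0)"
      by (simp add: if_bool_eq_conj)
  qed
  \<comment> \<open>In the limit the increments by \<open>u\<close> lie between \<open>a0\<close>,
    which bounds all multiples of \<open>u\<close> from above, and a constant. This is the situation
    excluded by \<open>no_exotic_slope\<close>.\<close>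
  have h_slope: "a0 \<le> h (b + u) - h b \<and> h (b + u) - h b \<le> a + a + a" if b: "b \<in> G" "0 \<le> b" for b
  proof -
    have b_u: "b + u \<in> G" "0 \<le> b + u" using b u by (auto simp: add_nonneg_nonneg less_imp_le)
    obtain r where r: "r \<in> G" "\<forall>\<^sub>F y in at_inf. \<theta> b y \<le> r" using bounded[OF b] by blast
    have t: "tends (\<lambda>y. \<theta> (b + u) y - \<theta> b y) (h (b + u) - h b)"
      by (rule tends_diff[OF h[OF b_u] h[OF b]])
    have "h (b + u) - h b \<in> G" using h_G b b_u by simp
    from tends_ge[OF t this a0(1)] tends_le[OF t this, of "a + a + a"] slope[OF b r] a(1)
    show ?thesis by (simp add: eventually_conj_iff)
  qed
  have "\<forall>\<^sub>F z in at_inf. nmul n u \<le> h (z + u) - h z" for n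
    using ev_gt[OF zero_G] ev_G
  proof eventually_elim
    case (elim z)
    then show ?case using h_slope[of z] a0(2)[of n] by (meson less_imp_le order_trans)
  qed
  moreover have "\<forall>\<^sub>F z in at_inf. h (z + u) - h z \<le> a + a + a"
    using ev_gt[OF zero_G] ev_G
  proof eventually_elim
    case (elim z)
    then show ?case using h_slope[of z] by (simp add: less_imp_le)
  qed
  moreover have "a + a + a \<in> G" using a by simp
  ultimately show False using no_exotic_slope[OF ne tm_h u] by blast
qed

end

section \<open>Definable predicates\<close>

lemma eval_tm_cong: "(\<And>i. i \<in> fv_tm t ==> e i = e' i) ==> eval_tm M e t = eval_tm M e' t"
proof (induction t)
  case (Fn f ts)
  have "map (eval_tm M e) ts = map (eval_tm M e') ts"
    by (rule map_cong[OF refl], rule Fn.IH) (use Fn.prems in auto)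
  then show ?case by (simp only: eval_tm.simps)
qed simp

lemma sat_cong: "(\<And>i. i \<in> fv \<phi> ==> e i = e' i) ==> sat M e \<phi> \<longleftrightarrow> sat M e' \<phi>"
proof (induction \<phi> arbitrary: e e')
  case (Eql s u)
  then show ?case using eval_tm_cong[of s e e' M] eval_tm_cong[of u e e' M] by simp
next
  case (Rel r ts)
  have "map (eval_tm M e) ts = map (eval_tm M e') ts"
    by (rule map_cong[OF refl], rule eval_tm_cong) (use Rel.prems in auto)
  then show ?case by (simp only: sat.simps)
next
  case (Imp \<phi> \<psi>)
  have "sat M e \<phi> \<longleftrightarrow> sat M e' \<phi>" "sat M e \<psi> \<longleftrightarrow> sat M e' \<psi>"
    by (rule Imp.IH, use Imp.prems in simp)+
  then show ?case by (simp only: sat.simps)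
next
  case (All i \<phi>)
  have "sat M (e(i := a)) \<phi> \<longleftrightarrow> sat M (e'(i := a)) \<phi>" for a
    by (rule All.IH) (use All.prems in auto)
  then show ?case by (simp only: sat.simps)
qed simp

lemma finite_fv_tm: "finite (fv_tm t)"
  by (induction t) auto

lemma finite_fv: "finite (fv \<phi>)"
  by (induction \<phi>) (auto simp: finite_fv_tm)

fun rename_tm :: "(nat \<Rightarrow> nat) \<Rightarrow> 'f tm \<Rightarrow> 'f tm" where
  "rename_tm f (Var i) = Var (f i)"
| "rename_tm f (Fn g ts) = Fn g (map (rename_tm f) ts)"

lemma eval_rename_tm: "eval_tm M e (rename_tm f t) = eval_tm M (\<lambda>i. e (f i)) t"
proof (induction t)
  case (Fn g ts)
  have "map (eval_tm M e) (map (rename_tm f) ts) = map (eval_tm M (\<lambda>i. e (f i))) ts"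
    unfolding map_map by (rule map_cong[OF refl]) (simp add: Fn.IH)
  then show ?case by (simp only: eval_tm.simps rename_tm.simps)
qed simp

lemma wf_rename_tm: "wf_tm L t ==> wf_tm L (rename_tm f t)"
  by (induction t) auto

text \<open>Bound variables are renamed to fresh ones, so \<open>f\<close> need not be injective.\<close>

lemma rename_fm:
  assumes "wf_fm L \<phi>"
  shows "\<exists>\<psi>. wf_fm L \<psi> \<and> (\<forall>e. sat M e \<psi> \<longleftrightarrow> sat M (\<lambda>i. e (f i)) \<phi>)"
  using assms
proof (induction \<phi> arbitrary: f)
  case (Eql s u)
  then show ?case
    by (intro exI[of _ "Eql (rename_tm f s) (rename_tm f u)"]) (simp add: wf_rename_tm eval_rename_tm)
next
  case (Rel r ts)
  have "map (eval_tm M e) (map (rename_tm f) ts) = map (eval_tm M (\<lambda>i. e (f i))) ts" for e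
    unfolding map_map by (rule map_cong[OF refl]) (simp add: eval_rename_tm)
  then have "sat M e (Rel r (map (rename_tm f) ts)) \<longleftrightarrow> sat M (\<lambda>i. e (f i)) (Rel r ts)" for e
    unfolding sat.simps by (rule arg_cong)
  moreover have "wf_fm L (Rel r (map (rename_tm f) ts))" using Rel by (auto simp: wf_rename_tm)
  ultimately show ?case by blast
next
  case Bot
  show ?case by (intro exI[of _ Bot]) simp
next
  case (Imp \<phi>1 \<phi>2)
  obtain \<psi>1 where "wf_fm L \<psi>1" "\<forall>e. sat M e \<psi>1 \<longleftrightarrow> sat M (\<lambda>i. e (f i)) \<phi>1"
    using Imp.IH(1)[of f] Imp.prems by auto
  moreover obtain \<psi>2 where "wf_fm L \<psi>2" "\<forall>e. sat M e \<psi>2 \<longleftrightarrow> sat M (\<lambda>i. e (f i)) \<phi>2"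
    using Imp.IH(2)[of f] Imp.prems by auto
  ultimately show ?case by (intro exI[of _ "Imp \<psi>1 \<psi>2"]) simp
next
  case (All i \<phi>)
  obtain j where j: "j \<notin> f ` fv \<phi>"
    using ex_new_if_finite[OF infinite_UNIV_nat finite_imageI[OF finite_fv]] by blast
  obtain \<psi> where \<psi>: "wf_fm L \<psi>" "\<And>e. sat M e \<psi> \<longleftrightarrow> sat M (\<lambda>k. e ((f(i := j)) k)) \<phi>"
    using All.IH[of "f(i := j)"] All.prems by auto
  have "sat M (e(j := a)) \<psi> \<longleftrightarrow> sat M ((\<lambda>k. e (f k))(i := a)) \<phi>" for e a
    unfolding \<psi>(2) by (rule sat_cong) (use j in auto)
  then show ?case using \<psi>(1) by (intro exI[of _ "All j \<psi>"]) simp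
qed

text \<open>Variables occupy the even positions and parameters the odd ones. A shift of the
  variables under a quantifier then leaves the parameters in place.\<close>

definition interleave :: "(nat \<Rightarrow> 'a) \<Rightarrow> (nat \<Rightarrow> 'a) \<Rightarrow> nat \<Rightarrow> 'a" where
  "interleave e p n = (if even n then e (n div 2) else p (n div 2))"

lemma interleave_simps [simp]: "interleave e p (2 * n) = e n" "interleave e p (Suc (2 * n)) = p n"
  by (simp_all add: interleave_def)

text \<open>Definability with parameters of a predicate on assignments: the parameters \<open>p\<close> are the values of
  the odd variables.\<close>

definition dfn :: "('f, 'r) lang \<Rightarrow> ('f, 'r, 'a) fo_struct \<Rightarrow> ((nat \<Rightarrow> 'a) \<Rightarrow> bool) \<Rightarrow> bool" where
  "dfn L M P \<longleftrightarrow> (\<exists>\<phi> p. wf_fm L \<phi> \<and> range p \<subseteq> univ M \<and>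
     (\<forall>e. range e \<subseteq> univ M \<longrightarrow> P e = sat M (interleave e p) \<phi>))"

lemma dfn_rename:
  assumes "wf_fm L \<phi>" "range p \<subseteq> univ M"
    and "\<And>e. range e \<subseteq> univ M ==> P e = sat M (\<lambda>i. interleave e p (f i)) \<phi>"
  shows "dfn L M P"
proof -
  obtain \<psi> where "wf_fm L \<psi>" "\<And>e. sat M e \<psi> \<longleftrightarrow> sat M (\<lambda>i. e (f i)) \<phi>"
    using rename_fm[OF assms(1)] by metis
  then show ?thesis unfolding dfn_def using assms(2,3) by metis
qed

lemma dfn_of_definable:
  fixes M :: "('f, 'r, 'a) fo_struct"
  assumes "definable L M n Ds"
  shows "dfn L M (\<lambda>e. map e [0..<n] \<in> Ds)"
proof -
  obtain \<phi> e0 where \<phi>: "wf_fm L \<phi>" "range e0 \<subseteq> univ M"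
    "Ds = {xs \<in> tuples n (univ M). sat M (\<lambda>i. if i < n then xs ! i else e0 i) \<phi>}"
    using assms unfolding definable_def by blast
  show ?thesis
  proof (rule dfn_rename[OF \<phi>(1,2), where f = "\<lambda>i. if i < n then 2 * i else Suc (2 * i)"])
    fix e :: "nat \<Rightarrow> 'a" assume e: "range e \<subseteq> univ M"
    have "(\<lambda>i. if i < n then map e [0..<n] ! i else e0 i) =
        (\<lambda>i. interleave e e0 (if i < n then 2 * i else Suc (2 * i)))"
      by (rule ext) simp
    moreover have "map e [0..<n] \<in> tuples n (univ M)"
      using e by (auto simp: tuples_def)
    ultimately show "map e [0..<n] \<in> Ds \<longleftrightarrow>
        sat M (\<lambda>i. interleave e e0 (if i < n then 2 * i else Suc (2 * i))) \<phi>"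
      by (simp add: \<phi>(3))
  qed
qed

text \<open>Returns to the convention in which the first \<open>n\<close> variables are the tuple
  and all others are parameters.\<close>

lemma definable_of_dfn:
  fixes M :: "('f, 'r, 'a) fo_struct"
  assumes "dfn L M P" "univ M \<noteq> {}" "Ds \<subseteq> tuples n (univ M)"
    and P: "\<And>e. range e \<subseteq> univ M ==> map e [0..<n] \<in> Ds \<longleftrightarrow> P e"
  shows "definable L M n Ds"
proof -
  obtain u where u: "u \<in> univ M" using assms(2) by blast
  obtain \<phi> p where \<phi>: "wf_fm L \<phi>" "range p \<subseteq> univ M"
    "\<And>e. range e \<subseteq> univ M ==> P e = sat M (interleave e p) \<phi>"
    using assms(1) unfolding dfn_def by blast
  \<comment> \<open>The even positions that belong to the tuple move to the front; all others move
    out of the way by \<open>n\<close>. Even positions beyond the tuple receive the dummy value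
    \<open>u\<close>.\<close>
  define f where "f m = (if even m then if m div 2 < n then m div 2 else n + m else n + m)" for m
  obtain \<psi> where \<psi>: "wf_fm L \<psi>" "\<And>e. sat M e \<psi> \<longleftrightarrow> sat M (\<lambda>i. e (f i)) \<phi>"
    using rename_fm[OF \<phi>(1)] by metis
  define e0 where "e0 i = (if odd (i - n) then p ((i - n) div 2) else u)" for i
  have "range e0 \<subseteq> univ M" using u \<phi>(2) by (auto simp: e0_def)
  moreover have "xs \<in> Ds \<longleftrightarrow> sat M (\<lambda>i. if i < n then xs ! i else e0 i) \<psi>"
    if xs: "xs \<in> tuples n (univ M)" for xs
  proof -
    define e where "e i = (if i < n then xs ! i else u)" for i
    have e: "range e \<subseteq> univ M" using xs u by (auto simp: e_def tuples_def)
    have "map e [0..<n] = xs" using xs by (auto simp: tuples_def e_def intro: nth_equalityI)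
    moreover have "(\<lambda>i. if f i < n then xs ! f i else e0 (f i)) = interleave e p"
      by (rule ext) (auto simp: f_def e0_def e_def interleave_def)
    ultimately show ?thesis using P[OF e] \<phi>(3)[OF e] \<psi>(2) by simp
  qed
  ultimately show ?thesis
    unfolding definable_def using \<psi>(1) assms(3) by (intro exI[of _ \<psi>] exI[of _ e0]) auto
qed

section \<open>Closure properties of the definable predicates of a structure\<close>

locale fo_structure =
  fixes L :: "('f, 'r) lang" and M :: "('f, 'r, 'a) fo_struct"
  assumes struct: "is_struct L M"
begin

lemma univ_nonempty: "univ M \<noteq> {}"
  using struct by (simp add: is_struct_def)

lemma fun_int_closed: "farity L f = Some (length xs) ==> set xs \<subseteq> univ M ==> fun_int M f xs \<in> univ M"
  using struct by (simp add: is_struct_def tuples_def)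

lemma dfn_sat:
  assumes "wf_fm L \<phi>" shows "dfn L M (\<lambda>e. sat M e \<phi>)"
proof -
  obtain u where "u \<in> univ M" using univ_nonempty by blast
  then show ?thesis
    by (intro dfn_rename[OF assms, where p = "\<lambda>_. u" and f = "\<lambda>i. 2 * i"]) (auto simp: o_def)
qed

sublocale definable_sets "univ M" "dfn L M"
proof
  show "dfn L M P'" if P: "dfn L M P" and eq: "\<And>E. range E \<subseteq> univ M ==> P E \<longleftrightarrow> P' E" for P P'
  proof -
    obtain \<phi> p where "wf_fm L \<phi>" "range p \<subseteq> univ M"
      "\<And>e. range e \<subseteq> univ M ==> P e = sat M (interleave e p) \<phi>"
      using P unfolding dfn_def by blast
    then show ?thesis unfolding dfn_def using eq by (intro exI[of _ \<phi>] exI[of _ p]) simp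
  qed
  show "dfn L M (\<lambda>E. \<not> P E)" if P: "dfn L M P" for P
  proof -
    obtain \<phi> p where "wf_fm L \<phi>" "range p \<subseteq> univ M"
      "\<And>e. range e \<subseteq> univ M ==> P e = sat M (interleave e p) \<phi>"
      using P unfolding dfn_def by blast
    then show ?thesis unfolding dfn_def by (intro exI[of _ "Neg \<phi>"] exI[of _ p]) simp
  qed
  show "dfn L M (\<lambda>E. P E \<and> P' E)" if P: "dfn L M P" "dfn L M P'" for P P'
  proof -
    obtain \<phi> p where \<phi>: "wf_fm L \<phi>" "range p \<subseteq> univ M"
      "\<And>e. range e \<subseteq> univ M ==> P e = sat M (interleave e p) \<phi>"
      using P(1) unfolding dfn_def by blast
    obtain \<phi>' p' where \<phi>': "wf_fm L \<phi>'" "range p' \<subseteq> univ M"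
      "\<And>e. range e \<subseteq> univ M ==> P' e = sat M (interleave e p') \<phi>'"
      using P(2) unfolding dfn_def by blast
    \<comment> \<open>The two parameter lists are themselves interleaved on the odd positions, and
      \<open>c\<close> selects one of them.\<close>
    define f where "f c m = (if even m then m else Suc (2 * (2 * (m div 2) + c)))" for c m :: nat
    obtain \<psi> where \<psi>: "wf_fm L \<psi>" "\<And>e. sat M e \<psi> \<longleftrightarrow> sat M (\<lambda>i. e (f 0 i)) \<phi>"
      using rename_fm[OF \<phi>(1)] by metis
    obtain \<psi>' where \<psi>': "wf_fm L \<psi>'" "\<And>e. sat M e \<psi>' \<longleftrightarrow> sat M (\<lambda>i. e (f 1 i)) \<phi>'"
      using rename_fm[OF \<phi>'(1)] by metis
    have f: "(\<lambda>i. interleave e (interleave p p') (f 0 i)) = interleave e p"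
      "(\<lambda>i. interleave e (interleave p p') (f 1 i)) = interleave e p'" for e
      by (auto simp: fun_eq_iff f_def interleave_def elim!: oddE)
    have "range (interleave p p') \<subseteq> univ M"
      using \<phi>(2) \<phi>'(2) by (auto simp: interleave_def)
    moreover have "wf_fm L (Neg (Imp \<psi> (Neg \<psi>')))" using \<psi>(1) \<psi>'(1) by simp
    moreover have "(P e \<and> P' e) = sat M (interleave e (interleave p p')) (Neg (Imp \<psi> (Neg \<psi>')))"
      if "range e \<subseteq> univ M" for e
      using \<phi>(3)[OF that] \<phi>'(3)[OF that] by (simp add: \<psi>(2) \<psi>'(2) f f(2)[simplified])
    ultimately show ?thesis unfolding dfn_def by blast
  qed
  show "dfn L M (\<lambda>E. \<exists>x\<in>univ M. R E x)" if R: "dfn L M (\<lambda>E. R (\<lambda>i. E (Suc i)) (E 0))"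
    for R :: "(nat \<Rightarrow> 'a) \<Rightarrow> 'a \<Rightarrow> bool"
  proof -
    obtain \<phi> p where \<phi>: "wf_fm L \<phi>" "range p \<subseteq> univ M"
      "\<And>e. range e \<subseteq> univ M ==> R (\<lambda>i. e (Suc i)) (e 0) = sat M (interleave e p) \<phi>"
      using R unfolding dfn_def by blast
    \<comment> \<open>Lowers the index of each variable by one, hence its even position by two.
      Truncated subtraction sends position 0 to itself, but there the quantifier overwrites the
      value.\<close>
    define f :: "nat \<Rightarrow> nat" where "f m = (if even m then m - 2 else m)" for m
    show ?thesis
    proof (rule dfn_rename[OF _ \<phi>(2), where f = f and \<phi> = "Neg (All 0 (Neg \<phi>))"])
      fix e :: "nat \<Rightarrow> 'a" assume e: "range e \<subseteq> univ M"
      have "R e a = sat M ((\<lambda>i. interleave e p (f i))(0 := a)) \<phi>" if "a \<in> univ M" for a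
      proof -
        have "(\<lambda>i. interleave e p (f i))(0 := a) = interleave (case_nat a e) p"
        proof
          fix m show "((\<lambda>i. interleave e p (f i))(0 := a)) m = interleave (case_nat a e) p m"
            by (cases "m div 2") (auto simp: f_def interleave_def elim!: evenE oddE)
        qed
        moreover have "range (case_nat a e) \<subseteq> univ M"
          using e that by (auto simp: image_subset_iff split: nat.splits)
        ultimately show ?thesis using \<phi>(3)[of "case_nat a e"] by simp
      qed
      then show "(\<exists>x\<in>univ M. R e x) = sat M (\<lambda>i. interleave e p (f i)) (Neg (All 0 (Neg \<phi>)))" by simp
    qed (use \<phi>(1) in simp)
  qed
  show "dfn L M (\<lambda>E. P (\<lambda>i. E (f i)))" if P: "dfn L M P" for P and f :: "nat \<Rightarrow> nat"
  proof -
    obtain \<phi> p where \<phi>: "wf_fm L \<phi>" "range p \<subseteq> univ M"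
      "\<And>e. range e \<subseteq> univ M ==> P e = sat M (interleave e p) \<phi>"
      using P unfolding dfn_def by blast
    show ?thesis
    proof (rule dfn_rename[OF \<phi>(1,2), where f = "\<lambda>m. if even m then 2 * f (m div 2) else m"])
      fix e :: "nat \<Rightarrow> 'a" assume "range e \<subseteq> univ M"
      then have "range (\<lambda>i. e (f i)) \<subseteq> univ M" by auto
      moreover have "(\<lambda>m. interleave e p (if even m then 2 * f (m div 2) else m)) = interleave (\<lambda>i. e (f i)) p"
        by (auto simp: fun_eq_iff interleave_def)
      ultimately show "P (\<lambda>i. e (f i)) = sat M (\<lambda>m. interleave e p (if even m then 2 * f (m div 2) else m)) \<phi>"
        using \<phi>(3) by simp
    qed
  qed
  show "dfn L M (\<lambda>E. E 0 = E 1)"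
    using dfn_sat[of "Eql (Var 0) (Var 1)"] by simp
  show "dfn L M (\<lambda>E. E 0 = c)" if "c \<in> univ M" for c
    unfolding dfn_def using that
    by (intro exI[of _ "Eql (Var 0) (Var 1)"] exI[of _ "\<lambda>_. c"]) (auto simp: interleave_def)
qed

lemma tm_Fn1:
  assumes "farity L f = Some 1" "tm s" shows "tm (\<lambda>E. fun_int M f [s E])"
proof (rule tm_comp1[OF _ assms(2)])
  have "dfn L M (\<lambda>E. E 0 = fun_int M f [E 1])"
    using dfn_sat[of "Eql (Var 0) (Fn f [Var 1])"] assms(1) by simp
  then show "tm (\<lambda>E. fun_int M f [E 0])"
    using fun_int_closed[of f "[_]"] assms(1) by (auto simp: tm_def image_subset_iff)
qed

lemma tm_Fn2:
  assumes "farity L f = Some 2" "tm s" "tm u" shows "tm (\<lambda>E. fun_int M f [s E, u E])"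
proof (rule tm_comp2[OF _ assms(2,3)])
  have "dfn L M (\<lambda>E. E 0 = fun_int M f [E 1, E (Suc 1)])"
    using dfn_sat[of "Eql (Var 0) (Fn f [Var 1, Var (Suc 1)])"] assms(1) by simp
  then show "tm (\<lambda>E. fun_int M f [E 0, E 1])"
    using fun_int_closed[of f "[_, _]"] assms(1) by (auto simp: tm_def image_subset_iff)
qed

lemma dfn_Rel1:
  assumes "rarity L r = Some 1" "tm s" shows "dfn L M (\<lambda>E. rel_int M r [s E])"
proof (rule D_comp1[OF _ assms(2)])
  show "dfn L M (\<lambda>E. rel_int M r [E 0])"
    using dfn_sat[of "Rel r [Var 0]"] assms(1) by simp
qed

end

section \<open>Quantifier elimination for algebraically closed fields\<close>

text \<open>Horner evaluation with the constant coefficient first. The leading coefficient is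
  \<open>last cs\<close>, and it may be zero.\<close>

primrec peval :: "('a, 'b) ring_scheme \<Rightarrow> 'a list \<Rightarrow> 'a \<Rightarrow> 'a" where
  "peval R [] x = \<zero>\<^bsub>R\<^esub>"
| "peval R (c # cs) x = c \<oplus>\<^bsub>R\<^esub> x \<otimes>\<^bsub>R\<^esub> peval R cs x"

text \<open>Algebraic closedness in terms of coefficient lists, a form that is established both for
  the valued field and for its residue field.\<close>

locale root_closed_field = field +
  assumes root: "set cs \<subseteq> carrier R ==> last cs \<noteq> \<zero> ==> 2 \<le> length cs ==>
    \<exists>x\<in>carrier R. peval R cs x = \<zero>"
begin

lemmas ring_expand = a_minus_def l_distr r_distr l_minus r_minus minus_add a_ac m_ac

lemma add_diff_cancel: assumes "u \<in> carrier R" "w \<in> carrier R" shows "(u \<ominus> w) \<oplus> w = u"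
  using assms by (simp add: a_minus_def a_assoc l_neg)

lemma diff_cancel:
  assumes "a \<in> carrier R" "b \<in> carrier R" "w \<in> carrier R" shows "(a \<oplus> w) \<ominus> (b \<oplus> w) = a \<ominus> b"
proof -
  have "(a \<oplus> w) \<oplus> (b' \<oplus> w') = (a \<oplus> b') \<oplus> (w \<oplus> w')" if "b' \<in> carrier R" "w' \<in> carrier R" for b' w'
    using assms that by (simp add: a_ac)
  from this[of "\<ominus> b" "\<ominus> w"] show ?thesis using assms by (simp add: a_minus_def minus_add r_neg)
qed

lemma peval_closed [simp]: "set cs \<subseteq> carrier R ==> x \<in> carrier R ==> peval R cs x \<in> carrier R"
  by (induction cs) auto

lemma peval_append:
  "set as \<subseteq> carrier R ==> set bs \<subseteq> carrier R ==> x \<in> carrier R ==>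
    peval R (as @ bs) x = peval R as x \<oplus> x [^] length as \<otimes> peval R bs x"
proof (induction as)
  case (Cons a as)
  then show ?case
    by (simp add: r_distr a_assoc nat_pow_Suc2 m_assoc m_lcomm)
qed simp

lemma peval_zero: "(\<And>c. c \<in> set cs ==> c = \<zero>) ==> x \<in> carrier R ==> peval R cs x = \<zero>"
proof (induction cs)
  case (Cons a cs)
  have "a = \<zero>" "peval R cs x = \<zero>" using Cons.prems(1)[of a] Cons.IH Cons.prems by auto
  then show ?case using Cons.prems(2) by simp
qed simp

text \<open>Horner's scheme read as division by x - a: the intermediate values at \<open>a\<close>
  are the coefficients of the quotient, and the last one is the remainder.\<close>

lemma peval_divide:
  assumes "cs \<noteq> []" "set cs \<subseteq> carrier R" "a \<in> carrier R"
  shows "\<exists>ds. set ds \<subseteq> carrier R \<and> Suc (length ds) = length cs \<and> (ds \<noteq> [] \<longrightarrow> last ds = last cs) \<and>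
    (\<forall>x\<in>carrier R. peval R cs x = (x \<ominus> a) \<otimes> peval R ds x \<oplus> peval R cs a)"
  using assms
proof (induction cs)
  case (Cons c cs)
  show ?case
  proof (cases "cs = []")
    case True
    then show ?thesis using Cons.prems by (intro exI[of _ "[]"]) simp
  next
    case False
    then obtain ds where ds: "set ds \<subseteq> carrier R" "Suc (length ds) = length cs" "ds \<noteq> [] \<longrightarrow> last ds = last cs"
      "\<And>x. x \<in> carrier R ==> peval R cs x = (x \<ominus> a) \<otimes> peval R ds x \<oplus> peval R cs a"
      using Cons.IH Cons.prems by auto
    have c: "c \<in> carrier R" "set cs \<subseteq> carrier R" using Cons.prems by auto
    define p where "p = peval R cs a"
    have p: "p \<in> carrier R" using c Cons.prems(3) by (simp add: p_def)
    have "peval R (c # cs) x = (x \<ominus> a) \<otimes> peval R (p # ds) x \<oplus> peval R (c # cs) a"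
      if x: "x \<in> carrier R" for x
    proof -
      define d where "d = peval R ds x"
      have d: "d \<in> carrier R" using ds(1) x by (simp add: d_def)
      have "c \<oplus> x \<otimes> ((x \<ominus> a) \<otimes> d \<oplus> p) = (x \<ominus> a) \<otimes> (p \<oplus> x \<otimes> d) \<oplus> (c \<oplus> a \<otimes> p)"
      proof -
        define u w where "u = x \<otimes> p \<oplus> (x \<ominus> a) \<otimes> (x \<otimes> d)" and "w = a \<otimes> p"
        have uw: "u \<in> carrier R" "w \<in> carrier R" using p d x Cons.prems(3) by (simp_all add: u_def w_def)
        have "(x \<ominus> a) \<otimes> (p \<oplus> x \<otimes> d) = u \<ominus> w"
          using p d x Cons.prems(3) by (simp add: u_def w_def ring_expand)
        moreover have "(u \<ominus> w) \<oplus> (c \<oplus> w) = c \<oplus> ((u \<ominus> w) \<oplus> w)" using uw c(1) by (intro a_lcomm) simp_all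
        moreover have "c \<oplus> x \<otimes> ((x \<ominus> a) \<otimes> d \<oplus> p) = c \<oplus> u"
          using c(1) p d x Cons.prems(3) by (simp add: u_def ring_expand)
        ultimately show ?thesis using add_diff_cancel[OF uw] by (simp add: w_def)
      qed
      then show ?thesis using ds(4)[OF x] by (simp add: p_def d_def)
    qed
    moreover have "last (p # ds) = last (c # cs)"
    proof (cases "ds = []")
      case True
      then obtain b where "cs = [b]" using ds(2) by (cases cs) auto
      then show ?thesis using True c Cons.prems(3) by (simp add: p_def)
    qed (use ds(3) False in simp)
    ultimately show ?thesis using ds(1,2) p by (intro exI[of _ "p # ds"]) auto
  qed
qed simp

lemma finite_roots:
  assumes "set cs \<subseteq> carrier R" "c \<in> set cs" "c \<noteq> \<zero>"
  shows "finite {x \<in> carrier R. peval R cs x = \<zero>}"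
  using assms
proof (induction "length cs" arbitrary: cs c rule: less_induct)
  case less
  have "cs \<noteq> []" using less.prems by auto
  show ?case
  proof (cases "last cs = \<zero>")
    case True
    have cs: "cs = butlast cs @ [\<zero>]" using \<open>cs \<noteq> []\<close> True by (metis append_butlast_last_id)
    then have "set (butlast cs) \<subseteq> carrier R" "c \<in> set (butlast cs)"
      using less.prems by (metis Un_iff set_append le_sup_iff, metis Un_iff set_append empty_iff insert_iff list.set)
    moreover have "peval R cs x = peval R (butlast cs) x" if "x \<in> carrier R" for x
      using peval_append[of "butlast cs" "[\<zero>]" x] that calculation(1) by (simp add: cs[symmetric])
    ultimately show ?thesis
      using less.hyps[of "butlast cs" c] less.prems(3) \<open>cs \<noteq> []\<close> by (simp cong: conj_cong)
  next
    case last: False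
    show ?thesis
    proof (cases "\<exists>a\<in>carrier R. peval R cs a = \<zero>")
      case True
      then obtain a where a: "a \<in> carrier R" "peval R cs a = \<zero>" by blast
      obtain ds where ds: "set ds \<subseteq> carrier R" "Suc (length ds) = length cs" "ds \<noteq> [] \<longrightarrow> last ds = last cs"
        "\<And>x. x \<in> carrier R ==> peval R cs x = (x \<ominus> a) \<otimes> peval R ds x \<oplus> peval R cs a"
        using peval_divide[OF \<open>cs \<noteq> []\<close> less.prems(1) a(1)] by blast
      have "ds \<noteq> []"
      proof
        assume "ds = []"
        then obtain b where "cs = [b]" using ds(2) by (cases cs) auto
        then show False using a last less.prems(1) by auto
      qed
      then have "finite {x \<in> carrier R. peval R ds x = \<zero>}"
        using less.hyps[of ds "last ds"] last_in_set[of ds] ds(1-3) last by simp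
      moreover have "{x \<in> carrier R. peval R cs x = \<zero>} \<subseteq> insert a {x \<in> carrier R. peval R ds x = \<zero>}"
        using ds(1,4) a by (auto simp: integral_iff r_right_minus_eq)
      ultimately show ?thesis using finite_subset by blast
    next
      case False
      then have "{x \<in> carrier R. peval R cs x = \<zero>} = {}" by blast
      then show ?thesis by (simp only: finite.emptyI)
    qed
  qed
qed

text \<open>If there were N nonzero elements only, each would satisfy x^N = 1, and the polynomial 1
  - x + x^(N+1) would take the value 1 everywhere and have no root.\<close>

lemma infinite_carrier: "infinite (carrier R)"
proof
  assume fin: "finite (carrier R)"
  interpret U: group "units_of R" by (rule units_group)
  define N where "N = order (units_of R)"
  have car: "carrier (units_of R) = carrier R - {\<zero>}" by (simp add: units_of_def field_Units)
  have "\<one> \<in> carrier (units_of R)" by (simp add: car)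
  then have N: "N > 0" using fin unfolding N_def order_def car card_gt_0_iff by blast
  have pow: "x [^] N = \<one>" if x: "x \<in> carrier R" "x \<noteq> \<zero>" for x
  proof -
    have "x [^]\<^bsub>units_of R\<^esub> N = \<one>\<^bsub>units_of R\<^esub>"
      unfolding N_def using fin by (intro U.pow_order_eq_1) (auto simp: car x)
    then show ?thesis using x by (simp add: units_of_pow field_Units units_of_one)
  qed
  define k where "k = N - 1"
  have N_k: "N = Suc k" using N by (simp add: k_def)
  define cs where "cs = [\<one>, \<ominus> \<one>] @ replicate k \<zero> @ [\<one>]"
  have "set cs \<subseteq> carrier R" "last cs \<noteq> \<zero>" "2 \<le> length cs" by (auto simp: cs_def)
  then obtain x where x: "x \<in> carrier R" "peval R cs x = \<zero>"
    using root by blast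
  have z: "peval R (replicate k \<zero>) x = \<zero>" using x(1) by (intro peval_zero) auto
  have s: "set (replicate k \<zero>) \<subseteq> carrier R" by auto
  have "peval R (replicate k \<zero> @ [\<one>]) x = x [^] k"
    using x(1) by (subst peval_append[OF s]) (auto simp: z)
  then have eq: "\<one> \<oplus> x \<otimes> (\<ominus> \<one> \<oplus> x \<otimes> x [^] k) = \<zero>" using x(2) by (simp add: cs_def)
  have xN: "x \<otimes> x [^] k = x [^] N"
    using x(1) by (simp add: N_k m_comm)
  show False
  proof (cases "x = \<zero>")
    case False
    then have "\<ominus> \<one> \<oplus> x [^] N = \<zero>" using pow[OF x(1)] by (simp add: l_neg)
    then show ?thesis using eq x(1) unfolding xN by simp
  qed (use eq in simp)
qed

section \<open>Polynomial functions of one variable and their divisibility\<close>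

definition polyfun :: "('a \<Rightarrow> 'a) \<Rightarrow> bool" where
  "polyfun F \<longleftrightarrow> (\<exists>cs. set cs \<subseteq> carrier R \<and> (\<forall>y\<in>carrier R. F y = peval R cs y))"

lemma polyfun_peval: "set cs \<subseteq> carrier R ==> polyfun (peval R cs)"
  unfolding polyfun_def by blast

lemma polyfun_closed: "polyfun F ==> y \<in> carrier R ==> F y \<in> carrier R"
  unfolding polyfun_def by auto

lemma polyfun_add:
  assumes "polyfun F" "polyfun H" shows "polyfun (\<lambda>y. F y \<oplus> H y)"
proof -
  have "\<exists>es. set es \<subseteq> carrier R \<and> (\<forall>y\<in>carrier R. peval R cs y \<oplus> peval R ds y = peval R es y)"
    if "set cs \<subseteq> carrier R" "set ds \<subseteq> carrier R" for cs ds
    using that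
  proof (induction cs arbitrary: ds)
    case Nil
    then show ?case by (intro exI[of _ ds]) simp
  next
    case (Cons c cs)
    show ?case
    proof (cases ds)
      case Nil
      then show ?thesis using Cons.prems by (intro exI[of _ "c # cs"]) simp
    next
      case (Cons d ds')
      then obtain es where es: "set es \<subseteq> carrier R" "\<And>y. y \<in> carrier R ==> peval R cs y \<oplus> peval R ds' y = peval R es y"
        using Cons.IH[of ds'] Cons.prems by auto
      have "peval R (c # cs) y \<oplus> peval R ds y = peval R ((c \<oplus> d) # es) y" if y: "y \<in> carrier R" for y
      proof -
        define p q where "p = peval R cs y" and "q = peval R ds' y"
        have "p \<in> carrier R" "q \<in> carrier R" "c \<in> carrier R" "d \<in> carrier R"
          using Cons.prems Cons y by (auto simp: p_def q_def)
        then have "c \<oplus> y \<otimes> p \<oplus> (d \<oplus> y \<otimes> q) = c \<oplus> d \<oplus> y \<otimes> (p \<oplus> q)" using y by (simp add: ring_expand)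
        then show ?thesis using Cons es(2)[OF y] by (simp add: p_def q_def)
      qed
      then show ?thesis using es(1) Cons Cons.prems by (intro exI[of _ "(c \<oplus> d) # es"]) auto
    qed
  qed
  then show ?thesis using assms unfolding polyfun_def by (metis (no_types, lifting))
qed

lemma polyfun_cmult:
  assumes "polyfun F" "c \<in> carrier R" shows "polyfun (\<lambda>y. c \<otimes> F y)"
proof -
  have "c \<otimes> peval R cs y = peval R (map ((\<otimes>) c) cs) y" if "set cs \<subseteq> carrier R" "y \<in> carrier R" for cs y
    using that
  proof (induction cs)
    case (Cons d cs)
    then have "c \<otimes> (y \<otimes> peval R cs y) = y \<otimes> (c \<otimes> peval R cs y)" using assms(2) by (intro m_lcomm) auto
    then show ?case using Cons assms(2) by (simp add: r_distr)
  qed (use assms(2) in simp)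
  moreover have "set (map ((\<otimes>) c) cs) \<subseteq> carrier R" if "set cs \<subseteq> carrier R" for cs
    using that assms(2) by auto
  ultimately show ?thesis using assms(1) unfolding polyfun_def by (metis (no_types, lifting))
qed

lemma polyfun_shift:
  assumes "polyfun F" shows "polyfun (\<lambda>y. y \<otimes> F y)"
proof -
  obtain cs where "set cs \<subseteq> carrier R" "\<forall>y\<in>carrier R. F y = peval R cs y"
    using assms unfolding polyfun_def by blast
  then show ?thesis unfolding polyfun_def by (intro exI[of _ "\<zero> # cs"]) auto
qed

lemma polyfun_const: "c \<in> carrier R ==> polyfun (\<lambda>y. c)"
  unfolding polyfun_def by (intro exI[of _ "[c]"]) auto

lemma polyfun_cong: "polyfun F ==> (\<And>y. y \<in> carrier R ==> F y = H y) ==> polyfun H"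
  unfolding polyfun_def by auto

lemma polyfun_mult:
  assumes "polyfun F" "polyfun H" shows "polyfun (\<lambda>y. F y \<otimes> H y)"
proof -
  have "polyfun (\<lambda>y. peval R cs y \<otimes> H y)" if "set cs \<subseteq> carrier R" for cs
    using that
  proof (induction cs)
    case Nil
    show ?case by (rule polyfun_cong[OF polyfun_const[of \<zero>]]) (simp_all add: polyfun_closed[OF assms(2)])
  next
    case (Cons c cs)
    have "polyfun (\<lambda>y. c \<otimes> H y \<oplus> y \<otimes> (peval R cs y \<otimes> H y))"
      using Cons by (intro polyfun_add polyfun_cmult polyfun_shift assms(2)) auto
    then show ?case
    proof (rule polyfun_cong)
      fix y assume "y \<in> carrier R"
      then show "c \<otimes> H y \<oplus> y \<otimes> (peval R cs y \<otimes> H y) = peval R (c # cs) y \<otimes> H y"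
        using Cons.prems polyfun_closed[OF assms(2)] by (simp add: l_distr m_assoc)
    qed
  qed
  moreover obtain cs where "set cs \<subseteq> carrier R" "\<forall>y\<in>carrier R. F y = peval R cs y"
    using assms(1) unfolding polyfun_def by blast
  ultimately show ?thesis using polyfun_cong[of "\<lambda>y. peval R cs y \<otimes> H y"] by simp
qed

lemma polyfun_var: "polyfun (\<lambda>y. y)"
  by (rule polyfun_cong[OF polyfun_shift[OF polyfun_const[OF one_closed]]]) simp

lemma polyfun_pow: "polyfun F ==> polyfun (\<lambda>y. F y [^] (n :: nat))"
  by (induction n) (auto intro: polyfun_const polyfun_mult)

lemma polyfun_zero_or_finite:
  assumes "polyfun F" "y0 \<in> carrier R" "F y0 \<noteq> \<zero>"
  shows "finite {y \<in> carrier R. F y = \<zero>}"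
proof -
  obtain cs where cs: "set cs \<subseteq> carrier R" "\<forall>y\<in>carrier R. F y = peval R cs y"
    using assms(1) unfolding polyfun_def by blast
  then obtain c where "c \<in> set cs" "c \<noteq> \<zero>" using peval_zero[of cs y0] assms(2,3) by auto
  then have "finite {y \<in> carrier R. peval R cs y = \<zero>}" using finite_roots cs(1) by blast
  then show ?thesis using cs(2) by (simp cong: conj_cong)
qed

lemma polyfun_mult_nonzero:
  assumes "polyfun F" "polyfun H" "y \<in> carrier R" "F y \<noteq> \<zero>" "z \<in> carrier R" "H z \<noteq> \<zero>"
  shows "\<exists>x\<in>carrier R. F x \<noteq> \<zero> \<and> H x \<noteq> \<zero>"
proof -
  have fin: "finite ({y \<in> carrier R. F y = \<zero>} \<union> {y \<in> carrier R. H y = \<zero>})"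
    using polyfun_zero_or_finite[OF assms(1,3,4)] polyfun_zero_or_finite[OF assms(2,5,6)] by (rule finite_UnI)
  have "\<not> carrier R \<subseteq> {y \<in> carrier R. F y = \<zero>} \<union> {y \<in> carrier R. H y = \<zero>}"
  proof
    assume "carrier R \<subseteq> {y \<in> carrier R. F y = \<zero>} \<union> {y \<in> carrier R. H y = \<zero>}"
    with fin have "finite (carrier R)" by (rule rev_finite_subset)
    then show False using infinite_carrier by simp
  qed
  then show ?thesis by blast
qed

text \<open>Divisibility is stated for functions rather than for coefficient lists; over an infinite
  field nothing is lost, because a nonzero polynomial has finitely many zeros.\<close>

definition pdvd :: "'a list \<Rightarrow> ('a \<Rightarrow> 'a) \<Rightarrow> bool" where
  "pdvd cs F \<longleftrightarrow> (\<exists>S. polyfun S \<and> (\<forall>y\<in>carrier R. F y = peval R cs y \<otimes> S y))"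

text \<open>A Nullstellensatz in one variable: no root has a multiplicity above the degree, so the
  degree is a sufficient exponent. The induction splits a root \<open>a\<close> off
  \<open>cs\<close>; one factor \<open>Q\<close> of the power supplies the matching y - a.\<close>

lemma roots_subset_iff:
  assumes "set cs \<subseteq> carrier R" "cs \<noteq> []" "last cs \<noteq> \<zero>" "polyfun Q"
  shows "(\<forall>y\<in>carrier R. peval R cs y = \<zero> \<longrightarrow> Q y = \<zero>) \<longleftrightarrow> pdvd cs (\<lambda>y. Q y [^] (length cs - 1))"
proof
  assume "\<forall>y\<in>carrier R. peval R cs y = \<zero> \<longrightarrow> Q y = \<zero>"
  then show "pdvd cs (\<lambda>y. Q y [^] (length cs - 1))"
    using assms(1-3)
  proof (induction "length cs - 1" arbitrary: cs)
    case 0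
    then obtain c where c: "cs = [c]" by (cases cs) auto
    then have "c \<in> carrier R" "c \<noteq> \<zero>" using 0 by auto
    then have "c \<in> Units R" by (simp add: field_Units)
    then have "\<forall>y\<in>carrier R. \<one> = peval R cs y \<otimes> inv c" using \<open>c \<in> carrier R\<close> by (simp add: c)
    then have "\<forall>y\<in>carrier R. Q y [^] (length cs - 1) = peval R cs y \<otimes> inv c" by (simp add: c)
    then show ?case unfolding pdvd_def using polyfun_const[OF Units_inv_closed[OF \<open>c \<in> Units R\<close>]] by blast
  next
    case (Suc d)
    have "2 \<le> length cs" using Suc.hyps(2) by simp
    then obtain a where a: "a \<in> carrier R" "peval R cs a = \<zero>" using root[OF Suc.prems(2,4)] by blast
    obtain ds where ds: "set ds \<subseteq> carrier R" "Suc (length ds) = length cs" "ds \<noteq> [] \<longrightarrow> last ds = last cs"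
      "\<And>x. x \<in> carrier R ==> peval R cs x = (x \<ominus> a) \<otimes> peval R ds x \<oplus> peval R cs a"
      using peval_divide[OF Suc.prems(3,2) a(1)] by blast
    have csx: "peval R cs x = (x \<ominus> a) \<otimes> peval R ds x" if "x \<in> carrier R" for x
      using ds(4)[OF that] a that ds(1) by simp
    have len: "length ds - 1 = d" "ds \<noteq> []" using ds(2) Suc.hyps(2) by auto
    have "pdvd ds (\<lambda>y. Q y [^] (length ds - 1))"
    proof (rule Suc.hyps(1))
      show "\<forall>y\<in>carrier R. peval R ds y = \<zero> \<longrightarrow> Q y = \<zero>"
      proof (intro ballI impI)
        fix y assume y: "y \<in> carrier R" "peval R ds y = \<zero>"
        have "peval R cs y = \<zero>" using csx[OF y(1)] y a(1) by simp
        then show "Q y = \<zero>" using Suc.prems(1) y(1) by blast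
      qed
    qed (use len ds Suc.prems(4) in simp_all)
    then obtain S where S: "polyfun S" "\<And>y. y \<in> carrier R ==> Q y [^] d = peval R ds y \<otimes> S y"
      unfolding pdvd_def len(1) by blast
    obtain qs where qs: "set qs \<subseteq> carrier R" "\<forall>y\<in>carrier R. Q y = peval R qs y"
      using assms(4) unfolding polyfun_def by blast
    have "\<exists>Q'. polyfun Q' \<and> (\<forall>y\<in>carrier R. Q y = (y \<ominus> a) \<otimes> Q' y)"
    proof (cases "qs = []")
      case True
      then show ?thesis using qs a(1) polyfun_const[of \<zero>] by (intro exI[of _ "\<lambda>y. \<zero>"]) auto
    next
      case False
      obtain es where es: "set es \<subseteq> carrier R" 
        "\<And>x. x \<in> carrier R ==> peval R qs x = (x \<ominus> a) \<otimes> peval R es x \<oplus> peval R qs a"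
        using peval_divide[OF False qs(1) a(1)] by blast
      have "peval R qs a = \<zero>" using bspec[OF Suc.prems(1) a(1)] a(2) bspec[OF qs(2) a(1)] by simp
      then have "Q y = (y \<ominus> a) \<otimes> peval R es y" if "y \<in> carrier R" for y
        using es(2)[OF that] bspec[OF qs(2) that] es(1) that a(1) by simp
      then show ?thesis using polyfun_peval[OF es(1)] by blast
    qed
    then obtain Q' where Q': "polyfun Q'" "\<And>y. y \<in> carrier R ==> Q y = (y \<ominus> a) \<otimes> Q' y" by blast
    have "Q y [^] (length cs - 1) = peval R cs y \<otimes> (S y \<otimes> Q' y)" if y: "y \<in> carrier R" for y
    proof -
      have cl: "peval R ds y \<in> carrier R" "S y \<in> carrier R" "Q' y \<in> carrier R" "y \<ominus> a \<in> carrier R"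
        using y a ds(1) polyfun_closed S(1) Q'(1) by auto
      have "Q y [^] Suc d = (peval R ds y \<otimes> S y) \<otimes> ((y \<ominus> a) \<otimes> Q' y)"
        using S(2)[OF y] Q'(2)[OF y] by simp
      also have "\<dots> = ((y \<ominus> a) \<otimes> peval R ds y) \<otimes> (S y \<otimes> Q' y)" using cl by (simp add: m_ac)
      finally show ?thesis using csx[OF y] Suc.hyps(2) by simp
    qed
    then show ?case unfolding pdvd_def using polyfun_mult[OF S(1) Q'(1)] by blast
  qed
next
  assume "pdvd cs (\<lambda>y. Q y [^] (length cs - 1))"
  then obtain S where S: "polyfun S" "\<And>y. y \<in> carrier R ==> Q y [^] (length cs - 1) = peval R cs y \<otimes> S y"
    unfolding pdvd_def by blast
  show "\<forall>y\<in>carrier R. peval R cs y = \<zero> \<longrightarrow> Q y = \<zero>"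
  proof (intro ballI impI)
    fix y assume y: "y \<in> carrier R" "peval R cs y = \<zero>"
    have pow: "z [^] (n :: nat) = \<zero> ==> z = \<zero>" if "z \<in> carrier R" for z n
      using that by (induction n) (auto simp: integral_iff)
    have "Q y [^] (length cs - 1) = \<zero>" using S y polyfun_closed[OF S(1)] by simp
    then show "Q y = \<zero>" using pow polyfun_closed[OF assms(4) y(1)] by blast
  qed
qed

text \<open>A root of \<open>cs\<close> is also a root of \<open>ds\<close>. Such common roots are
  cancelled one by one until \<open>cs\<close> is constant and nothing is left of
  \<open>ds\<close>.\<close>

lemma pdvd_small:
  assumes cs: "set cs \<subseteq> carrier R" "cs \<noteq> []" "last cs \<noteq> \<zero>"
    and ds: "set ds \<subseteq> carrier R" "length ds < length cs" "pdvd cs (peval R ds)"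
  shows "\<forall>c\<in>set ds. c = \<zero>"
proof (rule ccontr)
  assume ne: "\<not> ?thesis"
  obtain S where S: "polyfun S" "\<And>y. y \<in> carrier R ==> peval R ds y = peval R cs y \<otimes> S y"
    using ds(3) unfolding pdvd_def by blast
  obtain n where n: "length cs = Suc n" using cs(2) by (cases cs) auto
  show False
    using cs ds(1,2) ne S n
  proof (induction n arbitrary: cs ds S)
    case 0
    then show ?case by auto
  next
    case (Suc n)
    obtain a where a: "a \<in> carrier R" "peval R cs a = \<zero>" using root[of cs] Suc.prems by auto
    obtain cs' where cs': "set cs' \<subseteq> carrier R" "Suc (length cs') = length cs" "cs' \<noteq> [] \<longrightarrow> last cs' = last cs"
      "\<And>x. x \<in> carrier R ==> peval R cs x = (x \<ominus> a) \<otimes> peval R cs' x \<oplus> peval R cs a"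
      using peval_divide[OF Suc.prems(2,1) a(1)] by blast
    have "ds \<noteq> []" using Suc.prems(6) by auto
    obtain ds' where ds': "set ds' \<subseteq> carrier R" "Suc (length ds') = length ds" 
      "\<And>x. x \<in> carrier R ==> peval R ds x = (x \<ominus> a) \<otimes> peval R ds' x \<oplus> peval R ds a"
      using peval_divide[OF \<open>ds \<noteq> []\<close> Suc.prems(4) a(1)] by blast
    have dsa: "peval R ds a = \<zero>" using Suc.prems(8)[OF a(1)] a polyfun_closed[OF Suc.prems(7)] by simp
    have finz: "finite {y \<in> carrier R. peval R ds y = \<zero>}"
      using finite_roots[OF Suc.prems(4)] Suc.prems(6) by blast
    obtain y0 where y0: "y0 \<in> carrier R" "peval R ds y0 \<noteq> \<zero>"
      using finz infinite_carrier by (metis (mono_tags, lifting) mem_Collect_eq rev_finite_subset subsetI)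
    have "peval R ds' y0 \<noteq> \<zero>" using ds'(3)[OF y0(1)] dsa y0 a by auto
    then have ne': "\<not> (\<forall>c\<in>set ds'. c = \<zero>)" using peval_zero[of ds' y0] y0(1) by blast
    have eq: "peval R ds' y = peval R cs' y \<otimes> S y" if y: "y \<in> carrier R" "y \<noteq> a" for y
    proof -
      have cl: "peval R ds' y \<in> carrier R" "peval R cs' y \<in> carrier R" "S y \<in> carrier R" "y \<ominus> a \<in> carrier R"
        using y a ds'(1) cs'(1) polyfun_closed Suc.prems(7) by auto
      have "(y \<ominus> a) \<otimes> peval R ds' y = (y \<ominus> a) \<otimes> (peval R cs' y \<otimes> S y)"
        using Suc.prems(8)[OF y(1)] ds'(3)[OF y(1)] cs'(4)[OF y(1)] dsa a(2) cl by (simp add: m_assoc)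
      moreover have "y \<ominus> a \<noteq> \<zero>" using y a by (simp add: r_right_minus_eq)
      ultimately show ?thesis using cl by (simp add: m_lcancel)
    qed
    \<comment> \<open>After cancellation the identity is known for \<open>y \<noteq> a\<close>. The
      difference of its sides is a polynomial function with infinitely many zeros, so it vanishes at
      \<open>a\<close> as well.\<close>
    have eq': "peval R ds' y = peval R cs' y \<otimes> S y" if y: "y \<in> carrier R" for y
    proof -
      define F where "F y = peval R ds' y \<oplus> (\<ominus> \<one>) \<otimes> (peval R cs' y \<otimes> S y)" for y
      have pF: "polyfun F"
        unfolding F_def by (intro polyfun_add polyfun_cmult polyfun_mult polyfun_peval ds' cs' Suc.prems(7)) simp
      have Fz: "F z = \<zero>" if "z \<in> carrier R" "z \<noteq> a" for z
        using eq[OF that] cs'(1) that(1) polyfun_closed[OF Suc.prems(7)] by (simp add: F_def l_minus r_neg)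
      have "F y = \<zero>"
      proof (rule ccontr)
        assume "F y \<noteq> \<zero>"
        then have "finite {y \<in> carrier R. F y = \<zero>}" using polyfun_zero_or_finite[OF pF y] by blast
        moreover have "carrier R - {a} \<subseteq> {y \<in> carrier R. F y = \<zero>}" using Fz by auto
        ultimately show False using infinite_carrier by (meson finite_Diff2 finite.emptyI finite_insert finite_subset)
      qed
      then have "peval R ds' y \<ominus> peval R cs' y \<otimes> S y = \<zero>"
        using y cs'(1) polyfun_closed[OF Suc.prems(7)] by (simp add: F_def l_minus a_minus_def)
      then show ?thesis using y cs'(1) ds'(1) polyfun_closed[OF Suc.prems(7)] by (simp add: r_right_minus_eq)
    qed
    have "cs' \<noteq> []" using cs'(2) Suc.prems(9) by auto
    then show False
      using Suc.IH[OF cs'(1) _ _ ds'(1) _ ne' Suc.prems(7) eq'] cs' ds'(2) Suc.prems by auto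
  qed
qed

section \<open>Polynomial functions of assignments and constructible predicates\<close>

inductive_set pf :: "((nat \<Rightarrow> 'a) \<Rightarrow> 'a) set" where
  pf_var: "(\<lambda>e. e i) \<in> pf"
| pf_const: "c \<in> carrier R ==> (\<lambda>e. c) \<in> pf"
| pf_add: "f \<in> pf ==> g \<in> pf ==> (\<lambda>e. f e \<oplus> g e) \<in> pf"
| pf_mult: "f \<in> pf ==> g \<in> pf ==> (\<lambda>e. f e \<otimes> g e) \<in> pf"
| pf_neg: "f \<in> pf ==> (\<lambda>e. \<ominus> f e) \<in> pf"

lemma pf_closed: "f \<in> pf ==> range e \<subseteq> carrier R ==> f e \<in> carrier R"
  by (induction f rule: pf.induct) auto

text \<open>Constructible predicates, that is boolean combinations of polynomial equations, taken up
  to equivalence on assignments into the field.\<close>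

inductive con :: "((nat \<Rightarrow> 'a) \<Rightarrow> bool) \<Rightarrow> bool" where
  con_zero: "f \<in> pf ==> (\<And>e. range e \<subseteq> carrier R ==> P e \<longleftrightarrow> f e = \<zero>) ==> con P"
| con_not: "con Q ==> (\<And>e. range e \<subseteq> carrier R ==> P e \<longleftrightarrow> \<not> Q e) ==> con P"
| con_conj: "con Q ==> con Q' ==> (\<And>e. range e \<subseteq> carrier R ==> P e \<longleftrightarrow> Q e \<and> Q' e) ==> con P"

lemma con_cong: "con Q ==> (\<And>e. range e \<subseteq> carrier R ==> P e \<longleftrightarrow> Q e) ==> con P"
  by (rule con_conj[of Q Q]) auto

lemma con_and: "con Q ==> con Q' ==> con (\<lambda>e. Q e \<and> Q' e)"
  by (rule con_conj) simp_all

lemma con_neg: "con Q ==> con (\<lambda>e. \<not> Q e)"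
  by (rule con_not) simp_all

lemma con_disj: "con Q ==> con Q' ==> con (\<lambda>e. Q e \<or> Q' e)"
  using con_neg[OF con_and[OF con_neg con_neg, of Q Q']] by simp

lemma con_False: "con (\<lambda>e. False)"
  by (rule con_zero[OF pf_const[OF one_closed]]) simp

lemma con_ball: "(\<And>c. c \<in> set cs ==> con (Q c)) ==> con (\<lambda>e. \<forall>c\<in>set cs. Q c e)"
proof (induction cs)
  case Nil
  show ?case by (rule con_not[OF con_False]) simp
next
  case (Cons c cs)
  have "con (Q c)" "con (\<lambda>e. \<forall>c\<in>set cs. Q c e)" using Cons by (simp_all add: Cons.prems)
  from con_and[OF this] show ?case by simp
qed

lemma con_bex: "(\<And>c. c \<in> set cs ==> con (Q c)) ==> con (\<lambda>e. \<exists>c\<in>set cs. Q c e)"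
  using con_neg[OF con_ball[of cs "\<lambda>c e. \<not> Q c e"]] con_neg by simp

lemma con_pf: "f \<in> pf ==> con (\<lambda>e. f e = \<zero>)"
  by (rule con_zero) auto

text \<open>Polynomials in one variable whose coefficients are polynomial functions of the assignment.\<close>

definition ev_at :: "((nat \<Rightarrow> 'a) \<Rightarrow> 'a) list \<Rightarrow> (nat \<Rightarrow> 'a) \<Rightarrow> 'a list" where
  "ev_at p e = map (\<lambda>c. c e) p"

lemma ev_at_simps [simp]: "ev_at [] e = []" "ev_at (c # p) e = c e # ev_at p e" "length (ev_at p e) = length p"
  "ev_at (p @ q) e = ev_at p e @ ev_at q e"
  by (simp_all add: ev_at_def)

lemma ev_at_closed: "set p \<subseteq> pf ==> range e \<subseteq> carrier R ==> set (ev_at p e) \<subseteq> carrier R"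
  by (auto simp: ev_at_def intro: pf_closed)

lemma last_at: "p \<noteq> [] ==> last (ev_at p e) = last p e"
  by (simp add: ev_at_def last_map)

lemma butlast_at: 
  assumes "p \<noteq> []" "set p \<subseteq> pf" "range e \<subseteq> carrier R" "y \<in> carrier R" "last p e = \<zero>"
  shows "peval R (ev_at (butlast p) e) y = peval R (ev_at p e) y"
proof -
  have "set (butlast p) \<subseteq> pf" using assms(2) in_set_butlastD[of _ p] by blast
  then have "set (ev_at (butlast p) e) \<subseteq> carrier R" using assms(3) by (rule ev_at_closed)
  then have "peval R (ev_at (butlast p @ [last p]) e) y = peval R (ev_at (butlast p) e) y"
    using assms(4,5) peval_append[of "ev_at (butlast p) e" "[last p e]" y] by simp
  then show ?thesis using assms(1) by simp
qed

text \<open>One step of pseudo-division. The leading coefficient of \<open>p\<close> depends on the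
  assignment and may vanish, so \<open>r\<close> is multiplied by it instead of being
  divided.\<close>

lemma reduce:
  assumes p: "set p \<subseteq> pf" "p \<noteq> []" and r: "set r \<subseteq> pf" "length p \<le> length r"
  shows "\<exists>r'. set r' \<subseteq> pf \<and> length r' < length r \<and> (\<forall>e y. range e \<subseteq> carrier R \<longrightarrow> y \<in> carrier R \<longrightarrow>
    peval R (ev_at r' e) y = last p e \<otimes> peval R (ev_at r e) y \<ominus>
      last r e \<otimes> (y [^] (length r - length p) \<otimes> peval R (ev_at p e) y))"
proof -
  have "r \<noteq> []" using p(2) r(2) by auto
  define c l where "c = last p" and "l = last r"
  define p0 r0 where "p0 = butlast p" and "r0 = butlast r"
  have pr: "p = p0 @ [c]" "r = r0 @ [l]" using p(2) \<open>r \<noteq> []\<close> by (simp_all add: c_def l_def p0_def r0_def)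
  have cl: "c \<in> pf" "l \<in> pf" "set p0 \<subseteq> pf" "set r0 \<subseteq> pf" using p(1) r(1) by (auto simp: pr)
  define k where "k = length r0 - length p0"
  have len: "length r0 = k + length p0" using r(2) by (simp add: pr k_def)
  define sub where "sub xs ys = map2 (\<lambda>a b e. (c e \<otimes> a e) \<oplus> \<ominus> (l e \<otimes> b e)) xs ys" for xs ys :: "((nat \<Rightarrow> 'a) \<Rightarrow> 'a) list"
  define r' where "r' = sub r0 (replicate k (\<lambda>e. \<zero>) @ p0)"
  have sub_eval: "peval R (ev_at (sub xs ys) e) y = c e \<otimes> peval R (ev_at xs e) y \<ominus> l e \<otimes> peval R (ev_at ys e) y"
    if "length xs = length ys" "set xs \<subseteq> pf" "set ys \<subseteq> pf" "range e \<subseteq> carrier R" "y \<in> carrier R" for xs ys e y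
    using that
  proof (induction xs ys rule: list_induct2)
    case Nil
    then show ?case using cl pf_closed by (simp add: sub_def a_minus_def)
  next
    case (Cons a xs b ys)
    have cls: "c e \<in> carrier R" "l e \<in> carrier R" "a e \<in> carrier R" "b e \<in> carrier R"
      "peval R (ev_at xs e) y \<in> carrier R" "peval R (ev_at ys e) y \<in> carrier R"
      using cl Cons.prems pf_closed ev_at_closed by auto
    have ring_eq: "c \<otimes> a \<oplus> \<ominus> (l \<otimes> b) \<oplus> y \<otimes> (c \<otimes> p \<ominus> l \<otimes> q) = c \<otimes> (a \<oplus> y \<otimes> p) \<ominus> l \<otimes> (b \<oplus> y \<otimes> q)"
      if "c \<in> carrier R" "l \<in> carrier R" "a \<in> carrier R" "b \<in> carrier R" "p \<in> carrier R" "q \<in> carrier R"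
        "y \<in> carrier R" for c l a b p q y
      using that by (simp add: ring_expand)
    have "c e \<otimes> a e \<oplus> \<ominus> (l e \<otimes> b e) \<oplus> y \<otimes> (c e \<otimes> peval R (ev_at xs e) y \<ominus> l e \<otimes> peval R (ev_at ys e) y) =
      c e \<otimes> (a e \<oplus> y \<otimes> peval R (ev_at xs e) y) \<ominus> l e \<otimes> (b e \<oplus> y \<otimes> peval R (ev_at ys e) y)"
      using cls Cons.prems(4) by (intro ring_eq)
    then show ?case using Cons by (simp add: sub_def)
  qed
  have zp: "set (replicate k (\<lambda>e. \<zero>) @ p0) \<subseteq> pf" using pf_const[OF zero_closed] cl(3) by auto
  have "set r' \<subseteq> pf"
  proof
    fix f assume "f \<in> set r'"
    then obtain a b where ab: "(a, b) \<in> set (zip r0 (replicate k (\<lambda>e. \<zero>) @ p0))"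
      "f = (\<lambda>e. (c e \<otimes> a e) \<oplus> \<ominus> (l e \<otimes> b e))"
      unfolding r'_def sub_def by auto
    have "a \<in> pf" "b \<in> pf" using set_zip_leftD[OF ab(1)] set_zip_rightD[OF ab(1)] cl(4) zp by blast+
    then show "f \<in> pf" unfolding ab(2) using pf_add[OF pf_mult[OF cl(1)] pf_neg[OF pf_mult[OF cl(2)]]] by blast
  qed
  moreover have "length r' < length r" using len by (simp add: r'_def sub_def pr)
  moreover have "peval R (ev_at r' e) y = last p e \<otimes> peval R (ev_at r e) y \<ominus>
      last r e \<otimes> (y [^] (length r - length p) \<otimes> peval R (ev_at p e) y)"
    if e: "range e \<subseteq> carrier R" and y: "y \<in> carrier R" for e y
  proof -
    define P Q where "P = peval R (ev_at p0 e) y" and "Q = peval R (ev_at r0 e) y"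
    have cls: "c e \<in> carrier R" "l e \<in> carrier R" "P \<in> carrier R" "Q \<in> carrier R" "set (ev_at p0 e) \<subseteq> carrier R"
      "set (ev_at r0 e) \<subseteq> carrier R"
      using cl pf_closed ev_at_closed e y by (auto simp: P_def Q_def)
    have z: "ev_at (replicate k (\<lambda>e. \<zero>)) e = replicate k \<zero>" by (simp add: ev_at_def)
    have zz: "peval R (replicate k \<zero>) y = \<zero>" using y by (intro peval_zero) auto
    have zero_p0: "peval R (ev_at (replicate k (\<lambda>e. \<zero>) @ p0) e) y = y [^] k \<otimes> P"
      unfolding ev_at_simps(4) z using cls y
      by (subst peval_append) (auto simp: zz P_def)
    have 1: "peval R (ev_at r' e) y = c e \<otimes> Q \<ominus> l e \<otimes> (y [^] k \<otimes> P)"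
      unfolding r'_def zero_p0[symmetric] Q_def using len cl e y zp by (intro sub_eval) auto
    have 2: "peval R (ev_at r e) y = Q \<oplus> y [^] (k + length p0) \<otimes> l e"
      unfolding pr ev_at_simps(4) using cls y len by (subst peval_append) (auto simp: Q_def)
    have 3: "peval R (ev_at p e) y = P \<oplus> y [^] length p0 \<otimes> c e"
      unfolding pr ev_at_simps(4) using cls y by (subst peval_append) (auto simp: P_def)
    define z1 z2 where "z1 = y [^] k" and "z2 = y [^] length p0"
    have z12: "z1 \<in> carrier R" "z2 \<in> carrier R" "y [^] (k + length p0) = z1 \<otimes> z2"
      using y by (auto simp: z1_def z2_def nat_pow_mult)
    have ring_eq: "c \<otimes> Q \<ominus> l \<otimes> (z1 \<otimes> P) = c \<otimes> (Q \<oplus> z1 \<otimes> z2 \<otimes> l) \<ominus> l \<otimes> (z1 \<otimes> (P \<oplus> z2 \<otimes> c))"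
      if "c \<in> carrier R" "l \<in> carrier R" "P \<in> carrier R" "Q \<in> carrier R" "z1 \<in> carrier R" "z2 \<in> carrier R"
      for c l P Q z1 z2
    proof -
      define w where "w = l \<otimes> (z1 \<otimes> (z2 \<otimes> c))"
      have "c \<otimes> (Q \<oplus> z1 \<otimes> z2 \<otimes> l) = c \<otimes> Q \<oplus> w" "l \<otimes> (z1 \<otimes> (P \<oplus> z2 \<otimes> c)) = l \<otimes> (z1 \<otimes> P) \<oplus> w"
        using that by (simp_all add: w_def ring_expand)
      then show ?thesis using diff_cancel[of "c \<otimes> Q" "l \<otimes> (z1 \<otimes> P)" w] that by (simp add: w_def)
    qed
    have "c e \<otimes> Q \<ominus> l e \<otimes> (z1 \<otimes> P) =
        c e \<otimes> (Q \<oplus> z1 \<otimes> z2 \<otimes> l e) \<ominus> l e \<otimes> (z1 \<otimes> (P \<oplus> z2 \<otimes> c e))"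
      using cls(1-4) z12(1,2) by (intro ring_eq)
    moreover have "length r - length p = k" using len by (simp add: pr)
    ultimately show ?thesis
      unfolding 1 2 3 z12(3) c_def[symmetric] l_def[symmetric] by (simp add: z1_def z2_def)
  qed
  ultimately show ?thesis by blast
qed

text \<open>Where the leading coefficient of \<open>p\<close> is nonzero, a pseudo-division step
  does not affect divisibility by \<open>p\<close>. It shortens \<open>r\<close> until divisibility
  means that every coefficient of \<open>r\<close> vanishes.\<close>

lemma con_pdvd:
  assumes p: "set p \<subseteq> pf" "p \<noteq> []" and r: "set r \<subseteq> pf"
  shows "con (\<lambda>e. last p e \<noteq> \<zero> \<and> pdvd (ev_at p e) (peval R (ev_at r e)))"
  using r
proof (induction "length r" arbitrary: r rule: less_induct)
  case less
  have last_pf: "last p \<in> pf" using p by auto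
  have con_last: "con (\<lambda>e. last p e \<noteq> \<zero>)" by (rule con_not[OF con_pf[OF last_pf]]) simp
  show ?case
  proof (cases "length r < length p")
    case True
    have "con (\<lambda>e. \<forall>c\<in>set r. c e = \<zero>)"
      using less.prems by (intro con_ball[of r "\<lambda>c e. c e = \<zero>"] con_pf) auto
    then show ?thesis
    proof (rule con_conj[OF con_last])
      fix e :: "nat \<Rightarrow> 'a" assume e: "range e \<subseteq> carrier R"
      have "pdvd (ev_at p e) (peval R (ev_at r e)) \<longleftrightarrow> (\<forall>c\<in>set r. c e = \<zero>)" if "last p e \<noteq> \<zero>"
      proof
        assume "pdvd (ev_at p e) (peval R (ev_at r e))"
        moreover have "last (ev_at p e) \<noteq> \<zero>" "ev_at p e \<noteq> []" using that p(2) by (simp_all add: last_at) (simp add: ev_at_def)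
        moreover have "length (ev_at r e) < length (ev_at p e)" using True by simp
        ultimately have "\<forall>c\<in>set (ev_at r e). c = \<zero>"
          using pdvd_small[OF ev_at_closed[OF p(1) e] _ _ ev_at_closed[OF less.prems e]] by blast
        then show "\<forall>c\<in>set r. c e = \<zero>" by (simp add: ev_at_def)
      next
        assume "\<forall>c\<in>set r. c e = \<zero>"
        then have "peval R (ev_at r e) y = \<zero>" if "y \<in> carrier R" for y
          using that by (intro peval_zero) (auto simp: ev_at_def)
        then show "pdvd (ev_at p e) (peval R (ev_at r e))"
          unfolding pdvd_def using polyfun_const[of \<zero>] ev_at_closed[OF p(1) e] by (intro exI[of _ "\<lambda>y. \<zero>"]) auto
      qed
      then show "last p e \<noteq> \<zero> \<and> pdvd (ev_at p e) (peval R (ev_at r e)) \<longleftrightarrow> last p e \<noteq> \<zero> \<and> (\<forall>c\<in>set r. c e = \<zero>)" by blast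
    qed
  next
    case False
    obtain r' where r': "set r' \<subseteq> pf" "length r' < length r" "\<And>e y. range e \<subseteq> carrier R ==> y \<in> carrier R ==>
      peval R (ev_at r' e) y = last p e \<otimes> peval R (ev_at r e) y \<ominus>
        last r e \<otimes> (y [^] (length r - length p) \<otimes> peval R (ev_at p e) y)"
      using reduce[OF p less.prems] False by (metis not_less)
    show ?thesis
    proof (rule con_cong[OF less.hyps[OF r'(2,1)]])
      fix e :: "nat \<Rightarrow> 'a" assume e: "range e \<subseteq> carrier R"
      have "r \<noteq> []" using False p(2) by auto
      have ring1: "c \<otimes> (P \<otimes> s) \<ominus> l \<otimes> (z \<otimes> P) = P \<otimes> (c \<otimes> s \<oplus> (\<ominus> l) \<otimes> z)"
        if "c \<in> carrier R" "l \<in> carrier R" "P \<in> carrier R" "s \<in> carrier R" "z \<in> carrier R" for c l P s z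
        using that by (simp add: ring_expand)
      have ring2: "P \<otimes> (i \<otimes> (s \<oplus> l \<otimes> z)) = i \<otimes> (P \<otimes> s \<oplus> l \<otimes> (z \<otimes> P))"
        if "i \<in> carrier R" "l \<in> carrier R" "P \<in> carrier R" "s \<in> carrier R" "z \<in> carrier R" for i l P s z
        using that by (simp add: ring_expand)
      have ring3: "c \<otimes> Q \<ominus> l \<otimes> (z \<otimes> P) \<oplus> l \<otimes> (z \<otimes> P) = c \<otimes> Q"
        if "c \<in> carrier R" "l \<in> carrier R" "P \<in> carrier R" "Q \<in> carrier R" "z \<in> carrier R" for c l P Q z
        using that by (intro add_diff_cancel) simp_all
      have "last r \<in> pf" using less.prems last_in_set[OF \<open>r \<noteq> []\<close>] by blast
      then have cls: "last p e \<in> carrier R" "last r e \<in> carrier R"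
        using pf_closed[OF last_pf e] pf_closed[OF _ e, of "last r"] by simp_all
      have "pdvd (ev_at p e) (peval R (ev_at r e)) \<longleftrightarrow> pdvd (ev_at p e) (peval R (ev_at r' e))" if ne: "last p e \<noteq> \<zero>"
      proof
        let ?k = "length r - length p"
        assume "pdvd (ev_at p e) (peval R (ev_at r e))"
        then obtain S where S: "polyfun S" "\<And>y. y \<in> carrier R ==> peval R (ev_at r e) y = peval R (ev_at p e) y \<otimes> S y"
          unfolding pdvd_def by blast
        have "polyfun (\<lambda>y. last p e \<otimes> S y \<oplus> (\<ominus> last r e) \<otimes> y [^] ?k)"
          using cls by (intro polyfun_add polyfun_cmult polyfun_pow polyfun_var S(1)) auto
        moreover have "peval R (ev_at r' e) y = peval R (ev_at p e) y \<otimes> (last p e \<otimes> S y \<oplus> (\<ominus> last r e) \<otimes> y [^] ?k)"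
          if y: "y \<in> carrier R" for y
        proof -
          define P s z where "P = peval R (ev_at p e) y" and "s = S y" and "z = y [^] ?k"
          have "P \<in> carrier R" "s \<in> carrier R" "z \<in> carrier R"
            using y ev_at_closed[OF p(1) e] polyfun_closed[OF S(1) y] by (auto simp: P_def s_def z_def)
          then have "last p e \<otimes> (P \<otimes> s) \<ominus> last r e \<otimes> (z \<otimes> P) = P \<otimes> (last p e \<otimes> s \<oplus> (\<ominus> last r e) \<otimes> z)"
            using cls by (intro ring1) auto
          then show ?thesis using r'(3)[OF e y] S(2)[OF y] by (simp add: P_def s_def z_def)
        qed
        ultimately show "pdvd (ev_at p e) (peval R (ev_at r' e))" unfolding pdvd_def by blast
      next
        let ?k = "length r - length p"
        assume "pdvd (ev_at p e) (peval R (ev_at r' e))"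
        then obtain S where S: "polyfun S" "\<And>y. y \<in> carrier R ==> peval R (ev_at r' e) y = peval R (ev_at p e) y \<otimes> S y"
          unfolding pdvd_def by blast
        define i where "i = inv (last p e)"
        have "last p e \<in> Units R" using cls(1) ne by (simp add: field_Units)
        then have i: "i \<in> carrier R" "i \<otimes> last p e = \<one>" by (simp_all add: i_def)
        have "polyfun (\<lambda>y. i \<otimes> (S y \<oplus> last r e \<otimes> y [^] ?k))"
          using cls i by (intro polyfun_add polyfun_cmult polyfun_pow polyfun_var S(1)) auto
        moreover have "peval R (ev_at r e) y = peval R (ev_at p e) y \<otimes> (i \<otimes> (S y \<oplus> last r e \<otimes> y [^] ?k))"
          if y: "y \<in> carrier R" for y
        proof -
          define P s z Q where "P = peval R (ev_at p e) y" and "s = S y" and "z = y [^] ?k" and "Q = peval R (ev_at r e) y"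
          have cl: "P \<in> carrier R" "s \<in> carrier R" "z \<in> carrier R" "Q \<in> carrier R"
            using y ev_at_closed[OF p(1) e] ev_at_closed[OF less.prems e] polyfun_closed[OF S(1) y]
            by (auto simp: P_def s_def z_def Q_def)
          have "P \<otimes> s = last p e \<otimes> Q \<ominus> last r e \<otimes> (z \<otimes> P)"
            using r'(3)[OF e y] S(2)[OF y] by (simp add: P_def s_def z_def Q_def)
          moreover have "P \<otimes> (i \<otimes> (s \<oplus> last r e \<otimes> z)) = i \<otimes> (P \<otimes> s \<oplus> last r e \<otimes> (z \<otimes> P))"
            using cls cl i(1) by (intro ring2) auto
          moreover have "last p e \<otimes> Q \<ominus> last r e \<otimes> (z \<otimes> P) \<oplus> last r e \<otimes> (z \<otimes> P) = last p e \<otimes> Q"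
            using cls cl by (intro ring3) auto
          moreover have "i \<otimes> (last p e \<otimes> Q) = Q" using i cl cls by (simp add: m_assoc[symmetric])
          ultimately show ?thesis by (simp add: P_def s_def z_def Q_def)
        qed
        ultimately show "pdvd (ev_at p e) (peval R (ev_at r e))" unfolding pdvd_def by blast
      qed
      then show "last p e \<noteq> \<zero> \<and> pdvd (ev_at p e) (peval R (ev_at r e)) \<longleftrightarrow>
        last p e \<noteq> \<zero> \<and> pdvd (ev_at p e) (peval R (ev_at r' e))" by blast
    qed
  qed
qed

end


section \<open>Elimination of an existential quantifier\<close>

context root_closed_field
begin

lemma ev_at_cl [simp]: "set p \<subseteq> pf ==> range e \<subseteq> carrier R ==> y \<in> carrier R ==> peval R (ev_at p e) y \<in> carrier R"
  by (intro peval_closed ev_at_closed)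

lemma ev_at_add:
  assumes "set p \<subseteq> pf" "set q \<subseteq> pf"
  shows "\<exists>r. set r \<subseteq> pf \<and> (\<forall>e y. range e \<subseteq> carrier R \<longrightarrow> y \<in> carrier R \<longrightarrow>
    peval R (ev_at r e) y = peval R (ev_at p e) y \<oplus> peval R (ev_at q e) y)"
  using assms
proof (induction p arbitrary: q)
  case Nil
  then show ?case by (intro exI[of _ q]) simp
next
  case (Cons c p)
  show ?case
  proof (cases q)
    case Nil
    then show ?thesis using Cons.prems pf_closed by (intro exI[of _ "c # p"]) auto
  next
    case q: (Cons d q')
    then obtain r where r: "set r \<subseteq> pf" "\<And>e y. range e \<subseteq> carrier R ==> y \<in> carrier R ==>
      peval R (ev_at r e) y = peval R (ev_at p e) y \<oplus> peval R (ev_at q' e) y"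
      using Cons.IH[of q'] Cons.prems by auto
    have ring_eq: "c \<oplus> d \<oplus> y \<otimes> (a \<oplus> b) = c \<oplus> y \<otimes> a \<oplus> (d \<oplus> y \<otimes> b)"
      if "a \<in> carrier R" "b \<in> carrier R" "c \<in> carrier R" "d \<in> carrier R" "y \<in> carrier R" for a b c d y
      using that by (simp add: ring_expand)
    have "peval R (ev_at ((\<lambda>e. c e \<oplus> d e) # r) e) y = peval R (ev_at (c # p) e) y \<oplus> peval R (ev_at q e) y"
      if e: "range e \<subseteq> carrier R" and y: "y \<in> carrier R" for e y
    proof -
      define a b where "a = peval R (ev_at p e) y" and "b = peval R (ev_at q' e) y"
      have "a \<in> carrier R" "b \<in> carrier R" "c e \<in> carrier R" "d e \<in> carrier R"
        using Cons.prems q e y pf_closed by (auto simp: a_def b_def)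
      then have "c e \<oplus> d e \<oplus> y \<otimes> (a \<oplus> b) = c e \<oplus> y \<otimes> a \<oplus> (d e \<oplus> y \<otimes> b)"
        using y by (intro ring_eq)
      then show ?thesis using r(2)[OF e y] q by (simp add: a_def b_def)
    qed
    then show ?thesis using r(1) Cons.prems q
      by (intro exI[of _ "(\<lambda>e. c e \<oplus> d e) # r"]) (auto intro: pf_add)
  qed
qed

lemma ev_at_scale:
  assumes "set p \<subseteq> pf" "c \<in> pf"
  shows "\<exists>r. set r \<subseteq> pf \<and> (\<forall>e y. range e \<subseteq> carrier R \<longrightarrow> y \<in> carrier R \<longrightarrow>
    peval R (ev_at r e) y = c e \<otimes> peval R (ev_at p e) y)"
proof (intro exI conjI allI impI)
  show "set (map (\<lambda>d e. c e \<otimes> d e) p) \<subseteq> pf" using assms by (auto intro: pf_mult)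
  fix e :: "nat \<Rightarrow> 'a" and y assume e: "range e \<subseteq> carrier R" and y: "y \<in> carrier R"
  show "peval R (ev_at (map (\<lambda>d e. c e \<otimes> d e) p) e) y = c e \<otimes> peval R (ev_at p e) y"
    using assms(1)
  proof (induction p)
    case (Cons d p)
    then have "d e \<in> carrier R" "c e \<in> carrier R" "peval R (ev_at p e) y \<in> carrier R"
      using pf_closed assms(2) e y by auto
    then show ?case using Cons y by (simp add: r_distr m_lcomm)
  qed (use pf_closed[OF assms(2) e] in simp)
qed

lemma ev_at_mult:
  assumes "set p \<subseteq> pf" "set q \<subseteq> pf"
  shows "\<exists>r. set r \<subseteq> pf \<and> (\<forall>e y. range e \<subseteq> carrier R \<longrightarrow> y \<in> carrier R \<longrightarrow>
    peval R (ev_at r e) y = peval R (ev_at p e) y \<otimes> peval R (ev_at q e) y)"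
  using assms(1)
proof (induction p)
  case Nil
  show ?case using assms(2) by (intro exI[of _ "[]"]) simp
next
  case (Cons c p)
  then obtain r where r: "set r \<subseteq> pf" "\<And>e y. range e \<subseteq> carrier R ==> y \<in> carrier R ==>
      peval R (ev_at r e) y = peval R (ev_at p e) y \<otimes> peval R (ev_at q e) y" by auto
  obtain s where s: "set s \<subseteq> pf" "\<And>e y. range e \<subseteq> carrier R ==> y \<in> carrier R ==>
      peval R (ev_at s e) y = c e \<otimes> peval R (ev_at q e) y" using ev_at_scale[OF assms(2), of c] Cons.prems by auto
  have z: "set ((\<lambda>e. \<zero>) # r) \<subseteq> pf" using r(1) by (auto intro: pf_const)
  obtain t where t: "set t \<subseteq> pf" "\<And>e y. range e \<subseteq> carrier R ==> y \<in> carrier R ==>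
      peval R (ev_at t e) y = peval R (ev_at s e) y \<oplus> peval R (ev_at ((\<lambda>e. \<zero>) # r) e) y"
    using ev_at_add[OF s(1) z] by blast
  have "peval R (ev_at t e) y = peval R (ev_at (c # p) e) y \<otimes> peval R (ev_at q e) y"
    if e: "range e \<subseteq> carrier R" and y: "y \<in> carrier R" for e y
  proof -
    have "c e \<in> carrier R" "peval R (ev_at p e) y \<in> carrier R" "peval R (ev_at q e) y \<in> carrier R"
      using Cons.prems assms(2) e y pf_closed by auto
    then show ?thesis using t(2)[OF e y] s(2)[OF e y] r(2)[OF e y] y by (simp add: l_distr m_assoc)
  qed
  then show ?case using t(1) by blast
qed

lemma ev_at_pow:
  assumes "set q \<subseteq> pf"
  shows "\<exists>r. set r \<subseteq> pf \<and> (\<forall>e y. range e \<subseteq> carrier R \<longrightarrow> y \<in> carrier R \<longrightarrow>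
    peval R (ev_at r e) y = peval R (ev_at q e) y [^] (n :: nat))"
proof (induction n)
  case 0
  show ?case by (intro exI[of _ "[\<lambda>e. \<one>]"]) (auto intro: pf_const)
next
  case (Suc n)
  then obtain r where r: "set r \<subseteq> pf" "\<And>e y. range e \<subseteq> carrier R ==> y \<in> carrier R ==>
    peval R (ev_at r e) y = peval R (ev_at q e) y [^] n" by blast
  show ?case using ev_at_mult[OF r(1) assms] r(2) by (metis nat_pow_Suc)
qed

lemma pf_horner:
  assumes "f \<in> pf"
  shows "\<exists>p. set p \<subseteq> pf \<and> (\<forall>e y. range e \<subseteq> carrier R \<longrightarrow> y \<in> carrier R \<longrightarrow>
    f (e(i := y)) = peval R (ev_at p e) y)"
  using assms
proof induction
  case (pf_var j)
  show ?case
  proof (cases "j = i")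
    case True
    then show ?thesis by (intro exI[of _ "[\<lambda>e. \<zero>, \<lambda>e. \<one>]"]) (auto intro: pf_const)
  next
    case False
    then show ?thesis by (intro exI[of _ "[\<lambda>e. e j]"]) (auto simp: image_subset_iff intro: pf.pf_var)
  qed
next
  case (pf_const c)
  then show ?case by (intro exI[of _ "[\<lambda>e. c]"]) (auto intro: pf.pf_const)
next
  case (pf_add f g)
  then obtain p q where pq: "set p \<subseteq> pf" "set q \<subseteq> pf"
    "\<And>e y. range e \<subseteq> carrier R ==> y \<in> carrier R ==> f (e(i := y)) = peval R (ev_at p e) y"
    "\<And>e y. range e \<subseteq> carrier R ==> y \<in> carrier R ==> g (e(i := y)) = peval R (ev_at q e) y" by blast
  obtain r where r: "set r \<subseteq> pf" "\<And>e y. range e \<subseteq> carrier R ==> y \<in> carrier R ==>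
    peval R (ev_at r e) y = peval R (ev_at p e) y \<oplus> peval R (ev_at q e) y"
    using ev_at_add[OF pq(1,2)] by blast
  have "f (e(i := y)) \<oplus> g (e(i := y)) = peval R (ev_at r e) y"
    if "range e \<subseteq> carrier R" "y \<in> carrier R" for e y
    unfolding pq(3)[OF that] pq(4)[OF that] r(2)[OF that] by (rule refl)
  then show ?case using r(1) by blast
next
  case (pf_mult f g)
  then obtain p q where pq: "set p \<subseteq> pf" "set q \<subseteq> pf"
    "\<And>e y. range e \<subseteq> carrier R ==> y \<in> carrier R ==> f (e(i := y)) = peval R (ev_at p e) y"
    "\<And>e y. range e \<subseteq> carrier R ==> y \<in> carrier R ==> g (e(i := y)) = peval R (ev_at q e) y" by blast
  obtain r where r: "set r \<subseteq> pf" "\<And>e y. range e \<subseteq> carrier R ==> y \<in> carrier R ==>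
    peval R (ev_at r e) y = peval R (ev_at p e) y \<otimes> peval R (ev_at q e) y"
    using ev_at_mult[OF pq(1,2)] by blast
  have "f (e(i := y)) \<otimes> g (e(i := y)) = peval R (ev_at r e) y"
    if "range e \<subseteq> carrier R" "y \<in> carrier R" for e y
    unfolding pq(3)[OF that] pq(4)[OF that] r(2)[OF that] by (rule refl)
  then show ?case using r(1) by blast
next
  case (pf_neg f)
  then obtain p where p: "set p \<subseteq> pf"
    "\<And>e y. range e \<subseteq> carrier R ==> y \<in> carrier R ==> f (e(i := y)) = peval R (ev_at p e) y" by blast
  have "(\<lambda>e. \<ominus> \<one>) \<in> pf" by (rule pf.pf_const) simp
  then obtain r where r: "set r \<subseteq> pf" "\<And>e y. range e \<subseteq> carrier R ==> y \<in> carrier R ==>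
    peval R (ev_at r e) y = \<ominus> \<one> \<otimes> peval R (ev_at p e) y" using ev_at_scale[OF p(1)] by blast
  have "\<ominus> f (e(i := y)) = peval R (ev_at r e) y" if "range e \<subseteq> carrier R" "y \<in> carrier R" for e y
    using p(2)[OF that] r(2)[OF that] ev_at_cl[OF p(1) that] by (simp add: l_minus)
  then show ?case using r(1) by blast
qed

abbreviation solvable :: "((nat \<Rightarrow> 'a) \<Rightarrow> 'a) list list \<Rightarrow> ((nat \<Rightarrow> 'a) \<Rightarrow> 'a) list \<Rightarrow> (nat \<Rightarrow> 'a) \<Rightarrow> bool" where
  "solvable ps q e \<equiv> \<exists>y\<in>carrier R. (\<forall>p\<in>set ps. peval R (ev_at p e) y = \<zero>) \<and> peval R (ev_at q e) y \<noteq> \<zero>"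

lemma con_solvable:
  assumes "\<And>p. p \<in> set ps ==> set p \<subseteq> pf" "set q \<subseteq> pf"
  shows "con (solvable ps q)"
  using assms(1)
proof (induction "sum_list (map (\<lambda>p. Suc (length p)) ps)" arbitrary: ps rule: less_induct)
  case less
  \<comment> \<open>The empty list is the zero polynomial and imposes no condition.\<close>
  have drop: "con (solvable ps q)" if "set ps = insert [] (set ps')"
    "sum_list (map (\<lambda>p. Suc (length p)) ps') < sum_list (map (\<lambda>p. Suc (length p)) ps)" for ps'
    by (rule con_cong[OF less.hyps[OF that(2)]]) (use that(1) less.prems in auto)
  have pair: "con (solvable (a # b # rest) q)"
    if ab: "sum_list (map (\<lambda>p. Suc (length p)) (a # b # rest)) = sum_list (map (\<lambda>p. Suc (length p)) ps)"
      "a \<noteq> []" "length a \<le> length b" "set a \<subseteq> pf" "set b \<subseteq> pf" "\<And>p. p \<in> set rest ==> set p \<subseteq> pf" for a b rest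
  proof -
    obtain r where r: "set r \<subseteq> pf" "length r < length b" "\<And>e y. range e \<subseteq> carrier R ==> y \<in> carrier R ==>
      peval R (ev_at r e) y = last a e \<otimes> peval R (ev_at b e) y \<ominus>
        last b e \<otimes> (y [^] (length b - length a) \<otimes> peval R (ev_at a e) y)"
      using reduce[OF ab(4,2,5,3)] by blast
    have la: "last a \<in> pf" "last b \<in> pf" using ab(2,3,4,5) by (cases b; auto simp: subset_iff)+
    have 1: "con (solvable (butlast a # b # rest) q)"
      using ab in_set_butlastD[of _ a] by (intro less.hyps) (auto simp: ab(1)[symmetric])
    have 2: "con (solvable (a # r # rest) q)"
      using ab r by (intro less.hyps) (auto simp: ab(1)[symmetric])
    have 3: "con (\<lambda>e. last a e \<noteq> \<zero>)" by (rule con_not[OF con_pf[OF la(1)]]) simp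
    show ?thesis
    proof (rule con_cong[OF con_disj[OF con_and[OF con_pf[OF la(1)] 1] con_and[OF 3 2]]])
      fix e :: "nat \<Rightarrow> 'a" assume e: "range e \<subseteq> carrier R"
      have "peval R (ev_at b e) y = \<zero> \<longleftrightarrow> peval R (ev_at r e) y = \<zero>"
        if "last a e \<noteq> \<zero>" "y \<in> carrier R" "peval R (ev_at a e) y = \<zero>" for y
        using r(3)[OF e that(2)] that ev_at_cl[OF \<open>set b \<subseteq> pf\<close> e that(2)] pf_closed[OF la(1) e] pf_closed[OF la(2) e]
        by (simp add: integral_iff a_minus_def)
      moreover have "peval R (ev_at (butlast a) e) y = peval R (ev_at a e) y" if "last a e = \<zero>" "y \<in> carrier R" for y
        using butlast_at[OF \<open>a \<noteq> []\<close> \<open>set a \<subseteq> pf\<close> e that(2,1)] .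
      ultimately show "solvable (a # b # rest) q e \<longleftrightarrow>
        (last a e = \<zero> \<and> solvable (butlast a # b # rest) q e) \<or> (last a e \<noteq> \<zero> \<and> solvable (a # r # rest) q e)"
        by (cases "last a e = \<zero>") auto
    qed
  qed
  show ?case
  proof (cases ps)
    case Nil
    have "con (\<lambda>e. \<exists>c\<in>set q. c e \<noteq> \<zero>)"
    proof (rule con_bex)
      fix c assume "c \<in> set q"
      then have "c \<in> pf" using assms(2) by blast
      from con_neg[OF con_pf[OF this]] show "con (\<lambda>e. c e \<noteq> \<zero>)" .
    qed
    then show ?thesis
    proof (rule con_cong)
      fix e :: "nat \<Rightarrow> 'a" assume e: "range e \<subseteq> carrier R"
      show "solvable ps q e \<longleftrightarrow> (\<exists>c\<in>set q. c e \<noteq> \<zero>)"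
      proof
        assume "solvable ps q e"
        then obtain y where "y \<in> carrier R" "peval R (ev_at q e) y \<noteq> \<zero>" by blast
        then have "\<exists>c\<in>set (ev_at q e). c \<noteq> \<zero>" using peval_zero[of "ev_at q e" y] by blast
        then show "\<exists>c\<in>set q. c e \<noteq> \<zero>" by (auto simp: ev_at_def)
      next
        assume "\<exists>c\<in>set q. c e \<noteq> \<zero>"
        then obtain c where "c \<in> set (ev_at q e)" "c \<noteq> \<zero>" by (auto simp: ev_at_def)
        then have fin: "finite {y \<in> carrier R. peval R (ev_at q e) y = \<zero>}"
          using finite_roots[OF ev_at_closed[OF assms(2) e]] by blast
        have "\<not> carrier R \<subseteq> {y \<in> carrier R. peval R (ev_at q e) y = \<zero>}"
        proof
          assume "carrier R \<subseteq> {y \<in> carrier R. peval R (ev_at q e) y = \<zero>}"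
          with fin have "finite (carrier R)" by (rule rev_finite_subset)
          then show False using infinite_carrier by simp
        qed
        then show "solvable ps q e" using Nil by auto
      qed
    qed
  next
    case ps: (Cons p ps')
    show ?thesis
    proof (cases ps')
      case Nil
      show ?thesis
      proof (cases "p = []")
        case True
        then show ?thesis using ps Nil by (intro drop[of "[]"]) auto
      next
        case False
        have p: "set p \<subseteq> pf" using less.prems ps by auto
        have lp: "last p \<in> pf" using False p by auto
        obtain r where r: "set r \<subseteq> pf" "\<And>e y. range e \<subseteq> carrier R ==> y \<in> carrier R ==>
          peval R (ev_at r e) y = peval R (ev_at q e) y [^] (length p - 1)"
          using ev_at_pow[OF assms(2)] by blast
        have 1: "con (solvable [butlast p] q)"
          using False p in_set_butlastD[of _ p] by (intro less.hyps) (auto simp: ps Nil)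
        have 2: "con (\<lambda>e. last p e \<noteq> \<zero> \<and> pdvd (ev_at p e) (peval R (ev_at r e)))"
          by (rule con_pdvd[OF p False r(1)])
        have 3: "con (\<lambda>e. last p e \<noteq> \<zero>)" by (rule con_not[OF con_pf[OF lp]]) simp
        have 4: "con (\<lambda>e. \<not> (last p e \<noteq> \<zero> \<and> pdvd (ev_at p e) (peval R (ev_at r e))))" by (rule con_not[OF 2]) simp
        show ?thesis
        proof (rule con_cong[OF con_disj[OF con_and[OF con_pf[OF lp] 1] con_and[OF 3 4]]])
          fix e :: "nat \<Rightarrow> 'a" assume e: "range e \<subseteq> carrier R"
          have "solvable [p] q e \<longleftrightarrow> \<not> pdvd (ev_at p e) (peval R (ev_at r e))" if ne: "last p e \<noteq> \<zero>"
          proof -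
            have ne': "ev_at p e \<noteq> []" using False by (simp add: ev_at_def)
            have "(\<forall>y\<in>carrier R. peval R (ev_at p e) y = \<zero> \<longrightarrow> peval R (ev_at q e) y = \<zero>) \<longleftrightarrow>
                pdvd (ev_at p e) (\<lambda>y. peval R (ev_at q e) y [^] (length (ev_at p e) - 1))"
              using ne ne' by (intro roots_subset_iff ev_at_closed[OF p e] polyfun_peval ev_at_closed[OF assms(2) e])
                (simp_all add: last_at[OF False])
            also have "\<dots> \<longleftrightarrow> pdvd (ev_at p e) (peval R (ev_at r e))"
              unfolding pdvd_def using r(2)[OF e] by simp
            finally show ?thesis by auto
          qed
          moreover have "peval R (ev_at (butlast p) e) y = peval R (ev_at p e) y" if "last p e = \<zero>" "y \<in> carrier R" for y
            using butlast_at[OF False p e that(2,1)] .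
          ultimately show "solvable ps q e \<longleftrightarrow> (last p e = \<zero> \<and> solvable [butlast p] q e) \<or>
              (last p e \<noteq> \<zero> \<and> \<not> (last p e \<noteq> \<zero> \<and> pdvd (ev_at p e) (peval R (ev_at r e))))"
            unfolding ps Nil by (cases "last p e = \<zero>") auto
        qed
      qed
    next
      case ps': (Cons p2 rest)
      have pf: "set p \<subseteq> pf" "set p2 \<subseteq> pf" "\<And>p. p \<in> set rest ==> set p \<subseteq> pf"
        using less.prems ps ps' by auto
      consider "p = []" | "p2 = []" | "p \<noteq> []" "p2 \<noteq> []" by blast
      then show ?thesis
      proof cases
        case 1
        then show ?thesis using ps ps' by (intro drop[of "p2 # rest"]) auto
      next
        case 2
        then show ?thesis using ps ps' by (intro drop[of "p # rest"]) auto
      next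
        case 3
        show ?thesis
        proof (cases "length p \<le> length p2")
          case True
          then show ?thesis using pair[of p p2 rest] 3 pf unfolding ps ps' by auto
        next
          case False
          have "con (solvable (p2 # p # rest) q)"
            using False 3 pf by (intro pair) (auto simp: ps ps')
          then show ?thesis by (rule con_cong) (auto simp: ps ps')
        qed
      qed
    qed
  qed
qed

text \<open>A clause needs only one inequation: in a field, several of them are equivalent to one
  for their product.\<close>

definition holds :: "((nat \<Rightarrow> 'a) \<Rightarrow> 'a) list \<times> ((nat \<Rightarrow> 'a) \<Rightarrow> 'a) \<Rightarrow> (nat \<Rightarrow> 'a) \<Rightarrow> bool" where
  "holds cl e \<longleftrightarrow> (\<forall>p\<in>set (fst cl). p e = \<zero>) \<and> snd cl e \<noteq> \<zero>"

definition dnf :: "((nat \<Rightarrow> 'a) \<Rightarrow> bool) \<Rightarrow> bool" where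
  "dnf P \<longleftrightarrow> (\<exists>cls. (\<forall>cl\<in>set cls. set (fst cl) \<subseteq> pf \<and> snd cl \<in> pf) \<and>
    (\<forall>e. range e \<subseteq> carrier R \<longrightarrow> P e = (\<exists>cl\<in>set cls. holds cl e)))"

lemma dnf_cong: "dnf P ==> (\<And>e. range e \<subseteq> carrier R ==> Q e = P e) ==> dnf Q"
  unfolding dnf_def by (elim exE) (rule exI, auto)

lemma dnf_disj:
  assumes "dnf P" "dnf Q" shows "dnf (\<lambda>e. P e \<or> Q e)"
proof -
  obtain c1 c2 where "\<forall>cl\<in>set c1. set (fst cl) \<subseteq> pf \<and> snd cl \<in> pf" "\<forall>cl\<in>set c2. set (fst cl) \<subseteq> pf \<and> snd cl \<in> pf"
    "\<forall>e. range e \<subseteq> carrier R \<longrightarrow> P e = (\<exists>cl\<in>set c1. holds cl e)" "\<forall>e. range e \<subseteq> carrier R \<longrightarrow> Q e = (\<exists>cl\<in>set c2. holds cl e)"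
    using assms unfolding dnf_def by blast
  then show ?thesis unfolding dnf_def by (intro exI[of _ "c1 @ c2"]) auto
qed

lemma dnf_conj:
  assumes "dnf P" "dnf Q" shows "dnf (\<lambda>e. P e \<and> Q e)"
proof -
  obtain c1 c2 where c: "\<forall>cl\<in>set c1. set (fst cl) \<subseteq> pf \<and> snd cl \<in> pf" "\<forall>cl\<in>set c2. set (fst cl) \<subseteq> pf \<and> snd cl \<in> pf"
    "\<forall>e. range e \<subseteq> carrier R \<longrightarrow> P e = (\<exists>cl\<in>set c1. holds cl e)" "\<forall>e. range e \<subseteq> carrier R \<longrightarrow> Q e = (\<exists>cl\<in>set c2. holds cl e)"
    using assms unfolding dnf_def by blast
  define both where "both a b = (fst a @ fst b, \<lambda>e. snd a e \<otimes> snd b e)"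
    for a b :: "((nat \<Rightarrow> 'a) \<Rightarrow> 'a) list \<times> ((nat \<Rightarrow> 'a) \<Rightarrow> 'a)"
  have "holds (both a b) e \<longleftrightarrow> holds a e \<and> holds b e"
    if "snd a \<in> pf" "snd b \<in> pf" "range e \<subseteq> carrier R" for a b e
    using pf_closed[OF that(1,3)] pf_closed[OF that(2,3)] by (auto simp: holds_def both_def integral_iff)
  then have "\<forall>e. range e \<subseteq> carrier R \<longrightarrow> (P e \<and> Q e) = (\<exists>cl\<in>set (map (\<lambda>(a, b). both a b) (List.product c1 c2)). holds cl e)"
    using c by (simp add: split_def)
  moreover have "\<forall>cl\<in>set (map (\<lambda>(a, b). both a b) (List.product c1 c2)). set (fst cl) \<subseteq> pf \<and> snd cl \<in> pf"
    using c(1,2) by (auto simp: both_def intro!: pf_mult)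
  ultimately show ?thesis unfolding dnf_def by blast
qed

text \<open>The complement is carried along in the induction, so negation just exchanges the two
  normal forms.\<close>

lemma dnf_con: "con P ==> dnf P \<and> dnf (\<lambda>e. \<not> P e)"
proof (induction P rule: con.induct)
  case (con_zero f P)
  have "dnf P" unfolding dnf_def using con_zero
    by (intro exI[of _ "[([f], \<lambda>e. \<one>)]"]) (auto simp: holds_def intro: pf_const)
  moreover have "dnf (\<lambda>e. \<not> P e)" unfolding dnf_def using con_zero
    by (intro exI[of _ "[([], f)]"]) (auto simp: holds_def)
  ultimately show ?case by blast
next
  case (con_not Q P)
  then show ?case using dnf_cong[of Q "\<lambda>e. \<not> P e"] dnf_cong[of "\<lambda>e. \<not> Q e" P] by auto
next
  case (con_conj Q Q' P)
  then show ?case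
    using dnf_cong[OF dnf_conj[of Q Q'], of P] dnf_cong[OF dnf_disj[of "\<lambda>e. \<not> Q e" "\<lambda>e. \<not> Q' e"], of "\<lambda>e. \<not> P e"]
    by auto
qed

text \<open>The quantifier commutes with the disjunction over clauses; for one clause it becomes a
  question of type \<open>solvable\<close>.\<close>

lemma con_ex:
  assumes "con P" shows "con (\<lambda>e. \<exists>y\<in>carrier R. P (e(i := y)))"
proof -
  obtain cls where cls: "\<forall>cl\<in>set cls. set (fst cl) \<subseteq> pf \<and> snd cl \<in> pf"
    "\<And>e. range e \<subseteq> carrier R ==> P e = (\<exists>cl\<in>set cls. holds cl e)"
    using dnf_con[OF assms] unfolding dnf_def by blast
  obtain hor where hor: "\<And>f. f \<in> pf ==> set (hor f) \<subseteq> pf"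
    "\<And>f e y. f \<in> pf ==> range e \<subseteq> carrier R ==> y \<in> carrier R ==> f (e(i := y)) = peval R (ev_at (hor f) e) y"
  proof -
    have "\<forall>f\<in>pf. \<exists>p. set p \<subseteq> pf \<and> (\<forall>e y. range e \<subseteq> carrier R \<longrightarrow> y \<in> carrier R \<longrightarrow>
      f (e(i := y)) = peval R (ev_at p e) y)"
      using pf_horner by (intro ballI)
    from bchoice[OF this] obtain h where "\<forall>f\<in>pf. set (h f) \<subseteq> pf \<and> (\<forall>e y. range e \<subseteq> carrier R \<longrightarrow> y \<in> carrier R \<longrightarrow>
      f (e(i := y)) = peval R (ev_at (h f) e) y)" ..
    then show thesis by (intro that[of h]) simp_all
  qed
  have "con (\<lambda>e. \<exists>cl\<in>set cls. solvable (map hor (fst cl)) (hor (snd cl)) e)"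
    using cls(1) hor(1) by (intro con_bex con_solvable) auto
  then show ?thesis
  proof (rule con_cong)
    fix e :: "nat \<Rightarrow> 'a" assume e: "range e \<subseteq> carrier R"
    have P: "P (e(i := y)) \<longleftrightarrow> (\<exists>cl\<in>set cls. holds cl (e(i := y)))" if "y \<in> carrier R" for y
      using e that by (intro cls(2)) (auto simp: image_subset_iff)
    have hol: "holds cl (e(i := y)) \<longleftrightarrow>
      (\<forall>p\<in>set (map hor (fst cl)). peval R (ev_at p e) y = \<zero>) \<and> peval R (ev_at (hor (snd cl)) e) y \<noteq> \<zero>"
      if "cl \<in> set cls" "y \<in> carrier R" for cl y
    proof -
      have cl: "set (fst cl) \<subseteq> pf" "snd cl \<in> pf" using cls(1) that(1) by auto
      have "\<forall>p\<in>set (fst cl). p (e(i := y)) = peval R (ev_at (hor p) e) y"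
        using cl(1) hor(2)[OF _ e that(2)] by (intro ballI) (simp only: subset_iff)
      then show ?thesis unfolding holds_def hor(2)[OF cl(2) e that(2)] by simp
    qed
    have "(\<exists>y\<in>carrier R. P (e(i := y))) \<longleftrightarrow> (\<exists>y\<in>carrier R. \<exists>cl\<in>set cls. holds cl (e(i := y)))"
      by (rule bex_cong[OF refl P])
    also have "\<dots> \<longleftrightarrow> (\<exists>cl\<in>set cls. \<exists>y\<in>carrier R. holds cl (e(i := y)))"
      by blast
    also have "\<dots> \<longleftrightarrow> (\<exists>cl\<in>set cls. solvable (map hor (fst cl)) (hor (snd cl)) e)"
      by (intro bex_cong refl hol)
    finally show "(\<exists>y\<in>carrier R. P (e(i := y))) \<longleftrightarrow>
      (\<exists>cl\<in>set cls. solvable (map hor (fst cl)) (hor (snd cl)) e)" .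
  qed
qed

lemma pf_eval_tm:
  assumes "wf_tm pure_ring_lang t"
  shows "\<exists>f\<in>pf. \<forall>e. range e \<subseteq> carrier R \<longrightarrow> eval_tm (ring_struct R) e t = f e"
  using assms
proof (induction t)
  case (Var i)
  show ?case using pf_var[of i] by (intro bexI[of _ "\<lambda>e. e i"]) auto
next
  case (Fn g ts)
  have len: "length ts = ring_arity g" using Fn.prems by (simp add: pure_ring_lang_def)
  have IH: "\<exists>f\<in>pf. \<forall>e. range e \<subseteq> carrier R \<longrightarrow> eval_tm (ring_struct R) e t = f e" if "t \<in> set ts" for t
    using Fn.IH[OF that] Fn.prems that by auto
  show ?case
  proof (cases g)
    case RZero
    then show ?thesis by (intro bexI[OF _ pf_const[OF zero_closed]]) (simp add: ring_struct_def)
  next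
    case ROne
    then show ?thesis by (intro bexI[OF _ pf_const[OF one_closed]]) (simp add: ring_struct_def)
  next
    case RAdd
    then obtain t u where ts: "ts = [t, u]" using len by (auto simp: numeral_2_eq_2 length_Suc_conv)
    obtain f h where "f \<in> pf" "h \<in> pf" "\<forall>e. range e \<subseteq> carrier R \<longrightarrow> eval_tm (ring_struct R) e t = f e"
      "\<forall>e. range e \<subseteq> carrier R \<longrightarrow> eval_tm (ring_struct R) e u = h e" using IH[of t] IH[of u] ts by auto
    then show ?thesis using RAdd ts by (intro bexI[OF _ pf_add[of f h]]) (simp_all add: ring_struct_def)
  next
    case RMul
    then obtain t u where ts: "ts = [t, u]" using len by (auto simp: numeral_2_eq_2 length_Suc_conv)
    obtain f h where "f \<in> pf" "h \<in> pf" "\<forall>e. range e \<subseteq> carrier R \<longrightarrow> eval_tm (ring_struct R) e t = f e"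
      "\<forall>e. range e \<subseteq> carrier R \<longrightarrow> eval_tm (ring_struct R) e u = h e" using IH[of t] IH[of u] ts by auto
    then show ?thesis using RMul ts by (intro bexI[OF _ pf_mult[of f h]]) (simp_all add: ring_struct_def)
  next
    case RNeg
    then obtain t where ts: "ts = [t]" using len by (auto simp: length_Suc_conv)
    obtain f where "f \<in> pf" "\<forall>e. range e \<subseteq> carrier R \<longrightarrow> eval_tm (ring_struct R) e t = f e"
      using IH[of t] ts by auto
    then show ?thesis using RNeg ts by (intro bexI[OF _ pf_neg[of f]]) (simp_all add: ring_struct_def)
  qed
qed

lemma con_sat:
  assumes "wf_fm pure_ring_lang \<phi>" shows "con (\<lambda>e. sat (ring_struct R) e \<phi>)"
  using assms
proof (induction \<phi>)
  case (Eql s u)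
  obtain f h where f: "f \<in> pf" "h \<in> pf" "\<And>e. range e \<subseteq> carrier R ==> eval_tm (ring_struct R) e s = f e"
      "\<And>e. range e \<subseteq> carrier R ==> eval_tm (ring_struct R) e u = h e"
    using pf_eval_tm[of s] pf_eval_tm[of u] Eql by auto
  show ?case
  proof (rule con_zero[OF pf_add[OF f(1) pf_neg[OF f(2)]]])
    fix e :: "nat \<Rightarrow> 'a" assume e: "range e \<subseteq> carrier R"
    have "f e \<ominus> h e = \<zero> \<longleftrightarrow> f e = h e" using pf_closed[OF f(1) e] pf_closed[OF f(2) e] by (rule r_right_minus_eq)
    then show "sat (ring_struct R) e (Eql s u) \<longleftrightarrow> f e \<oplus> \<ominus> h e = \<zero>" using f(3,4)[OF e] by (simp add: a_minus_def)
  qed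
next
  case (Rel r ts)
  then show ?case by (simp add: pure_ring_lang_def)
next
  case Bot
  show ?case using con_False by simp
next
  case (Imp \<phi> \<psi>)
  then have "con (\<lambda>e. \<not> sat (ring_struct R) e \<phi>)" "con (\<lambda>e. sat (ring_struct R) e \<psi>)"
    using con_neg[of "\<lambda>e. sat (ring_struct R) e \<phi>"] by simp_all
  from con_disj[OF this] show ?case by (rule con_cong) auto
next
  case (All i \<phi>)
  then have "con (\<lambda>e. \<not> sat (ring_struct R) e \<phi>)" using con_neg[of "\<lambda>e. sat (ring_struct R) e \<phi>"] by simp
  from con_ex[OF this, of i] have "con (\<lambda>e. \<exists>y\<in>carrier R. \<not> sat (ring_struct R) (e(i := y)) \<phi>)" .
  then show ?case by (rule con_not) (simp add: ring_struct_def)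
qed

section \<open>Linear independence of characters\<close>

primrec msum :: "('s \<Rightarrow> 'x \<Rightarrow> 'a) \<Rightarrow> ('a \<times> 's) list \<Rightarrow> 'x \<Rightarrow> 'a" where
  "msum \<chi> [] a = \<zero>"
| "msum \<chi> (cs # l) a = fst cs \<otimes> \<chi> (snd cs) a \<oplus> msum \<chi> l a"

lemma msum_closed: "fst ` set l \<subseteq> carrier R ==> (\<And>s. \<chi> s a \<in> carrier R) ==> msum \<chi> l a \<in> carrier R"
  by (induction l) auto

lemma msum_append:
  "fst ` set l \<subseteq> carrier R ==> fst ` set l' \<subseteq> carrier R ==> (\<And>s. \<chi> s a \<in> carrier R) ==>
    msum \<chi> (l @ l') a = msum \<chi> l a \<oplus> msum \<chi> l' a"
  by (induction l) (auto simp: msum_closed a_assoc)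

lemma msum_zero: "(\<And>c. c \<in> fst ` set l ==> c = \<zero>) ==> (\<And>s. \<chi> s a \<in> carrier R) ==> msum \<chi> l a = \<zero>"
proof (induction l)
  case (Cons c l)
  have "fst c = \<zero>" "msum \<chi> l a = \<zero>" using Cons.prems(1)[of "fst c"] Cons.IH Cons.prems by auto
  then show ?case using Cons.prems(2) by simp
qed simp

text \<open>Dedekind's argument. The relation at \<open>a \<otimes> b\<close> minus
  \<open>\<chi> s0 b\<close> times the relation at \<open>a\<close> is a shorter relation, in which
  the coefficient of \<open>s\<close> is multiplied by
  \<open>\<chi> s b \<ominus> \<chi> s0 b\<close>. With \<open>b\<close> chosen to make this factor
  nonzero, the coefficient of \<open>s\<close> must vanish.\<close>

lemma independent_characters:
  assumes "fst ` set l \<subseteq> carrier R" "distinct (map snd l)"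
    and \<chi>: "\<And>s a. a \<in> Units R ==> \<chi> s a \<in> Units R"
      "\<And>s a b. a \<in> Units R ==> b \<in> Units R ==> \<chi> s (a \<otimes> b) = \<chi> s a \<otimes> \<chi> s b"
    and ne: "\<And>s t. s \<in> snd ` set l ==> t \<in> snd ` set l ==> s \<noteq> t ==> \<exists>b\<in>Units R. \<chi> s b \<noteq> \<chi> t b"
    and "\<And>a. a \<in> Units R ==> msum \<chi> l a = \<zero>"
  shows "\<forall>c\<in>fst ` set l. c = \<zero>"
  using assms(1,2) ne assms(6)
proof (induction "length l" arbitrary: l)
  case 0
  show ?case using 0(1) by simp
next
  case (Suc n)
  obtain c0 s0 l' where l: "l = (c0, s0) # l'" using Suc.hyps(2) by (cases l) auto
  have cl: "c0 \<in> carrier R" "fst ` set l' \<subseteq> carrier R" using Suc.prems(1) l by auto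
  have \<chi>_cl: "\<chi> s a \<in> carrier R" if "a \<in> Units R" for s a using \<chi>(1)[OF that] by auto
  have zero: "c = \<zero>" if c: "(c, s) \<in> set l'" for c s
  proof -
    have "s \<noteq> s0" using Suc.prems(2) c l by force
    then obtain b where b: "b \<in> Units R" "\<chi> s b \<noteq> \<chi> s0 b" using Suc.prems(3)[of s s0] c l by force
    define m where "m = map (\<lambda>(c, s). (c \<otimes> (\<chi> s b \<ominus> \<chi> s0 b), s)) l'"
    have msum_m: "msum \<chi> m a = msum \<chi> l' (a \<otimes> b) \<ominus> \<chi> s0 b \<otimes> msum \<chi> l' a" if a: "a \<in> Units R" for a
      unfolding m_def using cl(2)
    proof (induction l')
      case Nil
      then show ?case using \<chi>_cl[OF b(1)] by (simp add: a_minus_def)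
    next
      case (Cons d l')
      obtain c s where d: "d = (c, s)" by (cases d)
      define p q r x y z where "p = \<chi> s b" and "q = \<chi> s0 b" and "r = \<chi> s a" and "x = msum \<chi> l' (a \<otimes> b)" and "y = msum \<chi> l' a" and "z = c"
      have c: "p \<in> carrier R" "q \<in> carrier R" "r \<in> carrier R" "x \<in> carrier R" "y \<in> carrier R" "z \<in> carrier R"
        using Cons.prems d a b(1) \<chi>_cl Units_m_closed[OF a b(1)]
        by (auto simp: p_def q_def r_def x_def y_def z_def intro!: msum_closed)
      then have "z \<otimes> (p \<ominus> q) \<otimes> r \<oplus> (x \<ominus> q \<otimes> y) = z \<otimes> (r \<otimes> p) \<oplus> x \<ominus> q \<otimes> (z \<otimes> r \<oplus> y)"
        by (simp add: ring_expand)
      then show ?case using Cons d \<chi>(2)[OF a b(1), of s]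
        by (simp add: p_def q_def r_def x_def y_def z_def)
    qed
    have "\<forall>c\<in>fst ` set m. c = \<zero>"
    proof (rule Suc.hyps(1))
      show "n = length m" using Suc.hyps(2) by (simp add: l m_def)
      show "fst ` set m \<subseteq> carrier R" using cl(2) \<chi>_cl[OF b(1)] by (force simp: m_def)
      have snd_m: "map snd m = map snd l'" by (simp add: m_def split_def)
      then show "distinct (map snd m)" using Suc.prems(2) l by simp
      have "snd ` set m = snd ` set l'" using snd_m by (metis list.set_map)
      then show "\<exists>b\<in>Units R. \<chi> s b \<noteq> \<chi> t b" if "s \<in> snd ` set m" "t \<in> snd ` set m" "s \<noteq> t" for s t
        using Suc.prems(3)[of s t] that l by auto
      show "msum \<chi> m a = \<zero>" if a: "a \<in> Units R" for a
      proof -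
        have ab: "a \<otimes> b \<in> Units R" using a b(1) by simp
        define x y p q where "x = msum \<chi> l' (a \<otimes> b)" and "y = msum \<chi> l' a" and "p = \<chi> s0 a" and "q = \<chi> s0 b"
        have c: "x \<in> carrier R" "y \<in> carrier R" "p \<in> carrier R" "q \<in> carrier R"
          using cl(2) \<chi>_cl a b(1) ab by (auto simp: x_def y_def p_def q_def intro!: msum_closed)
        have 1: "c0 \<otimes> (p \<otimes> q) \<oplus> x = \<zero>" "c0 \<otimes> p \<oplus> y = \<zero>"
          using Suc.prems(4)[OF ab] Suc.prems(4)[OF a] \<chi>(2)[OF a b(1), of s0] by (simp_all add: l x_def y_def p_def q_def)
        have "c0 \<otimes> (p \<otimes> q) \<oplus> x = x \<oplus> c0 \<otimes> (p \<otimes> q)" "q \<otimes> (c0 \<otimes> p \<oplus> y) = q \<otimes> y \<oplus> c0 \<otimes> (p \<otimes> q)"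
          using c cl(1) by (simp_all add: ring_expand)
        then have "x \<ominus> q \<otimes> y = (c0 \<otimes> (p \<otimes> q) \<oplus> x) \<ominus> q \<otimes> (c0 \<otimes> p \<oplus> y)"
          using diff_cancel[of x "q \<otimes> y" "c0 \<otimes> (p \<otimes> q)"] c cl(1) by simp
        then show ?thesis using msum_m[OF a] 1 c by (simp add: x_def y_def q_def a_minus_def)
      qed
    qed
    then have "c \<otimes> (\<chi> s b \<ominus> \<chi> s0 b) = \<zero>" using c by (force simp: m_def)
    moreover have "\<chi> s b \<ominus> \<chi> s0 b \<noteq> \<zero>" using b(2) \<chi>_cl[OF b(1)] by (simp add: r_right_minus_eq)
    moreover have "c \<in> carrier R" using cl(2) c by force
    ultimately show ?thesis using \<chi>_cl[OF b(1)] by (simp add: integral_iff)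
  qed
  then have "msum \<chi> l' \<one> = \<zero>" using \<chi>_cl by (intro msum_zero) (auto)
  then have "c0 \<otimes> \<chi> s0 \<one> = \<zero>" using Suc.prems(4)[of \<one>] cl(1) \<chi>_cl[of \<one>] by (simp add: l)
  moreover have "\<chi> s0 \<one> \<noteq> \<zero>" using \<chi>(1)[of \<one> s0] by (simp add: field_Units)
  ultimately have "c0 = \<zero>" using cl(1) \<chi>_cl[of \<one>] by (simp add: integral_iff)
  then show ?case using zero by (force simp: l)
qed


text \<open>Indices are pairs of exponents, so \<open>msum mon\<close> evaluates a polynomial in two
  variables.\<close>

definition mon :: "nat \<times> nat \<Rightarrow> 'a \<times> 'a \<Rightarrow> 'a" where
  "mon s p = fst p [^] fst s \<otimes> snd p [^] snd s"

lemma mon_closed: "x \<in> carrier R ==> y \<in> carrier R ==> mon s (x, y) \<in> carrier R"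
  by (simp add: mon_def)

lemma msum_mult:
  assumes l: "fst ` set l \<subseteq> carrier R" "fst ` set l' \<subseteq> carrier R"
  shows "\<exists>m. fst ` set m \<subseteq> carrier R \<and> (\<forall>x\<in>carrier R. \<forall>y\<in>carrier R.
    msum mon m (x, y) =
    msum mon l (x, y) \<otimes> msum mon l' (x, y))"
  using l(1)
proof (induction l)
  case Nil
  have "msum mon l' (x, y) \<in> carrier R" if "x \<in> carrier R" "y \<in> carrier R" for x y
    using l(2) mon_closed[OF that] by (intro msum_closed)
  then show ?case by (intro exI[of _ "[]"]) simp
next
  case (Cons cs l)
  define \<chi> where "\<chi> = mon"
  obtain c i j where cs: "cs = (c, (i, j))" by (metis surj_pair)
  have c: "c \<in> carrier R" using Cons.prems cs by simp
  obtain m where m: "fst ` set m \<subseteq> carrier R" "\<And>x y. x \<in> carrier R ==> y \<in> carrier R ==>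
    msum \<chi> m (x, y) = msum \<chi> l (x, y) \<otimes> msum \<chi> l' (x, y)"
    using Cons unfolding \<chi>_def by auto
  define m' where "m' = map (\<lambda>(d, (i', j')). (c \<otimes> d, (i + i', j + j'))) l'"
  have m': "fst ` set m' \<subseteq> carrier R" using l(2) c by (force simp: m'_def)
  have \<chi>: "\<chi> s (x, y) \<in> carrier R" if "x \<in> carrier R" "y \<in> carrier R" for s x y
    using that by (cases s) (simp add: \<chi>_def mon_def)
  have 1: "msum \<chi> m' (x, y) = c \<otimes> \<chi> (i, j) (x, y) \<otimes> msum \<chi> l' (x, y)"
    if xy: "x \<in> carrier R" "y \<in> carrier R" for x y
    unfolding m'_def using l(2)
  proof (induction l')
    case Nil
    then show ?case using c \<chi>[OF xy] by simp
  next
    case (Cons d l')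
    obtain d' i' j' where d: "d = (d', (i', j'))" by (metis surj_pair)
    have \<chi>_add: "\<chi> (i + i', j + j') (x, y) = \<chi> (i, j) (x, y) \<otimes> \<chi> (i', j') (x, y)"
      using xy by (simp add: \<chi>_def mon_def nat_pow_mult[symmetric] m_ac)
    have d': "d' \<in> carrier R" using Cons.prems d by simp
    have "msum \<chi> l' (x, y) \<in> carrier R" using \<chi>[OF xy] Cons.prems by (intro msum_closed) auto
    then have "c \<otimes> d' \<otimes> (\<chi> (i, j) (x, y) \<otimes> \<chi> (i', j') (x, y)) \<oplus> c \<otimes> \<chi> (i, j) (x, y) \<otimes> msum \<chi> l' (x, y) =
      c \<otimes> \<chi> (i, j) (x, y) \<otimes> (d' \<otimes> \<chi> (i', j') (x, y) \<oplus> msum \<chi> l' (x, y))"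
      using c d' \<chi>[OF xy] by (simp add: r_distr m_ac)
    then show ?case using Cons d \<chi>_add by simp
  qed
  have "msum \<chi> (m' @ m) (x, y) = msum \<chi> (cs # l) (x, y) \<otimes> msum \<chi> l' (x, y)"
    if xy: "x \<in> carrier R" "y \<in> carrier R" for x y
  proof -
    have "msum \<chi> l (x, y) \<in> carrier R" "msum \<chi> l' (x, y) \<in> carrier R"
      using \<chi>[OF xy] Cons.prems l(2) by (intro msum_closed; auto)+
    then show ?thesis
      using msum_append[OF m' m(1), of \<chi> "(x, y)"] \<chi>[OF xy] 1[OF xy] m(2)[OF xy] c cs by (simp add: l_distr)
  qed
  then show ?case using m' m(1) unfolding \<chi>_def by (intro exI[of _ "m' @ m"]) auto
qed

text \<open>All variables except 0 and 1 are frozen at \<open>e\<close> and count as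
  constants.\<close>

lemma pf_msum:
  assumes "f \<in> pf" and e: "range e \<subseteq> carrier R"
  shows "\<exists>l. fst ` set l \<subseteq> carrier R \<and> (\<forall>x\<in>carrier R. \<forall>y\<in>carrier R.
    f (e(0 := x, 1 := y)) = msum mon l (x, y))"
  using assms(1)
proof induction
  case (pf_var k)
  consider "k = 0" | "k = 1" | "k \<noteq> 0" "k \<noteq> 1" by blast
  then show ?case
  proof cases
    case 1
    then show ?thesis by (intro exI[of _ "[(\<one>, (1, 0))]"]) (simp add: mon_def)
  next
    case 2
    then show ?thesis by (intro exI[of _ "[(\<one>, (0, 1))]"]) (simp add: mon_def)
  next
    case 3
    have "e k \<in> carrier R" using e by auto
    then show ?thesis using 3 by (intro exI[of _ "[(e k, (0, 0))]"]) (simp add: mon_def)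
  qed
next
  case (pf_const c)
  then show ?case by (intro exI[of _ "[(c, (0, 0))]"]) (simp add: mon_def)
next
  case (pf_add f g)
  obtain l where l: "fst ` set l \<subseteq> carrier R"
    "\<forall>x\<in>carrier R. \<forall>y\<in>carrier R. f (e(0 := x, 1 := y)) = msum mon l (x, y)"
    using pf_add.IH(1) by (elim exE conjE)
  obtain l' where l': "fst ` set l' \<subseteq> carrier R"
    "\<forall>x\<in>carrier R. \<forall>y\<in>carrier R. g (e(0 := x, 1 := y)) = msum mon l' (x, y)"
    using pf_add.IH(2) by (elim exE conjE)
  show ?case
  proof (intro exI[of _ "l @ l'"] conjI ballI)
    fix x y assume xy: "x \<in> carrier R" "y \<in> carrier R"
    show "f (e(0 := x, 1 := y)) \<oplus> g (e(0 := x, 1 := y)) =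
      msum mon (l @ l') (x, y)"
      using xy l(2) l'(2) mon_closed[OF xy] by (subst msum_append[OF l(1) l'(1)]) simp_all
  qed (use l(1) l'(1) in auto)
next
  case (pf_mult f g)
  obtain l where l: "fst ` set l \<subseteq> carrier R"
    "\<forall>x\<in>carrier R. \<forall>y\<in>carrier R. f (e(0 := x, 1 := y)) = msum mon l (x, y)"
    using pf_mult.IH(1) by (elim exE conjE)
  obtain l' where l': "fst ` set l' \<subseteq> carrier R"
    "\<forall>x\<in>carrier R. \<forall>y\<in>carrier R. g (e(0 := x, 1 := y)) = msum mon l' (x, y)"
    using pf_mult.IH(2) by (elim exE conjE)
  obtain m where m: "fst ` set m \<subseteq> carrier R" "\<forall>x\<in>carrier R. \<forall>y\<in>carrier R.
    msum mon m (x, y) = msum mon l (x, y) \<otimes> msum mon l' (x, y)"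
    using msum_mult[OF l(1) l'(1)] by (elim exE conjE)
  show ?case by (intro exI[of _ m] conjI m(1) ballI) (simp only: l(2) l'(2) m(2))
next
  case (pf_neg f)
  obtain l where l: "fst ` set l \<subseteq> carrier R"
    "\<forall>x\<in>carrier R. \<forall>y\<in>carrier R. f (e(0 := x, 1 := y)) = msum mon l (x, y)"
    using pf_neg.IH by (elim exE conjE)
  obtain m where m: "fst ` set m \<subseteq> carrier R" "\<forall>x\<in>carrier R. \<forall>y\<in>carrier R.
    msum mon m (x, y) =
    msum mon [(\<ominus> \<one>, (0, 0))] (x, y) \<otimes> msum mon l (x, y)"
    using msum_mult[OF _ l(1), of "[(\<ominus> \<one>, (0, 0))]"] by auto
  show ?case
  proof (intro exI[of _ m] conjI ballI m(1))
    fix x y assume xy: "x \<in> carrier R" "y \<in> carrier R"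
    have "f (e(0 := x, 1 := y)) \<in> carrier R" using pf_neg(1) e xy by (intro pf_closed) (auto simp: image_subset_iff)
    then show "\<ominus> f (e(0 := x, 1 := y)) = msum mon m (x, y)"
      using xy l(2) m(2) by (simp add: l_minus mon_def)
  qed
qed

lemma msum_distinct:
  assumes "fst ` set l \<subseteq> carrier R"
  shows "\<exists>m. fst ` set m \<subseteq> carrier R \<and> distinct (map snd m) \<and>
    (\<forall>a. (\<forall>s. \<chi> s a \<in> carrier R) \<longrightarrow> msum \<chi> m a = msum \<chi> l a)"
  using assms
proof (induction l)
  case Nil
  show ?case by (intro exI[of _ "[]"]) simp
next
  case (Cons cs l)
  obtain c s where cs: "cs = (c, s)" by (cases cs)
  obtain m where m: "fst ` set m \<subseteq> carrier R" "distinct (map snd m)"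
    "\<And>a. (\<forall>s. \<chi> s a \<in> carrier R) ==> msum \<chi> m a = msum \<chi> l a" using Cons by auto
  have c: "c \<in> carrier R" using Cons.prems cs by simp
  show ?case
  proof (cases "s \<in> snd ` set m")
    case False
    then show ?thesis using m c cs by (intro exI[of _ "cs # m"]) auto
  next
    case True
    then obtain d where "(d, s) \<in> set m" by force
    then obtain m1 m2 where mm: "m = m1 @ (d, s) # m2" by (meson split_list)
    have cl: "d \<in> carrier R" "fst ` set m1 \<subseteq> carrier R" "fst ` set m2 \<subseteq> carrier R" using m(1) mm by auto
    have "msum \<chi> (m1 @ (c \<oplus> d, s) # m2) a = msum \<chi> (cs # l) a" if a: "\<forall>s. \<chi> s a \<in> carrier R" for a
    proof -
      have a': "\<And>s. \<chi> s a \<in> carrier R" using a by blast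
      have eq: "msum \<chi> (m1 @ (b, s) # m2) a = msum \<chi> m1 a \<oplus> (b \<otimes> \<chi> s a \<oplus> msum \<chi> m2 a)"
        if "b \<in> carrier R" for b
        using msum_append[OF cl(2), of "(b, s) # m2" \<chi> a] cl(3) that a' by simp
      have "msum \<chi> m1 a \<in> carrier R" "msum \<chi> m2 a \<in> carrier R" using cl a' by (auto intro!: msum_closed)
      then have "msum \<chi> m1 a \<oplus> ((c \<oplus> d) \<otimes> \<chi> s a \<oplus> msum \<chi> m2 a) =
        c \<otimes> \<chi> s a \<oplus> (msum \<chi> m1 a \<oplus> (d \<otimes> \<chi> s a \<oplus> msum \<chi> m2 a))"
        using c cl(1) a' by (simp add: l_distr a_ac)
      then show ?thesis using m(3)[OF a] eq[OF cl(1)] eq[of "c \<oplus> d"] c cl(1) by (simp add: cs mm)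
    qed
    then show ?thesis using m(2) cl c by (intro exI[of _ "m1 @ (c \<oplus> d, s) # m2"]) (auto simp: mm)
  qed
qed

lemma polyfun_pf:
  assumes "f \<in> pf" "range e \<subseteq> carrier R" shows "polyfun (\<lambda>y. f (e(i := y)))"
proof -
  obtain p where p: "set p \<subseteq> pf" "\<forall>e y. range e \<subseteq> carrier R \<longrightarrow> y \<in> carrier R \<longrightarrow>
    f (e(i := y)) = peval R (ev_at p e) y" using pf_horner[OF assms(1)] by blast
  show ?thesis by (rule polyfun_cong[OF polyfun_peval[OF ev_at_closed[OF p(1) assms(2)]]]) (use p(2) assms(2) in simp)
qed

text \<open>The points where two factors are nonzero need not coincide. With their second
  coordinates kept, a common first coordinate is found, because a nonzero polynomial in one variable
  has finitely many zeros; then a common second coordinate is found in the same way.\<close>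

lemma pf_product:
  assumes "set fs \<subseteq> pf" and e: "range e \<subseteq> carrier R"
    and ne: "\<And>f. f \<in> set fs ==> \<exists>x\<in>carrier R. \<exists>y\<in>carrier R. f (e(0 := x, 1 := y)) \<noteq> \<zero>"
  shows "\<exists>F\<in>pf. (\<exists>x\<in>carrier R. \<exists>y\<in>carrier R. F (e(0 := x, 1 := y)) \<noteq> \<zero>) \<and>
    (\<forall>e f. range e \<subseteq> carrier R \<longrightarrow> f \<in> set fs \<longrightarrow> f e = \<zero> \<longrightarrow> F e = \<zero>)"
  using assms(1) ne
proof (induction fs)
  case Nil
  show ?case using pf_const[OF one_closed] by (intro bexI[of _ "\<lambda>e. \<one>"]) auto
next
  case (Cons f fs)
  have fs: "f \<in> pf" "set fs \<subseteq> pf" using Cons.prems(1) by simp_all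
  have IH: "\<exists>F\<in>pf. (\<exists>x\<in>carrier R. \<exists>y\<in>carrier R. F (e(0 := x, 1 := y)) \<noteq> \<zero>) \<and>
    (\<forall>e f. range e \<subseteq> carrier R \<longrightarrow> f \<in> set fs \<longrightarrow> f e = \<zero> \<longrightarrow> F e = \<zero>)"
    using fs(2) Cons.prems(2)[OF list.set_intros(2)] by (rule Cons.IH)
  obtain F x2 y2 where F: "F \<in> pf" "x2 \<in> carrier R" "y2 \<in> carrier R" "F (e(0 := x2, 1 := y2)) \<noteq> \<zero>"
    and F_zero: "\<forall>e f. range e \<subseteq> carrier R \<longrightarrow> f \<in> set fs \<longrightarrow> f e = \<zero> \<longrightarrow> F e = \<zero>"
    using IH by (elim bexE conjE)
  obtain x1 y1 where f: "f \<in> pf" "x1 \<in> carrier R" "y1 \<in> carrier R" "f (e(0 := x1, 1 := y1)) \<noteq> \<zero>"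
    using Cons.prems(2)[OF list.set_intros(1)] fs(1) by (elim bexE)
  have tw: "e(0 := x, 1 := y) = (e(1 := y))(0 := x)" for x y by (rule fun_upd_twist) simp
  have e1: "range (e(i := y)) \<subseteq> carrier R" if "y \<in> carrier R" for i y
    using e that by (auto simp: image_subset_iff)
  have "\<exists>x\<in>carrier R. f ((e(1 := y1))(0 := x)) \<noteq> \<zero> \<and> F ((e(1 := y2))(0 := x)) \<noteq> \<zero>"
    using f F by (intro polyfun_mult_nonzero[of _ _ x1 x2] polyfun_pf e1) (simp_all add: tw[symmetric] del: One_nat_def)
  then obtain x where x: "x \<in> carrier R" "f (e(0 := x, 1 := y1)) \<noteq> \<zero>" "F (e(0 := x, 1 := y2)) \<noteq> \<zero>"
    unfolding tw by blast
  have "\<exists>y\<in>carrier R. f (e(0 := x, 1 := y)) \<noteq> \<zero> \<and> F (e(0 := x, 1 := y)) \<noteq> \<zero>"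
    using f F x by (intro polyfun_mult_nonzero[of _ _ y1 y2] polyfun_pf e1) simp_all
  then obtain y where y: "y \<in> carrier R" "f (e(0 := x, 1 := y)) \<noteq> \<zero>" "F (e(0 := x, 1 := y)) \<noteq> \<zero>" by blast
  have e2: "range (e(0 := x, 1 := y)) \<subseteq> carrier R" using e x(1) y(1) by (auto simp: image_subset_iff)
  have "f (e(0 := x, 1 := y)) \<otimes> F (e(0 := x, 1 := y)) \<noteq> \<zero>"
    using y pf_closed[OF f(1) e2] pf_closed[OF F(1) e2] by (simp add: integral_iff)
  then have "\<exists>x\<in>carrier R. \<exists>y\<in>carrier R. f (e(0 := x, 1 := y)) \<otimes> F (e(0 := x, 1 := y)) \<noteq> \<zero>"
    using x(1) y(1) by blast
  moreover have "\<forall>e g. range e \<subseteq> carrier R \<longrightarrow> g \<in> set (f # fs) \<longrightarrow> g e = \<zero> \<longrightarrow> f e \<otimes> F e = \<zero>"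
  proof (intro allI impI)
    fix e g assume e: "range e \<subseteq> carrier R" and g: "g \<in> set (f # fs)" "g e = \<zero>"
    show "f e \<otimes> F e = \<zero>"
    proof (cases "g = f")
      case True
      then show ?thesis using g(2) pf_closed[OF F(1) e] by simp
    next
      case False
      then have "F e = \<zero>" using F_zero e g by simp
      then show ?thesis using pf_closed[OF f(1) e] by simp
    qed
  qed
  ultimately show ?case by (intro bexI[OF _ pf_mult[OF f(1) F(1)]] conjI)
qed

section \<open>Roots, roots of unity and definable homomorphisms\<close>

lemma peval_binomial:
  assumes "N > 0" "a \<in> carrier R" "x \<in> carrier R"
  shows "peval R (\<ominus> a # replicate (N - 1) \<zero> @ [\<one>]) x = x [^] N \<ominus> a"
proof -
  obtain k where k: "N = Suc k" using assms(1) by (cases N) auto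
  have z: "peval R (replicate k \<zero>) x = \<zero>" using assms(3) by (intro peval_zero) auto
  have s: "set (replicate k \<zero>) \<subseteq> carrier R" by auto
  have "peval R (replicate k \<zero> @ [\<one>]) x = x [^] k"
    using assms(3) by (subst peval_append[OF s]) (auto simp: z)
  then show ?thesis using assms(2,3) by (simp add: k a_minus_def a_comm m_comm)
qed

lemma nth_root:
  assumes "N > 0" "a \<in> carrier R" shows "\<exists>x\<in>carrier R. x [^] (N :: nat) = a"
proof -
  define cs where "cs = \<ominus> a # replicate (N - 1) \<zero> @ [\<one>]"
  have "set cs \<subseteq> carrier R" "last cs \<noteq> \<zero>" "2 \<le> length cs" using assms by (auto simp: cs_def)
  then obtain x where x: "x \<in> carrier R" "peval R cs x = \<zero>" using root by blast
  then have "x [^] N \<ominus> a = \<zero>" using peval_binomial[OF assms x(1)] by (simp only: cs_def)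
  then show ?thesis using x(1) assms(2) by (auto simp: r_right_minus_eq)
qed

lemma card_roots:
  assumes "set cs \<subseteq> carrier R" "cs \<noteq> []" "last cs \<noteq> \<zero>"
  shows "finite {x \<in> carrier R. peval R cs x = \<zero>} \<and> card {x \<in> carrier R. peval R cs x = \<zero>} \<le> length cs - 1"
  using assms
proof (induction "length cs" arbitrary: cs rule: less_induct)
  case less
  show ?case
  proof (cases "\<exists>a\<in>carrier R. peval R cs a = \<zero>")
    case True
    then obtain a where a: "a \<in> carrier R" "peval R cs a = \<zero>" by blast
    obtain ds where ds: "set ds \<subseteq> carrier R" "Suc (length ds) = length cs" "ds \<noteq> [] \<longrightarrow> last ds = last cs"
      "\<And>x. x \<in> carrier R ==> peval R cs x = (x \<ominus> a) \<otimes> peval R ds x \<oplus> peval R cs a"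
      using peval_divide[OF less.prems(2,1) a(1)] by blast
    have "ds \<noteq> []"
    proof
      assume "ds = []"
      then obtain b where "cs = [b]" using ds(2) by (cases cs) auto
      then show False using a less.prems by auto
    qed
    then have IH: "finite {x \<in> carrier R. peval R ds x = \<zero>}" "card {x \<in> carrier R. peval R ds x = \<zero>} \<le> length ds - 1"
      using less.hyps[of ds] ds(1-3) less.prems(3) by simp_all
    have sub: "{x \<in> carrier R. peval R cs x = \<zero>} \<subseteq> insert a {x \<in> carrier R. peval R ds x = \<zero>}"
      using ds(1,4) a by (auto simp: integral_iff r_right_minus_eq)
    have "card {x \<in> carrier R. peval R cs x = \<zero>} \<le> card (insert a {x \<in> carrier R. peval R ds x = \<zero>})"
      using IH(1) by (intro card_mono[OF _ sub]) simp
    also have "\<dots> \<le> Suc (card {x \<in> carrier R. peval R ds x = \<zero>})" by (rule card_insert_le_m1) simp_all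
    also have "\<dots> \<le> length cs - 1" using IH(2) ds(2) \<open>ds \<noteq> []\<close> by (cases ds) auto
    finally show ?thesis using finite_subset[OF sub] IH(1) by simp
  next
    case False
    then have "{x \<in> carrier R. peval R cs x = \<zero>} = {}" by blast
    then show ?thesis by (simp only: finite.emptyI card.empty) simp
  qed
qed

lemma card_roots_of_unity:
  assumes "N > 0"
  shows "finite {x \<in> carrier R. x [^] (N :: nat) = \<one>} \<and> card {x \<in> carrier R. x [^] N = \<one>} \<le> N"
proof -
  define cs where "cs = \<ominus> \<one> # replicate (N - 1) \<zero> @ [\<one>]"
  have "peval R cs x = \<zero> \<longleftrightarrow> x [^] N = \<one>" if "x \<in> carrier R" for x
    using peval_binomial[OF assms one_closed that] that unfolding cs_def by (simp only: r_right_minus_eq nat_pow_closed one_closed)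
  then have "{x \<in> carrier R. x [^] N = \<one>} = {x \<in> carrier R. peval R cs x = \<zero>}" by blast
  moreover have "length cs - 1 = N" using assms by (simp add: cs_def)
  moreover have "set cs \<subseteq> carrier R" "cs \<noteq> []" "last cs \<noteq> \<zero>" by (auto simp: cs_def)
  ultimately show ?thesis using card_roots[of cs] by simp
qed

lemma infinite_Units_pow:
  assumes "k > 0" shows "\<exists>a\<in>Units R. a [^] (k :: nat) \<noteq> \<one>"
proof (rule ccontr)
  assume "\<not> ?thesis"
  then have 1: "a [^] k = \<one>" if "a \<in> carrier R" "a \<noteq> \<zero>" for a using that by (auto simp: field_Units)
  have "polyfun (\<lambda>y. y [^] k \<oplus> \<ominus> \<one>)" by (intro polyfun_add polyfun_pow polyfun_var polyfun_const) simp
  moreover have "\<zero> [^] k \<oplus> \<ominus> \<one> \<noteq> \<zero>" using assms by (cases k) simp_all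
  ultimately have "finite {y \<in> carrier R. y [^] k \<oplus> \<ominus> \<one> = \<zero>}" using polyfun_zero_or_finite[OF _ zero_closed] by blast
  moreover have "carrier R - {\<zero>} \<subseteq> {y \<in> carrier R. y [^] k \<oplus> \<ominus> \<one> = \<zero>}" using 1 by (auto simp: r_neg)
  ultimately have "finite (carrier R - {\<zero>})" by (rule rev_finite_subset)
  then show False using infinite_carrier by simp
qed

text \<open>Quantifier elimination yields a nonzero polynomial \<open>F\<close> that vanishes on the
  graph of \<open>\<tau>\<close>. It is a linear relation between the characters a^i \<tau>(a)^j, so
  by independence two of them with different exponents coincide.\<close>

lemma definable_hom_power:
  fixes \<tau> :: "'a \<Rightarrow> 'a"
  assumes \<tau>: "\<And>a. a \<in> Units R ==> \<tau> a \<in> Units R"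
      "\<And>a b. a \<in> Units R ==> b \<in> Units R ==> \<tau> (a \<otimes> b) = \<tau> a \<otimes> \<tau> b"
    and def: "definable pure_ring_lang (ring_struct R) 2 {[a, \<tau> a] |a. a \<in> Units R}"
  shows "\<exists>n > 0. \<exists>i j. \<forall>a\<in>Units R. \<tau> a [^] (n :: nat) \<otimes> a [^] (i :: nat) = a [^] (j :: nat)"
proof -
  obtain \<phi> e where \<phi>: "wf_fm pure_ring_lang \<phi>" and e: "range e \<subseteq> carrier R"
    and D: "{[a, \<tau> a] |a. a \<in> Units R} = {xs \<in> tuples 2 (carrier R).
      sat (ring_struct R) (\<lambda>i. if i < 2 then xs ! i else e i) \<phi>}"
    using def unfolding definable_def by (auto simp: ring_struct_def)
  have env: "(\<lambda>i. if i < 2 then [x, y] ! i else e i) = e(0 := x, 1 := y)" for x y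
    by (rule ext) (auto simp: less_2_cases_iff)
  have er: "range (e(0 := x, 1 := y)) \<subseteq> carrier R" if "x \<in> carrier R" "y \<in> carrier R" for x y
    using e that by (auto simp: image_subset_iff)
  have graph: "sat (ring_struct R) (e(0 := x, 1 := y)) \<phi> \<longleftrightarrow> x \<in> Units R \<and> y = \<tau> x"
    if xy: "x \<in> carrier R" "y \<in> carrier R" for x y
  proof -
    have "[x, y] \<in> tuples 2 (carrier R)" using xy by (simp add: tuples_def)
    then have "sat (ring_struct R) (e(0 := x, 1 := y)) \<phi> \<longleftrightarrow> [x, y] \<in> {[a, \<tau> a] |a. a \<in> Units R}"
      unfolding D env[symmetric] by simp
    then show ?thesis by auto
  qed
  obtain cls where cls: "\<forall>cl\<in>set cls. set (fst cl) \<subseteq> pf \<and> snd cl \<in> pf"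
    "\<And>e. range e \<subseteq> carrier R ==> sat (ring_struct R) e \<phi> \<longleftrightarrow> (\<exists>cl\<in>set cls. holds cl e)"
    using dnf_con[OF con_sat[OF \<phi>]] unfolding dnf_def by blast
  have U: "a \<in> carrier R" if "a \<in> Units R" for a using that by auto
  let ?good = "\<lambda>f. f \<in> pf \<and> (\<exists>x\<in>carrier R. \<exists>y\<in>carrier R. f (e(0 := x, 1 := y)) \<noteq> \<zero>)"
  \<comment> \<open>If all equations of a clause vanished identically, a clause containing a point
    above \<open>a\<close> would hold for all but finitely many \<open>y\<close> above
    \<open>a\<close>; but the graph has only one point there.\<close>
  have ex_good: "\<exists>f\<in>set (fst cl). ?good f"
    if cl: "cl \<in> set cls" and a: "a \<in> Units R" "holds cl (e(0 := a, 1 := \<tau> a))" for cl a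
  proof (rule ccontr)
    assume no: "\<not> ?thesis"
    have "set (fst cl) \<subseteq> pf" and q: "snd cl \<in> pf" using cls(1) cl by auto
    then have z: "f (e(0 := a, 1 := y)) = \<zero>" if "f \<in> set (fst cl)" "y \<in> carrier R" for f y
      using no that U[OF a(1)] by blast
    have e0: "range (e(0 := a)) \<subseteq> carrier R" using e U[OF a(1)] by (auto simp: image_subset_iff)
    have "finite {y \<in> carrier R. snd cl (e(0 := a, 1 := y)) = \<zero>}"
      using polyfun_zero_or_finite[OF polyfun_pf[OF q e0] U[OF \<tau>(1)[OF a(1)]]] a(2) by (simp add: holds_def)
    moreover have "carrier R - {\<tau> a} \<subseteq> {y \<in> carrier R. snd cl (e(0 := a, 1 := y)) = \<zero>}"
    proof
      fix y assume y: "y \<in> carrier R - {\<tau> a}"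
      then have "\<not> holds cl (e(0 := a, 1 := y))"
        using graph[OF U[OF a(1)], of y] cls(2)[OF er[OF U[OF a(1)], of y]] cl by blast
      then show "y \<in> {y \<in> carrier R. snd cl (e(0 := a, 1 := y)) = \<zero>}" using y z by (auto simp: holds_def)
    qed
    ultimately have "finite (carrier R - {\<tau> a})" by (rule rev_finite_subset)
    then show False using infinite_carrier by simp
  qed
  \<comment> \<open>Every point of the graph is a zero of one of these nontrivial polynomials, so
    their product vanishes on the whole graph without being zero.\<close>
  define fs where "fs = filter ?good (concat (map fst cls))"
  have fs: "set fs \<subseteq> pf" by (auto simp: fs_def)
  have fs_nonzero: "\<exists>x\<in>carrier R. \<exists>y\<in>carrier R. f (e(0 := x, 1 := y)) \<noteq> \<zero>" if "f \<in> set fs" for f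
    using that unfolding fs_def by simp
  have "\<exists>F\<in>pf. (\<exists>x\<in>carrier R. \<exists>y\<in>carrier R. F (e(0 := x, 1 := y)) \<noteq> \<zero>) \<and>
    (\<forall>e f. range e \<subseteq> carrier R \<longrightarrow> f \<in> set fs \<longrightarrow> f e = \<zero> \<longrightarrow> F e = \<zero>)"
    by (rule pf_product[OF fs e]) (rule fs_nonzero)
  then obtain F x0 y0 where F: "F \<in> pf" "x0 \<in> carrier R" "y0 \<in> carrier R" "F (e(0 := x0, 1 := y0)) \<noteq> \<zero>"
    and F_zero: "\<forall>e f. range e \<subseteq> carrier R \<longrightarrow> f \<in> set fs \<longrightarrow> f e = \<zero> \<longrightarrow> F e = \<zero>"
    by (elim bexE conjE)
  have F0: "F (e(0 := a, 1 := \<tau> a)) = \<zero>" if a: "a \<in> Units R" for a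
  proof -
    have r: "range (e(0 := a, 1 := \<tau> a)) \<subseteq> carrier R" by (intro er U a \<tau>(1))
    obtain cl where cl: "cl \<in> set cls" "holds cl (e(0 := a, 1 := \<tau> a))"
      using cls(2)[OF r] graph[OF U[OF a] U[OF \<tau>(1)[OF a]]] a by blast
    obtain f where "f \<in> set (fst cl)" "?good f" using ex_good[OF cl(1) a cl(2)] by blast
    then have "f \<in> set fs" "f (e(0 := a, 1 := \<tau> a)) = \<zero>" using cl by (auto simp: fs_def holds_def)
    then show ?thesis using F_zero r by blast
  qed
  define \<chi> where "\<chi> = mon"
  have \<chi>_cl: "\<chi> s (x, y) \<in> carrier R" if "x \<in> carrier R" "y \<in> carrier R" for s x y
    using that by (cases s) (simp add: \<chi>_def mon_def)
  obtain l' where l': "fst ` set l' \<subseteq> carrier R" "\<And>x y. x \<in> carrier R ==> y \<in> carrier R ==>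
    F (e(0 := x, 1 := y)) = msum \<chi> l' (x, y)"
    using pf_msum[OF F(1) e] unfolding \<chi>_def by blast
  obtain l where l: "fst ` set l \<subseteq> carrier R" "distinct (map snd l)"
    "\<forall>a. (\<forall>s. \<chi> s a \<in> carrier R) \<longrightarrow> msum \<chi> l a = msum \<chi> l' a"
    using msum_distinct[OF l'(1), of \<chi>] by blast
  have Fl: "F (e(0 := x, 1 := y)) = msum \<chi> l (x, y)" if "x \<in> carrier R" "y \<in> carrier R" for x y
    using l(3) l'(2)[OF that] \<chi>_cl[OF that] by simp
  define \<psi> where "\<psi> s a = \<chi> s (a, \<tau> a)" for s a
  have msum_\<psi>: "msum \<psi> m a = msum \<chi> m (a, \<tau> a)" for m a
    by (induction m) (simp_all add: \<psi>_def)
  have "\<exists>s\<in>snd ` set l. \<exists>t\<in>snd ` set l. s \<noteq> t \<and> (\<forall>b\<in>Units R. \<psi> s b = \<psi> t b)"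
  proof (rule ccontr)
    assume no: "\<not> ?thesis"
    have "\<forall>c\<in>fst ` set l. c = \<zero>"
    proof (rule independent_characters[OF l(1,2)])
      show "\<psi> s a \<in> Units R" if "a \<in> Units R" for s a
        using that \<tau>(1)[OF that] by (cases s) (auto simp: \<psi>_def \<chi>_def mon_def intro!: Units_m_closed Units_pow_closed)
      show "\<psi> s (a \<otimes> b) = \<psi> s a \<otimes> \<psi> s b" if "a \<in> Units R" "b \<in> Units R" for s a b
        using U[OF that(1)] U[OF that(2)] U[OF \<tau>(1)[OF that(1)]] U[OF \<tau>(1)[OF that(2)]] \<tau>(2)[OF that]
        by (cases s) (simp add: \<psi>_def \<chi>_def mon_def nat_pow_distrib m_ac)
      show "\<exists>b\<in>Units R. \<psi> s b \<noteq> \<psi> t b" if "s \<in> snd ` set l" "t \<in> snd ` set l" "s \<noteq> t" for s t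
        using no that by blast
      show "msum \<psi> l a = \<zero>" if "a \<in> Units R" for a
        using F0[OF that] Fl[OF U[OF that] U[OF \<tau>(1)[OF that]]] by (simp add: msum_\<psi>)
    qed
    then have "msum \<chi> l (x0, y0) = \<zero>" using \<chi>_cl[OF F(2,3)] by (intro msum_zero) auto
    then show False using F(2-4) Fl by simp
  qed
  then obtain i j i' j' where ij: "(i, j) \<noteq> (i', j')" "\<And>b. b \<in> Units R ==> \<psi> (i, j) b = \<psi> (i', j') b" by auto
  have eq: "b [^] i \<otimes> \<tau> b [^] j = b [^] i' \<otimes> \<tau> b [^] j'" if "b \<in> Units R" for b
    using ij(2)[OF that] by (simp add: \<psi>_def \<chi>_def mon_def)
  \<comment> \<open>Cancelling the smaller power of \<open>\<tau> b\<close> leaves a positive power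
    on one side.\<close>
  have lt: ?thesis if "j < j'" "\<And>b. b \<in> Units R ==> b [^] i \<otimes> \<tau> b [^] j = b [^] i' \<otimes> \<tau> b [^] j'" for i j i' j' :: nat
  proof -
    have pos: "0 < j' - j" using that(1) by simp
    have "\<forall>b\<in>Units R. \<tau> b [^] (j' - j) \<otimes> b [^] i' = b [^] i"
    proof
    fix b assume b: "b \<in> Units R"
    define s where "s = \<tau> b [^] j"
    have s: "s \<in> carrier R" "s \<noteq> \<zero>" using Units_pow_closed[OF \<tau>(1)[OF b], of j] by (auto simp: s_def field_Units)
    have "\<tau> b [^] j' = s \<otimes> \<tau> b [^] (j' - j)"
      using that(1) U[OF \<tau>(1)[OF b]] by (simp add: s_def nat_pow_mult)
    then have "s \<otimes> (\<tau> b [^] (j' - j) \<otimes> b [^] i') = s \<otimes> b [^] i"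
      using that(2)[OF b] U[OF b] U[OF \<tau>(1)[OF b]] s(1) by (simp add: s_def[symmetric] m_ac)
    then show "\<tau> b [^] (j' - j) \<otimes> b [^] i' = b [^] i"
      using s U[OF b] U[OF \<tau>(1)[OF b]] by (subst (asm) m_lcancel) auto
    qed
    with pos show ?thesis by blast
  qed
  \<comment> \<open>With equal powers of \<open>\<tau> b\<close>, cancellation would make all units
    roots of unity of one fixed order.\<close>
  have eq_case: False if "i < i'" "\<And>b. b \<in> Units R ==> b [^] i \<otimes> \<tau> b [^] j = b [^] i' \<otimes> \<tau> b [^] j" for i i' :: nat
  proof -
    have "b [^] (i' - i) = \<one>" if b: "b \<in> Units R" for b
    proof -
      define s where "s = b [^] i \<otimes> \<tau> b [^] j"
      have "s \<in> Units R" using Units_pow_closed \<tau>(1)[OF b] b by (auto simp: s_def)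
      then have s: "s \<in> carrier R" "s \<noteq> \<zero>" by (auto simp: field_Units)
      have "b [^] i' = b [^] i \<otimes> b [^] (i' - i)" using \<open>i < i'\<close> U[OF b] by (simp add: nat_pow_mult)
      have "s \<otimes> b [^] (i' - i) = b [^] i \<otimes> b [^] (i' - i) \<otimes> \<tau> b [^] j"
        using U[OF b] U[OF \<tau>(1)[OF b]] by (simp add: s_def m_ac)
      also have "\<dots> = b [^] i' \<otimes> \<tau> b [^] j" by (simp only: \<open>b [^] i' = _\<close>)
      also have "\<dots> = s" using \<open>\<And>b. b \<in> Units R ==> b [^] i \<otimes> \<tau> b [^] j = b [^] i' \<otimes> \<tau> b [^] j\<close>[OF b] by (simp add: s_def)
      finally have "s \<otimes> b [^] (i' - i) = s \<otimes> \<one>" using s(1) by simp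
      then show ?thesis using s U[OF b] by (subst (asm) m_lcancel) auto
    qed
    then show False using infinite_Units_pow[of "i' - i"] \<open>i < i'\<close> by auto
  qed
  show ?thesis
  proof (cases j j' rule: linorder_cases)
    case less
    then show ?thesis using lt eq by blast
  next
    case greater
    then show ?thesis using lt[of j' j i' i] eq by simp
  next
    case equal
    then have "i < i' \<or> i' < i" using ij(1) by auto
    then show ?thesis using eq_case[of i i'] eq_case[of i' i] eq equal by auto
  qed
qed

end

section \<open>Algebraically closed valued fields\<close>

locale acvf =
  fixes L :: "('f, 'r) lang" and M :: "('f, 'r, 'a) vf_struct" and K (structure)
  assumes K: "K = vfield M" and is_struct_M: "is_struct (vf_lang L) M" and acvf: "ACVF M"
    and c_minimal: "\<And>S. S \<subseteq> univ M ==> definable (vf_lang L) M 1 ((\<lambda>x. [x]) ` S) ==>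
      S \<in> ball_combinations M"
begin

abbreviation Df :: "((nat \<Rightarrow> 'a) \<Rightarrow> bool) \<Rightarrow> bool" where "Df \<equiv> dfn (vf_lang L) M"
abbreviation VR :: "'a set" where "VR \<equiv> valset M"
abbreviation UR :: "'a set" where "UR \<equiv> Units (valring M)"

lemma univ_M: "univ M = carrier K"
  and mult_K: "x \<otimes> y = fun_int M (Inl RMul) [x, y]"
  and add_K: "x \<oplus> y = fun_int M (Inl RAdd) [x, y]"
  and one_K: "\<one> = fun_int M (Inl ROne) []"
  and zero_K: "\<zero> = fun_int M (Inl RZero) []"
  by (simp_all add: K vfield_def)

sublocale algebraically_closed K
  using acvf by (simp add: ACVF_def K)

sublocale root_closed_field K
proof (intro root_closed_field.intro field_axioms root_closed_field_axioms.intro)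
  show "\<exists>x\<in>carrier K. peval K cs x = \<zero>"
    if cs: "set cs \<subseteq> carrier K" "last cs \<noteq> \<zero>" "2 \<le> length cs" for cs
  proof -
    \<comment> \<open>\<open>eval\<close> expects the leading coefficient first and
      \<open>peval\<close> the constant one, hence the reversal.\<close>
    have eval: "eval (rev ds) x = peval K ds x" if "set ds \<subseteq> carrier K" "x \<in> carrier K" for ds x
      using that
    proof (induction ds)
      case (Cons d ds)
      have "eval (rev ds @ [d]) x = eval (rev ds) x \<otimes> x \<oplus> d"
        using Cons.prems by (intro eval_append_aux) auto
      then show ?case using Cons eval_in_carrier[of "rev ds" x] by (simp add: m_comm a_comm)
    qed simp
    have "cs \<noteq> []" using cs(3) by auto
    then have "rev cs \<in> carrier (poly_ring K)" "degree (rev cs) = length cs - 1"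
      using cs by (auto simp: sym[OF univ_poly_carrier] polynomial_def hd_rev)
    moreover from this(1) have "size (roots (rev cs)) = degree (rev cs)"
      using roots_over_carrier unfolding splitted_def by blast
    ultimately have "roots (rev cs) \<noteq> {#}" using cs(3) by auto
    then obtain x where "x \<in># roots (rev cs)" by blast
    then have "is_root (rev cs) x"
      using roots_mem_iff_is_root[OF \<open>rev cs \<in> carrier (poly_ring K)\<close>] by blast
    then show ?thesis unfolding is_root_def using eval[OF cs(1)] by auto
  qed
qed

lemma minus_K: "x \<in> carrier K ==> \<ominus> x = fun_int M (Inl RNeg) [x]"
  using acvf by (simp add: ACVF_def K univ_M[symmetric, unfolded K])

lemma subring_VR: "subring VR K"
  using acvf by (simp add: ACVF_def K)

lemma VR_or_inv: "x \<in> carrier K ==> x \<noteq> \<zero> ==> x \<in> VR \<or> inv x \<in> VR"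
  and VR_neq: "VR \<noteq> carrier K"
  using acvf by (simp_all add: ACVF_def K[symmetric] univ_M)

lemma VR_K: "x \<in> VR ==> x \<in> carrier K"
  using subringE(1)[OF subring_VR] by blast

lemma VR_simps [simp]: "\<zero> \<in> VR" "\<one> \<in> VR" "x \<in> VR ==> y \<in> VR ==> x \<oplus> y \<in> VR"
  "x \<in> VR ==> y \<in> VR ==> x \<otimes> y \<in> VR" "x \<in> VR ==> \<ominus> x \<in> VR"
  using subringE[OF subring_VR] by auto

lemma VR_diff [simp]: "x \<in> VR ==> y \<in> VR ==> x \<ominus> y \<in> VR"
  by (simp add: a_minus_def)

sublocale definable_sets "carrier K" Df
proof -
  interpret fo_structure "vf_lang L" M by unfold_locales (rule is_struct_M)
  show "definable_sets (carrier K) Df"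
    using definable_sets_axioms by (simp add: univ_M)
qed

lemma tm_ring:
  assumes "tm s" "tm u"
  shows tm_mult: "tm (\<lambda>E. s E \<otimes> u E)" and tm_plus: "tm (\<lambda>E. s E \<oplus> u E)"
    and tm_uminus: "tm (\<lambda>E. \<ominus> s E)" and tm_minus: "tm (\<lambda>E. s E \<ominus> u E)"
proof -
  interpret S: fo_structure "vf_lang L" M by unfold_locales (rule is_struct_M)
  note su = assms[unfolded univ_M[symmetric]]
  have ar: "farity (vf_lang L) (Inl RMul) = Some 2" "farity (vf_lang L) (Inl RAdd) = Some 2"
    "farity (vf_lang L) (Inl RNeg) = Some 1"
    by (simp_all add: vf_lang_def)
  show "tm (\<lambda>E. s E \<otimes> u E)"
    using S.tm_Fn2[OF ar(1) su] by (simp add: mult_K univ_M)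
  show plus: "tm (\<lambda>E. s E \<oplus> u E)"
    using S.tm_Fn2[OF ar(2) su] by (simp add: add_K univ_M)
  \<comment> \<open>The function symbol is known to agree with ring negation on the carrier, so the
    graphs are identified on assignments into it.\<close>
  have uminus: "tm (\<lambda>E. \<ominus> s E)" if "tm s" for s
  proof -
    have "tm (\<lambda>E. fun_int M (Inl RNeg) [s E])"
      using S.tm_Fn1[OF ar(3), of s] that by (simp add: univ_M)
    moreover have "fun_int M (Inl RNeg) [s E] = \<ominus> s E" if "range E \<subseteq> carrier K" for E
      using minus_K[OF tm_G[OF \<open>tm s\<close> that]] by simp
    ultimately show ?thesis
      unfolding tm_def
    proof (elim conjE, intro conjI)
      assume *: "Df (\<lambda>E. E 0 = fun_int M (Inl RNeg) [s (\<lambda>i. E (Suc i))])"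
      show "Df (\<lambda>E. E 0 = \<ominus> s (\<lambda>i. E (Suc i)))"
      proof (rule D_cong[OF *])
        fix E :: "nat \<Rightarrow> 'a" assume "range E \<subseteq> carrier K"
        then have "range (\<lambda>i. E (Suc i)) \<subseteq> carrier K" by auto
        then show "E 0 = fun_int M (Inl RNeg) [s (\<lambda>i. E (Suc i))] \<longleftrightarrow> E 0 = \<ominus> s (\<lambda>i. E (Suc i))"
          using \<open>\<And>E. range E \<subseteq> carrier K ==> fun_int M (Inl RNeg) [s E] = \<ominus> s E\<close> by simp
      qed
    qed (use that in \<open>auto simp: tm_def image_subset_iff\<close>)
  qed
  show "tm (\<lambda>E. \<ominus> s E)" by (rule uminus[OF assms(1)])
  have "tm (\<lambda>E. s E \<oplus> \<ominus> u E)"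
    using S.tm_Fn2[OF ar(2), of s "\<lambda>E. \<ominus> u E"] assms(1) uminus[OF assms(2)] by (simp add: add_K univ_M)
  then show "tm (\<lambda>E. s E \<ominus> u E)" by (simp add: a_minus_def)
qed

lemma tm_zero_one: "tm (\<lambda>E. \<zero>)" "tm (\<lambda>E. \<one>)"
  by (simp_all add: tm_const)

lemma Df_VR: assumes "tm s" shows "Df (\<lambda>E. s E \<in> VR)"
proof -
  interpret S: fo_structure "vf_lang L" M by unfold_locales (rule is_struct_M)
  have "Df (\<lambda>E. rel_int M (Inl InO) [s E])"
    using S.dfn_Rel1[of "Inl InO" s] assms by (simp add: vf_lang_def univ_M)
  then show ?thesis
    by (rule D_cong) (use tm_G[OF assms] in \<open>simp add: valset_def univ_M\<close>)
qed

text \<open>Inversion extended by \<open>0 \<mapsto> 1\<close> and the identity with 0 replaced by 1: the valuation below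
  takes the junk value 0 at 0.\<close>

definition nz :: "'a \<Rightarrow> 'a" where "nz x = (if x = \<zero> then \<one> else x)"
definition ninv :: "'a \<Rightarrow> 'a" where "ninv x = inv (nz x)"

lemma nz_closed [simp]: "x \<in> carrier K ==> nz x \<in> carrier K"
  and nz_nonzero [simp]: "nz x \<noteq> \<zero>"
  and nz_id [simp]: "x \<noteq> \<zero> ==> nz x = x"
  by (auto simp: nz_def)

lemma inv_nonzero:
  assumes "x \<in> carrier K" "x \<noteq> \<zero>"
  shows "inv x \<in> carrier K" "inv x \<noteq> \<zero>" "x \<otimes> inv x = \<one>" "inv x \<otimes> x = \<one>" "inv (inv x) = x"
proof -
  have x: "x \<in> Units K" using assms by (simp add: field_Units)
  show "inv x \<in> carrier K" "x \<otimes> inv x = \<one>" "inv x \<otimes> x = \<one>" "inv (inv x) = x" using x by simp_all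
  then show "inv x \<noteq> \<zero>" using assms(1) by (metis r_null zero_not_one)
qed

lemma inv_mult_nonzero:
  assumes "x \<in> carrier K" "x \<noteq> \<zero>" "y \<in> carrier K" "y \<noteq> \<zero>"
  shows "inv (x \<otimes> y) = inv x \<otimes> inv y"
proof -
  note ix = inv_nonzero[OF assms(1,2)] and iy = inv_nonzero[OF assms(3,4)]
  have "(inv x \<otimes> inv y) \<otimes> (x \<otimes> y) = (inv x \<otimes> x) \<otimes> (inv y \<otimes> y)"
    using assms ix(1) iy(1) by (simp add: m_ac)
  then have "(inv x \<otimes> inv y) \<otimes> (x \<otimes> y) = \<one>" using ix iy by simp
  then show ?thesis using assms ix(1) iy(1) by (intro inv_char) (auto simp: m_comm)
qed

lemma tm_nz: assumes "tm s" shows "tm (\<lambda>E. nz (s E))"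
proof (rule tm_comp1[OF _ assms])
  have "Df (\<lambda>E. (E 1 = \<zero> \<longrightarrow> E 0 = \<one>) \<and> (\<not> E 1 = \<zero> \<longrightarrow> E 0 = E 1))"
    by (intro D_conj D_imp D_not D_eq tm_var tm_zero_one)
  then have "Df (\<lambda>E. E 0 = nz (E 1))" by (rule D_cong) (simp add: nz_def)
  then show "tm (\<lambda>E. nz (E 0))" by (auto simp: tm_def image_subset_iff)
qed

lemma tm_ninv: assumes "tm s" shows "tm (\<lambda>E. ninv (s E))"
proof (rule tm_comp1[OF _ assms])
  have "Df (\<lambda>E. E 0 \<otimes> nz (E 1) = \<one>)"
    by (intro D_eq tm_mult tm_nz tm_var tm_zero_one)
  then have "Df (\<lambda>E. E 0 = ninv (E 1))"
  proof (rule D_cong)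
    fix E :: "nat \<Rightarrow> 'a" assume "range E \<subseteq> carrier K"
    then have E: "E 0 \<in> carrier K" "nz (E 1) \<in> carrier K" by (auto simp: image_subset_iff)
    show "E 0 \<otimes> nz (E 1) = \<one> \<longleftrightarrow> E 0 = ninv (E 1)"
    proof
      assume "E 0 \<otimes> nz (E 1) = \<one>"
      then have "inv (nz (E 1)) = E 0" using E by (intro inv_char) (simp_all add: m_comm)
      then show "E 0 = ninv (E 1)" by (simp add: ninv_def)
    next
      assume "E 0 = ninv (E 1)"
      then show "E 0 \<otimes> nz (E 1) = \<one>" using inv_nonzero(4)[OF E(2)] by (simp add: ninv_def)
    qed
  qed
  moreover have "ninv x \<in> carrier K" if "x \<in> carrier K" for x
    using inv_nonzero(1)[of "nz x"] that by (simp add: ninv_def)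
  ultimately show "tm (\<lambda>E. ninv (E 0))" by (auto simp: tm_def image_subset_iff)
qed

lemmas tm_K_intros = tm_var tm_const tm_mult tm_plus tm_uminus tm_minus tm_zero_one tm_nz tm_ninv

section \<open>The value group as an ordered group\<close>

lemma UR_iff: "x \<in> UR \<longleftrightarrow> x \<in> VR \<and> x \<noteq> \<zero> \<and> inv x \<in> VR"
proof
  have eq: "monoid.mult (valring M) = monoid.mult K" "one (valring M) = \<one>" "carrier (valring M) = VR"
    by (simp_all add: valring_def K)
  {
    assume "x \<in> UR"
    then obtain y where y: "x \<in> VR" "y \<in> VR" "y \<otimes> x = \<one>" "x \<otimes> y = \<one>"
      unfolding Units_def eq by auto
    then have "x \<noteq> \<zero>" using VR_K by (metis l_null zero_not_one r_null)
    moreover have "inv x = y" using y VR_K by (intro inv_char) auto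
    ultimately show "x \<in> VR \<and> x \<noteq> \<zero> \<and> inv x \<in> VR" using y by simp
  next
    assume "x \<in> VR \<and> x \<noteq> \<zero> \<and> inv x \<in> VR"
    then show "x \<in> UR" unfolding Units_def eq using inv_nonzero[of x] VR_K by (auto intro!: bexI[of _ "inv x"])
  }
qed

lemma units_of_K: "carrier (units_of K) = carrier K - {\<zero>}" "monoid.mult (units_of K) = monoid.mult K"
  "one (units_of K) = \<one>"
  by (simp_all add: units_of_def field_Units)

lemma comm_group_units_K: "comm_group (units_of K)"
  by (rule units_comm_group)

lemma subgroup_UR: "subgroup UR (units_of K)"
proof -
  interpret U: comm_group "units_of K" by (rule comm_group_units_K)
  have inv: "inv\<^bsub>units_of K\<^esub> x = inv x" if "x \<in> carrier K" "x \<noteq> \<zero>" for x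
    using that by (simp add: units_of_inv field_Units)
  show ?thesis
  proof (rule U.subgroupI)
    show "UR \<subseteq> carrier (units_of K)" using VR_K by (auto simp: units_of_K UR_iff)
    show "UR \<noteq> {}" using UR_iff[of \<one>] by auto
    show "inv\<^bsub>units_of K\<^esub> x \<in> UR" if "x \<in> UR" for x
      using that VR_K inv_nonzero[of x] by (simp add: inv UR_iff)
    show "x \<otimes>\<^bsub>units_of K\<^esub> y \<in> UR" if "x \<in> UR" "y \<in> UR" for x y
      using that VR_K inv_mult_nonzero[of x y] by (auto simp: units_of_K UR_iff integral_iff)
  qed
qed

lemma valgroup_K: "valgroup M = units_of K Mod UR" and gval_K: "gval M x = UR #>\<^bsub>units_of K\<^esub> x"
  by (simp_all add: valgroup_def gval_def K)

lemma gval_iff: "y \<in> gval M x \<longleftrightarrow> (\<exists>h\<in>UR. y = h \<otimes> x)"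
  by (auto simp: gval_K r_coset_def units_of_K)

lemma carrier_valgroup: "carrier (valgroup M) = gval M ` (carrier K - {\<zero>})"
  by (auto simp: valgroup_K FactGroup_def RCOSETS_def units_of_K gval_K)

lemma gval_mult:
  assumes "x \<in> carrier K - {\<zero>}" "y \<in> carrier K - {\<zero>}"
  shows "gval M x \<otimes>\<^bsub>valgroup M\<^esub> gval M y = gval M (x \<otimes> y)"
proof -
  interpret U: comm_group "units_of K" by (rule comm_group_units_K)
  interpret N: normal UR "units_of K" by (rule U.subgroup_imp_normal[OF subgroup_UR])
  show ?thesis using N.rcos_sum[of x y] assms
    by (simp add: valgroup_K gval_K FactGroup_def units_of_K)
qed

text \<open>\<open>gle\<close> refers to arbitrary representatives. They differ from
  \<open>x\<close> and \<open>y\<close> by units of the valuation ring, which do not affect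
  membership in that ring.\<close>

lemma gle_gval:
  assumes x: "x \<in> carrier K" "x \<noteq> \<zero>" and y: "y \<in> carrier K" "y \<noteq> \<zero>"
  shows "gle M (gval M x) (gval M y) \<longleftrightarrow> y \<otimes> inv x \<in> VR"
proof
  assume "gle M (gval M x) (gval M y)"
  then obtain h h' where h: "h \<in> UR" "h' \<in> UR" "(h' \<otimes> y) \<otimes> inv (h \<otimes> x) \<in> VR"
    by (auto simp: gle_def gval_iff K[symmetric])
  then have hK: "h \<in> carrier K" "h \<noteq> \<zero>" "h' \<in> carrier K" "h' \<noteq> \<zero>" using VR_K by (auto simp: UR_iff)
  note i = inv_nonzero[OF x] inv_nonzero[OF hK(1,2)] inv_nonzero[OF hK(3,4)]
  have ac: "(a' \<otimes> b) \<otimes> ((b' \<otimes> z) \<otimes> (c \<otimes> d)) = (a' \<otimes> b') \<otimes> ((c \<otimes> b) \<otimes> (z \<otimes> d))"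
    if "a' \<in> carrier K" "b \<in> carrier K" "b' \<in> carrier K" "z \<in> carrier K" "c \<in> carrier K" "d \<in> carrier K"
    for a' b b' z c d
    using that by (simp add: m_ac)
  have "(inv h' \<otimes> h) \<otimes> ((h' \<otimes> y) \<otimes> inv (h \<otimes> x)) = (inv h' \<otimes> h') \<otimes> ((inv h \<otimes> h) \<otimes> (y \<otimes> inv x))"
    unfolding inv_mult_nonzero[OF hK(1,2) x] using x y hK i(1,6,11) by (intro ac) auto
  also have "\<dots> = y \<otimes> inv x" using i x y by simp
  finally show "y \<otimes> inv x \<in> VR"
    using h by (metis VR_simps(4) UR_iff)
next
  assume *: "y \<otimes> inv x \<in> VR"
  have "\<one> \<in> UR" using UR_iff[of \<one>] by simp
  then have "x \<in> gval M x" "y \<in> gval M y" using x y by (auto simp: gval_iff intro!: bexI[of _ \<one>])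
  then show "gle M (gval M x) (gval M y)" using * by (auto simp: gle_def K[symmetric])
qed

lemma gval_eq:
  assumes x: "x \<in> carrier K" "x \<noteq> \<zero>" and y: "y \<in> carrier K" "y \<noteq> \<zero>"
    and "y \<otimes> inv x \<in> VR" "x \<otimes> inv y \<in> VR"
  shows "gval M x = gval M y"
proof -
  interpret U: comm_group "units_of K" by (rule comm_group_units_K)
  note i = inv_nonzero[OF x] inv_nonzero[OF y]
  have "inv (x \<otimes> inv y) = y \<otimes> inv x"
    using inv_mult_nonzero[OF x i(6,7)] i x y by (simp add: m_comm)
  then have "x \<otimes> inv y \<in> UR" using assms by (simp add: UR_iff integral_iff i)
  moreover have "x = (x \<otimes> inv y) \<otimes> y" using x y i by (simp add: m_assoc)
  ultimately have "x \<in> UR #>\<^bsub>units_of K\<^esub> y"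
    using gval_iff[of x y] by (auto simp: gval_K)
  then show ?thesis
    unfolding gval_K using U.repr_independence[OF _ _ subgroup_UR] y by (simp add: units_of_K)
qed

lemma ordered_valgroup: "ordered_comm_group (valgroup M) (gle M)"
  unfolding ordered_comm_group_def carrier_valgroup
proof (intro conjI)
  interpret U: comm_group "units_of K" by (rule comm_group_units_K)
  show "comm_group (valgroup M)"
    unfolding valgroup_K by (rule U.abelian_FactGroup[OF subgroup_UR])
  have key: "(y \<otimes> inv x) \<otimes> (z \<otimes> inv y) = z \<otimes> inv x"
    if "x \<in> carrier K" "x \<noteq> \<zero>" "y \<in> carrier K" "y \<noteq> \<zero>" "z \<in> carrier K" for x y z
  proof -
    have "(a \<otimes> b) \<otimes> (c \<otimes> d) = (a \<otimes> d) \<otimes> (c \<otimes> b)"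
      if "a \<in> carrier K" "b \<in> carrier K" "c \<in> carrier K" "d \<in> carrier K" for a b c d
      using that by (simp add: m_ac)
    from this[of y "inv x" z "inv y"]
    have "(y \<otimes> inv x) \<otimes> (z \<otimes> inv y) = (y \<otimes> inv y) \<otimes> (z \<otimes> inv x)"
      using that inv_nonzero(1)[of x] inv_nonzero(1)[of y] by simp
    then show ?thesis using that inv_nonzero[of x] inv_nonzero[of y] by simp
  qed
  have "gle M (gval M x) (gval M y) \<or> gle M (gval M y) (gval M x)"
    if xy: "x \<in> carrier K" "x \<noteq> \<zero>" "y \<in> carrier K" "y \<noteq> \<zero>" for x y
  proof -
    have "inv (y \<otimes> inv x) = x \<otimes> inv y"
      using inv_mult_nonzero[OF xy(3,4) inv_nonzero(1,2)[OF xy(1,2)]] inv_nonzero[OF xy(1,2)]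
        inv_nonzero[OF xy(3,4)] xy by (simp add: m_comm)
    then show ?thesis
      using VR_or_inv[of "y \<otimes> inv x"] xy inv_nonzero[OF xy(1,2)] by (simp add: gle_gval integral_iff)
  qed
  then show "\<forall>x\<in>gval M ` (carrier K - {\<zero>}). \<forall>y\<in>gval M ` (carrier K - {\<zero>}). gle M x y \<or> gle M y x"
    by simp
  show "\<forall>x\<in>gval M ` (carrier K - {\<zero>}). \<forall>y\<in>gval M ` (carrier K - {\<zero>}). gle M x y \<longrightarrow> gle M y x \<longrightarrow> x = y"
    using gval_eq by (simp add: gle_gval)
  have "gle M (gval M x) (gval M z)"
    if "x \<in> carrier K" "x \<noteq> \<zero>" "y \<in> carrier K" "y \<noteq> \<zero>" "z \<in> carrier K" "z \<noteq> \<zero>"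
      "gle M (gval M x) (gval M y)" "gle M (gval M y) (gval M z)" for x y z
    using key[of x y z] VR_simps(4)[of "y \<otimes> inv x" "z \<otimes> inv y"] that by (simp add: gle_gval)
  then show "\<forall>x\<in>gval M ` (carrier K - {\<zero>}). \<forall>y\<in>gval M ` (carrier K - {\<zero>}). \<forall>z\<in>gval M ` (carrier K - {\<zero>}).
      gle M x y \<longrightarrow> gle M y z \<longrightarrow> gle M x z"
    by simp blast
  have "gle M (gval M z \<otimes>\<^bsub>valgroup M\<^esub> gval M x) (gval M z \<otimes>\<^bsub>valgroup M\<^esub> gval M y)"
    if xyz: "x \<in> carrier K" "x \<noteq> \<zero>" "y \<in> carrier K" "y \<noteq> \<zero>" "z \<in> carrier K" "z \<noteq> \<zero>"
      "gle M (gval M x) (gval M y)" for x y z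
  proof -
    have "(z \<otimes> y) \<otimes> inv (z \<otimes> x) = (z \<otimes> inv z) \<otimes> (y \<otimes> inv x)"
      using xyz inv_nonzero[of x] inv_nonzero[of z] by (simp add: inv_mult_nonzero m_ac)
    also have "\<dots> = y \<otimes> inv x" using xyz inv_nonzero[of x] inv_nonzero[of z] by simp
    finally show ?thesis using xyz by (simp add: gval_mult gle_gval integral_iff)
  qed
  then show "\<forall>x\<in>gval M ` (carrier K - {\<zero>}). \<forall>y\<in>gval M ` (carrier K - {\<zero>}). \<forall>z\<in>gval M ` (carrier K - {\<zero>}).
      gle M x y \<longrightarrow> gle M (z \<otimes>\<^bsub>valgroup M\<^esub> x) (z \<otimes>\<^bsub>valgroup M\<^esub> y)"
    by simp
qed

text \<open>A fixed embedding into a type of ordered groups, so that values are added and compared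
  by type class operations.\<close>

definition emb :: "'a set \<Rightarrow> 'a set lexprod" where
  "emb = (SOME \<iota>. (\<forall>x\<in>carrier (valgroup M). \<forall>y\<in>carrier (valgroup M).
     \<iota> (x \<otimes>\<^bsub>valgroup M\<^esub> y) = \<iota> x + \<iota> y \<and> (\<iota> x \<le> \<iota> y \<longleftrightarrow> gle M x y)) \<and> inj_on \<iota> (carrier (valgroup M)))"

lemma emb:
  shows emb_mult: "x \<in> carrier (valgroup M) ==> y \<in> carrier (valgroup M) ==>
      emb (x \<otimes>\<^bsub>valgroup M\<^esub> y) = emb x + emb y"
    and emb_le: "x \<in> carrier (valgroup M) ==> y \<in> carrier (valgroup M) ==> emb x \<le> emb y \<longleftrightarrow> gle M x y"
    and inj_emb: "inj_on emb (carrier (valgroup M))"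
proof -
  have "\<exists>\<iota> :: 'a set \<Rightarrow> 'a set lexprod. (\<forall>x\<in>carrier (valgroup M). \<forall>y\<in>carrier (valgroup M).
     \<iota> (x \<otimes>\<^bsub>valgroup M\<^esub> y) = \<iota> x + \<iota> y \<and> (\<iota> x \<le> \<iota> y \<longleftrightarrow> gle M x y)) \<and> inj_on \<iota> (carrier (valgroup M))"
    by (rule embed_ordered_comm_group[OF ordered_valgroup]) blast
  from someI_ex[OF this] show "x \<in> carrier (valgroup M) ==> y \<in> carrier (valgroup M) ==>
      emb (x \<otimes>\<^bsub>valgroup M\<^esub> y) = emb x + emb y"
    "x \<in> carrier (valgroup M) ==> y \<in> carrier (valgroup M) ==> emb x \<le> emb y \<longleftrightarrow> gle M x y"
    "inj_on emb (carrier (valgroup M))"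
    unfolding emb_def by blast+
qed

definition v :: "'a \<Rightarrow> 'a set lexprod" where
  "v x = (if x = \<zero> then 0 else emb (gval M x))"

lemma gval_closed: "x \<in> carrier K ==> x \<noteq> \<zero> ==> gval M x \<in> carrier (valgroup M)"
  by (auto simp: carrier_valgroup)

lemma v_zero [simp]: "v \<zero> = 0"
  by (simp add: v_def)

lemma v_mult:
  assumes "x \<in> carrier K" "x \<noteq> \<zero>" "y \<in> carrier K" "y \<noteq> \<zero>" shows "v (x \<otimes> y) = v x + v y"
  using assms emb_mult[of "gval M x" "gval M y"] gval_mult[of x y]
  by (simp add: v_def integral_iff gval_closed)

lemma v_le_iff:
  assumes "x \<in> carrier K" "x \<noteq> \<zero>" "y \<in> carrier K" "y \<noteq> \<zero>"
  shows "v x \<le> v y \<longleftrightarrow> y \<otimes> inv x \<in> VR"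
  using assms by (simp add: v_def emb_le gval_closed gle_gval)

lemma v_one [simp]: "v \<one> = 0"
  using v_mult[of \<one> \<one>] by simp

lemma v_inv: assumes "x \<in> carrier K" "x \<noteq> \<zero>" shows "v (inv x) = - v x"
  using v_mult[OF assms inv_nonzero(1,2)[OF assms]] inv_nonzero(3)[OF assms]
    group_add_class.minus_unique[of "v x" "v (inv x)"] by simp

lemma v_nz [simp]: "v (nz x) = v x"
  by (simp add: nz_def)

lemma v_ninv: "x \<in> carrier K ==> v (ninv x) = - v x"
  using v_inv[of "nz x"] by (simp add: ninv_def)

lemma VR_iff: "x \<in> carrier K ==> x \<in> VR \<longleftrightarrow> x = \<zero> \<or> 0 \<le> v x"
  using v_le_iff[of \<one> x] by (cases "x = \<zero>") simp_all

lemma UR_v: "x \<in> carrier K ==> x \<in> UR \<longleftrightarrow> x \<noteq> \<zero> \<and> v x = 0"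
  using VR_iff[of x] VR_iff[of "inv x"] inv_nonzero[of x] v_inv[of x] by (auto simp: UR_iff)

lemma v_uminus: assumes "x \<in> carrier K" shows "v (\<ominus> x) = v x"
proof -
  have "\<ominus> \<one> \<noteq> \<zero>" by (metis minus_minus minus_zero one_closed zero_not_one)
  have "v (\<ominus> \<one>) + v (\<ominus> \<one>) = 0"
    using v_mult[of "\<ominus> \<one>" "\<ominus> \<one>"] \<open>\<ominus> \<one> \<noteq> \<zero>\<close> by (simp add: l_minus r_minus)
  \<comment> \<open>An ordered group has no element of order two.\<close>
  then have "v (\<ominus> \<one>) = 0"
    using add_self_less_iff[of "v (\<ominus> \<one>)" 0] add_self_less_iff[of 0 "v (\<ominus> \<one>)"] by (metis add_0 less_irrefl neq_iff)
  show ?thesis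
  proof (cases "x = \<zero>")
    case False
    then show ?thesis
      using v_mult[of "\<ominus> \<one>" x] assms \<open>\<ominus> \<one> \<noteq> \<zero>\<close> \<open>v (\<ominus> \<one>) = 0\<close> by (simp add: l_minus)
  qed simp
qed

text \<open>\<open>vge\<close> and \<open>vgt\<close> treat the value of 0 as infinite, which
  compensates for the convention \<open>v \<zero> = 0\<close>.\<close>

definition vge :: "'a set lexprod \<Rightarrow> 'a \<Rightarrow> bool" where "vge \<gamma> x \<longleftrightarrow> x = \<zero> \<or> \<gamma> \<le> v x"
definition vgt :: "'a set lexprod \<Rightarrow> 'a \<Rightarrow> bool" where "vgt \<gamma> x \<longleftrightarrow> x = \<zero> \<or> \<gamma> < v x"

lemma vge_VR: "x \<in> carrier K ==> x \<in> VR \<longleftrightarrow> vge 0 x"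
  by (simp add: VR_iff vge_def)

lemma v_plus_min:
  assumes "x \<in> carrier K" "x \<noteq> \<zero>" "y \<in> carrier K" "y \<noteq> \<zero>" "x \<oplus> y \<noteq> \<zero>" "v x \<le> v y"
  shows "v x \<le> v (x \<oplus> y)"
proof -
  have "(x \<oplus> y) \<otimes> inv x = \<one> \<oplus> y \<otimes> inv x"
    using assms inv_nonzero[of x] by (simp add: l_distr)
  moreover have "y \<otimes> inv x \<in> VR" using assms by (simp add: v_le_iff)
  ultimately have "(x \<oplus> y) \<otimes> inv x \<in> VR" by simp
  then show ?thesis using assms by (simp add: v_le_iff)
qed

lemma vgt_plus:
  assumes "x \<in> carrier K" "y \<in> carrier K" "vgt \<gamma> x" "vgt \<gamma> y" shows "vgt \<gamma> (x \<oplus> y)"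
proof (cases "x = \<zero> \<or> y = \<zero> \<or> x \<oplus> y = \<zero>")
  case False
  then have ne: "x \<noteq> \<zero>" "y \<noteq> \<zero>" "x \<oplus> y \<noteq> \<zero>" "y \<oplus> x \<noteq> \<zero>" and \<gamma>: "\<gamma> < v x" "\<gamma> < v y"
    using assms by (auto simp: vgt_def a_comm)
  have "v x \<le> v (x \<oplus> y) \<or> v y \<le> v (x \<oplus> y)"
    using v_plus_min[OF assms(1) ne(1) assms(2) ne(2,3)] v_plus_min[OF assms(2) ne(2) assms(1) ne(1,4)]
      linear[of "v x" "v y"] a_comm[OF assms(1,2)] by auto
  then have "\<gamma> < v (x \<oplus> y)" using \<gamma> by (meson order_trans order_less_le_trans)
  then show ?thesis by (simp add: vgt_def)
qed (use assms in \<open>auto simp: vgt_def\<close>)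

lemma vge_uminus: "x \<in> carrier K ==> vge \<gamma> (\<ominus> x) \<longleftrightarrow> vge \<gamma> x"
  and vgt_uminus: "x \<in> carrier K ==> vgt \<gamma> (\<ominus> x) \<longleftrightarrow> vgt \<gamma> x"
  by (auto simp: vge_def vgt_def v_uminus)

text \<open>If the value of the sum exceeded \<open>v x\<close>, subtracting \<open>y\<close> again
  would give \<open>x\<close> a value above its own.\<close>

lemma v_plus_dominant:
  assumes x: "x \<in> carrier K" "x \<noteq> \<zero>" and y: "y \<in> carrier K" and "vgt (v x) y"
  shows "x \<oplus> y \<noteq> \<zero>" "v (x \<oplus> y) = v x"
proof -
  show ne: "x \<oplus> y \<noteq> \<zero>"
  proof
    assume "x \<oplus> y = \<zero>"
    then have "y = \<ominus> x" using x y by (simp add: minus_equality[symmetric] a_comm)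
    then show False using assms vgt_uminus[OF x(1)] by (simp add: vgt_def)
  qed
  show "v (x \<oplus> y) = v x"
  proof (cases "y = \<zero>")
    case False
    then have lt: "v x < v y" using assms(4) by (simp add: vgt_def)
    then have "v x \<le> v (x \<oplus> y)" using v_plus_min[OF x y False ne] by simp
    moreover have "\<not> v x < v (x \<oplus> y)"
    proof
      assume "v x < v (x \<oplus> y)"
      then have "vgt (v x) ((x \<oplus> y) \<oplus> \<ominus> y)"
        using vgt_plus[of "x \<oplus> y" "\<ominus> y"] vgt_uminus[of y] x y assms(4) by (simp add: vgt_def)
      moreover have "(x \<oplus> y) \<oplus> \<ominus> y = x" using x y by (simp add: a_assoc r_neg)
      ultimately show False using x by (simp add: vgt_def)
    qed
    ultimately show ?thesis by order
  qed (use x in simp)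
qed

lemma v_minus_dominant:
  assumes "x \<in> carrier K" "c \<in> carrier K"
  shows "x \<noteq> \<zero> ==> vgt (v x) c ==> x \<ominus> c \<noteq> \<zero> \<and> v (x \<ominus> c) = v x"
    and "c \<noteq> \<zero> ==> vgt (v c) x ==> x \<ominus> c \<noteq> \<zero> \<and> v (x \<ominus> c) = v c"
proof -
  show "x \<ominus> c \<noteq> \<zero> \<and> v (x \<ominus> c) = v x" if "x \<noteq> \<zero>" "vgt (v x) c"
    using v_plus_dominant[of x "\<ominus> c"] assms that by (simp add: a_minus_def vgt_uminus)
  show "x \<ominus> c \<noteq> \<zero> \<and> v (x \<ominus> c) = v c" if "c \<noteq> \<zero>" "vgt (v c) x"
  proof -
    have "\<ominus> c \<noteq> \<zero>" using assms(2) that(1) by (metis minus_minus minus_zero)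
    then show ?thesis
      using v_plus_dominant[of "\<ominus> c" x] assms that by (simp add: a_minus_def v_uminus a_comm)
  qed
qed

section \<open>From balls to cells of values and to residue classes\<close>

lemma is_ball_iff:
  "is_ball M B \<longleftrightarrow> (\<exists>c\<in>carrier K. \<exists>g\<in>carrier K - {\<zero>}.
     B = {x \<in> carrier K. vge (v g) (x \<ominus> c)} \<or> B = {x \<in> carrier K. vgt (v g) (x \<ominus> c)})"
proof -
  have "vle M (Some (gval M g)) (val M z) \<longleftrightarrow> vge (v g) z"
    "vless M (Some (gval M g)) (val M z) \<longleftrightarrow> vgt (v g) z"
    if "g \<in> carrier K - {\<zero>}" "z \<in> carrier K" for g z
    using that by (auto simp: val_def K[symmetric] vge_def vgt_def vless_def v_def emb_le gval_closed not_le[symmetric])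
  then have "{x \<in> carrier K. vle M (Some (gval M g)) (val M (x \<ominus> c))} = {x \<in> carrier K. vge (v g) (x \<ominus> c)}"
    "{x \<in> carrier K. vless M (Some (gval M g)) (val M (x \<ominus> c))} = {x \<in> carrier K. vgt (v g) (x \<ominus> c)}"
    if "g \<in> carrier K - {\<zero>}" "c \<in> carrier K" for g c
    using that by auto
  then show ?thesis
    unfolding is_ball_def by (simp add: carrier_valgroup univ_M K[symmetric])
qed

abbreviation \<Gamma> :: "'a set lexprod set" where "\<Gamma> \<equiv> v ` carrier K"

text \<open>Unless \<open>v x = v c\<close>, the value of \<open>x \<ominus> c\<close> is the
  smaller of \<open>v x\<close> and \<open>v c\<close>, or just \<open>v x\<close> for
  \<open>c = \<zero>\<close>. Membership in a ball around \<open>c\<close> is therefore decided by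
  the position of \<open>v x\<close> relative to \<open>v c\<close> and the radius.\<close>

lemma ball_combination_cells:
  assumes "S \<in> ball_combinations M"
  shows "\<exists>B\<subseteq>\<Gamma>. finite B \<and> (\<forall>x\<in>carrier K - {\<zero>}. \<forall>y\<in>carrier K - {\<zero>}.
    v x \<notin> B \<and> v y \<notin> B \<and> (\<forall>b\<in>B. b < v x \<longleftrightarrow> b < v y) \<longrightarrow> (x \<in> S \<longleftrightarrow> y \<in> S))"
  using assms
proof induction
  case (ball B)
  then obtain c g where cg: "c \<in> carrier K" "g \<in> carrier K"
    "B = {x \<in> carrier K. vge (v g) (x \<ominus> c)} \<or> B = {x \<in> carrier K. vgt (v g) (x \<ominus> c)}"
    unfolding is_ball_iff by blast
  obtain r where r: "r = (\<le>) \<or> r = (<)" "B = {x \<in> carrier K. x \<ominus> c = \<zero> \<or> r (v g) (v (x \<ominus> c))}"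
    using cg(3) unfolding vge_def vgt_def by blast
  have mem: "x \<in> B \<longleftrightarrow> r (v g) (if c = \<zero> \<or> v x < v c then v x else v c)"
    if "x \<in> carrier K" "x \<noteq> \<zero>" "v x \<noteq> v c" for x
  proof -
    have "x \<ominus> c \<noteq> \<zero> \<and> v (x \<ominus> c) = (if c = \<zero> \<or> v x < v c then v x else v c)"
    proof (cases "c = \<zero> \<or> v x < v c")
      case True
      then have "vgt (v x) c" by (auto simp: vgt_def)
      then show ?thesis using v_minus_dominant(1)[OF that(1) cg(1) that(2)] True by simp
    next
      case False
      then have "v c < v x" using that(3) by (auto simp: order_le_less not_less)
      then have "vgt (v c) x" by (auto simp: vgt_def)
      then show ?thesis using v_minus_dominant(2)[OF that(1) cg(1)] False by simp
    qed
    then show ?thesis using that(1) by (simp add: r(2))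
  qed
  have cut: "(a < d \<longleftrightarrow> b < d) \<and> (r d a \<longleftrightarrow> r d b)"
    if "a \<noteq> d" "b \<noteq> d" "d < a \<longleftrightarrow> d < b" for a b d
  proof -
    have "a < d \<longleftrightarrow> \<not> d < a" "b < d \<longleftrightarrow> \<not> d < b" "d \<le> a \<longleftrightarrow> d < a" "d \<le> b \<longleftrightarrow> d < b"
      using that(1,2) by (auto simp: not_less order_le_less)
    then show ?thesis using that(3) r(1) by auto
  qed
  have "x \<in> B \<longleftrightarrow> y \<in> B"
    if xy: "x \<in> carrier K" "x \<noteq> \<zero>" "y \<in> carrier K" "y \<noteq> \<zero>" "v x \<noteq> v c" "v x \<noteq> v g" "v y \<noteq> v c" "v y \<noteq> v g"
      "v c < v x \<longleftrightarrow> v c < v y" "v g < v x \<longleftrightarrow> v g < v y" for x y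
    using mem[OF xy(1,2,5)] mem[OF xy(3,4,7)] cut[OF xy(5,7,9)] cut[OF xy(6,8,10)] by simp
  then show ?case using cg(1,2) by (intro exI[of _ "{v c, v g}"]) simp
next
  case (point a)
  then show ?case by (intro exI[of _ "{v a}"]) (auto simp: univ_M)
next
  case (compl S)
  then show ?case by (auto simp: univ_M)
next
  case (union S S')
  obtain B where B: "B \<subseteq> \<Gamma>" "finite B" "\<And>x y. x \<in> carrier K - {\<zero>} ==> y \<in> carrier K - {\<zero>} ==>
    v x \<notin> B \<and> v y \<notin> B \<and> (\<forall>b\<in>B. b < v x \<longleftrightarrow> b < v y) ==> (x \<in> S \<longleftrightarrow> y \<in> S)"
    using union.IH(1) by blast
  obtain B' where B': "B' \<subseteq> \<Gamma>" "finite B'" "\<And>x y. x \<in> carrier K - {\<zero>} ==> y \<in> carrier K - {\<zero>} ==>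
    v x \<notin> B' \<and> v y \<notin> B' \<and> (\<forall>b\<in>B'. b < v x \<longleftrightarrow> b < v y) ==> (x \<in> S' \<longleftrightarrow> y \<in> S')"
    using union.IH(2) by blast
  show ?case
  proof (intro exI[of _ "B \<union> B'"] conjI ballI impI)
    show "x \<in> S \<union> S' \<longleftrightarrow> y \<in> S \<union> S'"
      if "x \<in> carrier K - {\<zero>}" "y \<in> carrier K - {\<zero>}"
        "v x \<notin> B \<union> B' \<and> v y \<notin> B \<union> B' \<and> (\<forall>b\<in>B \<union> B'. b < v x \<longleftrightarrow> b < v y)" for x y
      using B(3)[OF that(1,2)] B'(3)[OF that(1,2)] that(3) by auto
  qed (use B B' in auto)
qed

text \<open>For a centre \<open>c\<close> in the valuation ring, \<open>x \<ominus> c\<close> has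
  value 0 off the residue class of \<open>c\<close>; for a centre outside the ring it has value
  \<open>v c\<close> throughout. So a ball is constant on the ring off at most one residue
  class.\<close>

lemma ball_combination_residues:
  assumes "S \<in> ball_combinations M"
  shows "\<exists>E\<subseteq>VR. finite E \<and> (\<forall>x\<in>VR. \<forall>y\<in>VR. (\<forall>e\<in>E. \<not> vgt 0 (x \<ominus> e) \<and> \<not> vgt 0 (y \<ominus> e)) \<longrightarrow>
    (x \<in> S \<longleftrightarrow> y \<in> S))"
  using assms
proof induction
  case (ball B)
  then obtain c g where cg: "c \<in> carrier K" "g \<in> carrier K"
    "B = {x \<in> carrier K. vge (v g) (x \<ominus> c)} \<or> B = {x \<in> carrier K. vgt (v g) (x \<ominus> c)}"
    unfolding is_ball_iff by blast
  obtain r where r: "B = {x \<in> carrier K. x \<ominus> c = \<zero> \<or> r (v g) (v (x \<ominus> c))}"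
    using cg(3) unfolding vge_def vgt_def by blast
  show ?case
  proof (cases "c \<in> VR")
    case True
    have val: "x \<ominus> c \<noteq> \<zero> \<and> v (x \<ominus> c) = 0" if "x \<in> VR" "\<not> vgt 0 (x \<ominus> c)" for x
      using that True VR_iff[of "x \<ominus> c"] VR_K by (auto simp: vgt_def order_le_less)
    have "x \<in> B \<longleftrightarrow> r (v g) 0" if "x \<in> VR" "\<not> vgt 0 (x \<ominus> c)" for x
      using val[OF that] VR_K[OF that(1)] by (simp add: r)
    then show ?thesis using True by (intro exI[of _ "{c}"]) simp
  next
    case False
    have val: "x \<ominus> c \<noteq> \<zero> \<and> v (x \<ominus> c) = v c" if "x \<in> VR" for x
    proof -
      have c: "c \<noteq> \<zero>" "v c < 0" using False VR_iff[OF cg(1)] by (auto simp: not_le)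
      have "x = \<zero> \<or> 0 \<le> v x" using VR_iff[OF VR_K[OF that]] that by simp
      then have "vgt (v c) x" using c(2) by (auto simp: vgt_def)
      then show ?thesis using v_minus_dominant(2)[OF VR_K[OF that] cg(1) c(1)] by simp
    qed
    have "x \<in> B \<longleftrightarrow> r (v g) (v c)" if "x \<in> VR" for x
      using val[OF that] VR_K[OF that] by (simp add: r)
    then show ?thesis by (intro exI[of _ "{}"]) simp
  qed
next
  case (point a)
  have "x \<noteq> a" if "x \<in> VR" "\<forall>e\<in>{a} \<inter> VR. \<not> vgt 0 (x \<ominus> e)" for x
  proof
    assume "x = a"
    then have "\<not> vgt 0 (x \<ominus> x)" using that by blast
    then show False using VR_K[OF that(1)] by (simp add: vgt_def)
  qed
  then have ne: "x \<notin> {a}" if "x \<in> VR" "\<forall>e\<in>{a} \<inter> VR. \<not> vgt 0 (x \<ominus> e)" for x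
    using that by simp
  show ?case
  proof (intro exI[of _ "{a} \<inter> VR"] conjI ballI impI)
    show "(x \<in> {a}) = (y \<in> {a})"
      if "x \<in> VR" "y \<in> VR" "\<forall>e\<in>{a} \<inter> VR. \<not> vgt 0 (x \<ominus> e) \<and> \<not> vgt 0 (y \<ominus> e)" for x y
    proof -
      have "x \<notin> {a}" by (rule ne[OF that(1)]) (use that(3) in blast)
      moreover have "y \<notin> {a}" by (rule ne[OF that(2)]) (use that(3) in blast)
      ultimately show ?thesis by simp
    qed
  qed auto
next
  case (compl S)
  then obtain E where E: "E \<subseteq> VR" "finite E" "\<And>x y. x \<in> VR ==> y \<in> VR ==>
    (\<forall>e\<in>E. \<not> vgt 0 (x \<ominus> e) \<and> \<not> vgt 0 (y \<ominus> e)) ==> (x \<in> S \<longleftrightarrow> y \<in> S)" by blast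
  show ?case
  proof (intro exI[of _ E] conjI ballI impI E(1,2))
    show "x \<in> univ M - S \<longleftrightarrow> y \<in> univ M - S"
      if "x \<in> VR" "y \<in> VR" "\<forall>e\<in>E. \<not> vgt 0 (x \<ominus> e) \<and> \<not> vgt 0 (y \<ominus> e)" for x y
      using E(3)[OF that] VR_K[OF that(1)] VR_K[OF that(2)] by (simp add: univ_M)
  qed
next
  case (union S S')
  obtain B where B: "B \<subseteq> VR" "finite B" "\<And>x y. x \<in> VR ==> y \<in> VR ==>
    (\<forall>e\<in>B. \<not> vgt 0 (x \<ominus> e) \<and> \<not> vgt 0 (y \<ominus> e)) ==> (x \<in> S \<longleftrightarrow> y \<in> S)"
    using union.IH(1) by blast
  obtain B' where B': "B' \<subseteq> VR" "finite B'" "\<And>x y. x \<in> VR ==> y \<in> VR ==>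
    (\<forall>e\<in>B'. \<not> vgt 0 (x \<ominus> e) \<and> \<not> vgt 0 (y \<ominus> e)) ==> (x \<in> S' \<longleftrightarrow> y \<in> S')"
    using union.IH(2) by blast
  show ?case
  proof (intro exI[of _ "B \<union> B'"] conjI ballI impI)
    show "x \<in> S \<union> S' \<longleftrightarrow> y \<in> S \<union> S'"
      if "x \<in> VR" "y \<in> VR" "\<forall>e\<in>B \<union> B'. \<not> vgt 0 (x \<ominus> e) \<and> \<not> vgt 0 (y \<ominus> e)" for x y
      using B(3)[OF that(1,2)] B'(3)[OF that(1,2)] that(3) by auto
  qed (use B B' in auto)
qed

lemma definable_ball_combination:
  assumes "Df (\<lambda>E. Q (E 0))" shows "{x \<in> carrier K. Q x} \<in> ball_combinations M"
proof (rule c_minimal)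
  show "{x \<in> carrier K. Q x} \<subseteq> univ M" by (auto simp: univ_M)
  show "definable (vf_lang L) M 1 ((\<lambda>x. [x]) ` {x \<in> carrier K. Q x})"
  proof (rule definable_of_dfn[OF assms])
    show "univ M \<noteq> {}" using univ_M by auto
    show "(\<lambda>x. [x]) ` {x \<in> carrier K. Q x} \<subseteq> tuples 1 (univ M)" by (auto simp: tuples_def univ_M)
    show "map e [0..<1] \<in> (\<lambda>x. [x]) ` {x \<in> carrier K. Q x} \<longleftrightarrow> Q (e 0)" if "range e \<subseteq> univ M" for e
      using that by (auto simp: univ_M image_iff)
  qed
qed

lemma Df_v_le: "tm s ==> tm u ==> Df (\<lambda>E. v (s E) \<le> v (u E))"
proof (rule D_comp2[where R = "\<lambda>x y. v x \<le> v y"])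
  have "Df (\<lambda>E. nz (E 1) \<otimes> ninv (E 0) \<in> VR)" by (intro Df_VR tm_K_intros)
  then show "Df (\<lambda>E. v (E 0) \<le> v (E 1))"
  proof (rule D_cong)
    fix E :: "nat \<Rightarrow> 'a" assume "range E \<subseteq> carrier K"
    then show "nz (E 1) \<otimes> ninv (E 0) \<in> VR \<longleftrightarrow> v (E 0) \<le> v (E 1)"
      using v_le_iff[of "nz (E 0)" "nz (E 1)"] by (auto simp: ninv_def image_subset_iff)
  qed
qed

lemma Df_v_less: "tm s ==> tm u ==> Df (\<lambda>E. v (s E) < v (u E))"
  using D_not[OF Df_v_le[of u s]] by (simp add: not_le)

lemma Df_v_eq: "tm s ==> tm u ==> Df (\<lambda>E. v (s E) = v (u E))"
  using D_conj[OF Df_v_le[of s u] Df_v_le[of u s]] by (simp add: order_eq_iff)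

lemma sqrt_exists:
  assumes "a \<in> carrier K" shows "\<exists>x\<in>carrier K. x \<otimes> x = a"
  using nth_root[of 2 a] assms by (auto simp: numeral_2_eq_2)

text \<open>A predicate on values counts as definable if its pullback along \<open>v\<close> is.
  O-minimality comes from C-minimality by \<open>ball_combination_cells\<close>, and halves come
  from square roots.\<close>

sublocale G: ominimal_group \<Gamma> "\<lambda>P. Df (\<lambda>e. P (\<lambda>i. v (e i)))"
proof
  show "Df (\<lambda>e. P' (\<lambda>i. v (e i)))" if "Df (\<lambda>e. P (\<lambda>i. v (e i)))"
    "\<And>E. range E \<subseteq> \<Gamma> ==> P E \<longleftrightarrow> P' E" for P P'
    by (rule D_cong[OF that(1)], rule that(2)) auto
  show "Df (\<lambda>e. \<not> P (\<lambda>i. v (e i)))" if "Df (\<lambda>e. P (\<lambda>i. v (e i)))" for P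
    using that by (rule D_not)
  show "Df (\<lambda>e. P (\<lambda>i. v (e i)) \<and> P' (\<lambda>i. v (e i)))"
    if "Df (\<lambda>e. P (\<lambda>i. v (e i)))" "Df (\<lambda>e. P' (\<lambda>i. v (e i)))" for P P'
    using that by (rule D_conj)
  show "Df (\<lambda>e. \<exists>x\<in>\<Gamma>. R (\<lambda>i. v (e i)) x)" if "Df (\<lambda>e. R (\<lambda>i. v (e (Suc i))) (v (e 0)))"
    for R :: "(nat \<Rightarrow> 'a set lexprod) \<Rightarrow> 'a set lexprod \<Rightarrow> bool"
    using D_ex[of "\<lambda>e x. R (\<lambda>i. v (e i)) (v x)"] that by simp
  show "Df (\<lambda>e. P (\<lambda>i. v (e (f i))))" if "Df (\<lambda>e. P (\<lambda>i. v (e i)))" for P and f :: "nat \<Rightarrow> nat"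
    using D_subst[OF that] .
  show "Df (\<lambda>e. v (e 0) = v (e 1))" by (intro Df_v_eq tm_var)
  show "Df (\<lambda>e. v (e 0) = c)" if c: "c \<in> \<Gamma>" for c
  proof -
    obtain a where "a \<in> carrier K" "c = v a" using c by blast
    then show ?thesis using Df_v_eq[OF tm_var tm_const] by simp
  qed
  show "0 \<in> \<Gamma>" using v_one by (metis imageI one_closed)
  have nzG: "\<exists>a. a \<in> carrier K \<and> a \<noteq> \<zero> \<and> x = v a" if "x \<in> \<Gamma>" for x
    using that v_nz nz_nonzero nz_closed by (metis imageE)
  show "x + y \<in> \<Gamma>" if "x \<in> \<Gamma>" "y \<in> \<Gamma>" for x y
    using nzG[OF that(1)] nzG[OF that(2)] v_mult m_closed by (metis imageI)
  show "- x \<in> \<Gamma>" if "x \<in> \<Gamma>" for x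
    using nzG[OF that(1)] v_inv inv_nonzero(1) by (metis imageI)
  show "\<exists>x\<in>\<Gamma>. x \<noteq> 0"
  proof -
    obtain a where "a \<in> carrier K" "a \<notin> VR" using VR_neq VR_K by blast
    then show ?thesis using VR_iff[of a] by force
  qed
  show "\<exists>y\<in>\<Gamma>. y + y = x" if x: "x \<in> \<Gamma>" for x
  proof -
    obtain a where a: "a \<in> carrier K" "a \<noteq> \<zero>" "x = v a" using nzG[OF x] by blast
    obtain b where b: "b \<in> carrier K" "b \<otimes> b = a" using sqrt_exists[OF a(1)] by blast
    then have "v b + v b = x" using v_mult[of b b] a b(1) by (metis l_null)
    then show ?thesis using b(1) by blast
  qed
  show "Df (\<lambda>e. v (e 0) \<le> v (e 1))" by (intro Df_v_le tm_var)
  have "Df (\<lambda>e. v (e 0) = v (nz (e 1) \<otimes> nz (e 2)))" by (intro Df_v_eq tm_K_intros)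
  then show "Df (\<lambda>e. v (e 0) = v (e 1) + v (e 2))"
    by (rule D_cong) (auto simp: v_mult image_subset_iff)
  show "\<exists>B\<subseteq>\<Gamma>. finite B \<and> (\<forall>x\<in>\<Gamma> - B. \<forall>y\<in>\<Gamma> - B. (\<forall>b\<in>B. b < x \<longleftrightarrow> b < y) \<longrightarrow> Q x = Q y)"
    if DQ: "Df (\<lambda>e. Q (v (e 0)))" for Q
  proof -
    obtain B where B: "B \<subseteq> \<Gamma>" "finite B" "\<forall>x\<in>carrier K - {\<zero>}. \<forall>y\<in>carrier K - {\<zero>}.
        v x \<notin> B \<and> v y \<notin> B \<and> (\<forall>b\<in>B. b < v x \<longleftrightarrow> b < v y) \<longrightarrow>
        (x \<in> {x \<in> carrier K. Q (v x)} \<longleftrightarrow> y \<in> {x \<in> carrier K. Q (v x)})"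
      using ball_combination_cells[OF definable_ball_combination[of "\<lambda>x. Q (v x)", OF DQ]] by blast
    have "Q x = Q y" if xy: "x \<in> \<Gamma>" "x \<notin> B" "y \<in> \<Gamma>" "y \<notin> B" "\<forall>b\<in>B. b < x \<longleftrightarrow> b < y" for x y
    proof -
      obtain a where a: "a \<in> carrier K" "a \<noteq> \<zero>" "x = v a" using nzG[OF xy(1)] by blast
      obtain b where b: "b \<in> carrier K" "b \<noteq> \<zero>" "y = v b" using nzG[OF xy(3)] by blast
      have ab: "a \<in> carrier K - {\<zero>}" "b \<in> carrier K - {\<zero>}" using a b by auto
      have "v a \<notin> B \<and> v b \<notin> B \<and> (\<forall>c\<in>B. c < v a \<longleftrightarrow> c < v b)" using xy a(3) b(3) by (intro conjI) simp_all
      with bspec[OF bspec[OF B(3) ab(1)] ab(2)]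
      have "a \<in> {x \<in> carrier K. Q (v x)} \<longleftrightarrow> b \<in> {x \<in> carrier K. Q (v x)}" by (rule mp)
      then show ?thesis using a b by simp
    qed
    then show ?thesis using B(1,2) by blast
  qed
qed

end

section \<open>The residue field\<close>

context acvf
begin

lemma maxideal_iff: "x \<in> maxideal M \<longleftrightarrow> x \<in> VR \<and> vgt 0 x"
proof -
  have "x \<in> VR ==> x \<notin> UR \<longleftrightarrow> vgt 0 x"
    using UR_v[OF VR_K, of x] VR_iff[OF VR_K, of x] by (auto simp: vgt_def order_le_less)
  then show ?thesis by (auto simp: maxideal_def)
qed

lemma UR_VR: "x \<in> UR ==> x \<in> VR"
  by (simp add: UR_iff)

lemma UR_K:
  assumes "x \<in> UR" shows "x \<in> carrier K" "x \<noteq> \<zero>" "v x = 0"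
proof -
  show "x \<in> carrier K" by (rule VR_K[OF UR_VR[OF assms]])
  then show "x \<noteq> \<zero>" "v x = 0" using UR_v[of x] assms by simp_all
qed

lemma UR_mult: assumes "x \<in> UR" "y \<in> UR" shows "x \<otimes> y \<in> UR"
  using UR_K[OF assms(1)] UR_K[OF assms(2)] UR_v[of "x \<otimes> y"] by (simp add: v_mult integral_iff)

lemma UR_inv: assumes "x \<in> UR" shows "inv x \<in> UR"
  using UR_v[of "inv x"] UR_K[OF assms] inv_nonzero[of x] v_inv[of x] by simp

lemma UR_one: "\<one> \<in> UR"
  using UR_v[of \<one>] by simp

lemma UR_pow: "x \<in> UR ==> x [^] (n :: nat) \<in> UR"
  by (induction n) (simp_all add: UR_one UR_mult)

lemma vgt_mult:
  assumes "x \<in> carrier K" "y \<in> carrier K" "vgt 0 x" "vge 0 y" shows "vgt 0 (x \<otimes> y)"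
proof (cases "x = \<zero> \<or> y = \<zero>")
  case False
  then have "0 < v x + v y" using assms by (auto simp: vgt_def vge_def intro: add_pos_nonneg)
  then show ?thesis using False assms(1,2) by (simp add: vgt_def v_mult)
qed (use assms in \<open>auto simp: vgt_def\<close>)

lemma valring_ops: "carrier (valring M) = VR" "monoid.mult (valring M) = monoid.mult K"
  "one (valring M) = \<one>" "\<zero>\<^bsub>valring M\<^esub> = \<zero>" "ring.add (valring M) = ring.add K"
  by (simp_all add: valring_def K)

lemma cring_valring: "cring (valring M)"
  using subring_is_domain[OF subring_VR] by (simp add: valring_def K[symmetric] domain_def)

lemma res_eq: "res M x = (\<lambda>h. h \<oplus> x) ` maxideal M"
  by (auto simp: res_def a_r_coset_def r_coset_def valring_ops)

lemma ideal_maxideal: "maximalideal (maxideal M) (valring M)"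
proof -
  interpret V: cring "valring M" by (rule cring_valring)
  have plus: "vgt 0 (x \<oplus> y)" if "x \<in> VR" "y \<in> VR" "vgt 0 x" "vgt 0 y" for x y
    using vgt_plus[OF VR_K[OF that(1)] VR_K[OF that(2)]] that(3,4) .
  have uminus: "\<ominus>\<^bsub>valring M\<^esub> x = \<ominus> x" if "x \<in> VR" for x
    using that VR_K[OF that] V.minus_equality[of "\<ominus> x" x] by (simp add: valring_ops l_neg)
  have mult: "vgt 0 (a \<otimes> x)" "vgt 0 (x \<otimes> a)" if "a \<in> VR" "vgt 0 a" "x \<in> VR" for a x
    using vgt_mult[OF VR_K[OF that(1)] VR_K[OF that(3)] that(2)] vge_VR[OF VR_K[OF that(3)]]
      m_comm[OF VR_K[OF that(1)] VR_K[OF that(3)]] that(3) by simp_all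
  have "subgroup (maxideal M) (add_monoid (valring M))"
  proof (rule V.add.subgroupI)
    show "maxideal M \<subseteq> carrier (valring M)" by (auto simp: maxideal_iff valring_ops)
    show "maxideal M \<noteq> {}" using maxideal_iff[of \<zero>] by (auto simp: vgt_def)
    show "\<ominus>\<^bsub>valring M\<^esub> a \<in> maxideal M" if "a \<in> maxideal M" for a
    proof -
      have a: "a \<in> VR" "vgt 0 a" using that by (simp_all add: maxideal_iff)
      then show ?thesis
        using uminus[OF a(1)] vgt_uminus[OF VR_K[OF a(1)]] by (simp add: maxideal_iff)
    qed
    show "a \<oplus>\<^bsub>valring M\<^esub> b \<in> maxideal M" if "a \<in> maxideal M" "b \<in> maxideal M" for a b
      using that plus by (simp add: maxideal_iff valring_ops)
  qed
  then have I: "ideal (maxideal M) (valring M)"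
    using mult by (intro idealI V.ring_axioms) (simp_all add: maxideal_iff valring_ops)
  show ?thesis
  proof (rule maximalidealI[OF I])
    have "\<one> \<notin> maxideal M" by (simp add: maxideal_iff vgt_def)
    then show "carrier (valring M) \<noteq> maxideal M" using VR_simps(2) by (metis valring_ops(1))
    fix J assume J: "ideal J (valring M)" "maxideal M \<subseteq> J" "J \<subseteq> carrier (valring M)"
    interpret J: ideal J "valring M" by (rule J(1))
    show "J = maxideal M \<or> J = carrier (valring M)"
    proof (cases "J \<subseteq> maxideal M")
      case False
      then obtain x where x: "x \<in> J" "x \<notin> maxideal M" by blast
      then have "x \<in> UR" using J(3) by (auto simp: maxideal_def valring_ops)
      then have "inv x \<otimes> x = \<one>" "inv x \<in> VR" using UR_inv UR_VR UR_K inv_nonzero[of x] by blast+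
      then have "\<one> \<in> J" using J.I_l_closed[OF x(1), of "inv x"] by (simp add: valring_ops)
      then show ?thesis using J.one_imp_carrier by (simp add: valring_ops)
    qed (use J(2) in blast)
  qed
qed

abbreviation k :: "'a set ring" where "k \<equiv> resfield M"

sublocale Q: field k
  unfolding resfield_def by (rule maximalideal.quotient_is_field[OF ideal_maxideal cring_valring])

lemma res_hom: "ring_hom_ring (valring M) k (res M)"
proof -
  interpret I: maximalideal "maxideal M" "valring M" by (rule ideal_maxideal)
  have "res M = (+>\<^bsub>valring M\<^esub>) (maxideal M)" by (rule ext) (simp add: res_def)
  then show ?thesis using I.rcos_ring_hom_ring by (simp add: resfield_def)
qed

lemma res_simps:
  assumes "x \<in> VR" "y \<in> VR"
  shows res_mult: "res M (x \<otimes> y) = res M x \<otimes>\<^bsub>k\<^esub> res M y"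
    and res_add: "res M (x \<oplus> y) = res M x \<oplus>\<^bsub>k\<^esub> res M y"
    and res_closed: "res M x \<in> carrier k"
  using ring_hom_ring.homh[OF res_hom] assms
  by (simp_all add: ring_hom_def valring_ops Pi_def)

lemma res_one: "res M \<one> = \<one>\<^bsub>k\<^esub>" and res_zero: "res M \<zero> = \<zero>\<^bsub>k\<^esub>"
proof -
  interpret h: ring_hom_ring "valring M" k "res M" by (rule res_hom)
  show "res M \<one> = \<one>\<^bsub>k\<^esub>" using h.hom_one by (simp add: valring_ops)
  show "res M \<zero> = \<zero>\<^bsub>k\<^esub>" using h.hom_zero by (simp add: valring_ops)
qed

lemma carrier_k: "carrier k = res M ` VR"
  by (auto simp: resfield_def FactRing_def A_RCOSETS_def' res_def valring_ops)

lemma res_eq_iff: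
  assumes "x \<in> VR" "y \<in> VR" shows "res M x = res M y \<longleftrightarrow> vgt 0 (x \<ominus> y)"
proof
  note xy = VR_K[OF assms(1)] VR_K[OF assms(2)]
  assume "res M x = res M y"
  moreover have "x \<in> res M x"
    unfolding res_eq using xy by (intro image_eqI[of _ _ \<zero>]) (auto simp: maxideal_iff vgt_def)
  ultimately obtain h where h: "h \<in> maxideal M" "x = h \<oplus> y" unfolding res_eq by blast
  then have "x \<ominus> y = h" using xy VR_K by (simp add: maxideal_iff a_minus_def a_assoc r_neg)
  then show "vgt 0 (x \<ominus> y)" using h(1) by (simp add: maxideal_iff)
next
  note xy = VR_K[OF assms(1)] VR_K[OF assms(2)]
  assume *: "vgt 0 (x \<ominus> y)"
  have "res M x = res M ((x \<ominus> y) \<oplus> y)" using xy by (simp add: a_minus_def a_assoc l_neg)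
  also have "\<dots> = res M (x \<ominus> y) \<oplus>\<^bsub>k\<^esub> res M y" using assms by (intro res_add) simp_all
  also have "res M (x \<ominus> y) = \<zero>\<^bsub>k\<^esub>"
  proof -
    interpret I: maximalideal "maxideal M" "valring M" by (rule ideal_maxideal)
    have "x \<ominus> y \<in> maxideal M" using * assms by (simp add: maxideal_iff)
    then have "res M (x \<ominus> y) = maxideal M"
      unfolding res_def by (rule I.a_rcos_const)
    then show ?thesis by (simp add: resfield_def FactRing_def)
  qed
  finally show "res M x = res M y" using assms(2) res_closed by simp
qed

lemma res_zero_iff: "x \<in> VR ==> res M x = \<zero>\<^bsub>k\<^esub> \<longleftrightarrow> x \<notin> UR"
  using res_eq_iff[of x \<zero>] VR_K[of x] maxideal_iff[of x] by (simp add: res_zero a_minus_def maxideal_def)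

lemma Units_k: "Units k = res M ` UR"
  using res_zero_iff UR_VR by (auto simp: Q.field_Units carrier_k)

lemma res_pow: "x \<in> VR ==> res M (x [^] (n :: nat)) = res M x [^]\<^bsub>k\<^esub> n \<and> x [^] n \<in> VR"
  by (induction n) (simp_all add: res_one res_mult)

lemma res_inv: assumes "x \<in> UR" shows "res M (inv x) = inv\<^bsub>k\<^esub> (res M x)"
proof (rule Q.comm_inv_char[symmetric])
  show "res M x \<otimes>\<^bsub>k\<^esub> res M (inv x) = \<one>\<^bsub>k\<^esub>"
    using res_mult[of x "inv x"] UR_VR UR_inv assms UR_K inv_nonzero[of x] by (simp add: res_one)
qed (use assms UR_VR UR_inv res_closed in auto)

text \<open>The reason why the valuation ring is integrally closed: at a point outside it the
  leading term dominates, so a polynomial over the ring with unit leading coefficient has no root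
  there.\<close>

lemma v_peval_neg:
  assumes x: "x \<in> carrier K" "x \<noteq> \<zero>" "v x < 0" and ds: "set ds \<subseteq> VR" "ds \<noteq> []" "last ds \<in> UR"
  shows "peval K ds x \<noteq> \<zero> \<and> v (peval K ds x) \<le> 0 \<and> (2 \<le> length ds \<longrightarrow> v (peval K ds x) < 0)"
  using ds
proof (induction ds)
  case (Cons d ds)
  show ?case
  proof (cases "ds = []")
    case True
    then show ?thesis using Cons.prems UR_K[of d] x by simp
  next
    case False
    define p where "p = peval K ds x"
    have d: "d \<in> carrier K" "vge 0 d" and "set ds \<subseteq> carrier K" using Cons.prems(1) VR_K vge_VR by auto
    then have p: "p \<in> carrier K" "p \<noteq> \<zero>" "v p \<le> 0" using Cons False x(1) by (auto simp: p_def)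
    have "v (x \<otimes> p) < 0" using x p by (simp add: v_mult add_neg_nonpos)
    moreover from this have "vgt (v (x \<otimes> p)) d" using d(2) by (auto simp: vge_def vgt_def)
    moreover have "x \<otimes> p \<in> carrier K" "x \<otimes> p \<noteq> \<zero>" using x p by (auto simp: integral_iff)
    ultimately have "x \<otimes> p \<oplus> d \<noteq> \<zero> \<and> v (x \<otimes> p \<oplus> d) < 0"
      using v_plus_dominant[of "x \<otimes> p" d] d(1) by simp
    then show ?thesis using d(1) \<open>x \<otimes> p \<in> carrier K\<close> by (auto simp: p_def[symmetric] a_comm intro: less_imp_le)
  qed
qed simp

lemma res_peval: "set ds \<subseteq> VR ==> x \<in> VR ==> res M (peval K ds x) = peval k (map (res M) ds) (res M x) \<and> peval K ds x \<in> VR"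
  by (induction ds) (auto simp: res_zero res_add res_mult)

text \<open>The coefficients are lifted to the valuation ring. A root of the lifted polynomial in
  the field lies in the ring by \<open>v_peval_neg\<close> and reduces to the desired root.\<close>

sublocale Q: root_closed_field k
proof (intro root_closed_field.intro Q.field_axioms root_closed_field_axioms.intro)
  fix cs assume cs: "set cs \<subseteq> carrier k" "last cs \<noteq> \<zero>\<^bsub>k\<^esub>" "2 \<le> length cs"
  have "\<forall>c\<in>set cs. \<exists>d\<in>VR. res M d = c" using cs(1) carrier_k by auto
  then obtain lift where lift: "\<And>c. c \<in> set cs ==> lift c \<in> VR \<and> res M (lift c) = c" by metis
  define ds where "ds = map lift cs"
  have "cs \<noteq> []" using cs(3) by auto
  have ds: "set ds \<subseteq> VR" "map (res M) ds = cs" "length ds = length cs" "ds \<noteq> []"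
    using lift \<open>cs \<noteq> []\<close> by (auto simp: ds_def intro: map_idI)
  have last: "last ds \<in> UR"
    using lift[of "last cs"] res_zero_iff[of "lift (last cs)"] cs(2) \<open>cs \<noteq> []\<close> by (simp add: ds_def last_map)
  then have "last ds \<noteq> \<zero>" by (rule UR_K)
  moreover have "set ds \<subseteq> carrier K" using ds(1) VR_K by blast
  ultimately obtain x where x: "x \<in> carrier K" "peval K ds x = \<zero>" using root[of ds] cs(3) ds(3) by auto
  have "x \<in> VR"
  proof (rule ccontr)
    assume "x \<notin> VR"
    then have "x \<noteq> \<zero>" "v x < 0" using VR_iff[OF x(1)] by (auto simp: not_le)
    then show False using v_peval_neg[OF x(1) _ _ ds(1,4) last] x(2) by blast
  qed
  then show "\<exists>x\<in>carrier k. peval k cs x = \<zero>\<^bsub>k\<^esub>"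
    using res_peval[OF ds(1) \<open>x \<in> VR\<close>] x(2) ds(2) res_zero res_closed[OF \<open>x \<in> VR\<close> \<open>x \<in> VR\<close>] by auto
qed

lemma infinite_res_VR: "infinite (res M ` VR)"
  using Q.infinite_carrier by (simp add: carrier_k)

lemma infinite_res_UR: "infinite (res M ` UR)"
  using Q.infinite_carrier by (simp add: Units_k[symmetric] Q.field_Units)

lemma Df_vgt: "tm s ==> tm u ==> Df (\<lambda>E. vgt (v (s E)) (u E))"
  unfolding vgt_def by (intro D_disj D_eq Df_v_less tm_K_intros)

lemma Df_UR: assumes "tm s" shows "Df (\<lambda>E. s E \<in> UR)"
proof -
  have "Df (\<lambda>E. \<not> s E = \<zero> \<and> v (s E) = v \<one>)"
    by (intro D_conj D_not D_eq Df_v_eq tm_K_intros assms)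
  then show ?thesis by (rule D_cong) (simp add: UR_v tm_G[OF assms])
qed

text \<open>Equality of nonzero residues, expressed on representatives to be a definable relation on
  the field. It is reflexive on units only.\<close>

definition sim :: "'a \<Rightarrow> 'a \<Rightarrow> bool" where
  "sim x y \<longleftrightarrow> x \<in> UR \<and> y \<in> UR \<and> res M x = res M y"

lemma Df_sim: assumes "tm s" "tm u" shows "Df (\<lambda>E. sim (s E) (u E))"
proof -
  have "Df (\<lambda>E. s E \<in> UR \<and> u E \<in> UR \<and> vgt (v \<one>) (s E \<ominus> u E))"
    by (intro D_conj Df_UR Df_vgt tm_K_intros assms)
  then show ?thesis by (rule D_cong) (simp add: sim_def res_eq_iff[OF UR_VR UR_VR] cong: conj_cong)
qed

lemma sim_mult: "sim x y ==> sim x' y' ==> sim (x \<otimes> x') (y \<otimes> y')"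
  by (simp add: sim_def UR_mult res_mult UR_VR)

lemma sim_pow: "sim x y ==> sim (x [^] (n :: nat)) (y [^] n)"
  by (simp add: sim_def UR_pow res_pow UR_VR)

lemma sim_inv: "sim x y ==> sim (inv x) (inv y)"
  by (simp add: sim_def UR_inv res_inv)

lemma sim_sym: "sim x y ==> sim y x"
  by (simp add: sim_def)

lemma sim_trans: "sim x y ==> sim y z ==> sim x z"
  by (simp add: sim_def)

lemma sim_refl: "x \<in> UR ==> sim x x"
  by (simp add: sim_def)

text \<open>Strong minimality of the residue field. \<open>Q\<close> need not be a union of residue
  classes, but only finitely many classes meet both \<open>Q\<close> and its complement.\<close>

lemma res_cases:
  assumes "Df (\<lambda>E. Q (E 0))"
  shows "finite (res M ` {x \<in> VR. Q x}) \<or> finite (res M ` {x \<in> VR. \<not> Q x})"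
proof -
  obtain E where E: "E \<subseteq> VR" "finite E" "\<And>x y. x \<in> VR ==> y \<in> VR ==>
    (\<forall>e\<in>E. \<not> vgt 0 (x \<ominus> e) \<and> \<not> vgt 0 (y \<ominus> e)) ==> (x \<in> {x \<in> carrier K. Q x} \<longleftrightarrow> y \<in> {x \<in> carrier K. Q x})"
    using ball_combination_residues[OF definable_ball_combination[OF assms]] by blast
  have same: "Q x \<longleftrightarrow> Q y" if xy: "x \<in> VR" "y \<in> VR" "res M x \<notin> res M ` E" "res M y \<notin> res M ` E" for x y
  proof -
    have "\<forall>e\<in>E. \<not> vgt 0 (x \<ominus> e) \<and> \<not> vgt 0 (y \<ominus> e)"
      using xy E(1) res_eq_iff by (metis image_eqI subsetD)
    from E(3)[OF xy(1,2) this] show ?thesis using VR_K[OF xy(1)] VR_K[OF xy(2)] by simp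
  qed
  have "res M ` {x \<in> VR. Q x} \<subseteq> res M ` E \<or> res M ` {x \<in> VR. \<not> Q x} \<subseteq> res M ` E"
    using same by blast
  then show ?thesis using E(2) finite_subset by blast
qed

text \<open>The filters of elements whose value tends to the lower end of \<open>J\<close>, for \<open>J\<close> the whole value
  group or its set of positive elements.\<close>

definition end_segment :: "'a set lexprod set \<Rightarrow> bool" where
  "end_segment J \<longleftrightarrow> J \<subseteq> \<Gamma> \<and> J \<noteq> {} \<and> (\<forall>h\<in>J. \<forall>g\<in>\<Gamma>. h \<le> g \<longrightarrow> g \<in> J) \<and> (\<forall>h\<in>J. \<exists>g\<in>J. g < h) \<and>
    Df (\<lambda>E. v (E 0) \<in> J)"

definition near :: "'a set lexprod set \<Rightarrow> ('a \<Rightarrow> bool) \<Rightarrow> bool" where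
  "near J P \<longleftrightarrow> (\<exists>\<gamma>\<in>J. \<forall>x\<in>carrier K. x \<noteq> \<zero> \<and> v x \<in> J \<and> v x < \<gamma> \<longrightarrow> P x)"

lemma nz_value: "\<gamma> \<in> \<Gamma> ==> \<exists>x. x \<in> carrier K \<and> x \<noteq> \<zero> \<and> v x = \<gamma>"
  using v_nz nz_nonzero nz_closed by (metis imageE)

lemma Gamma_below: assumes "h \<in> \<Gamma>" shows "\<exists>g\<in>\<Gamma>. g < h"
proof -
  obtain y where y: "y \<in> \<Gamma>" "- h < y" by (rule G.ex_greater[OF G.minus_G[OF assms]])
  then have "- y < h" by (simp add: minus_less_iff)
  then show ?thesis using G.minus_G[OF y(1)] by blast
qed

lemma end_segment_Gamma: "end_segment \<Gamma>"
proof -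
  have "Df (\<lambda>E. v (E 0) \<in> \<Gamma>)" by (rule D_cong[OF D_triv[of True]]) (simp add: image_subset_iff)
  moreover have "\<Gamma> \<noteq> {}" using G.zero_G by blast
  ultimately show ?thesis unfolding end_segment_def using Gamma_below by blast
qed

lemma end_segment_pos: "end_segment {\<gamma> \<in> \<Gamma>. 0 < \<gamma>}"
proof -
  have "Df (\<lambda>E. v \<one> < v (E 0))" by (intro Df_v_less tm_K_intros)
  then have "Df (\<lambda>E. v (E 0) \<in> {\<gamma> \<in> \<Gamma>. 0 < \<gamma>})" by (rule D_cong) (simp add: image_subset_iff)
  moreover obtain y where "y \<in> \<Gamma>" "0 < y" by (rule G.ex_greater[OF G.zero_G])
  moreover have "\<exists>g\<in>{\<gamma> \<in> \<Gamma>. 0 < \<gamma>}. g < h" if h: "h \<in> {\<gamma> \<in> \<Gamma>. 0 < \<gamma>}" for h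
  proof -
    obtain y where y: "y \<in> \<Gamma>" "y + y = h" using G.half h by blast
    have "\<not> y \<le> 0"
    proof
      assume "y \<le> 0"
      then have "y + y \<le> 0" by (intro add_nonpos_nonpos)
      then have "h \<le> 0" using y(2) by simp
      moreover have "0 < h" using h by simp
      ultimately show False using leD by blast
    qed
    then have "0 < y" by simp
    then have "y < h" unfolding y(2)[symmetric] by simp
    then show ?thesis using y(1) \<open>0 < y\<close> by blast
  qed
  moreover have "g \<in> {\<gamma> \<in> \<Gamma>. 0 < \<gamma>}" if "h \<in> {\<gamma> \<in> \<Gamma>. 0 < \<gamma>}" "g \<in> \<Gamma>" "h \<le> g" for h g
  proof -
    have "0 < h" using that(1) by simp
    then have "0 < g" using that(3) by (rule order_less_le_trans)
    then show ?thesis using that(2) by simp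
  qed
  ultimately show ?thesis unfolding end_segment_def by blast
qed

section \<open>Dichotomy and finiteness near an end of the value group\<close>

lemma near_mono: "near J P ==> (\<And>x. x \<in> carrier K ==> x \<noteq> \<zero> ==> v x \<in> J ==> P x ==> P' x) ==> near J P'"
  unfolding near_def by blast

lemma near_conj: assumes "near J P" "near J P'" shows "near J (\<lambda>x. P x \<and> P' x)"
proof -
  obtain a b where a: "a \<in> J" "\<forall>x\<in>carrier K. x \<noteq> \<zero> \<and> v x \<in> J \<and> v x < a \<longrightarrow> P x"
    and b: "b \<in> J" "\<forall>x\<in>carrier K. x \<noteq> \<zero> \<and> v x \<in> J \<and> v x < b \<longrightarrow> P' x" using assms unfolding near_def by blast
  show ?thesis unfolding near_def
    by (rule bexI[of _ "min a b"]) (use a b in \<open>auto simp: min_def\<close>)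
qed

lemma near_ex:
  assumes "end_segment J" "near J P" "\<gamma> \<in> J"
  obtains x where "x \<in> carrier K" "x \<noteq> \<zero>" "v x \<in> J" "v x < \<gamma>" "P x"
proof -
  obtain a where a: "a \<in> J" "\<forall>x\<in>carrier K. x \<noteq> \<zero> \<and> v x \<in> J \<and> v x < a \<longrightarrow> P x"
    using assms(2) unfolding near_def by blast
  have "min a \<gamma> \<in> J" using a(1) assms(3) by (simp add: min_def)
  then obtain g where g: "g \<in> J" "g < min a \<gamma>" using assms(1) unfolding end_segment_def by blast
  moreover have "g \<in> \<Gamma>" using assms(1) g(1) unfolding end_segment_def by blast
  ultimately show thesis using nz_value[of g] a(2) that by (metis min_less_iff_conj)
qed

lemma near_ball:
  assumes "finite E" "end_segment J" "\<And>e. e \<in> E ==> near J (P e)" shows "near J (\<lambda>x. \<forall>e\<in>E. P e x)"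
  using assms(1,3)
proof (induction E)
  case empty
  show ?case using assms(2) unfolding near_def end_segment_def by auto
next
  case (insert e E)
  have "near J (P e)" "near J (\<lambda>x. \<forall>e\<in>E. P e x)" using insert by simp_all
  from near_conj[OF this] show ?case by simp
qed

lemma near_cases:
  assumes J: "end_segment J" and "Df (\<lambda>E. Q (E 0))"
  shows "near J Q \<or> near J (\<lambda>x. \<not> Q x)"
proof -
  obtain B where B: "B \<subseteq> \<Gamma>" "finite B" "\<forall>x\<in>carrier K - {\<zero>}. \<forall>y\<in>carrier K - {\<zero>}.
      v x \<notin> B \<and> v y \<notin> B \<and> (\<forall>b\<in>B. b < v x \<longleftrightarrow> b < v y) \<longrightarrow> (x \<in> {x \<in> carrier K. Q x} \<longleftrightarrow> y \<in> {x \<in> carrier K. Q x})"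
    using ball_combination_cells[OF definable_ball_combination[OF assms(2)]] by blast
  have "\<exists>\<gamma>\<in>J. \<forall>b\<in>B \<inter> J. \<gamma> \<le> b"
  proof (cases "B \<inter> J = {}")
    case True
    then show ?thesis using J unfolding end_segment_def by blast
  next
    case False
    then show ?thesis using Min_in[of "B \<inter> J"] Min_le[of "B \<inter> J"] B(2) by (intro bexI[of _ "Min (B \<inter> J)"]) auto
  qed
  then obtain \<gamma> where \<gamma>: "\<gamma> \<in> J" "\<And>b. b \<in> B ==> b \<in> J ==> \<gamma> \<le> b" by blast
  \<comment> \<open>Break points outside \<open>J\<close> lie below all of \<open>J\<close>, so they
    do not separate its elements.\<close>
  have up: "b < g" if "b \<in> B" "b \<notin> J" "g \<in> J" for b g
    using J that B(1) unfolding end_segment_def by (meson not_le subsetD)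
  have same: "Q x \<longleftrightarrow> Q y"
    if x: "x \<in> carrier K" "x \<noteq> \<zero>" "v x \<in> J" "v x < \<gamma>" and y: "y \<in> carrier K" "y \<noteq> \<zero>" "v y \<in> J" "v y < \<gamma>" for x y
  proof -
    have "v x \<notin> B" "v y \<notin> B" using \<gamma>(2)[OF _ x(3)] \<gamma>(2)[OF _ y(3)] x(4) y(4) by auto
    moreover have "b < v x \<longleftrightarrow> b < v y" if "b \<in> B" for b
    proof (cases "b \<in> J")
      case True
      then have "\<not> b < v x" "\<not> b < v y" using \<gamma>(2)[OF that True] x(4) y(4) by auto
      then show ?thesis by simp
    next
      case False
      then show ?thesis using up[OF that False x(3)] up[OF that False y(3)] by simp
    qed
    ultimately have "x \<in> {x \<in> carrier K. Q x} \<longleftrightarrow> y \<in> {x \<in> carrier K. Q x}"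
      using B(3) x y by blast
    then show ?thesis using x y by simp
  qed
  show ?thesis
  proof (cases "\<exists>x\<in>carrier K. x \<noteq> \<zero> \<and> v x \<in> J \<and> v x < \<gamma> \<and> Q x")
    case True
    then obtain x where "x \<in> carrier K" "x \<noteq> \<zero>" "v x \<in> J" "v x < \<gamma>" "Q x" by blast
    then have "near J Q" unfolding near_def using same[of x] \<gamma>(1) by blast
    then show ?thesis ..
  next
    case False
    then have "near J (\<lambda>x. \<not> Q x)" unfolding near_def using \<gamma>(1) by blast
    then show ?thesis ..
  qed
qed

lemma Df_near:
  assumes "Df (\<lambda>E. R (\<lambda>i. E (Suc i)) (E 0))" "end_segment J"
  shows "Df (\<lambda>E. near J (\<lambda>x. R E x))"
proof -
  have J: "Df (\<lambda>E. v (E 0) \<in> J)" "J \<subseteq> \<Gamma>" using assms(2) unfolding end_segment_def by blast+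
  have J': "Df (\<lambda>E. v (E i) \<in> J)" for i using D_comp1[OF J(1) tm_var] .
  have R': "Df (\<lambda>E. R (\<lambda>i. E (Suc (Suc i))) (E 0))"
    using D_subst[OF assms(1), of "\<lambda>i. case i of 0 \<Rightarrow> 0 | Suc i \<Rightarrow> Suc (Suc i)"] by simp
  have "Df (\<lambda>E. \<exists>g\<in>carrier K. v g \<in> J \<and> (\<forall>x\<in>carrier K. \<not> x = \<zero> \<and> v x \<in> J \<and> v x < v g \<longrightarrow> R E x))"
    by (intro D_ex D_conj D_all D_imp D_not D_eq Df_v_less J' R' tm_K_intros)
  then show ?thesis
  proof (rule D_cong)
    fix E :: "nat \<Rightarrow> 'a"
    show "(\<exists>g\<in>carrier K. v g \<in> J \<and> (\<forall>x\<in>carrier K. \<not> x = \<zero> \<and> v x \<in> J \<and> v x < v g \<longrightarrow> R E x)) \<longleftrightarrow>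
      near J (\<lambda>x. R E x)"
      unfolding near_def using J(2) by blast
  qed
qed

text \<open>The principle \<open>finite_UN_antitone\<close> for residue classes in place of
  elements; a class has the property at a level if one of its members does.\<close>

lemma finite_res_UN:
  assumes J: "end_segment J" and DQ: "Df (\<lambda>E. Q (E 0) (v (E 1)))"
    and antitone: "\<And>d g h. d \<in> VR ==> g \<in> J ==> h \<in> J ==> h \<le> g ==> Q d g ==> Q d h"
    and fin: "\<And>g. g \<in> J ==> finite (res M ` {d \<in> VR. Q d g})"
  shows "finite (res M ` {d \<in> VR. \<exists>g\<in>J. Q d g})"
proof -
  define P where "P Z g \<longleftrightarrow> (\<exists>d\<in>VR. res M d = Z \<and> Q d g)" for Z g
  have J': "J \<subseteq> \<Gamma>" "J \<noteq> {}" "\<And>h g. h \<in> J ==> g \<in> \<Gamma> ==> h \<le> g ==> g \<in> J" "\<And>h. h \<in> J ==> \<exists>g\<in>J. g < h"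
    "Df (\<lambda>E. v (E 0) \<in> J)"
    using J unfolding end_segment_def by blast+
  have DJ: "Df (\<lambda>E. v (E i) \<in> J)" for i using D_comp1[OF J'(5) tm_var] .
  have D_P': "Df (\<lambda>E. P (res M (E i)) (v (E j)) \<and> E i \<in> VR)" for i j
  proof -
    have "Df (\<lambda>E. Q (E 0) (v (E (Suc j))))" by (rule D_comp2[OF DQ tm_var tm_var])
    then have "Df (\<lambda>E. \<exists>d\<in>carrier K. d \<in> VR \<and> E i \<in> VR \<and> vgt (v \<one>) (d \<ominus> E i) \<and> Q d (v (E j)))"
      by (intro D_ex D_conj Df_VR Df_vgt tm_K_intros)
    then show ?thesis
      by (rule D_cong) (use res_eq_iff VR_K in \<open>auto simp: P_def\<close>)
  qed
  have set_eq: "{Z \<in> res M ` VR. P Z g} = res M ` {d \<in> VR. Q d g}" for g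
    by (auto simp: P_def)
  have "finite {Z \<in> res M ` VR. \<exists>g\<in>J. P Z g}"
  proof (rule G.finite_UN_antitone[OF J'(1-4)])
    show "P Z h" if "Z \<in> res M ` VR" "g \<in> J" "h \<in> J" "h \<le> g" "P Z g" for Z h g
      using that(5) antitone[OF _ that(2,3,4)] unfolding P_def by blast
    show "Df (\<lambda>e. v (e 0) \<in> J \<and> P Z (v (e 0)))" if Z: "Z \<in> res M ` VR" for Z
    proof -
      obtain d where d: "d \<in> VR" "Z = res M d" using Z by blast
      have "Df (\<lambda>E. v (E 1) \<in> J \<and> P (res M (E 0)) (v (E 1)) \<and> E 0 \<in> VR)"
        by (intro D_conj[OF DJ D_P'])
      from D_comp2[of "\<lambda>x y. v y \<in> J \<and> P (res M x) (v y) \<and> x \<in> VR", OF this tm_const[OF VR_K[OF d(1)]] tm_var[of 0]]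
      show ?thesis using d by simp
    qed
    show "Df (\<lambda>e. \<exists>x\<in>res M ` VR. G.threshold J P x (v (e 0)))"
    proof -
      have D_P'': "Df (\<lambda>E. E i \<in> VR \<longrightarrow> P (res M (E i)) (v (E j)))" for i j
        using D_imp[OF Df_VR[OF tm_var] D_P'[of i j]] by (rule D_cong) auto
      have "Df (\<lambda>E. \<exists>d\<in>carrier K. d \<in> VR \<and> v (E 0) \<in> J \<and>
        (\<forall>h\<in>carrier K. v h \<in> J \<and> v h < v (E 0) \<longrightarrow> (d \<in> VR \<longrightarrow> P (res M d) (v h))) \<and>
        (\<forall>h\<in>carrier K. v (E 0) < v h \<longrightarrow> \<not> (P (res M d) (v h) \<and> d \<in> VR)))"
        by (intro D_ex D_conj D_all D_imp D_not Df_VR Df_v_less DJ D_P' D_P''[unfolded imp_conv_disj] D_P'' tm_K_intros)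
      then show ?thesis
        by (rule D_cong) (auto simp: G.threshold_def dest: VR_K)
    qed
    show "finite {Z \<in> res M ` VR. P Z g}" if "g \<in> J" for g
      unfolding set_eq by (rule fin[OF that])
  qed
  moreover have "{Z \<in> res M ` VR. \<exists>g\<in>J. P Z g} = res M ` {d \<in> VR. \<exists>g\<in>J. Q d g}"
    by (auto simp: P_def)
  ultimately show ?thesis by simp
qed

text \<open>Otherwise every \<open>d\<close> is avoided by all \<open>x\<close> sufficiently near
  the end of \<open>J\<close>. By \<open>finite_res_UN\<close> one level \<open>g\<close> serves
  infinitely many classes, hence all but finitely many. The remaining finitely many classes are
  avoided near the end as well, so no class is left for such \<open>x\<close>.\<close>

lemma generic_residue:
  assumes J: "end_segment J" and DR: "Df (\<lambda>E. R (E 0) (E 1))"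
    and total: "near J (\<lambda>x. \<exists>d\<in>VR. R x d)"
    and cong: "\<And>x d d'. x \<in> carrier K ==> d \<in> VR ==> d' \<in> VR ==> res M d = res M d' ==> R x d ==> R x d'"
  shows "\<exists>d\<in>VR. near J (\<lambda>x. R x d)"
proof (rule ccontr)
  assume "\<not> ?thesis"
  moreover have "near J (\<lambda>x. R x d) \<or> near J (\<lambda>x. \<not> R x d)" if "d \<in> VR" for d
    by (rule near_cases[OF J D_comp2[of R, OF DR tm_var tm_const[OF VR_K[OF that]]]])
  ultimately have no: "near J (\<lambda>x. \<not> R x d)" if "d \<in> VR" for d using that by blast
  define Q where "Q d g \<longleftrightarrow> (\<forall>x\<in>carrier K. \<not> x = \<zero> \<and> v x \<in> J \<and> v x < g \<longrightarrow> \<not> R x d)" for d g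
  have J': "J \<subseteq> \<Gamma>" "Df (\<lambda>E. v (E 0) \<in> J)" using J unfolding end_segment_def by blast+
  have DJ: "Df (\<lambda>E. v (E i) \<in> J)" for i using D_comp1[OF J'(2) tm_var] .
  have DR': "Df (\<lambda>E. R (E i) (E j))" for i j using D_comp2[OF DR tm_var tm_var] .
  have DQ: "Df (\<lambda>E. Q (E 0) (v (E 1)))"
    unfolding Q_def by (intro D_all D_imp D_conj D_not D_eq DJ DR' Df_v_less tm_K_intros)
  have "\<not> finite (res M ` {d \<in> VR. \<exists>g\<in>J. Q d g})"
  proof -
    have "{d \<in> VR. \<exists>g\<in>J. Q d g} = VR" using no unfolding near_def Q_def by blast
    then show ?thesis using infinite_res_VR by simp
  qed
  then obtain g where g: "g \<in> J" "infinite (res M ` {d \<in> VR. Q d g})"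
    using finite_res_UN[OF J DQ] unfolding Q_def by (meson order_less_le_trans)
  have "g \<in> \<Gamma>" using J'(1) g(1) by blast
  then obtain z where z: "z \<in> carrier K" "v z = g" by blast
  have "Df (\<lambda>E. Q (E 0) (v z))"
    using D_comp2[of "\<lambda>x y. Q x (v y)", OF DQ tm_var tm_const[OF z(1)]] .
  from res_cases[OF this] have "finite (res M ` {d \<in> VR. \<not> Q d g})" using g(2) z(2) by simp
  from finite_subset_image[OF this subset_refl] obtain E where E: "E \<subseteq> {d \<in> VR. \<not> Q d g}" "finite E" "res M ` {d \<in> VR. \<not> Q d g} = res M ` E"
    by blast
  have "near J (\<lambda>x. \<exists>e\<in>E. R x e)"
  proof -
    have "near J (\<lambda>x. v x < g)" unfolding near_def using g(1) by blast
    from near_conj[OF total this] show ?thesis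
    proof (rule near_mono)
      fix x assume x: "x \<in> carrier K" "x \<noteq> \<zero>" "v x \<in> J" "(\<exists>d\<in>VR. R x d) \<and> v x < g"
      then obtain d where d: "d \<in> VR" "R x d" by blast
      then have "\<not> Q d g" using x unfolding Q_def by blast
      then obtain e where e: "e \<in> E" "res M d = res M e" using E(3) d(1) by blast
      then have "R x e" using cong[OF x(1) d(1) _ e(2) d(2)] E(1) by blast
      then show "\<exists>e\<in>E. R x e" using e(1) by blast
    qed
  qed
  moreover have "near J (\<lambda>x. \<forall>e\<in>E. \<not> R x e)"
    using E(1) no by (intro near_ball[OF E(2) J]) blast
  ultimately have "near J (\<lambda>x. (\<exists>e\<in>E. R x e) \<and> (\<forall>e\<in>E. \<not> R x e))" by (rule near_conj)
  then show False using near_ex[OF J _ g(1)] by blast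
qed

text \<open>By \<open>res_cases\<close> the complement of the subgroup meets finitely many residue
  classes only. But for an \<open>a\<close> outside the subgroup it contains the coset of
  \<open>a\<close>, which meets infinitely many.\<close>

lemma subgroup_UR_all:
  assumes DB: "Df (\<lambda>E. B (E 0))" and mult: "\<And>c c'. c \<in> UR ==> c' \<in> UR ==> B c ==> B c' ==> B (c \<otimes> c')"
    and inv: "\<And>c. c \<in> UR ==> B c ==> B (inv c)"
    and inf: "infinite (res M ` {c \<in> UR. B c})" and a: "a \<in> UR"
  shows "B a"
proof (rule ccontr)
  assume "\<not> B a"
  have "Df (\<lambda>E. E 0 \<in> UR \<and> B (E 0))" by (intro D_conj Df_UR DB tm_var)
  from res_cases[OF this] have "finite (res M ` {c \<in> VR. c \<in> UR \<and> B c}) \<or> finite (res M ` {c \<in> VR. \<not> (c \<in> UR \<and> B c)})" .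
  moreover have "{c \<in> VR. c \<in> UR \<and> B c} = {c \<in> UR. B c}" using UR_VR by blast
  ultimately have fin: "finite (res M ` {c \<in> VR. \<not> (c \<in> UR \<and> B c)})" using inf by simp
  have "res M c \<in> (\<lambda>Z. res M (inv a) \<otimes>\<^bsub>k\<^esub> Z) ` res M ` {c \<in> VR. \<not> (c \<in> UR \<and> B c)}" if c: "c \<in> UR" "B c" for c
  proof -
    have "\<not> B (a \<otimes> c)"
    proof
      assume "B (a \<otimes> c)"
      then have "B ((a \<otimes> c) \<otimes> inv c)" using mult[OF UR_mult[OF a c(1)] UR_inv[OF c(1)] _ inv[OF c]] by simp
      then show False using \<open>\<not> B a\<close> UR_K[OF a] UR_K[OF c(1)] inv_nonzero[of c] by (simp add: m_assoc)
    qed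
    then have "a \<otimes> c \<in> {c \<in> VR. \<not> (c \<in> UR \<and> B c)}" using UR_VR[OF UR_mult[OF a c(1)]] by simp
    moreover have "res M c = res M (inv a) \<otimes>\<^bsub>k\<^esub> res M (a \<otimes> c)"
    proof -
      have "inv a \<otimes> (a \<otimes> c) = c" using UR_K[OF a] UR_K[OF c(1)] inv_nonzero[of a] by (simp add: m_assoc[symmetric])
      then show ?thesis using res_mult[OF UR_VR[OF UR_inv[OF a]] UR_VR[OF UR_mult[OF a c(1)]]] by simp
    qed
    ultimately show ?thesis by blast
  qed
  then have "res M ` {c \<in> UR. B c} \<subseteq> (\<lambda>Z. res M (inv a) \<otimes>\<^bsub>k\<^esub> Z) ` res M ` {c \<in> VR. \<not> (c \<in> UR \<and> B c)}" by blast
  then show False using inf finite_subset[OF _ finite_imageI[OF fin]] by blast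
qed

text \<open>The subgroups grow as \<open>g\<close> decreases, and together they exhaust the units.
  By \<open>finite_res_UN\<close> one of them has infinitely many residues, so it is
  everything.\<close>

lemma subgroup_UR_family:
  assumes DB: "Df (\<lambda>E. B (E 0) (v (E 1)))"
    and antitone: "\<And>c g h. c \<in> UR ==> g \<in> \<Gamma> ==> h \<in> \<Gamma> ==> h \<le> g ==> B c g ==> B c h"
    and mult: "\<And>c c' g. c \<in> UR ==> c' \<in> UR ==> B c g ==> B c' g ==> B (c \<otimes> c') g"
    and inv: "\<And>c g. c \<in> UR ==> B c g ==> B (inv c) g"
    and un: "\<And>c. c \<in> UR ==> \<exists>g\<in>\<Gamma>. B c g"
  shows "\<exists>g\<in>\<Gamma>. \<forall>c\<in>UR. B c g"
proof -
  have DQ: "Df (\<lambda>E. E 0 \<in> UR \<and> B (E 0) (v (E 1)))" by (intro D_conj Df_UR DB tm_var)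
  have "{d \<in> VR. \<exists>g\<in>\<Gamma>. d \<in> UR \<and> B d g} = UR" using un UR_VR by blast
  then have "\<not> finite (res M ` {d \<in> VR. \<exists>g\<in>\<Gamma>. d \<in> UR \<and> B d g})" using infinite_res_UR by simp
  then obtain g where g: "g \<in> \<Gamma>" "infinite (res M ` {d \<in> VR. d \<in> UR \<and> B d g})"
    using finite_res_UN[of \<Gamma> "\<lambda>d g. d \<in> UR \<and> B d g", OF end_segment_Gamma DQ] antitone by blast
  have eq: "{d \<in> VR. d \<in> UR \<and> B d g} = {d \<in> UR. B d g}" using UR_VR by blast
  obtain z where z: "z \<in> carrier K" "v z = g" using g(1) by blast
  have Dg: "Df (\<lambda>E. B (E 0) g)"
    using D_comp2[of "\<lambda>x y. B x (v y)", OF DB tm_var tm_const[OF z(1)]] z(2) by simp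
  have "B c g" if "c \<in> UR" for c
    by (rule subgroup_UR_all[of "\<lambda>c. B c g", OF Dg _ _ g(2)[unfolded eq] that]) (use mult inv in blast)+
  then show ?thesis using g(1) by blast
qed

end

section \<open>Functions growing faster than all powers\<close>

lemma nmul_nonpos: "x \<le> 0 ==> nmul n x \<le> 0"
  by (induction n) (simp_all add: add_nonpos_nonpos)

lemma nmul_le_self:
  assumes "x \<le> 0" "n > 0" shows "nmul n x \<le> x"
proof -
  obtain m where "n = Suc m" using assms(2) by (cases n) auto
  then show ?thesis using nmul_nonpos[OF assms(1), of m] by simp
qed

context acvf
begin

text \<open>The multiplicative increment of \<open>h\<close> under scaling by \<open>c\<close>;
  \<open>quo_mult\<close> is its cocycle identity.\<close>

definition quo :: "('a \<Rightarrow> 'a) \<Rightarrow> 'a \<Rightarrow> 'a \<Rightarrow> 'a" where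
  "quo h c x = h (c \<otimes> x) \<otimes> ninv (h x)"

lemma v_pow: "x \<in> carrier K ==> x \<noteq> \<zero> ==> v (x [^] n) = nmul n (v x) \<and> x [^] (n :: nat) \<noteq> \<zero>"
  by (induction n) (simp_all add: v_mult integral_iff add.commute)

lemma tm_pow: "tm s ==> tm (\<lambda>E. s E [^] (n :: nat))"
  by (induction n) (simp_all add: tm_K_intros)

lemma UR_scale:
  assumes "c \<in> UR" "x \<in> carrier K" "x \<noteq> \<zero>"
  shows "c \<otimes> x \<in> carrier K" "c \<otimes> x \<noteq> \<zero>" "v (c \<otimes> x) = v x" "c \<otimes> (inv c \<otimes> x) = x"
  using assms UR_K[OF assms(1)] inv_nonzero[of c] by (simp_all add: integral_iff v_mult m_assoc[symmetric])

lemma near_scale: assumes "near \<Gamma> P" "c \<in> UR" shows "near \<Gamma> (\<lambda>x. P (c \<otimes> x))"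
proof -
  obtain g where g: "g \<in> \<Gamma>" "\<forall>x\<in>carrier K. x \<noteq> \<zero> \<and> v x \<in> \<Gamma> \<and> v x < g \<longrightarrow> P x"
    using assms(1) unfolding near_def by blast
  have "\<forall>x\<in>carrier K. x \<noteq> \<zero> \<and> v x \<in> \<Gamma> \<and> v x < g \<longrightarrow> P (c \<otimes> x)"
    using g(2) UR_scale(1-3)[OF assms(2)] by simp
  then show ?thesis unfolding near_def using g(1) by blast
qed

lemma quo_closed:
  assumes "\<And>x. x \<in> carrier K ==> x \<noteq> \<zero> ==> h x \<in> carrier K \<and> h x \<noteq> \<zero>" "c \<in> UR" "x \<in> carrier K" "x \<noteq> \<zero>"
  shows "quo h c x \<in> carrier K" "quo h c x \<noteq> \<zero>" "h (c \<otimes> x) = quo h c x \<otimes> h x"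
    "v (quo h c x) = v (h (c \<otimes> x)) - v (h x)"
proof -
  have h: "h x \<in> carrier K" "h x \<noteq> \<zero>" "h (c \<otimes> x) \<in> carrier K" "h (c \<otimes> x) \<noteq> \<zero>"
    using assms(1)[OF assms(3,4)] assms(1)[OF UR_scale(1,2)[OF assms(2-4)]] by simp_all
  note i = inv_nonzero[OF h(1,2)]
  show "quo h c x \<in> carrier K" "quo h c x \<noteq> \<zero>" "h (c \<otimes> x) = quo h c x \<otimes> h x"
    "v (quo h c x) = v (h (c \<otimes> x)) - v (h x)"
    using h i by (simp_all add: quo_def ninv_def integral_iff m_assoc v_mult v_inv)
qed

lemma quo_mult:
  assumes h: "\<And>x. x \<in> carrier K ==> x \<noteq> \<zero> ==> h x \<in> carrier K \<and> h x \<noteq> \<zero>"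
    and c: "c \<in> UR" "c' \<in> UR" and x: "x \<in> carrier K" "x \<noteq> \<zero>"
  shows "quo h (c \<otimes> c') x = quo h c (c' \<otimes> x) \<otimes> quo h c' x"
proof -
  note c'x = UR_scale(1,2)[OF c(2) x]
  have hx: "h x \<in> carrier K" "h x \<noteq> \<zero>" using h[OF x] by auto
  have "h ((c \<otimes> c') \<otimes> x) = h (c \<otimes> (c' \<otimes> x))" using UR_K(1)[OF c(1)] UR_K(1)[OF c(2)] x by (simp add: m_assoc)
  also have "\<dots> = quo h c (c' \<otimes> x) \<otimes> (quo h c' x \<otimes> h x)"
    using quo_closed(3)[OF h c(1) c'x] quo_closed(3)[OF h c(2) x] by simp
  finally have "quo h (c \<otimes> c') x = quo h c (c' \<otimes> x) \<otimes> (quo h c' x \<otimes> h x) \<otimes> inv (h x)"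
    using hx by (simp add: quo_def ninv_def)
  also have "\<dots> = quo h c (c' \<otimes> x) \<otimes> (quo h c' x \<otimes> (h x \<otimes> inv (h x)))"
    using quo_closed(1)[OF h c(1) c'x] quo_closed(1)[OF h c(2) x] hx inv_nonzero(1)[OF hx] by (simp add: m_assoc)
  finally show ?thesis using inv_nonzero(3)[OF hx] quo_closed(1)[OF h c(2) x] by simp
qed

lemma quo_inv:
  assumes h: "\<And>x. x \<in> carrier K ==> x \<noteq> \<zero> ==> h x \<in> carrier K \<and> h x \<noteq> \<zero>"
    and c: "c \<in> UR" and x: "x \<in> carrier K" "x \<noteq> \<zero>"
  shows "quo h (inv c) x = inv (quo h c (inv c \<otimes> x))"
proof -
  note ic = UR_inv[OF c]
  note cx = UR_scale(1,2)[OF ic x]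
  have "quo h c (inv c \<otimes> x) \<otimes> quo h (inv c) x = quo h (c \<otimes> inv c) x"
    using quo_mult[OF h c ic x] by simp
  also have "\<dots> = \<one>" using UR_K[OF c] inv_nonzero[of c] h[OF x] inv_nonzero[of "h x"] x
    by (simp add: quo_def ninv_def)
  finally show ?thesis
    using quo_closed(1)[OF h c cx] quo_closed(1)[OF h ic x] by (intro inv_char[symmetric]) (auto simp: m_comm)
qed

text \<open>Turns a bound that depends on the unit \<open>c\<close> into one that does not. Scaling
  by units preserves values, so the cocycle conditions on \<open>T\<close> make the units that are
  good below the level \<open>g\<close> a subgroup.\<close>

lemma uniform_near:
  assumes DT: "Df (\<lambda>E. T (E 0) (E 1))"
    and mult: "\<And>c c' x. c \<in> UR ==> c' \<in> UR ==> x \<in> carrier K ==> x \<noteq> \<zero> ==> T c (c' \<otimes> x) ==> T c' x ==> T (c \<otimes> c') x"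
    and inv: "\<And>c x. c \<in> UR ==> x \<in> carrier K ==> x \<noteq> \<zero> ==> T c (inv c \<otimes> x) ==> T (inv c) x"
    and near: "\<And>c. c \<in> UR ==> near \<Gamma> (T c)"
  shows "\<exists>g\<in>\<Gamma>. \<forall>c\<in>UR. \<forall>x\<in>carrier K. x \<noteq> \<zero> \<and> v x < g \<longrightarrow> T c x"
proof -
  have DT': "Df (\<lambda>E. T (E i) (E j))" for i j using D_comp2[OF DT tm_var tm_var] .
  define B where "B c g \<longleftrightarrow> (\<forall>x\<in>carrier K. \<not> x = \<zero> \<and> v x < g \<longrightarrow> T c x)" for c g
  have "\<exists>g\<in>\<Gamma>. \<forall>c\<in>UR. B c g"
  proof (rule subgroup_UR_family)
    show "Df (\<lambda>E. B (E 0) (v (E 1)))"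
      unfolding B_def by (intro D_all D_imp D_conj D_not D_eq DT' Df_v_less tm_K_intros)
    show "B c h" if "h \<le> g" "B c g" for c g h using that unfolding B_def by (meson order_less_le_trans)
    show "B (c \<otimes> c') g" if "c \<in> UR" "c' \<in> UR" "B c g" "B c' g" for c c' g
      using that mult UR_scale[OF that(2)] unfolding B_def by simp
    show "B (inv c) g" if "c \<in> UR" "B c g" for c g
      using that inv UR_scale[OF UR_inv[OF that(1)]] unfolding B_def by simp
    show "\<exists>g\<in>\<Gamma>. B c g" if "c \<in> UR" for c
      using near[OF that] unfolding near_def B_def by auto
  qed
  then show ?thesis unfolding B_def by blast
qed

text \<open>Both signs are reversed: large \<open>x\<close> have very negative values, but should
  correspond to large arguments of \<open>F\<close>. Outside the range where \<open>h\<close> is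
  controlled, \<open>F\<close> is set to 0.\<close>

lemma tm_quotient:
  assumes th: "tm (\<lambda>E. h (E 0))" and h: "\<And>x. x \<in> carrier K ==> h x \<noteq> \<zero>" and g: "g \<in> \<Gamma>"
    and const: "\<And>x y. x \<in> carrier K ==> x \<noteq> \<zero> ==> y \<in> carrier K ==> y \<noteq> \<zero> ==> v x = v y ==> v x < g ==> v (h x) = v (h y)"
  shows "\<exists>F. G.tm (\<lambda>E. F (E 0)) \<and> (\<forall>x\<in>carrier K. x \<noteq> \<zero> \<and> v x < g \<longrightarrow> F (- v x) = - v (h x))"
proof -
  have h_K: "h x \<in> carrier K" if "x \<in> carrier K" for x using tm_G1[OF th that] .
  define pick where "pick a = (SOME x. x \<in> carrier K \<and> x \<noteq> \<zero> \<and> v x = - a)" for a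
  have pick: "pick a \<in> carrier K" "pick a \<noteq> \<zero>" "v (pick a) = - a" if "a \<in> \<Gamma>" for a
    using someI_ex[OF nz_value[OF G.minus_G[OF that]]] unfolding pick_def by blast+
  define F where "F a = (if - a < g then - v (h (pick a)) else 0)" for a
  have F: "F (- v x) = - v (h x)" if x: "x \<in> carrier K" "x \<noteq> \<zero>" "v x < g" for x
  proof -
    have "- v x \<in> \<Gamma>" using x(1) by (intro G.minus_G imageI)
    then have "v (h (pick (- v x))) = v (h x)" using const[OF x(1,2) pick(1,2)] pick(3) x(3) by simp
    then show ?thesis using x(3) by (simp add: F_def)
  qed
  obtain z where z: "z \<in> carrier K" "v z = g" using g by blast
  have "Df (\<lambda>E. (\<exists>x\<in>carrier K. \<not> x = \<zero> \<and> v x = v (ninv (E 1)) \<and> v x < v z \<and> v (E 0) = v (ninv (h x))) \<or>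
    (\<not> v (ninv (E 1)) < v z \<and> v (E 0) = v \<one>))"
    by (intro D_ex D_conj D_disj D_not D_eq Df_v_eq Df_v_less tm_K_intros tm_comp1[OF th] z(1))
  then have "Df (\<lambda>E. v (E 0) = F (v (E 1)))"
  proof (rule D_cong)
    fix E :: "nat \<Rightarrow> 'a" assume E: "range E \<subseteq> carrier K"
    then have E1: "E 1 \<in> carrier K" by auto
    then have G1: "v (E 1) \<in> \<Gamma>" by blast
    show "(\<exists>x\<in>carrier K. \<not> x = \<zero> \<and> v x = v (ninv (E 1)) \<and> v x < v z \<and> v (E 0) = v (ninv (h x))) \<or>
      (\<not> v (ninv (E 1)) < v z \<and> v (E 0) = v \<one>) \<longleftrightarrow> v (E 0) = F (v (E 1))"
    proof (cases "- v (E 1) < g")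
      case True
      have F_E: "F (v (E 1)) = - v (h x)" if "x \<in> carrier K" "x \<noteq> \<zero>" "v x = - v (E 1)" for x
        using F[OF that(1,2)] that(3) True by simp
      moreover have "\<exists>x\<in>carrier K. x \<noteq> \<zero> \<and> v x = - v (E 1)" using pick[OF G1] by blast
      ultimately obtain x0 where x0: "x0 \<in> carrier K" "x0 \<noteq> \<zero>" "v x0 = - v (E 1)" "F (v (E 1)) = - v (h x0)"
        by blast
      have lt: "v (ninv (E 1)) < v z" using True v_ninv[OF E1] z(2) by simp
      have "(\<exists>x\<in>carrier K. \<not> x = \<zero> \<and> v x = v (ninv (E 1)) \<and> v x < v z \<and> v (E 0) = v (ninv (h x))) \<longleftrightarrow>
        v (E 0) = F (v (E 1))"
      proof
        assume "\<exists>x\<in>carrier K. \<not> x = \<zero> \<and> v x = v (ninv (E 1)) \<and> v x < v z \<and> v (E 0) = v (ninv (h x))"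
        then obtain x where x: "x \<in> carrier K" "x \<noteq> \<zero>" "v x = v (ninv (E 1))" "v (E 0) = v (ninv (h x))"
          by blast
        then show "v (E 0) = F (v (E 1))" using F_E[OF x(1,2)] v_ninv[OF E1] v_ninv[OF h_K[OF x(1)]] by simp
      next
        assume "v (E 0) = F (v (E 1))"
        then show "\<exists>x\<in>carrier K. \<not> x = \<zero> \<and> v x = v (ninv (E 1)) \<and> v x < v z \<and> v (E 0) = v (ninv (h x))"
          using x0 v_ninv[OF E1] v_ninv[OF h_K[OF x0(1)]] lt by (intro bexI[OF _ x0(1)]) simp
      qed
      then show ?thesis using lt by simp
    next
      case False
      then show ?thesis using z(2) v_ninv[OF E1] by (auto simp: F_def)
    qed
  qed
  moreover have "F a \<in> \<Gamma>" if "a \<in> \<Gamma>" for a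
    using pick(1)[OF that] h_K G.minus_G G.zero_G unfolding F_def by auto
  ultimately have "G.tm (\<lambda>E. F (E 0))" unfolding G.tm_def by (auto simp: image_subset_iff)
  then show ?thesis using F by blast
qed

lemma finite_res_inv:
  assumes "finite (res M ` {c \<in> UR. P c})" shows "finite (res M ` {c \<in> UR. P (inv c)})"
proof (rule finite_subset[OF _ finite_imageI[OF assms, of "\<lambda>Z. inv\<^bsub>k\<^esub> Z"]])
  show "res M ` {c \<in> UR. P (inv c)} \<subseteq> (\<lambda>Z. inv\<^bsub>k\<^esub> Z) ` res M ` {c \<in> UR. P c}"
  proof
    fix Z assume "Z \<in> res M ` {c \<in> UR. P (inv c)}"
    then obtain c where c: "c \<in> UR" "P (inv c)" "Z = res M c" by blast
    have "Z = inv\<^bsub>k\<^esub> (res M (inv c))"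
      using res_inv[OF UR_inv[OF c(1)]] UR_K[OF c(1)] inv_nonzero[of c] c(3) by simp
    then show "Z \<in> (\<lambda>Z. inv\<^bsub>k\<^esub> Z) ` res M ` {c \<in> UR. P c}" using UR_inv[OF c(1)] c(2) by blast
  qed
qed

lemma sim_cancel:
  assumes "sim (w \<otimes> a) a" "w \<in> UR" "a \<in> UR" shows "sim w \<one>"
proof -
  have "sim (w \<otimes> a \<otimes> inv a) (a \<otimes> inv a)" using sim_mult[OF assms(1) sim_refl[OF UR_inv[OF assms(3)]]] .
  then show ?thesis using UR_K[OF assms(2)] UR_K[OF assms(3)] inv_nonzero[of a] by (simp add: m_assoc)
qed

text \<open>An automorphism \<open>\<phi>\<close> of the embedded copy of the value group is carried
  back along \<open>emb\<close>, and the resulting multiples are carried forward again.\<close>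

lemma G_no_exotic:
  assumes "no_exotic_automorphisms_value L M" shows "G.no_exotic"
  unfolding G.no_exotic_def
proof (intro allI impI)
  fix \<phi> :: "'a set lexprod \<Rightarrow> 'a set lexprod"
  assume tm: "G.tm (\<lambda>E. \<phi> (E 0))" and bij: "bij_betw \<phi> \<Gamma> \<Gamma>"
    and add: "\<forall>x\<in>\<Gamma>. \<forall>y\<in>\<Gamma>. \<phi> (x + y) = \<phi> x + \<phi> y" and mono: "\<forall>x\<in>\<Gamma>. \<forall>y\<in>\<Gamma>. x < y \<longrightarrow> \<phi> x < \<phi> y"
  define C where "C = carrier (valgroup M)"
  interpret V: comm_group "valgroup M" using ordered_valgroup by (simp add: ordered_comm_group_def)
  have emb_v: "emb (gval M x) = v x" if "x \<noteq> \<zero>" for x using that by (simp add: v_def)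
  have "emb ` C = \<Gamma>"
  proof
    show "emb ` C \<subseteq> \<Gamma>" using emb_v by (auto simp: C_def carrier_valgroup)
    show "\<Gamma> \<subseteq> emb ` C"
    proof
      fix g assume "g \<in> \<Gamma>"
      then obtain x where "x \<in> carrier K" "x \<noteq> \<zero>" "v x = g" using nz_value by blast
      then show "g \<in> emb ` C" using emb_v[of x] gval_closed[of x] by (auto simp: C_def intro!: image_eqI[of _ _ "gval M x"])
    qed
  qed
  then have bij_emb: "bij_betw emb C \<Gamma>" using inj_emb by (simp add: bij_betw_def C_def)
  define \<psi> where "\<psi> = the_inv_into C emb"
  have bij_\<psi>: "bij_betw \<psi> \<Gamma> C" unfolding \<psi>_def by (rule bij_betw_the_inv_into[OF bij_emb])
  have emb_\<psi>: "emb (\<psi> g) = g" if "g \<in> \<Gamma>" for g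
    using f_the_inv_into_f_bij_betw[OF bij_emb, of g] that by (simp add: \<psi>_def)
  define \<sigma> where "\<sigma> = (\<lambda>A. \<psi> (\<phi> (emb A)))"
  have embG: "emb A \<in> \<Gamma>" if "A \<in> C" for A using bij_emb that bij_betwE by blast
  have \<phi>G: "\<phi> g \<in> \<Gamma>" if "g \<in> \<Gamma>" for g using bij that bij_betwE by blast
  have \<sigma>: "\<sigma> A \<in> C" "emb (\<sigma> A) = \<phi> (emb A)" if "A \<in> C" for A
    using \<phi>G[OF embG[OF that]] emb_\<psi> bij_betwE[OF bij_\<psi>] by (auto simp: \<sigma>_def)
  have inj: "A = B" if "A \<in> C" "B \<in> C" "emb A = emb B" for A B
    using bij_emb that by (meson bij_betw_imp_inj_on inj_onD)
  have bij_\<sigma>: "bij_betw \<sigma> C C"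
    using bij_betw_trans[OF bij_betw_trans[OF bij_emb bij] bij_\<psi>] by (simp add: \<sigma>_def comp_def)
  have hom: "\<sigma> (A \<otimes>\<^bsub>valgroup M\<^esub> B) = \<sigma> A \<otimes>\<^bsub>valgroup M\<^esub> \<sigma> B" if A: "A \<in> C" and B: "B \<in> C" for A B
  proof (rule inj)
    have AB: "A \<otimes>\<^bsub>valgroup M\<^esub> B \<in> C" using A B by (simp add: C_def)
    then show "\<sigma> (A \<otimes>\<^bsub>valgroup M\<^esub> B) \<in> C" by (rule \<sigma>(1))
    show "\<sigma> A \<otimes>\<^bsub>valgroup M\<^esub> \<sigma> B \<in> C" using \<sigma>(1)[OF A] \<sigma>(1)[OF B] by (simp add: C_def)
    have "\<phi> (emb A + emb B) = \<phi> (emb A) + \<phi> (emb B)" using add embG[OF A] embG[OF B] by blast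
    then show "emb (\<sigma> (A \<otimes>\<^bsub>valgroup M\<^esub> B)) = emb (\<sigma> A \<otimes>\<^bsub>valgroup M\<^esub> \<sigma> B)"
      using \<sigma>[OF A] \<sigma>[OF B] \<sigma>[OF AB] emb_mult[of A B] emb_mult[of "\<sigma> A" "\<sigma> B"] A B
      by (simp add: C_def)
  qed
  have \<phi>_le: "\<phi> x \<le> \<phi> y \<longleftrightarrow> x \<le> y" if "x \<in> \<Gamma>" "y \<in> \<Gamma>" for x y
  proof (cases x y rule: linorder_cases)
    case less
    then have "\<phi> x < \<phi> y" using mono that by blast
    then show ?thesis using less by (simp add: less_imp_le)
  next
    case greater
    then have "\<phi> y < \<phi> x" using mono that by blast
    then show ?thesis using greater leD by blast
  qed simp
  have order: "\<forall>\<alpha>\<in>C. \<forall>\<beta>\<in>C. gle M \<alpha> \<beta> = gle M (\<sigma> \<alpha>) (\<sigma> \<beta>)"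
  proof (intro ballI)
    fix \<alpha> \<beta> assume ab: "\<alpha> \<in> C" "\<beta> \<in> C"
    show "gle M \<alpha> \<beta> = gle M (\<sigma> \<alpha>) (\<sigma> \<beta>)"
      using emb_le[of \<alpha> \<beta>] emb_le[of "\<sigma> \<alpha>" "\<sigma> \<beta>"] \<sigma>[OF ab(1)] \<sigma>[OF ab(2)] \<phi>_le[OF embG[OF ab(1)] embG[OF ab(2)]] ab
      by (simp add: C_def)
  qed
  have "definable_quot_map (vf_lang L) M (Units (vfield M)) (gval M) \<sigma>"
    unfolding definable_quot_map_def
  proof (rule definable_of_dfn)
    have "Df (\<lambda>E. v (E 0) = \<phi> (v (E 1)))" using tm by (simp add: G.tm_def)
    from D_comp2[of "\<lambda>x y. v x = \<phi> (v y)", OF this tm_var[of 1] tm_var[of 0]]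
    show "Df (\<lambda>E. (\<not> E 0 = \<zero> \<and> \<not> E 1 = \<zero>) \<and> v (E 1) = \<phi> (v (E 0)))"
      by (intro D_conj D_not D_eq tm_var tm_zero_one)
    show "univ M \<noteq> {}" using univ_M by auto
    show "{[x, y] |x y. x \<in> Units (vfield M) \<and> y \<in> Units (vfield M) \<and> \<sigma> (gval M x) = gval M y} \<subseteq> tuples 2 (univ M)"
      by (auto simp: tuples_def univ_M K[symmetric])
    fix e :: "nat \<Rightarrow> 'a" assume "range e \<subseteq> univ M"
    then have e: "e 0 \<in> carrier K" "e 1 \<in> carrier K" by (auto simp: univ_M)
    have "\<sigma> (gval M (e 0)) = gval M (e 1) \<longleftrightarrow> v (e 1) = \<phi> (v (e 0))" if ne: "e 0 \<noteq> \<zero>" "e 1 \<noteq> \<zero>"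
    proof -
      have gC: "gval M (e 0) \<in> C" "gval M (e 1) \<in> C" using gval_closed e ne by (simp_all add: C_def)
      have "\<sigma> (gval M (e 0)) = gval M (e 1) \<longleftrightarrow> emb (\<sigma> (gval M (e 0))) = emb (gval M (e 1))"
        using inj[OF \<sigma>(1)[OF gC(1)] gC(2)] by auto
      then show ?thesis using \<sigma>(2)[OF gC(1)] emb_v ne by auto
    qed
    moreover have "map e [0..<2] = [e 0, e 1]" by (simp add: numeral_2_eq_2)
    ultimately show "map e [0..<2] \<in> {[x, y] |x y. x \<in> Units (vfield M) \<and> y \<in> Units (vfield M) \<and> \<sigma> (gval M x) = gval M y}
      \<longleftrightarrow> (\<not> e 0 = \<zero> \<and> \<not> e 1 = \<zero>) \<and> v (e 1) = \<phi> (v (e 0))"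
      using e by (auto simp: K[symmetric] field_Units)
  qed
  note def_\<sigma> = this
  have "\<sigma> \<in> hom (valgroup M) (valgroup M)" using hom \<sigma>(1) by (intro homI) (simp_all add: C_def)
  then have "\<sigma> \<in> iso (valgroup M) (valgroup M)" using bij_\<sigma> by (simp add: iso_def C_def)
  from mp[OF mp[OF mp[OF spec[OF assms[unfolded no_exotic_automorphisms_value_def], of \<sigma>] this]
      order[unfolded C_def]] def_\<sigma>]
  obtain m n :: nat where mn: "m > 0" "n > 0"
    "\<forall>\<gamma>\<in>C. \<sigma> \<gamma> [^]\<^bsub>valgroup M\<^esub> n = \<gamma> [^]\<^bsub>valgroup M\<^esub> m"
    unfolding C_def by blast
  have emb_one: "emb \<one>\<^bsub>valgroup M\<^esub> = 0"
    using emb_mult[of "\<one>\<^bsub>valgroup M\<^esub>" "\<one>\<^bsub>valgroup M\<^esub>"] by simp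
  have emb_pow: "emb (A [^]\<^bsub>valgroup M\<^esub> i) = nmul i (emb A)" if "A \<in> C" for A and i :: nat
    using that emb_mult by (induction i) (simp_all add: C_def emb_one add.commute)
  have "nmul n (\<phi> x) = nmul m x" if x: "x \<in> \<Gamma>" for x
  proof -
    have A: "\<psi> x \<in> C" using bij_betwE[OF bij_\<psi>] x by blast
    show ?thesis
      using mn(3) A emb_pow[OF A, of m] emb_pow[OF \<sigma>(1)[OF A], of n] \<sigma>(2)[OF A] emb_\<psi>[OF x] by auto
  qed
  then show "\<exists>m n. m > 0 \<and> n > 0 \<and> (\<forall>x\<in>\<Gamma>. nmul n (\<phi> x) = nmul m x)" using mn(1,2) by blast
qed

end

text \<open>The form in which a failure of polynomial boundedness is used: \<open>f\<close> vanishes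
  nowhere, and for large \<open>x\<close> the value of \<open>f x\<close> is at most any given
  natural multiple of \<open>v x\<close>.\<close>

locale superlinear = acvf L M K
  for L :: "('f, 'r) lang" and M :: "('f, 'r, 'a) vf_struct" and K (structure) +
  fixes f :: "'a \<Rightarrow> 'a"
  assumes tm_f: "tm (\<lambda>E. f (E 0))" and f_nonzero: "x \<in> carrier K ==> f x \<noteq> \<zero>"
    and superlinear: "near \<Gamma> (\<lambda>x. v (f x) \<le> nmul n (v x))"
begin

lemma f_closed: "x \<in> carrier K ==> f x \<in> carrier K"
  using tm_G1[OF tm_f] .

lemma f_nz: "x \<in> carrier K ==> x \<noteq> \<zero> ==> f x \<in> carrier K \<and> f x \<noteq> \<zero>"
  using f_closed f_nonzero by blast

lemmas tm_f' = tm_comp1[OF tm_f]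

text \<open>Inversion of \<open>c\<close> exchanges the units that lower the value with those that
  raise it. The two sets are disjoint, so by \<open>res_cases\<close> they cannot both have
  infinitely many residues; hence neither has. The units that preserve the value are a definable
  subgroup with infinitely many residues.\<close>

lemma v_f_scale_near: assumes "c \<in> UR" shows "near \<Gamma> (\<lambda>x. v (f (c \<otimes> x)) = v (f x))"
proof -
  define lt where "lt c \<longleftrightarrow> near \<Gamma> (\<lambda>x. v (f (c \<otimes> x)) < v (f x))" for c
  define gt where "gt c \<longleftrightarrow> near \<Gamma> (\<lambda>x. v (f x) < v (f (c \<otimes> x)))" for c
  define eq where "eq c \<longleftrightarrow> near \<Gamma> (\<lambda>x. v (f (c \<otimes> x)) = v (f x))" for c
  have D_lt: "Df (\<lambda>E. lt (E 0))" unfolding lt_def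
    by (rule Df_near[where R = "\<lambda>E x. v (f (E 0 \<otimes> x)) < v (f x)", OF _ end_segment_Gamma]) (intro Df_v_less tm_f' tm_K_intros)
  have D_eq: "Df (\<lambda>E. eq (E 0))" unfolding eq_def
    by (rule Df_near[where R = "\<lambda>E x. v (f (E 0 \<otimes> x)) = v (f x)", OF _ end_segment_Gamma]) (intro Df_v_eq tm_f' tm_K_intros)
  have cases: "lt c \<or> gt c \<or> eq c" if c: "c \<in> UR" for c
  proof -
    have 1: "lt c \<or> near \<Gamma> (\<lambda>x. \<not> v (f (c \<otimes> x)) < v (f x))" unfolding lt_def
      using UR_K(1)[OF c] by (intro near_cases[OF end_segment_Gamma] Df_v_less tm_f' tm_K_intros)
    have 2: "gt c \<or> near \<Gamma> (\<lambda>x. \<not> v (f x) < v (f (c \<otimes> x)))" unfolding gt_def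
      using UR_K(1)[OF c] by (intro near_cases[OF end_segment_Gamma] Df_v_less tm_f' tm_K_intros)
    have "eq c" if "near \<Gamma> (\<lambda>x. \<not> v (f (c \<otimes> x)) < v (f x))" "near \<Gamma> (\<lambda>x. \<not> v (f x) < v (f (c \<otimes> x)))"
      unfolding eq_def by (rule near_mono[OF near_conj[OF that]]) auto
    then show ?thesis using 1 2 by blast
  qed
  have lt_inv: "gt (inv c)" if "c \<in> UR" "lt c" for c
    using near_scale[OF that(2)[unfolded lt_def] UR_inv[OF that(1)]] unfolding gt_def
    by (rule near_mono) (simp add: UR_scale(4)[OF that(1)])
  have gt_inv: "lt (inv c)" if "c \<in> UR" "gt c" for c
    using near_scale[OF that(2)[unfolded gt_def] UR_inv[OF that(1)]] unfolding lt_def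
    by (rule near_mono) (simp add: UR_scale(4)[OF that(1)])
  have disjoint: False if lg: "lt c" "gt c" for c
  proof -
    have "near \<Gamma> (\<lambda>x. v (f (c \<otimes> x)) < v (f x) \<and> v (f x) < v (f (c \<otimes> x)))"
      using lg unfolding lt_def gt_def by (rule near_conj)
    then obtain x where "v (f (c \<otimes> x)) < v (f x) \<and> v (f x) < v (f (c \<otimes> x))"
      by (rule near_ex[OF end_segment_Gamma _ G.zero_G])
    then show False using order_less_asym by blast
  qed
  have fin_lt: "finite (res M ` {c \<in> UR. lt c})"
  proof (rule ccontr)
    assume inf: "infinite (res M ` {c \<in> UR. lt c})"
    have "Df (\<lambda>E. E 0 \<in> UR \<and> lt (E 0))" by (intro D_conj Df_UR D_lt tm_var)
    from res_cases[OF this]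
    have "finite (res M ` {c \<in> VR. c \<in> UR \<and> lt c}) \<or> finite (res M ` {c \<in> VR. \<not> (c \<in> UR \<and> lt c)})" .
    moreover have "{c \<in> VR. c \<in> UR \<and> lt c} = {c \<in> UR. lt c}" using UR_VR by blast
    ultimately have "finite (res M ` {c \<in> VR. \<not> (c \<in> UR \<and> lt c)})" using inf by simp
    moreover have "{c \<in> UR. gt c} \<subseteq> {c \<in> VR. \<not> (c \<in> UR \<and> lt c)}" using disjoint UR_VR by blast
    ultimately have "finite (res M ` {c \<in> UR. gt c})" by (meson finite_subset image_mono)
    then have "finite (res M ` {c \<in> UR. gt (inv c)})" by (rule finite_res_inv)
    moreover have "{c \<in> UR. lt c} \<subseteq> {c \<in> UR. gt (inv c)}" using lt_inv by blast
    ultimately show False using inf by (meson finite_subset image_mono)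
  qed
  have "finite (res M ` {c \<in> UR. lt (inv c)})" using fin_lt by (rule finite_res_inv)
  moreover have "{c \<in> UR. gt c} \<subseteq> {c \<in> UR. lt (inv c)}" using gt_inv by blast
  ultimately have fin_gt: "finite (res M ` {c \<in> UR. gt c})" by (meson finite_subset image_mono)
  have "res M ` UR \<subseteq> res M ` {c \<in> UR. lt c} \<union> res M ` {c \<in> UR. gt c} \<union> res M ` {c \<in> UR. eq c}"
    using cases by blast
  then have inf: "infinite (res M ` {c \<in> UR. eq c})"
    using infinite_res_UR fin_lt fin_gt by (meson finite_UnI finite_subset)
  have "eq c"
  proof (rule subgroup_UR_all[of eq, OF D_eq _ _ inf assms])
    show "eq (c \<otimes> c')" if c: "c \<in> UR" "c' \<in> UR" "eq c" "eq c'" for c c'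
      using near_conj[OF near_scale[OF c(3)[unfolded eq_def] c(2)] c(4)[unfolded eq_def]] unfolding eq_def
      by (rule near_mono) (simp add: m_assoc UR_K(1)[OF c(1)] UR_K(1)[OF c(2)])
    show "eq (inv c)" if c: "c \<in> UR" "eq c" for c
      using near_scale[OF c(2)[unfolded eq_def] UR_inv[OF c(1)]] unfolding eq_def
      by (rule near_mono) (simp add: UR_scale(4)[OF c(1)])
  qed
  then show ?thesis by (simp add: eq_def)
qed

lemma v_f_const:
  "\<exists>g\<in>\<Gamma>. \<forall>x\<in>carrier K. \<forall>y\<in>carrier K. x \<noteq> \<zero> \<and> y \<noteq> \<zero> \<and> v x = v y \<and> v x < g \<longrightarrow> v (f x) = v (f y)"
proof -
  have "\<exists>g\<in>\<Gamma>. \<forall>c\<in>UR. \<forall>x\<in>carrier K. x \<noteq> \<zero> \<and> v x < g \<longrightarrow> v (f (c \<otimes> x)) = v (f x)"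
  proof (rule uniform_near[where T = "\<lambda>c x. v (f (c \<otimes> x)) = v (f x)"])
    show "Df (\<lambda>E. v (f (E 0 \<otimes> E 1)) = v (f (E 1)))" by (intro Df_v_eq tm_f' tm_K_intros)
    show "v (f (c \<otimes> c' \<otimes> x)) = v (f x)" if "c \<in> UR" "c' \<in> UR" "x \<in> carrier K" "x \<noteq> \<zero>"
      "v (f (c \<otimes> (c' \<otimes> x))) = v (f (c' \<otimes> x))" "v (f (c' \<otimes> x)) = v (f x)" for c c' x
      using that UR_K(1) by (simp add: m_assoc)
    show "v (f (inv c \<otimes> x)) = v (f x)" if "c \<in> UR" "x \<in> carrier K" "x \<noteq> \<zero>"
      "v (f (c \<otimes> (inv c \<otimes> x))) = v (f (inv c \<otimes> x))" for c x
      using that(4) UR_scale(4)[OF that(1-3)] by simp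
  qed (rule v_f_scale_near)
  then obtain g where g: "g \<in> \<Gamma>" "\<And>c x. c \<in> UR ==> x \<in> carrier K ==> x \<noteq> \<zero> ==> v x < g ==> v (f (c \<otimes> x)) = v (f x)"
    by blast
  have "v (f x) = v (f y)"
    if xy: "x \<in> carrier K" "y \<in> carrier K" "x \<noteq> \<zero>" "y \<noteq> \<zero>" "v x = v y" "v x < g" for x y
  proof -
    have "y \<otimes> inv x \<in> UR" using xy inv_nonzero[of x] by (simp add: UR_v v_mult v_inv integral_iff)
    moreover have "(y \<otimes> inv x) \<otimes> x = y" using xy inv_nonzero[of x] by (simp add: m_assoc)
    ultimately show ?thesis using g(2)[of "y \<otimes> inv x" x] xy by simp
  qed
  then show ?thesis using g(1) by blast
qed

lemma value_case:
  assumes "no_exotic_automorphisms_value L M" "u \<in> \<Gamma>" "0 < u" "a \<in> \<Gamma>" "\<And>n. nmul n u \<le> a"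
  shows False
proof -
  obtain g where g: "g \<in> \<Gamma>" "\<And>x y. x \<in> carrier K ==> x \<noteq> \<zero> ==> y \<in> carrier K ==> y \<noteq> \<zero> ==>
    v x = v y ==> v x < g ==> v (f x) = v (f y)" using v_f_const by blast
  obtain F where F: "G.tm (\<lambda>E. F (E 0))" "\<And>x. x \<in> carrier K ==> x \<noteq> \<zero> ==> v x < g ==> F (- v x) = - v (f x)"
    using tm_quotient[OF tm_f f_nonzero g] by blast
  have "\<forall>\<^sub>F x in G.at_inf. nmul n x \<le> F x" for n
  proof -
    obtain h where h: "h \<in> \<Gamma>" "\<forall>x\<in>carrier K. x \<noteq> \<zero> \<and> v x \<in> \<Gamma> \<and> v x < h \<longrightarrow> v (f x) \<le> nmul n (v x)"
      using superlinear[of n] unfolding near_def by blast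
    have "nmul n y \<le> F y" if y: "y \<in> \<Gamma>" "max (- g) (- h) < y" for y
    proof -
      obtain x where x: "x \<in> carrier K" "x \<noteq> \<zero>" "v x = - y" using nz_value[OF G.minus_G[OF y(1)]] by blast
      have "- g < y" "- h < y" using y(2) by simp_all
      then have lt: "v x < g" "v x < h" using x(3) by (simp_all add: minus_less_iff)
      have "v (f x) \<le> nmul n (v x)" using h(2) x(1,2) lt(2) by blast
      then have "nmul n y \<le> - v (f x)" using x(3) by (simp add: nmul_minus le_minus_iff)
      then show ?thesis using F(2)[OF x(1,2) lt(1)] x(3) by simp
    qed
    moreover have "max (- g) (- h) \<in> \<Gamma>" using G.minus_G[OF g(1)] G.minus_G[OF h(1)] by (simp add: max_def)
    ultimately show ?thesis unfolding G.eventually_at_inf by blast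
  qed
  then show False by (rule G.no_superlinear[OF G_no_exotic[OF assms(1)] F(1) _ assms(2-5)])
qed

end


section \<open>The homomorphism induced on the residue field\<close>

context superlinear
begin

lemma near_quo_UR: "c \<in> UR ==> near \<Gamma> (\<lambda>x. quo f c x \<in> UR)"
  using v_f_scale_near[of c] by (rule near_mono) (simp_all add: UR_v quo_closed f_nz)

definition S :: "'a \<Rightarrow> 'a \<Rightarrow> bool" where
  "S c d \<longleftrightarrow> near \<Gamma> (\<lambda>x. sim (quo f c x) d)"

lemma Df_S: assumes "tm s" "tm u" shows "Df (\<lambda>E. S (s E) (u E))"
proof (rule D_comp2[where R = S, OF _ assms])
  show "Df (\<lambda>E. S (E 0) (E 1))"
    unfolding S_def quo_def
    by (rule Df_near[where R = "\<lambda>E x. sim (f (E 0 \<otimes> x) \<otimes> ninv (f x)) (E 1)", OF _ end_segment_Gamma])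
      (intro Df_sim tm_f' tm_K_intros)
qed

lemma sim_cong: "sim a d ==> d' \<in> VR ==> res M d = res M d' ==> sim a d'"
  using res_zero_iff[of d] res_zero_iff[of d'] UR_VR by (auto simp: sim_def)

text \<open>For each large \<open>x\<close> the quotient has some residue;
  \<open>generic_residue\<close> makes it independent of \<open>x\<close>.\<close>

lemma S_ex: assumes c: "c \<in> UR" shows "\<exists>d. S c d"
proof -
  have "\<exists>d\<in>VR. near \<Gamma> (\<lambda>x. sim (quo f c x) d)"
  proof (rule generic_residue[OF end_segment_Gamma])
    show "Df (\<lambda>E. sim (quo f c (E 0)) (E 1))"
      unfolding quo_def using UR_K(1)[OF c] by (intro Df_sim tm_f' tm_K_intros)
    show "near \<Gamma> (\<lambda>x. \<exists>d\<in>VR. sim (quo f c x) d)"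
      using near_quo_UR[OF c] by (rule near_mono) (use sim_refl UR_VR in blast)
    show "sim (quo f c x) d'" if "d' \<in> VR" "res M d = res M d'" "sim (quo f c x) d" for x d d'
      using sim_cong that by blast
  qed
  then show ?thesis unfolding S_def by blast
qed

lemma S_unique: assumes "S c d" "S c d'" shows "sim d d'"
proof -
  have "near \<Gamma> (\<lambda>x. sim (quo f c x) d \<and> sim (quo f c x) d')"
    using assms unfolding S_def by (rule near_conj)
  then obtain x where "sim (quo f c x) d \<and> sim (quo f c x) d'"
    by (rule near_ex[OF end_segment_Gamma _ G.zero_G])
  then show ?thesis using sim_trans[OF sim_sym] by blast
qed

lemma S_sim: "S c d ==> sim d d' ==> S c d'"
  unfolding S_def by (erule near_mono) (blast intro: sim_trans)

lemma S_UR: "S c d ==> d \<in> UR"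
  using S_unique[of c d d] by (simp add: sim_def)

lemma S_mult:
  assumes "c \<in> UR" "c' \<in> UR" "S c d" "S c' d'" shows "S (c \<otimes> c') (d \<otimes> d')"
  using near_conj[OF near_scale[OF assms(3)[unfolded S_def] assms(2)] assms(4)[unfolded S_def]] unfolding S_def
  by (rule near_mono) (simp add: quo_mult[OF f_nz assms(1,2)] sim_mult)

lemma S_one: "S \<one> \<one>"
proof -
  have "near \<Gamma> (\<lambda>x. True)" using end_segment_Gamma unfolding near_def end_segment_def by blast
  then show ?thesis unfolding S_def
  proof (rule near_mono)
    fix x assume x: "x \<in> carrier K" "x \<noteq> \<zero>"
    then have "quo f \<one> x = \<one>" using f_nz[OF x] inv_nonzero[of "f x"] by (simp add: quo_def ninv_def)
    then show "sim (quo f \<one> x) \<one>" using sim_refl[OF UR_one] by simp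
  qed
qed

lemma S_inv: assumes "c \<in> UR" "S c d" shows "S (inv c) (inv d)"
proof -
  obtain h where h: "S (inv c) h" using S_ex[OF UR_inv[OF assms(1)]] by blast
  note U = S_UR[OF assms(2)] S_UR[OF h]
  have "S (c \<otimes> inv c) (d \<otimes> h)" by (rule S_mult[OF assms(1) UR_inv[OF assms(1)] assms(2) h])
  then have "S \<one> (d \<otimes> h)" using UR_K[OF assms(1)] inv_nonzero[of c] by simp
  then have "sim (d \<otimes> h) \<one>" using S_one by (rule S_unique)
  then have "sim (inv d \<otimes> (d \<otimes> h)) (inv d \<otimes> \<one>)" using sim_mult[OF sim_refl[OF UR_inv[OF U(1)]]] by blast
  moreover have "inv d \<otimes> (d \<otimes> h) = h"
    using UR_K[OF U(1)] UR_K[OF U(2)] inv_nonzero[of d] by (simp add: m_assoc[symmetric])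
  ultimately have "sim h (inv d)" using UR_K[OF U(1)] inv_nonzero[of d] by simp
  then show ?thesis by (rule S_sim[OF h])
qed

text \<open>Generic elements of \<open>1 + \<mm>\<close> near its boundary all have the same image \<open>d\<close>; as every element
  is a quotient of two generic ones, the image is trivial.\<close>

lemma S_one_units: assumes "sim c \<one>" shows "S c \<one>"
proof (cases "c = \<one>")
  case False
  have c: "c \<in> UR" "c \<in> carrier K" using assms UR_K by (auto simp: sim_def)
  define J where "J = {\<gamma> \<in> \<Gamma>. 0 < \<gamma>}"
  have J: "end_segment J" unfolding J_def by (rule end_segment_pos)
  define b where "b = c \<ominus> \<one>"
  have "\<one> \<oplus> (c \<oplus> \<ominus> \<one>) = c \<oplus> (\<one> \<oplus> \<ominus> \<one>)" using c(2) by (intro a_lcomm) auto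
  then have b: "b \<in> carrier K" "b \<noteq> \<zero>" "c = \<one> \<oplus> b"
    using c(2) False r_right_minus_eq[of c \<one>] by (simp_all add: b_def r_neg) (simp add: a_minus_def)
  have "vgt 0 b" using assms res_eq_iff[of c \<one>] UR_VR by (simp add: sim_def b_def)
  then have vb: "v b \<in> J" using b by (simp add: vgt_def J_def)
  have one_plus: "\<one> \<oplus> a \<in> UR" if "a \<in> carrier K" "v a \<in> J" for a
    using v_plus_dominant[of \<one> a] that by (simp add: UR_v vgt_def J_def)
  have "\<exists>d\<in>VR. near J (\<lambda>a. S (\<one> \<oplus> a) d)"
  proof (rule generic_residue[OF J])
    show "Df (\<lambda>E. S (\<one> \<oplus> E 0) (E 1))" by (intro Df_S tm_K_intros)
    have "near J (\<lambda>x. True)" unfolding near_def using vb by blast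
    then show "near J (\<lambda>a. \<exists>d\<in>VR. S (\<one> \<oplus> a) d)"
      by (rule near_mono) (use S_ex one_plus S_UR UR_VR in blast)
    show "S (\<one> \<oplus> a) d'" if "d' \<in> VR" "res M d = res M d'" "S (\<one> \<oplus> a) d" for a d d'
      using S_sim[OF that(3)] sim_cong[OF sim_refl[OF S_UR[OF that(3)]] that(1,2)] by blast
  qed
  then obtain d g where g: "g \<in> J" "\<And>a. a \<in> carrier K ==> a \<noteq> \<zero> ==> v a \<in> J ==> v a < g ==> S (\<one> \<oplus> a) d"
    unfolding near_def by blast
  have "min g (v b) \<in> J" using g(1) vb by (simp add: min_def)
  moreover have "near J (\<lambda>x. True)" unfolding near_def using vb by blast
  ultimately obtain a where a: "a \<in> carrier K" "a \<noteq> \<zero>" "v a \<in> J" "v a < min g (v b)"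
    using near_ex[OF J, of "\<lambda>x. True" "min g (v b)"] by blast
  \<comment> \<open>As \<open>v a < v b\<close>, the product of \<open>\<one> \<oplus> a\<close> and
    \<open>c = \<one> \<oplus> b\<close> is \<open>\<one> \<oplus> a'\<close> with
    \<open>v a' = v a\<close>. So the product is again generic and has the same image
    \<open>d\<close>.\<close>
  define a' where "a' = a \<oplus> (b \<oplus> a \<otimes> b)"
  have "v (a \<otimes> b) = v a + v b" using a b by (simp add: v_mult)
  moreover have "v a < v b" "0 < v a" "0 < v b" using a(3,4) vb by (simp_all add: J_def)
  ultimately have "vgt (v a) b" "vgt (v a) (a \<otimes> b)" by (simp_all add: vgt_def)
  then have "vgt (v a) (b \<oplus> a \<otimes> b)" using a(1) b(1) by (intro vgt_plus) simp_all
  then have a': "a' \<in> carrier K" "a' \<noteq> \<zero>" "v a' = v a"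
    using v_plus_dominant[of a "b \<oplus> a \<otimes> b"] a b unfolding a'_def by simp_all
  have eq: "(\<one> \<oplus> a) \<otimes> c = \<one> \<oplus> a'"
    using a(1) b(1) by (simp add: b(3) a'_def l_distr r_distr a_ac)
  have Sa: "S (\<one> \<oplus> a) d" using g(2)[OF a(1-3)] a(4) by simp
  have Sa': "S ((\<one> \<oplus> a) \<otimes> c) d" unfolding eq using g(2)[OF a'(1,2)] a'(3) a(3,4) by simp
  obtain e where e: "S c e" using S_ex[OF c(1)] by blast
  have "S ((\<one> \<oplus> a) \<otimes> c) (d \<otimes> e)" by (rule S_mult[OF one_plus[OF a(1,3)] c(1) Sa e])
  from S_unique[OF this Sa'] have "sim (e \<otimes> d) d"
    using UR_K(1)[OF S_UR[OF e]] UR_K(1)[OF S_UR[OF Sa]] by (simp add: m_comm)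
  then have "sim e \<one>" using S_UR[OF e] S_UR[OF Sa] by (rule sim_cancel)
  then show ?thesis by (rule S_sim[OF e])
qed (simp add: S_one)

lemma S_cong: assumes "sim c c'" "S c d" shows "S c' d"
proof -
  have c: "c \<in> UR" "c' \<in> UR" using assms(1) by (simp_all add: sim_def)
  have "sim (inv c \<otimes> c') (inv c \<otimes> c)" by (rule sim_mult[OF sim_refl[OF UR_inv[OF c(1)]] sim_sym[OF assms(1)]])
  then have "S (inv c \<otimes> c') \<one>" using UR_K[OF c(1)] inv_nonzero[of c] by (intro S_one_units) simp
  then have "S (c \<otimes> (inv c \<otimes> c')) (d \<otimes> \<one>)" using S_mult[OF c(1) UR_mult[OF UR_inv[OF c(1)] c(2)] assms(2)] by blast
  then show ?thesis using UR_scale(4)[OF c(1) UR_K(1,2)[OF c(2)]] UR_K(1)[OF S_UR[OF assms(2)]] by simp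
qed

lemma S_kernel_coset:
  assumes "c \<in> UR" "c' \<in> UR" "S c d" "S c' d'" "sim d d'" shows "S (c' \<otimes> inv c) \<one>"
proof -
  note d = S_UR[OF assms(3)]
  have "S (c' \<otimes> inv c) (d' \<otimes> inv d)" by (rule S_mult[OF assms(2) UR_inv[OF assms(1)] assms(4) S_inv[OF assms(1,3)]])
  moreover have "sim (d' \<otimes> inv d) (d \<otimes> inv d)" by (rule sim_mult[OF sim_sym[OF assms(5)] sim_refl[OF UR_inv[OF d]]])
  ultimately show ?thesis using UR_K[OF d] inv_nonzero[of d] S_sim by simp
qed

text \<open>The kernel of the induced homomorphism, as a set of residues.\<close>

definition \<kappa> :: "'a set set" where "\<kappa> = res M ` {c \<in> UR. S c \<one>}"

lemma S_of_\<kappa>: "c \<in> UR ==> res M c \<in> \<kappa> ==> S c \<one>"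
proof -
  assume c: "c \<in> UR" "res M c \<in> \<kappa>"
  then obtain e where "e \<in> UR" "S e \<one>" "res M e = res M c" unfolding \<kappa>_def by auto
  then show "S c \<one>" using S_cong[of e c \<one>] c(1) by (simp add: sim_def)
qed

text \<open>The elements of a group of order N are N-th roots of unity. A field has at most N of
  these, so the kernel consists of all of them.\<close>

lemma \<kappa>_roots_of_unity:
  assumes "finite \<kappa>"
  shows "\<exists>N>0. \<forall>c\<in>UR. S c \<one> \<longleftrightarrow> res M (c [^] (N :: nat)) = \<one>\<^bsub>k\<^esub>"
proof -
  interpret U: comm_group "units_of k" by (rule Q.units_comm_group)
  have sub: "subgroup \<kappa> (units_of k)"
  proof (rule U.subgroupI)
    show "\<kappa> \<subseteq> carrier (units_of k)" by (auto simp: \<kappa>_def units_of_def Units_k)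
    show "\<kappa> \<noteq> {}" using S_one UR_one by (auto simp: \<kappa>_def)
    show "inv\<^bsub>units_of k\<^esub> a \<in> \<kappa>" if "a \<in> \<kappa>" for a
    proof -
      obtain c where c: "c \<in> UR" "S c \<one>" "a = res M c" using \<open>a \<in> \<kappa>\<close> by (auto simp: \<kappa>_def)
      have "inv\<^bsub>units_of k\<^esub> a = res M (inv c)" using c(1,3) by (simp add: Q.units_of_inv Units_k res_inv)
      moreover have "S (inv c) \<one>" using S_inv[OF c(1,2)] by simp
      ultimately show ?thesis using UR_inv[OF c(1)] by (auto simp: \<kappa>_def)
    qed
    show "a \<otimes>\<^bsub>units_of k\<^esub> b \<in> \<kappa>" if "a \<in> \<kappa>" "b \<in> \<kappa>" for a b
    proof -
      obtain c where c: "c \<in> UR" "S c \<one>" "a = res M c" using \<open>a \<in> \<kappa>\<close> by (auto simp: \<kappa>_def)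
      obtain d where d: "d \<in> UR" "S d \<one>" "b = res M d" using \<open>b \<in> \<kappa>\<close> by (auto simp: \<kappa>_def)
      have "a \<otimes>\<^bsub>units_of k\<^esub> b = res M (c \<otimes> d)" using c d UR_VR by (simp add: units_of_mult res_mult)
      moreover have "S (c \<otimes> d) \<one>" using S_mult[OF c(1) d(1) c(2) d(2)] by simp
      ultimately show ?thesis using UR_mult[OF c(1) d(1)] by (auto simp: \<kappa>_def)
    qed
  qed
  define N where "N = card \<kappa>"
  have "\<kappa> \<noteq> {}" using S_one UR_one by (auto simp: \<kappa>_def)
  then have N: "N > 0" using assms by (simp add: N_def card_gt_0_iff)
  interpret H: group "units_of k\<lparr>carrier := \<kappa>\<rparr>" by (rule U.subgroup_imp_group[OF sub])
  have pow: "a [^]\<^bsub>k\<^esub> N = \<one>\<^bsub>k\<^esub>" if "a \<in> \<kappa>" for a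
  proof -
    have "a [^]\<^bsub>units_of k\<lparr>carrier := \<kappa>\<rparr>\<^esub> N = \<one>\<^bsub>units_of k\<^esub>"
      using H.pow_order_eq_1[of a] assms that by (simp add: order_def N_def)
    moreover have "a \<in> Units k" using that by (auto simp: \<kappa>_def Units_k)
    ultimately show ?thesis
      by (simp add: U.nat_pow_consistent[symmetric] Q.units_of_pow units_of_one)
  qed
  define \<mu> where "\<mu> = {x \<in> carrier k. x [^]\<^bsub>k\<^esub> N = \<one>\<^bsub>k\<^esub>}"
  have \<mu>: "finite \<mu>" "card \<mu> \<le> card \<kappa>" using Q.card_roots_of_unity[OF N] by (simp_all add: \<mu>_def N_def)
  have "\<kappa> \<subseteq> \<mu>" using pow UR_VR carrier_k by (auto simp: \<mu>_def \<kappa>_def)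
  then have eq: "\<kappa> = \<mu>" using \<mu> by (metis card_seteq)
  have "S c \<one> \<longleftrightarrow> res M (c [^] N) = \<one>\<^bsub>k\<^esub>" if c: "c \<in> UR" for c
  proof -
    have "S c \<one> \<longleftrightarrow> res M c \<in> \<kappa>" using S_of_\<kappa>[OF c] c by (auto simp: \<kappa>_def)
    also have "\<dots> \<longleftrightarrow> res M c [^]\<^bsub>k\<^esub> N = \<one>\<^bsub>k\<^esub>" unfolding eq \<mu>_def using carrier_k UR_VR[OF c] by auto
    finally show ?thesis using res_pow[OF UR_VR[OF c]] by simp
  qed
  then show ?thesis using N by blast
qed

text \<open>The image is a definable subgroup of the units. It has infinitely many residues because
  there are infinitely many arguments and each fibre lies in a coset of the finite kernel.\<close>

lemma S_onto:
  assumes "finite \<kappa>" "d \<in> UR" shows "\<exists>c\<in>UR. S c d"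
proof -
  define sig where "sig c = (SOME d. S c d)" for c
  have sig: "S c (sig c)" if "c \<in> UR" for c
    unfolding sig_def by (rule someI_ex[OF S_ex[OF that]])
  define B where "B d \<longleftrightarrow> (\<exists>c\<in>carrier K. c \<in> UR \<and> S c d)" for d
  have "infinite (res M ` {d \<in> UR. B d})"
  proof
    assume fin: "finite (res M ` {d \<in> UR. B d})"
    have sub: "res M ` UR \<subseteq> (\<Union>Y\<in>res M ` {d \<in> UR. B d}. res M ` {c \<in> UR. res M (sig c) = Y})"
    proof
      fix Z assume "Z \<in> res M ` UR"
      then obtain c where c: "c \<in> UR" "Z = res M c" by blast
      have "B (sig c)" using sig[OF c(1)] c(1) UR_K(1) unfolding B_def by blast
      then show "Z \<in> (\<Union>Y\<in>res M ` {d \<in> UR. B d}. res M ` {c \<in> UR. res M (sig c) = Y})"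
        using c S_UR[OF sig[OF c(1)]] by blast
    qed
    have "finite (res M ` {c \<in> UR. res M (sig c) = Y})" for Y
    proof (cases "\<exists>c0\<in>UR. res M (sig c0) = Y")
      case True
      then obtain c0 where c0: "c0 \<in> UR" "res M (sig c0) = Y" by blast
      have "res M ` {c \<in> UR. res M (sig c) = Y} \<subseteq> (\<lambda>Z. Z \<otimes>\<^bsub>k\<^esub> res M c0) ` \<kappa>"
      proof
        fix Z assume "Z \<in> res M ` {c \<in> UR. res M (sig c) = Y}"
        then obtain c where c: "c \<in> UR" "res M (sig c) = Y" "Z = res M c" by blast
        have "sim (sig c0) (sig c)"
          using c0(2) c(2) S_UR[OF sig[OF c0(1)]] S_UR[OF sig[OF c(1)]] by (simp add: sim_def)
        then have "S (c \<otimes> inv c0) \<one>" by (rule S_kernel_coset[OF c0(1) c(1) sig[OF c0(1)] sig[OF c(1)]])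
        moreover have U: "c \<otimes> inv c0 \<in> UR" using UR_mult UR_inv c(1) c0(1) by blast
        ultimately have "res M (c \<otimes> inv c0) \<in> \<kappa>" by (auto simp: \<kappa>_def)
        moreover have "(c \<otimes> inv c0) \<otimes> c0 = c"
          using UR_K[OF c(1)] UR_K[OF c0(1)] inv_nonzero[of c0] by (simp add: m_assoc)
        then have "Z = res M (c \<otimes> inv c0) \<otimes>\<^bsub>k\<^esub> res M c0"
          using res_mult[OF UR_VR[OF U] UR_VR[OF c0(1)]] c(3) by simp
        ultimately show "Z \<in> (\<lambda>Z. Z \<otimes>\<^bsub>k\<^esub> res M c0) ` \<kappa>" by blast
      qed
      then show ?thesis using finite_subset finite_imageI[OF assms(1)] by blast
    next
      case False
      then have "{c \<in> UR. res M (sig c) = Y} = {}" by blast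
      then show ?thesis by (simp only: image_empty finite.emptyI)
    qed
    then have "finite (\<Union>Y\<in>res M ` {d \<in> UR. B d}. res M ` {c \<in> UR. res M (sig c) = Y})"
      using fin by blast
    then show False using infinite_res_UR finite_subset[OF sub] by blast
  qed
  moreover have "Df (\<lambda>E. B (E 0))" unfolding B_def by (intro D_ex D_conj Df_UR Df_S tm_var)
  moreover have "B (a \<otimes> b)" if "B a" "B b" for a b
    using that S_mult UR_mult UR_K(1) unfolding B_def by blast
  moreover have "B (inv a)" if "B a" for a
    using that S_inv UR_inv UR_K(1) unfolding B_def by blast
  ultimately have "B d" using subgroup_UR_all[of B d] assms(2) by blast
  then show ?thesis unfolding B_def by blast
qed

text \<open>An infinite kernel is everything, which gives the exponents 1, 0 and 0. A finite kernel
  of N-th roots of unity is divided out by passing from \<open>c\<close> to \<open>c [^] N\<close>;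
  this is why the exponents supplied by \<open>definable_hom_power\<close> reappear multiplied by
  \<open>N\<close>.\<close>

lemma S_power:
  assumes "no_exotic_automorphisms_residue L M"
  shows "\<exists>n>0. \<exists>i j. \<forall>c\<in>UR. \<forall>d. S c d \<longrightarrow> sim (d [^] (n :: nat) \<otimes> c [^] (i :: nat)) (c [^] (j :: nat))"
proof (cases "finite \<kappa>")
  case False
  have D1: "Df (\<lambda>E. S (E 0) \<one>)" by (intro Df_S tm_K_intros)
  have "S c \<one>" if "c \<in> UR" for c
  proof (rule subgroup_UR_all[of "\<lambda>c. S c \<one>", OF D1 _ _ _ that])
    show "infinite (res M ` {c \<in> UR. S c \<one>})" using False by (simp add: \<kappa>_def)
    show "S (c \<otimes> c') \<one>" if "c \<in> UR" "c' \<in> UR" "S c \<one>" "S c' \<one>" for c c' using S_mult[OF that] by simp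
    show "S (inv c) \<one>" if "c \<in> UR" "S c \<one>" for c using S_inv[OF that] by simp
  qed
  then have "sim d \<one>" if "c \<in> UR" "S c d" for c d using S_unique[OF that(2)] that(1) by blast
  then have "\<forall>c\<in>UR. \<forall>d. S c d \<longrightarrow> sim (d [^] (1 :: nat) \<otimes> c [^] (0 :: nat)) (c [^] (0 :: nat))"
    using S_UR UR_K(1) by simp
  then show ?thesis using zero_less_one by blast
next
  case True
  obtain N :: nat where N: "N > 0" "\<And>c. c \<in> UR ==> S c \<one> \<longleftrightarrow> res M (c [^] N) = \<one>\<^bsub>k\<^esub>"
    using \<kappa>_roots_of_unity[OF True] by blast
  define sig where "sig c = (SOME d. S c d)" for c
  have sig: "S c (sig c)" if "c \<in> UR" for c
    unfolding sig_def by (rule someI_ex[OF S_ex[OF that]])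
  have sig_eq: "res M (sig c) = res M d \<longleftrightarrow> S c d" if "c \<in> UR" "d \<in> UR" for c d
    using S_unique[OF sig[OF that(1)], of d] S_sim[OF sig[OF that(1)], of d] S_UR[OF sig[OF that(1)]] that(2)
    by (auto simp: sim_def)
  have sig_UR: "sig c \<in> UR" if "c \<in> UR" for c using S_UR[OF sig[OF that]] .
  have pow_quot: "res M ((c' \<otimes> inv c) [^] N) = \<one>\<^bsub>k\<^esub> \<longleftrightarrow> res M (c' [^] N) = res M (c [^] N)"
    if c: "c \<in> UR" "c' \<in> UR" for c c'
  proof -
    define e where "e = c' \<otimes> inv c"
    have e: "e \<in> UR" using c UR_mult UR_inv by (simp add: e_def)
    have "c' = e \<otimes> c" using UR_K[OF c(1)] UR_K[OF c(2)] inv_nonzero[of c] by (simp add: e_def m_assoc)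
    then have "c' [^] N = e [^] N \<otimes> c [^] N" using UR_K(1)[OF e] UR_K(1)[OF c(1)] by (simp add: nat_pow_distrib)
    then have eq: "res M (c' [^] N) = res M (e [^] N) \<otimes>\<^bsub>k\<^esub> res M (c [^] N)"
      using res_mult UR_VR UR_pow e c(1) by simp
    have cl: "res M (e [^] N) \<in> carrier k" "res M (c [^] N) \<in> carrier k" "res M (c [^] N) \<noteq> \<zero>\<^bsub>k\<^esub>"
      using UR_VR UR_pow e c(1) res_zero_iff[of "c [^] N"] carrier_k by auto
    have "res M (e [^] N) = \<one>\<^bsub>k\<^esub>" if "res M (c' [^] N) = res M (c [^] N)"
    proof -
      have "res M (c [^] N) \<otimes>\<^bsub>k\<^esub> res M (e [^] N) = res M (c [^] N) \<otimes>\<^bsub>k\<^esub> \<one>\<^bsub>k\<^esub>"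
        using that eq cl Q.m_comm by simp
      then show ?thesis using Q.m_lcancel[of "res M (c [^] N)" "res M (e [^] N)" "\<one>\<^bsub>k\<^esub>"] cl by simp
    qed
    then show ?thesis using eq cl(2) unfolding e_def[symmetric] by auto
  qed
  \<comment> \<open>The choice of the N-th root does not matter, because two roots of the same
    residue differ by an element of the kernel.\<close>
  define \<tau> where "\<tau> Z = res M (sig (SOME c. c \<in> UR \<and> res M (c [^] N) = Z))" for Z
  have \<tau>: "\<tau> (res M (c [^] N)) = res M (sig c)" if c: "c \<in> UR" for c
  proof -
    define c' where "c' = (SOME c'. c' \<in> UR \<and> res M (c' [^] N) = res M (c [^] N))"
    have "\<exists>c'. c' \<in> UR \<and> res M (c' [^] N) = res M (c [^] N)" using c by blast
    from someI_ex[OF this] have c': "c' \<in> UR" "res M (c' [^] N) = res M (c [^] N)"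
      unfolding c'_def by blast+
    note quot = UR_mult[OF c'(1) UR_inv[OF c]]
    have "S (c' \<otimes> inv c) \<one>" using pow_quot[OF c c'(1)] c'(2) N(2)[OF quot] by blast
    then have "S ((c' \<otimes> inv c) \<otimes> c) (\<one> \<otimes> sig c)"
      by (rule S_mult[OF quot c _ sig[OF c]])
    moreover have "(c' \<otimes> inv c) \<otimes> c = c'"
      using UR_K[OF c] UR_K[OF c'(1)] inv_nonzero[of c] by (simp add: m_assoc)
    ultimately have "S c' (sig c)" using UR_K(1)[OF sig_UR[OF c]] by simp
    then have "res M (sig c') = res M (sig c)" using sig_eq[OF c'(1) sig_UR[OF c]] by simp
    then show ?thesis unfolding \<tau>_def c'_def .
  qed
  have root_ex: "\<exists>c\<in>UR. Z = res M (c [^] N)" if "Z \<in> Units k" for Z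
  proof -
    have Z: "Z \<in> carrier k" "Z \<noteq> \<zero>\<^bsub>k\<^esub>" using that by (auto simp: Q.field_Units)
    obtain Y where Y: "Y \<in> carrier k" "Y [^]\<^bsub>k\<^esub> N = Z" using Q.nth_root[OF N(1) Z(1)] by blast
    then obtain c where c: "c \<in> VR" "Y = res M c" using carrier_k by auto
    have "Y \<noteq> \<zero>\<^bsub>k\<^esub>"
    proof
      assume Y0: "Y = \<zero>\<^bsub>k\<^esub>"
      obtain m where "N = Suc m" using N(1) by (cases N) auto
      then have "Y [^]\<^bsub>k\<^esub> N = \<zero>\<^bsub>k\<^esub>" using Y0 by simp
      then show False using Y(2) Z(2) by simp
    qed
    then have "c \<in> UR" using res_zero_iff[OF c(1)] c(2) by simp
    then show ?thesis using res_pow[OF c(1)] c(2) Y(2) by auto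
  qed
  have mult: "\<tau> (a \<otimes>\<^bsub>k\<^esub> b) = \<tau> a \<otimes>\<^bsub>k\<^esub> \<tau> b" if a: "a \<in> Units k" and b: "b \<in> Units k" for a b
  proof -
    obtain c where c: "c \<in> UR" "a = res M (c [^] N)" using root_ex[OF a] by blast
    obtain d where d: "d \<in> UR" "b = res M (d [^] N)" using root_ex[OF b] by blast
    have "a \<otimes>\<^bsub>k\<^esub> b = res M ((c \<otimes> d) [^] N)"
      using c d res_mult[of "c [^] N" "d [^] N"] UR_VR UR_pow UR_K(1) by (simp add: nat_pow_distrib)
    then have "\<tau> (a \<otimes>\<^bsub>k\<^esub> b) = res M (sig (c \<otimes> d))" using \<tau>[OF UR_mult[OF c(1) d(1)]] by simp
    also have "\<dots> = res M (sig c \<otimes> sig d)"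
      using sig_eq[OF UR_mult[OF c(1) d(1)] UR_mult[OF sig_UR[OF c(1)] sig_UR[OF d(1)]]]
        S_mult[OF c(1) d(1) sig[OF c(1)] sig[OF d(1)]] by simp
    finally show ?thesis using \<tau>[OF c(1)] \<tau>[OF d(1)] c(2) d(2) res_mult UR_VR sig_UR c(1) d(1) by simp
  qed
  have closed: "\<tau> a \<in> Units k" if a: "a \<in> Units k" for a
  proof -
    obtain c where "c \<in> UR" "a = res M (c [^] N)" using root_ex[OF a] by blast
    then show ?thesis using \<tau> sig_UR by (simp add: Units_k)
  qed
  have inj: "inj_on \<tau> (Units k)"
  proof (rule inj_onI)
    fix a b assume ab: "a \<in> Units k" "b \<in> Units k" "\<tau> a = \<tau> b"
    obtain c where c: "c \<in> UR" "a = res M (c [^] N)" using root_ex[OF ab(1)] by blast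
    obtain d where d: "d \<in> UR" "b = res M (d [^] N)" using root_ex[OF ab(2)] by blast
    have "sim (sig d) (sig c)" using ab(3) \<tau>[OF c(1)] \<tau>[OF d(1)] c(2) d(2) sig_UR c(1) d(1) by (simp add: sim_def)
    then have "S (c \<otimes> inv d) \<one>" by (rule S_kernel_coset[OF d(1) c(1) sig[OF d(1)] sig[OF c(1)]])
    then show "a = b" using N(2) pow_quot[OF d(1) c(1)] UR_mult UR_inv c d by simp
  qed
  have surj: "\<tau> ` Units k = Units k"
  proof
    show "\<tau> ` Units k \<subseteq> Units k" using closed by blast
    show "Units k \<subseteq> \<tau> ` Units k"
    proof
      fix Z assume "Z \<in> Units k"
      then obtain d where d: "d \<in> UR" "Z = res M d" by (auto simp: Units_k)
      then obtain c where c: "c \<in> UR" "S c d" using S_onto[OF True] by blast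
      have "\<tau> (res M (c [^] N)) = Z" using \<tau>[OF c(1)] sig_eq[OF c(1) d(1)] c(2) d(2) by simp
      moreover have "res M (c [^] N) \<in> Units k" using UR_pow[OF c(1)] by (simp add: Units_k)
      ultimately show "Z \<in> \<tau> ` Units k" by blast
    qed
  qed
  have iso: "\<tau> \<in> iso (units_of k) (units_of k)"
    using mult closed inj surj by (auto simp: iso_def hom_def bij_betw_def units_of_def)
  have "definable_quot_map (vf_lang L) M UR (res M) \<tau>"
    unfolding definable_quot_map_def
  proof (rule definable_of_dfn)
    show "Df (\<lambda>E. E 0 \<in> UR \<and> E 1 \<in> UR \<and> (\<exists>c\<in>carrier K. c \<in> UR \<and> sim (c [^] N) (E 0) \<and> S c (E 1)))"
      by (intro D_conj D_ex Df_UR Df_sim Df_S tm_pow tm_var)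
    show "univ M \<noteq> {}" using univ_M by auto
    show "{[x, y] |x y. x \<in> UR \<and> y \<in> UR \<and> \<tau> (res M x) = res M y} \<subseteq> tuples 2 (univ M)"
      using UR_K(1) by (auto simp: tuples_def univ_M)
    fix e :: "nat \<Rightarrow> 'a" assume "range e \<subseteq> univ M"
    have iff: "\<tau> (res M x) = res M y \<longleftrightarrow> (\<exists>c\<in>carrier K. c \<in> UR \<and> sim (c [^] N) x \<and> S c y)"
      if xy: "x \<in> UR" "y \<in> UR" for x y
    proof
      assume *: "\<tau> (res M x) = res M y"
      obtain c where c: "c \<in> UR" "res M x = res M (c [^] N)" using root_ex[of "res M x"] xy(1) by (auto simp: Units_k)
      have "sim (c [^] N) x" using c xy(1) UR_pow by (simp add: sim_def)
      moreover have "S c y" using * c \<tau>[OF c(1)] sig_eq[OF c(1) xy(2)] by simp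
      ultimately show "\<exists>c\<in>carrier K. c \<in> UR \<and> sim (c [^] N) x \<and> S c y" using c(1) UR_K(1) by blast
    next
      assume "\<exists>c\<in>carrier K. c \<in> UR \<and> sim (c [^] N) x \<and> S c y"
      then obtain c where c: "c \<in> UR" "sim (c [^] N) x" "S c y" by blast
      then have "res M x = res M (c [^] N)" by (simp add: sim_def)
      then show "\<tau> (res M x) = res M y" using \<tau>[OF c(1)] sig_eq[OF c(1) xy(2)] c(3) by simp
    qed
    have "map e [0..<2] = [e 0, e 1]" by (simp add: numeral_2_eq_2)
    then show "map e [0..<2] \<in> {[x, y] |x y. x \<in> UR \<and> y \<in> UR \<and> \<tau> (res M x) = res M y} \<longleftrightarrow>
      e 0 \<in> UR \<and> e 1 \<in> UR \<and> (\<exists>c\<in>carrier K. c \<in> UR \<and> sim (c [^] N) (e 0) \<and> S c (e 1))"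
      using iff[of "e 0" "e 1"] by auto
  qed
  then have "definable pure_ring_lang (ring_struct k) 2 {[\<alpha>, \<tau> \<alpha>] |\<alpha>. \<alpha> \<in> Units k}"
    using assms iso unfolding no_exotic_automorphisms_residue_def by blast
  then obtain n i j :: nat where n: "n > 0"
    "\<And>a. a \<in> Units k ==> \<tau> a [^]\<^bsub>k\<^esub> n \<otimes>\<^bsub>k\<^esub> a [^]\<^bsub>k\<^esub> i = a [^]\<^bsub>k\<^esub> j"
    using Q.definable_hom_power[of \<tau>, OF closed mult] by blast
  have "sim (d [^] n \<otimes> c [^] (N * i)) (c [^] (N * j))" if cd: "c \<in> UR" "S c d" for c d
  proof -
    have d: "d \<in> UR" "res M (sig c) = res M d" using S_UR[OF cd(2)] sig_eq[OF cd(1)] cd(2) by auto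
    have "res M (c [^] N) \<in> Units k" using UR_pow[OF cd(1)] by (simp add: Units_k)
    from n(2)[OF this] have "res M d [^]\<^bsub>k\<^esub> n \<otimes>\<^bsub>k\<^esub> res M (c [^] N) [^]\<^bsub>k\<^esub> i = res M (c [^] N) [^]\<^bsub>k\<^esub> j"
      using \<tau>[OF cd(1)] d(2) by simp
    moreover have "res M (c [^] N) [^]\<^bsub>k\<^esub> l = res M (c [^] (N * l))" for l :: nat
      using res_pow[OF UR_VR[OF UR_pow[OF cd(1)]], of N l] UR_K(1)[OF cd(1)] by (simp add: nat_pow_pow)
    ultimately have "res M (d [^] n \<otimes> c [^] (N * i)) = res M (c [^] (N * j))"
      using res_pow[OF UR_VR[OF d(1)], of n] res_mult[of "d [^] n" "c [^] (N * i)"] UR_VR UR_pow cd(1) by simp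
    then show ?thesis using UR_mult UR_pow d(1) cd(1) by (simp add: sim_def)
  qed
  then show ?thesis using n(1) by blast
qed

lemma residue_case:
  assumes "no_exotic_automorphisms_residue L M" shows False
proof -
  obtain n i j :: nat where n: "n > 0" "\<And>c d. c \<in> UR ==> S c d ==> sim (d [^] n \<otimes> c [^] i) (c [^] j)"
    using S_power[OF assms] by blast
  \<comment> \<open>The exponents from \<open>S_power\<close> are such that \<open>quo g c x\<close>
    has residue 1 for large \<open>x\<close>. Using \<open>nz\<close> and \<open>ninv\<close> keeps
    \<open>g\<close> nonzero at 0.\<close>
  define g where "g x = f x [^] n \<otimes> (nz x [^] i \<otimes> ninv x [^] j)" for x
  have tm_g: "tm (\<lambda>E. g (E 0))" unfolding g_def by (intro tm_pow tm_f' tm_K_intros)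
  note tm_g' = tm_comp1[OF tm_g]
  have ninv: "ninv x \<in> carrier K" "ninv x \<noteq> \<zero>" if "x \<in> carrier K" for x
    using inv_nonzero[of "nz x"] that by (simp_all add: ninv_def)
  have g: "g x \<in> carrier K" "g x \<noteq> \<zero>" if x: "x \<in> carrier K" for x
    using f_closed[OF x] f_nonzero[OF x] ninv[OF x] x v_pow by (simp_all add: g_def integral_iff)
  have g_nz: "g x \<in> carrier K \<and> g x \<noteq> \<zero>" if "x \<in> carrier K" "x \<noteq> \<zero>" for x using g[OF that(1)] by blast
  have v_g: "v (g x) = nmul n (v (f x)) + (nmul i (v x) - nmul j (v x))" if x: "x \<in> carrier K" for x
    using f_closed[OF x] f_nonzero[OF x] ninv[OF x] x v_pow
    by (simp add: g_def v_mult integral_iff v_ninv nmul_minus)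
  have quo_g: "quo g c x = quo f c x [^] n \<otimes> (c [^] i \<otimes> inv c [^] j)"
    if c: "c \<in> UR" and x: "x \<in> carrier K" "x \<noteq> \<zero>" for c x
  proof -
    note cx = UR_scale(1,2)[OF c x]
    define p q y ic iy where "p = quo f c x" and "q = f x" and "y = nz x" and "ic = inv c" and "iy = ninv x"
    have cl: "p \<in> carrier K" "q \<in> carrier K" "y \<in> carrier K" "ic \<in> carrier K" "iy \<in> carrier K" "c \<in> carrier K"
      using quo_closed(1)[OF f_nz c x] f_closed[OF x(1)] x ninv[OF x(1)] UR_K[OF c] inv_nonzero[of c]
      by (simp_all add: p_def q_def y_def ic_def iy_def)
    have 1: "f (c \<otimes> x) = p \<otimes> q" using quo_closed(3)[OF f_nz c x] by (simp add: p_def q_def)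
    have 2: "nz (c \<otimes> x) = c \<otimes> y" "ninv (c \<otimes> x) = ic \<otimes> iy"
      using cx x UR_K[OF c] inv_mult_nonzero[of c x] by (simp_all add: y_def ic_def iy_def ninv_def)
    have "g (c \<otimes> x) = (p [^] n \<otimes> (c [^] i \<otimes> ic [^] j)) \<otimes> (q [^] n \<otimes> (y [^] i \<otimes> iy [^] j))"
      unfolding g_def 1 2 using cl by (simp add: nat_pow_distrib m_ac)
    also have "q [^] n \<otimes> (y [^] i \<otimes> iy [^] j) = g x" by (simp add: g_def q_def y_def iy_def)
    finally have "quo g c x = (p [^] n \<otimes> (c [^] i \<otimes> ic [^] j)) \<otimes> (g x \<otimes> inv (g x))"
      using cl g[OF x(1)] inv_nonzero[OF g[OF x(1)]] by (simp add: quo_def ninv_def m_assoc)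
    then show ?thesis using cl inv_nonzero[OF g[OF x(1)]] by (simp add: p_def ic_def)
  qed
  have near_g: "near \<Gamma> (\<lambda>x. sim (quo g c x) \<one>)" if c: "c \<in> UR" for c
  proof -
    obtain d where d: "S c d" using S_ex[OF c] by blast
    show ?thesis using d[unfolded S_def]
    proof (rule near_mono)
      fix x assume x: "x \<in> carrier K" "x \<noteq> \<zero>" "sim (quo f c x) d"
      have icj: "inv c [^] j \<in> UR" using UR_pow UR_inv c by blast
      have "sim (quo f c x [^] n \<otimes> c [^] i) (d [^] n \<otimes> c [^] i)"
        by (rule sim_mult[OF sim_pow[OF x(3)] sim_refl[OF UR_pow[OF c]]])
      then have "sim (quo f c x [^] n \<otimes> c [^] i) (c [^] j)" using n(2)[OF c d] by (rule sim_trans)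
      then have "sim (quo f c x [^] n \<otimes> c [^] i \<otimes> inv c [^] j) (c [^] j \<otimes> inv c [^] j)"
        using sim_mult[OF _ sim_refl[OF icj]] by blast
      moreover have "c [^] j \<otimes> inv c [^] j = \<one>"
        using UR_K[OF c] inv_nonzero[of c] by (simp add: nat_pow_distrib[symmetric])
      moreover have "quo f c x [^] n \<otimes> c [^] i \<otimes> inv c [^] j = quo g c x"
        unfolding quo_g[OF c x(1,2)] using UR_K[OF c] inv_nonzero[of c] quo_closed(1)[OF f_nz c x(1,2)] by (simp add: m_assoc)
      ultimately show "sim (quo g c x) \<one>" by simp
    qed
  qed
  have "\<exists>h\<in>\<Gamma>. \<forall>c\<in>UR. \<forall>x\<in>carrier K. x \<noteq> \<zero> \<and> v x < h \<longrightarrow> sim (quo g c x) \<one>"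
  proof (rule uniform_near[where T = "\<lambda>c x. sim (quo g c x) \<one>"])
    show "Df (\<lambda>E. sim (quo g (E 0) (E 1)) \<one>)" unfolding quo_def by (intro Df_sim tm_g' tm_K_intros)
    show "sim (quo g (c \<otimes> c') x) \<one>" if "c \<in> UR" "c' \<in> UR" "x \<in> carrier K" "x \<noteq> \<zero>"
      "sim (quo g c (c' \<otimes> x)) \<one>" "sim (quo g c' x) \<one>" for c c' x
      using sim_mult[OF that(5,6)] quo_mult[OF g_nz that(1-4)] by simp
    show "sim (quo g (inv c) x) \<one>" if "c \<in> UR" "x \<in> carrier K" "x \<noteq> \<zero>" "sim (quo g c (inv c \<otimes> x)) \<one>" for c x
      using sim_inv[OF that(4)] quo_inv[OF g_nz that(1-3)] by simp
  qed (rule near_g)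
  then obtain h where h: "h \<in> \<Gamma>" "\<And>c x. c \<in> UR ==> x \<in> carrier K ==> x \<noteq> \<zero> ==> v x < h ==> sim (quo g c x) \<one>"
    by blast
  \<comment> \<open>Two elements of equal value differ by a unit factor, so the uniform bound says
    that their images under \<open>g\<close> have the same leading term.\<close>
  have sim_g: "sim (g y \<otimes> inv (g x)) \<one>"
    if xy: "x \<in> carrier K" "x \<noteq> \<zero>" "y \<in> carrier K" "y \<noteq> \<zero>" "v x = v y" "v x < h" for x y
  proof -
    have "y \<otimes> inv x \<in> UR" using xy inv_nonzero[of x] by (simp add: UR_v v_mult v_inv integral_iff)
    moreover have "(y \<otimes> inv x) \<otimes> x = y" using xy inv_nonzero[of x] by (simp add: m_assoc)
    ultimately show ?thesis using h(2)[of "y \<otimes> inv x" x] xy g[OF xy(1)] by (simp add: quo_def ninv_def)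
  qed
  have v_sim: "v a = v b" if "a \<in> carrier K" "a \<noteq> \<zero>" "b \<in> carrier K" "b \<noteq> \<zero>" "sim (a \<otimes> inv b) \<one>" for a b
    using that UR_K(3)[of "a \<otimes> inv b"] inv_nonzero[of b] by (simp add: sim_def v_mult v_inv)
  have v_g_const: "v (g x) = v (g y)"
    if "x \<in> carrier K" "x \<noteq> \<zero>" "y \<in> carrier K" "y \<noteq> \<zero>" "v x = v y" "v x < h" for x y
    by (rule v_sim[OF g[OF that(3)] g[OF that(1)] sim_g[OF that], symmetric])
  have "\<exists>F. G.tm (\<lambda>E. F (E 0)) \<and> (\<forall>x\<in>carrier K. x \<noteq> \<zero> \<and> v x < h \<longrightarrow> F (- v x) = - v (g x))"
    by (rule tm_quotient[OF tm_g g(2) h(1) v_g_const])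
  then obtain F where F: "G.tm (\<lambda>E. F (E 0))"
    "\<And>x. x \<in> carrier K ==> x \<noteq> \<zero> ==> v x < h ==> F (- v x) = - v (g x)" by blast
  \<comment> \<open>Superlinearity with exponent \<open>Suc j\<close> absorbs the factor
    \<open>ninv x [^] j\<close> and leaves one power of \<open>x\<close> to spare.\<close>
  have near_vg: "near \<Gamma> (\<lambda>x. v (g x) \<le> v x)"
  proof -
    have "near \<Gamma> (\<lambda>x. v x < 0)" unfolding near_def using G.zero_G by blast
    from near_conj[OF superlinear[of "Suc j"] this] show ?thesis
    proof (rule near_mono)
      fix x assume x: "x \<in> carrier K" "x \<noteq> \<zero>" "v (f x) \<le> nmul (Suc j) (v x) \<and> v x < 0"
      then have "v (f x) \<le> 0" using nmul_nonpos[of "v x" "Suc j"] by (meson order_less_imp_le order_trans)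
      then have "nmul n (v (f x)) \<le> nmul (Suc j) (v x)" using nmul_le_self[of "v (f x)" n] n(1) x(3) by (meson order_trans)
      then have "nmul n (v (f x)) + nmul i (v x) \<le> nmul (Suc j) (v x) + 0"
        using x(3) less_imp_le by (intro add_mono nmul_nonpos) blast+
      then have "v (g x) + nmul j (v x) \<le> v x + nmul j (v x)" using v_g[OF x(1)] by (simp add: algebra_simps)
      then show "v (g x) \<le> v x" by (simp only: add_le_cancel_right)
    qed
  qed
  have F_inf: "\<forall>\<^sub>F x in G.at_inf. r < F x" if r: "r \<in> \<Gamma>" for r
  proof -
    obtain s where s: "s \<in> \<Gamma>" "\<forall>x\<in>carrier K. x \<noteq> \<zero> \<and> v x \<in> \<Gamma> \<and> v x < s \<longrightarrow> v (g x) \<le> v x"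
      using near_vg unfolding near_def by blast
    have "r < F y" if y: "y \<in> \<Gamma>" "max r (max (- s) (- h)) < y" for y
    proof -
      obtain x where x: "x \<in> carrier K" "x \<noteq> \<zero>" "v x = - y" using nz_value[OF G.minus_G[OF y(1)]] by blast
      have y': "- h < y" "- s < y" "r < y" using y(2) by simp_all
      then have lt: "v x < h" "v x < s" using x(3) by (simp_all add: minus_less_iff)
      have "v (g x) \<le> v x" using s(2) x(1,2) lt(2) by blast
      then have "y \<le> - v (g x)" using x(3) by (simp add: le_minus_iff)
      then show ?thesis using F(2)[OF x(1,2) lt(1)] x(3) y'(3) by simp
    qed
    moreover have "max r (max (- s) (- h)) \<in> \<Gamma>"
      using r G.minus_G[OF s(1)] G.minus_G[OF h(1)] by (simp add: max_def)
    ultimately show ?thesis unfolding G.eventually_at_inf by blast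
  qed
  obtain c0 where c0: "c0 \<in> \<Gamma>" "\<And>x y. x \<in> \<Gamma> ==> y \<in> \<Gamma> ==> c0 < x ==> x < y ==> F x < F y"
    by (rule G.increasing_at_inf[OF F(1) F_inf], assumption) (rule that)
  \<comment> \<open>Below \<open>l\<close>, the leading term of \<open>g x\<close> depends only on
    \<open>v x\<close>, and conversely the value of \<open>g x\<close> determines
    \<open>v x\<close>.\<close>
  define l where "l = min h (- c0)"
  have l: "l \<in> \<Gamma>" using h(1) G.minus_G[OF c0(1)] by (simp add: l_def min_def)
  have v_inj: "v x = v y"
    if xy: "x \<in> carrier K" "x \<noteq> \<zero>" "v x < l" "y \<in> carrier K" "y \<noteq> \<zero>" "v y < l" "v (g x) = v (g y)" for x y
  proof -
    have F_eq: "F (- v x) = F (- v y)" using F(2)[OF xy(1,2)] F(2)[OF xy(4,5)] xy(3,6,7) by (simp add: l_def)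
    have G: "- v x \<in> \<Gamma>" "- v y \<in> \<Gamma>" using xy(1,4) by (auto intro!: G.minus_G)
    have "c0 < - v x" "c0 < - v y" using xy(3,6) by (simp_all add: l_def less_minus_iff)
    then have "\<not> - v x < - v y" "\<not> - v y < - v x"
      using c0(2)[OF G] c0(2)[OF G(2,1)] F_eq by auto
    then show ?thesis by simp
  qed
  obtain z where z: "z \<in> carrier K" "v z = l" using l by blast
  \<comment> \<open>By \<open>near_cases\<close> this set contains all large elements or none of
    them. The elements \<open>g x\<close> exclude the second case; multiples of them by a unit with
    residue other than 1 will exclude the first.\<close>
  define W where "W y \<longleftrightarrow> (\<exists>x\<in>carrier K. \<not> x = \<zero> \<and> v x < v z \<and> sim (y \<otimes> ninv (g x)) \<one>)" for y
  have D_W: "Df (\<lambda>E. W (E 0))"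
    unfolding W_def by (intro D_ex D_conj D_not D_eq Df_v_less Df_sim tm_g' tm_K_intros z(1))
  have W_g: "W (g x)" if x: "x \<in> carrier K" "x \<noteq> \<zero>" "v x < l" for x
    unfolding W_def using x z(2) g[OF x(1)] inv_nonzero[OF g[OF x(1)]] sim_refl[OF UR_one]
    by (intro bexI[of _ x]) (simp_all add: ninv_def)
  have "\<not> near \<Gamma> (\<lambda>y. \<not> W y)"
  proof
    assume "near \<Gamma> (\<lambda>y. \<not> W y)"
    then obtain s where s: "s \<in> \<Gamma>" "\<And>y. y \<in> carrier K ==> y \<noteq> \<zero> ==> v y < s ==> \<not> W y"
      unfolding near_def by auto
    have "min s l \<in> \<Gamma>" using s(1) l by (simp add: min_def)
    from near_ex[OF end_segment_Gamma near_vg this]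
    obtain x where x: "x \<in> carrier K" "x \<noteq> \<zero>" "v x < min s l" "v (g x) \<le> v x" by blast
    have "v (g x) < s" using order_le_less_trans[OF x(4)] x(3) by simp
    then show False using s(2)[OF g[OF x(1)]] W_g[OF x(1,2)] x(3) by simp
  qed
  then have "near \<Gamma> W" using near_cases[OF end_segment_Gamma D_W] by blast
  then obtain s where s: "s \<in> \<Gamma>" "\<And>y. y \<in> carrier K ==> y \<noteq> \<zero> ==> v y < s ==> W y"
    unfolding near_def by auto
  have "min s l \<in> \<Gamma>" using s(1) l by (simp add: min_def)
  from near_ex[OF end_segment_Gamma near_vg this]
  obtain x where x: "x \<in> carrier K" "x \<noteq> \<zero>" "v x < min s l" "v (g x) \<le> v x" by blast
  have "v (g x) < s" using order_le_less_trans[OF x(4)] x(3) by simp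
  have "\<exists>c\<in>UR. res M c \<noteq> \<one>\<^bsub>k\<^esub>"
  proof (rule ccontr)
    assume "\<not> ?thesis"
    then have "res M ` UR \<subseteq> {\<one>\<^bsub>k\<^esub>}" by blast
    then show False using infinite_res_UR finite_subset by blast
  qed
  then obtain c where c: "c \<in> UR" "res M c \<noteq> \<one>\<^bsub>k\<^esub>" by blast
  note gx = g[OF x(1)]
  note cg = UR_scale(1-3)[OF c(1) gx]
  have "W (c \<otimes> g x)" using s(2)[OF cg(1,2)] cg(3) \<open>v (g x) < s\<close> by simp
  then obtain y where y: "y \<in> carrier K" "y \<noteq> \<zero>" "v y < l" "sim (c \<otimes> g x \<otimes> ninv (g y)) \<one>"
    unfolding W_def z(2) by blast
  note gy = g[OF y(1)]
  have sim_y: "sim (c \<otimes> g x \<otimes> inv (g y)) \<one>" using y(4) gy by (simp add: ninv_def)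
  have "v (c \<otimes> g x) = v (g y)" by (rule v_sim[OF cg(1,2) gy sim_y])
  \<comment> \<open>Equal values of \<open>g\<close> force equal values of the arguments, and these
    force equal leading terms of \<open>g\<close>. Then \<open>c\<close> would have residue
    1.\<close>
  then have "v x = v y" using v_inj[OF x(1,2) _ y(1-3)] x(3) cg(3) by simp
  then have "sim (g y \<otimes> inv (g x)) \<one>" using sim_g[OF x(1,2) y(1,2)] x(3) by (simp add: l_def)
  with sim_y have "sim ((c \<otimes> g x \<otimes> inv (g y)) \<otimes> (g y \<otimes> inv (g x))) (\<one> \<otimes> \<one>)" by (rule sim_mult)
  moreover have "(c \<otimes> g x \<otimes> inv (g y)) \<otimes> (g y \<otimes> inv (g x)) = c"
  proof -
    have ac: "(c \<otimes> a \<otimes> b) \<otimes> (a' \<otimes> b') = c \<otimes> ((a \<otimes> b') \<otimes> (b \<otimes> a'))"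
      if "a \<in> carrier K" "b \<in> carrier K" "a' \<in> carrier K" "b' \<in> carrier K" for a b a' b'
      using that UR_K(1)[OF c(1)] by (simp add: m_ac)
    show ?thesis
      using ac[OF gx(1) inv_nonzero(1)[OF gy] gy(1) inv_nonzero(1)[OF gx]] UR_K(1)[OF c(1)]
        inv_nonzero(3)[OF gx] inv_nonzero(4)[OF gy] by simp
  qed
  ultimately have "res M c = res M \<one>" by (simp add: sim_def)
  then show False using c(2) res_one by simp
qed

end

section \<open>Polynomial boundedness\<close>

context acvf
begin

text \<open>The dictionary between the option-valued valuation and \<open>v\<close>; the case
  \<open>y = \<zero>\<close> accounts for the infinite value.\<close>

lemma val_less_iff:
  assumes "x \<in> carrier K" "x \<noteq> \<zero>" "y \<in> carrier K"
  shows "vless M (vmult M (int n) (val M x)) (val M y) \<longleftrightarrow> y = \<zero> \<or> nmul n (v x) < v y"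
proof -
  interpret V: comm_group "valgroup M" using ordered_valgroup by (simp add: ordered_comm_group_def)
  have gx: "gval M x \<in> carrier (valgroup M)" by (rule gval_closed[OF assms(1,2)])
  have emb_one: "emb \<one>\<^bsub>valgroup M\<^esub> = 0"
    using emb_mult[of "\<one>\<^bsub>valgroup M\<^esub>" "\<one>\<^bsub>valgroup M\<^esub>"] by simp
  have emb_pow: "emb (gval M x [^]\<^bsub>valgroup M\<^esub> m) = nmul m (emb (gval M x))" for m :: nat
    using gx emb_mult by (induction m) (simp_all add: emb_one add.commute)
  have vm: "vmult M (int n) (val M x) = Some (gval M x [^]\<^bsub>valgroup M\<^esub> n)"
    using assms(2) by (simp add: vmult_def val_def K[symmetric] int_pow_int)
  show ?thesis
  proof (cases "y = \<zero>")
    case True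
    then show ?thesis unfolding vm by (simp add: val_def K[symmetric] vless_def)
  next
    case False
    have gy: "gval M y \<in> carrier (valgroup M)" by (rule gval_closed[OF assms(3) False])
    have "vless M (Some (gval M x [^]\<^bsub>valgroup M\<^esub> n)) (Some (gval M y)) \<longleftrightarrow>
        \<not> emb (gval M y) \<le> emb (gval M x [^]\<^bsub>valgroup M\<^esub> n)"
      using emb_le[OF gy V.nat_pow_closed[OF gx]] by (simp add: vless_def)
    then show ?thesis unfolding vm emb_pow using False assms(2) by (simp add: val_def K[symmetric] v_def not_le)
  qed
qed

lemma vbounded_ball:
  assumes "\<gamma> \<in> \<Gamma>" shows "vbounded M {x \<in> carrier K. vge \<gamma> x}"
proof -
  obtain g where g: "g \<in> carrier K - {\<zero>}" "v g = \<gamma>" using nz_value[OF assms] by blast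
  have "{x \<in> carrier K. vge \<gamma> x} = {x \<in> carrier K. vge (v g) (x \<ominus> \<zero>)}"
    using g(2) by (auto simp: a_minus_def)
  then have "is_ball M {x \<in> carrier K. vge \<gamma> x}" unfolding is_ball_iff using g(1) by blast
  then show ?thesis unfolding vbounded_def by blast
qed

text \<open>For each \<open>n\<close> the points where the inequality fails are not contained in a
  ball, so by dichotomy they comprise all large points. At such points \<open>f\<close> is nonzero,
  since 0 has infinite value; hence replacing the zeros of \<open>f\<close> by 1 changes nothing
  there.\<close>

lemma not_polynomially_bounded:
  assumes "\<not> polynomially_bounded L M"
  obtains f where "superlinear L M K f"
proof -
  obtain f where f: "f \<in> univ M \<rightarrow> univ M" "definable (vf_lang L) M 2 {[x, f x] |x. x \<in> univ M}"
    and unb: "\<And>n S. vbounded M S ==> \<exists>x\<in>univ M - S. \<not> vless M (vmult M n (val M x)) (val M (f x))"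
    using assms unfolding polynomially_bounded_def by blast
  have f_K: "f x \<in> carrier K" if "x \<in> carrier K" for x using f(1) that by (auto simp: univ_M)
  have "Df (\<lambda>e. map e [0..<2] \<in> {[x, f x] |x. x \<in> univ M})" by (rule dfn_of_definable[OF f(2)])
  then have "Df (\<lambda>e. e 1 = f (e 0))"
    by (rule D_cong) (auto simp: numeral_2_eq_2 univ_M)
  from D_comp2[of "\<lambda>x y. y = f x", OF this tm_var[of 1] tm_var[of 0]]
  have "Df (\<lambda>E. E 0 = f (E 1))" .
  then have tm_f: "tm (\<lambda>E. f (E 0))" using f_K by (auto simp: tm_def image_subset_iff)
  have near_le: "near \<Gamma> (\<lambda>x. \<not> (f x = \<zero> \<or> nmul n (v x) < v (f x)))" for n
  proof -
    have D: "Df (\<lambda>E. f (E 0) = \<zero> \<or> v (nz (E 0) [^] n) < v (f (E 0)))"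
      by (intro D_disj D_eq Df_v_less tm_pow tm_comp1[OF tm_f] tm_K_intros)
    have "v (nz x [^] n) = nmul n (v x)" if "x \<in> carrier K" for x
      using v_pow[of "nz x" n] that by simp
    then have "Df (\<lambda>E. f (E 0) = \<zero> \<or> nmul n (v (E 0)) < v (f (E 0)))"
      by (intro D_cong[OF D]) (simp add: image_subset_iff)
    from near_cases[OF end_segment_Gamma this]
    have "near \<Gamma> (\<lambda>x. f x = \<zero> \<or> nmul n (v x) < v (f x)) \<or> near \<Gamma> (\<lambda>x. \<not> (f x = \<zero> \<or> nmul n (v x) < v (f x)))" .
    moreover have "\<not> near \<Gamma> (\<lambda>x. f x = \<zero> \<or> nmul n (v x) < v (f x))"
    proof
      assume "near \<Gamma> (\<lambda>x. f x = \<zero> \<or> nmul n (v x) < v (f x))"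
      then obtain g where g: "g \<in> \<Gamma>" "\<And>x. x \<in> carrier K ==> x \<noteq> \<zero> ==> v x < g ==> f x = \<zero> \<or> nmul n (v x) < v (f x)"
        unfolding near_def by blast
      obtain x where x: "x \<in> univ M - {x \<in> carrier K. vge g x}" "\<not> vless M (vmult M (int n) (val M x)) (val M (f x))"
        using unb[OF vbounded_ball[OF g(1)]] by blast
      then have x': "x \<in> carrier K" "x \<noteq> \<zero>" "v x < g" by (auto simp: univ_M vge_def)
      then show False using x(2) g(2)[OF x'] val_less_iff[OF x'(1,2) f_K[OF x'(1)], of n] by simp
    qed
    ultimately show ?thesis by blast
  qed
  have "superlinear L M K (\<lambda>x. nz (f x))"
  proof unfold_locales
    show "tm (\<lambda>E. nz (f (E 0)))" by (rule tm_nz[OF tm_f])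
    show "near \<Gamma> (\<lambda>x. v (nz (f x)) \<le> nmul n (v x))" for n
      using near_le[of n] by (rule near_mono) (simp add: not_less)
  qed simp
  then show thesis by (rule that)
qed

text \<open>The constant \<open>t\<close> makes the type of an element whose value exceeds all multiples of \<open>v t\<close>
  parameter-free.\<close>

lemma value_above_multiples:
  assumes "monster_model (vf_lang L) T M" "farity L t = Some 0"
    and t: "fun_int M (Inr t) [] \<noteq> \<zero>" "0 < v (fun_int M (Inr t) [])"
  obtains a where "a \<in> \<Gamma>" "\<And>n. nmul n (v (fun_int M (Inr t) [])) \<le> a"
proof -
  define u where "u = fun_int M (Inr t) []"
  obtain \<kappa> :: "'a rel" where \<kappa>: "Card_order \<kappa>" "|{\<phi>. wf_fm (vf_lang L) \<phi>}| <o \<kappa>" "saturated \<kappa> (vf_lang L) M"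
    using assms(1) unfolding monster_model_def by blast
  have "|{} :: 'a set| \<le>o |{\<phi>. wf_fm (vf_lang L) \<phi>}|" by (rule card_of_empty)
  then have empty: "|{} :: 'a set| <o \<kappa>" using \<kappa>(2) ordLeq_ordLess_trans by blast
  have ar: "farity (vf_lang L) (Inr t) = Some 0" "farity (vf_lang L) (Inl RMul) = Some 2"
    "farity (vf_lang L) (Inl ROne) = Some 0" "farity (vf_lang L) (Inl RZero) = Some 0"
    "rarity (vf_lang L) (Inl InO) = Some 1"
    using assms(2) by (simp_all add: vf_lang_def)
  have u: "u \<in> carrier K"
    using is_struct_M ar(1) unfolding is_struct_def u_def univ_M by (auto simp: tuples_def)
  define pw :: "nat \<Rightarrow> (ring_sym + 'f) tm" where
    "pw n = ((\<lambda>s. Fn (Inl RMul) [Fn (Inr t) [], s]) ^^ n) (Fn (Inl ROne) [])" for n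
  have pw_wf: "wf_tm (vf_lang L) (pw n)" for n by (induction n) (simp_all add: pw_def ar)
  have pw_fv: "fv_tm (pw n) = {}" for n by (induction n) (simp_all add: pw_def)
  have pw_eval: "eval_tm M e (pw n) = u [^] n" for e n
  proof (induction n)
    case 0
    show ?case by (simp add: pw_def one_K)
  next
    case (Suc n)
    have "eval_tm M e (pw (Suc n)) = u \<otimes> eval_tm M e (pw n)" by (simp add: pw_def u_def mult_K)
    then show ?case using Suc u by (simp add: m_comm)
  qed
  define zero :: "(ring_sym + 'f) tm" where "zero = Fn (Inl RZero) []"
  \<comment> \<open>\<open>\<psi> n\<close> says that variable 0 is a multiple of the n-th power of
    \<open>t\<close> in the valuation ring, so that a nonzero element has at least n times the value
    of \<open>t\<close>. Since 0 satisfies every \<open>\<psi> n\<close>, it is excluded by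
    \<open>\<psi>0\<close>.\<close>
  define \<psi> :: "nat \<Rightarrow> (ring_sym + 'f, val_sym + 'r) fm" where
    "\<psi> n = Imp (All 1 (Imp (Rel (Inl InO) [Var 1]) (Imp (Eql (Var 0) (Fn (Inl RMul) [pw n, Var 1])) Bot))) Bot" for n
  define \<psi>0 :: "(ring_sym + 'f, val_sym + 'r) fm" where "\<psi>0 = Imp (Eql (Var 0) zero) Bot"
  have wf: "wf_fm (vf_lang L) (\<psi> n)" "wf_fm (vf_lang L) \<psi>0" for n
    by (simp_all add: \<psi>_def \<psi>0_def zero_def ar pw_wf)
  have fv: "fv (\<psi> n) - {0} = {}" "fv \<psi>0 - {0} = {}" for n
    by (auto simp: \<psi>_def \<psi>0_def zero_def pw_fv)
  have sat: "sat M e (\<psi> n) \<longleftrightarrow> (\<exists>z\<in>VR. e 0 = u [^] n \<otimes> z)" "sat M e \<psi>0 \<longleftrightarrow> e 0 \<noteq> \<zero>" for e n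
    by (auto simp: \<psi>_def \<psi>0_def zero_def pw_eval zero_K mult_K valset_def)
  have v_u: "v (u [^] n) = nmul n (v u)" "u [^] n \<noteq> \<zero>" for n :: nat
    using v_pow[OF u] t(1) by (simp_all add: u_def)
  define e0 where "e0 = (\<lambda>i :: nat. \<zero>)"
  define p where "p = insert (\<psi>0, e0) (range (\<lambda>n. (\<psi> n, e0)))"
  have "\<exists>a\<in>univ M. \<forall>(\<phi>, e)\<in>p. sat M (e(0 := a)) \<phi>"
  proof (rule \<kappa>(3)[unfolded saturated_def, rule_format, OF empty_subsetI empty])
    show "case z of (\<phi>, e) \<Rightarrow> wf_fm (vf_lang L) \<phi> \<and> e ` (fv \<phi> - {0}) \<subseteq> {}" if "z \<in> p" for z
      using that wf fv by (auto simp: p_def)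
    fix q assume q: "finite q" "q \<subseteq> p"
    define I where "I = {n. (\<psi> n, e0) \<in> q}"
    \<comment> \<open>Each formula \<open>\<psi> n\<close> that occurs in the finite part equals one
      of index at most \<open>m\<close>, so the power of \<open>t\<close> with exponent
      \<open>m\<close> realises the finite part.\<close>
    obtain m where m: "\<And>n. (\<psi> n, e0) \<in> q ==> \<exists>i\<le>m. \<psi> n = \<psi> i"
    proof -
      have "q - {(\<psi>0, e0)} \<subseteq> range (\<lambda>n. (\<psi> n, e0))" using q(2) by (auto simp: p_def)
      from finite_subset_image[OF _ this] q(1)
      obtain C where C: "finite C" "q - {(\<psi>0, e0)} = (\<lambda>n. (\<psi> n, e0)) ` C" by auto
      have ne: "\<psi> n \<noteq> \<psi>0" for n by (simp add: \<psi>_def \<psi>0_def)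
      have "\<exists>i\<le>Max (insert 0 C). \<psi> n = \<psi> i" if "(\<psi> n, e0) \<in> q" for n
      proof -
        have "(\<psi> n, e0) \<in> (\<lambda>n. (\<psi> n, e0)) ` C" using that ne[of n] C(2) by blast
        then obtain i where "i \<in> C" "\<psi> n = \<psi> i" by blast
        then show ?thesis using C(1) by (intro exI[of _ i]) simp
      qed
      then show thesis by (rule that)
    qed
    have "sat M (e(0 := u [^] m)) \<phi>" if mem: "(\<phi>, e) \<in> q" for \<phi> e
    proof -
      have "\<phi> = \<psi>0 \<and> e = e0 \<or> (\<exists>n. \<phi> = \<psi> n \<and> e = e0)" using mem q(2) by (auto simp: p_def)
      then show ?thesis
      proof
        assume "\<phi> = \<psi>0 \<and> e = e0"
        then show ?thesis using v_u(2) by (simp add: sat(2))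
      next
        assume "\<exists>n. \<phi> = \<psi> n \<and> e = e0"
        then obtain n where n: "\<phi> = \<psi> n" "(\<psi> n, e0) \<in> q" using mem by blast
        obtain i where i: "i \<le> m" "\<phi> = \<psi> i" using m[OF n(2)] n(1) by blast
        have eq: "u [^] m = u [^] i \<otimes> u [^] (m - i)" using i(1) u by (simp add: nat_pow_mult)
        have "u \<in> VR" using VR_iff[OF u] t(2) by (simp add: u_def less_imp_le)
        then have "u [^] (m - i) \<in> VR" using res_pow by blast
        then have "\<exists>z\<in>VR. u [^] m = u [^] i \<otimes> z" using eq by blast
        then show ?thesis unfolding i(2) sat(1) by simp
      qed
    qed
    then show "\<exists>a\<in>univ M. \<forall>(\<phi>, e)\<in>q. sat M (e(0 := a)) \<phi>"
      using u by (intro bexI[of _ "u [^] m"]) (simp_all add: univ_M split_paired_all)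
  qed
  then obtain a where a: "a \<in> carrier K" "\<And>\<phi> e. (\<phi>, e) \<in> p ==> sat M (e(0 := a)) \<phi>"
    unfolding univ_M by blast
  have "(\<psi>0, e0) \<in> p" by (simp add: p_def)
  from a(2)[OF this] have ne: "a \<noteq> \<zero>" by (simp add: sat(2))
  have "nmul n (v u) \<le> v a" for n
  proof -
    have "(\<psi> n, e0) \<in> p" by (simp add: p_def)
    from a(2)[OF this] obtain z where z: "z \<in> VR" "a = u [^] n \<otimes> z" by (auto simp: sat(1))
    have "z \<noteq> \<zero>" using ne z(2) u by auto
    then have "0 \<le> v z" "v a = v (u [^] n) + v z" using z VR_iff[OF VR_K[OF z(1)]] v_u(2) u VR_K[OF z(1)] v_mult by simp_all
    then show ?thesis by (simp add: v_u(1))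
  qed
  then show thesis using that[of "v a"] a(1) by (auto simp: u_def)
qed

end

theorem theorem5p3:
  fixes L :: "('f, 'r) lang"
    and T :: "(ring_sym + 'f, val_sym + 'r) fm set"
    and M :: "('f, 'r, 'a) vf_struct"
    and t :: 'f
  assumes "complete_theory TYPE('a) (vf_lang L) T"
    and "C_minimal_ACVF_expansion TYPE('a) L T"
    and "monster_model (vf_lang L) T M"
    and "farity L t = Some 0"
    and "fun_int M (Inr t) [] \<noteq> \<zero>\<^bsub>vfield M\<^esub>"
    and "vless M (val M \<one>\<^bsub>vfield M\<^esub>) (val M (fun_int M (Inr t) []))"
    and "no_exotic_automorphisms_residue L M \<or> no_exotic_automorphisms_value L M"
  shows "polynomially_bounded L M"
proof (rule ccontr)
  assume not_bounded: "\<not> polynomially_bounded L M"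
  have model: "is_model (vf_lang L) T M" using assms(3) unfolding monster_model_def by blast
  then have struct: "is_struct (vf_lang L) M" unfolding is_model_def by blast
  have ACVF: "ACVF M" and c_min: "\<And>S. S \<subseteq> univ M ==> definable (vf_lang L) M 1 ((\<lambda>x. [x]) ` S) ==> S \<in> ball_combinations M"
    using assms(2) model unfolding C_minimal_ACVF_expansion_def by blast+
  interpret acvf L M "vfield M" by (rule acvf.intro[OF refl struct ACVF c_min])
  obtain f where "superlinear L M (vfield M) f" using not_polynomially_bounded[OF not_bounded] by blast
  then interpret superlinear L M "vfield M" f .
  define u where "u = fun_int M (Inr t) []"
  have u: "u \<in> carrier (vfield M)" "u \<noteq> \<zero>\<^bsub>vfield M\<^esub>"
    using struct assms(4,5) unfolding is_struct_def u_def univ_M by (auto simp: tuples_def vf_lang_def)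
  \<comment> \<open>Brings the hypothesis on \<open>t\<close> into the shape of
    \<open>val_less_iff\<close> for the element 1 and the multiple 1, which turns it into
    \<open>0 < v u\<close>.\<close>
  have "vmult M (int 1) (val M \<one>\<^bsub>vfield M\<^esub>) = val M \<one>\<^bsub>vfield M\<^esub>"
  proof -
    interpret V: comm_group "valgroup M" using ordered_valgroup by (simp add: ordered_comm_group_def)
    show ?thesis using gval_closed[of "\<one>\<^bsub>vfield M\<^esub>"] by (simp add: vmult_def val_def int_pow_int)
  qed
  then have "vless M (vmult M (int 1) (val M \<one>\<^bsub>vfield M\<^esub>)) (val M u)" using assms(6) by (simp only: u_def)
  then have "0 < v u" using val_less_iff[of "\<one>\<^bsub>vfield M\<^esub>" u 1] u by simp
  moreover from this obtain a where "a \<in> v ` carrier (vfield M)" "\<And>n. nmul n (v u) \<le> a"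
    using value_above_multiples[OF assms(3,4,5)] unfolding u_def by blast
  ultimately have "\<not> no_exotic_automorphisms_value L M"
    using value_case[of "v u" a] u(1) by blast
  then show False using residue_case assms(7) by blast
qed

end
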